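(* Suppose that either (1) $n\ge4$, $m\ge2$ and $\alpha\in\mathbb{N}$, or (2) $n\in\{2,3\}$, $m\ge2$ and $\alpha=1$. Let $$p=\frac{2\left(n+m-2+\frac{1}{\alpha+1}\right)}{n+m-2+\frac{2}{\alpha+1}},\qquad q=\frac{2\left(n+m-2+\frac{1}{\alpha+1}\right)}{n+m-2}.$$ If $0\le\beta<1/q$, there exists a constant $C>0$ depending only on $\alpha,\beta,n$ and $m$ such that for every $k\in\mathbb{N}_0$ and every $g\in L^p(\Omega,d\Omega)$, $$\left\|\psi^{-\beta}(\phi)P_k\left(\psi^{-\beta}(\cdot)g\right)\right\|_{L^q(\Omega,d\Omega)}\le C(k+1)^{\frac{n+m-2}{n+m-2+\frac{1}{\alpha+1}}}\|g\|_{L^p(\Omega,d\Omega)}.$$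
   Context: $\mathbb{N}=\{1,2,\dots\}$, $\mathbb{N}_0=\{0,1,2,\dots\}$. Points of $\mathbb{R}^{n+m}$ are $(x,y)$, $x\in\mathbb{R}^n$, $y\in\mathbb{R}^m$. Polar coordinates $(\rho,\phi,\omega_1,\omega_2)$: $\rho=\left(|x|^{2(\alpha+1)}+(\alpha+1)^2|y|^2\right)^{\frac{1}{2(\alpha+1)}}$, $\phi\in[0,\pi/2]$ with $|x|=\rho\sin^{\frac1{\alpha+1}}\phi$, $|y|=\frac{1}{\alpha+1}\rho^{\alpha+1}\cos\phi$, $\omega_1=x/|x|\in\mathbb{S}^{n-1}$, $\omega_2=y/|y|\in\mathbb{S}^{m-1}$. The angle function is $\psi(\phi)=\sin^{\frac{2\alpha}{\alpha+1}}\phi$. $\Omega=\{\rho=1\}$ is equipped with $d\Omega=\sin^{\frac{n-2}{\alpha+1}+1}\phi\,\cos^{m-1}\phi\,d\phi\,d\omega_1\,d\omega_2$ ($d\omega_1,d\omega_2$ surface measures on the spheres). Let $\{Y_{\ell,p}\}_{1\le p\le d_\ell(n)}$ be an orthonormal basis of the spherical harmonics of degree $\ell$ on $\mathbb{S}^{n-1}$ ($d_\ell(n)$ the dimension of that space), and similarly $\{Y_{j,q}\}_{1\le q\le d_j(m)}$ on $\mathbb{S}^{m-1}$ (these indices $p,q$ are unrelated to the exponents in the claim). With $P_N^{(a,b)}$ the Jacobi polynomials, put $\widetilde{k}=\frac{k-\ell-j(\alpha+1)}{2(\alpha+1)}$, $\mu=\frac{n-2+2\ell}{2(\alpha+1)}$,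 $\gamma=j+\frac m2$, $h_{k,\ell,j}(\phi)=\cos^j\phi\,\sin^{\frac{\ell}{\alpha+1}}\phi\,P_{\widetilde k}^{(\mu,\gamma-1)}(\cos2\phi)$. $\mathcal{H}_k^\alpha$ (restricted to $\Omega$) is the span of $h_{k,\ell,j}(\phi)Y_{\ell,p}(\omega_1)Y_{j,q}(\omega_2)$ over all $0\le\ell,j\le k$ with $\widetilde k\in\mathbb{N}_0$ and all indices $p,q$; these functions are mutually orthogonal in $L^2(\Omega,d\Omega)$. $P_k:L^2(\Omega,d\Omega)\to\mathcal{H}_k^\alpha$ is the orthogonal projection, which is the integral operator $P_k(g)=\int_\Omega G_k(\cdot,\zeta)g(\zeta)\,d\Omega(\zeta)$ with $G_k(z,\zeta)=\sum_ie_i(z)\overline{e_i(\zeta)}$ for any orthonormal basis $\{e_i\}$ of $\mathcal{H}_k^\alpha$; this formula defines $P_k$ on $L^1(\Omega,d\Omega)$. *)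

theory Defs
  imports "HOL-Analysis.Analysis" "HOL-Library.Function_Algebras"
begin

section \<open>Complex-valued functions: linear algebra, \<open>L\<^sup>p\<close>, orthonormal bases\<close>

definition cscale :: "complex \<Rightarrow> ('a \<Rightarrow> complex) \<Rightarrow> 'a \<Rightarrow> complex" where
  "cscale c f = (\<lambda>x. c * f x)"

lemma vector_space_cscale: "vector_space cscale"
  by unfold_locales (auto simp: cscale_def fun_eq_iff algebra_simps)

abbreviation cspan :: "('a \<Rightarrow> complex) set \<Rightarrow> ('a \<Rightarrow> complex) set" where
  "cspan \<equiv> module.span cscale"

abbreviation cdim :: "('a \<Rightarrow> complex) set \<Rightarrow> nat" where
  "cdim \<equiv> vector_space.dim cscale"

definition Lp :: "real \<Rightarrow> 'a measure \<Rightarrow> ('a \<Rightarrow> complex) set" where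
  "Lp p M = {f \<in> borel_measurable M. integrable M (\<lambda>x. norm (f x) powr p)}"

definition Lp_norm :: "real \<Rightarrow> 'a measure \<Rightarrow> ('a \<Rightarrow> complex) \<Rightarrow> real" where
  "Lp_norm p M f = (LINT x|M. norm (f x) powr p) powr (1 / p)"

definition orthonormal_basis ::
    "'a measure \<Rightarrow> ('a \<Rightarrow> complex) set \<Rightarrow> nat set \<Rightarrow> (nat \<Rightarrow> 'a \<Rightarrow> complex) \<Rightarrow> bool" where
  "orthonormal_basis M V I e \<longleftrightarrow>
     (\<forall>i\<in>I. e i \<in> Lp 2 M) \<and>
     (\<forall>i\<in>I. \<forall>j\<in>I. (LINT x|M. e i x * cnj (e j x)) = (if i = j then 1 else 0)) \<and>
     cspan (e ` I) = V"


section \<open>Spheres and spherical harmonics\<close>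

text \<open>The surface measure of the unit sphere, as the normalised cone measure
  \<open>\<sigma>(A) = d \<cdot> \<lambda>({x. 0 < |x| < 1 \<and> x/|x| \<in> A})\<close>, where \<open>d\<close> is the dimension of the
  ambient space.\<close>

definition surface_measure :: "'a::euclidean_space measure" where
  "surface_measure =
     scale_measure (of_nat DIM('a))
       (distr (restrict_space lborel (ball 0 1 - {0})) (restrict_space borel (sphere 0 1)) sgn)"

lemma surface_measure_sets: "sets (surface_measure :: 'a::euclidean_space measure) = sets (restrict_space borel (sphere 0 1))"
  "space (surface_measure :: 'a::euclidean_space measure) = sphere 0 1"
  by (simp_all add: surface_measure_def space_restrict_space space_scale_measure)

lemma measurable_sgn_sphere: "(sgn :: 'a::euclidean_space \<Rightarrow> 'a) \<in> restrict_space lborel (ball 0 1 - {0}) \<rightarrow>\<^sub>M restrict_space borel (sphere 0 1)"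
proof (rule measurable_restrict_space2)
  show "sgn \<in> space (restrict_space lborel (ball (0::'a) 1 - {0})) \<rightarrow> sphere 0 1"
    by (auto simp: space_restrict_space norm_sgn)
  have "(\<lambda>x::'a. x /\<^sub>R norm x) \<in> borel_measurable lborel" by measurable
  then show "sgn \<in> borel_measurable (restrict_space lborel (ball (0::'a) 1 - {0}))"
    unfolding sgn_div_norm [abs_def] by (rule measurable_restrict_space1)
qed

definition laplacian :: "('a::euclidean_space \<Rightarrow> complex) \<Rightarrow> 'a \<Rightarrow> complex" where
  "laplacian f x =
     (\<Sum>b\<in>Basis. vector_derivative
        (\<lambda>s. vector_derivative (\<lambda>t. f (x + t *\<^sub>R b)) (at s)) (at 0))"

text \<open>Functions on the sphere are extended by \<open>0\<close>, so that equality of functions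
  is equality on the sphere.\<close>

definition spherical_harmonics :: "nat \<Rightarrow> ('a::euclidean_space \<Rightarrow> complex) set" where
  "spherical_harmonics l =
     {\<lambda>w. if w \<in> sphere 0 1 then P w else 0 | P.
        polynomial_function P \<and>
        (\<forall>t x. P (t *\<^sub>R x) = of_real (t ^ l) * P x) \<and>
        (\<forall>x. laplacian P x = 0)}"

definition spherical_harmonic_bases :: "(nat \<Rightarrow> nat \<Rightarrow> 'a::euclidean_space \<Rightarrow> complex) \<Rightarrow> bool" where
  "spherical_harmonic_bases Y \<longleftrightarrow>
     (\<forall>l. orthonormal_basis surface_measure (spherical_harmonics l)
            {1..cdim (spherical_harmonics l :: ('a \<Rightarrow> complex) set)} (Y l))"


section \<open>Jacobi polynomials\<close>

definition jacobi :: "nat \<Rightarrow> real \<Rightarrow> real \<Rightarrow> real \<Rightarrow> real" where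
  "jacobi N a b x =
     (\<Sum>s\<le>N. ((real N + a) gchoose (N - s)) * ((real N + b) gchoose s) *
        ((x - 1) / 2) ^ s * ((x + 1) / 2) ^ (N - s))"


section \<open>Polar coordinates and the surface \<open>\<Omega>\<close>\<close>

definition rho :: "nat \<Rightarrow> (real^'n) \<times> (real^'m) \<Rightarrow> real" where
  "rho \<alpha> = (\<lambda>(x, y).
     (norm x ^ (2 * (\<alpha> + 1)) + (real \<alpha> + 1)\<^sup>2 * (norm y)\<^sup>2) powr (1 / (2 * (real \<alpha> + 1))))"

text \<open>The angle is recovered from \<open>|y| = \<rho>\<^sup>\<alpha>\<^sup>+\<^sup>1 cos \<phi> / (\<alpha> + 1)\<close>; see \<open>polar_Omega\<close> below.\<close>

definition phi :: "nat \<Rightarrow> (real^'n) \<times> (real^'m) \<Rightarrow> real" where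
  "phi \<alpha> z = arccos ((real \<alpha> + 1) * norm (snd z) / rho \<alpha> z ^ (\<alpha> + 1))"

definition psi :: "nat \<Rightarrow> real \<Rightarrow> real" where
  "psi \<alpha> t = sin t powr (2 * real \<alpha> / (real \<alpha> + 1))"

definition Omega :: "nat \<Rightarrow> ((real^'n) \<times> (real^'m)) set" where
  "Omega \<alpha> = {z. rho \<alpha> z = 1}"

definition polar :: "nat \<Rightarrow> real \<times> (real^'n) \<times> (real^'m) \<Rightarrow> (real^'n) \<times> (real^'m)" where
  "polar \<alpha> = (\<lambda>(t, w1, w2).
     ((sin t powr (1 / (real \<alpha> + 1))) *\<^sub>R w1, (cos t / (real \<alpha> + 1)) *\<^sub>R w2))"

lemma polar_Omega: assumes "t \<in> {0..pi/2}" "norm w1 = 1" "norm w2 = 1"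
  shows "polar \<alpha> (t,w1,w2) \<in> (Omega \<alpha> :: ((real^'n) \<times> (real^'m)) set)" 
    "phi \<alpha> (polar \<alpha> (t,w1::real^'n,w2::real^'m)) = t"
proof -
  have s: "sin t \<ge> 0" "cos t \<ge> 0" using assms by (auto intro: sin_ge_zero cos_ge_zero)
  have "(sin t powr (1 / (real \<alpha> + 1))) ^ (2 * (\<alpha> + 1)) = (sin t)\<^sup>2"
  proof (cases "sin t = 0")
    case False
    then have p: "sin t > 0" using s by simp
    have "(sin t powr (1 / (real \<alpha> + 1))) ^ (2 * (\<alpha> + 1)) = (sin t powr (1 / (real \<alpha> + 1))) powr real (2 * (\<alpha> + 1))"
      using p by (intro powr_realpow[symmetric]) simp
    also have "\<dots> = sin t powr (1 / (real \<alpha> + 1) * real (2 * (\<alpha> + 1)))"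
      by (rule powr_powr)
    also have "1 / (real \<alpha> + 1) * real (2 * (\<alpha> + 1)) = real 2" by (simp add: field_simps)
    also have "sin t powr real 2 = (sin t)\<^sup>2" using p by (rule powr_realpow)
    finally show ?thesis .
  qed simp
  moreover have "(real \<alpha> + 1)\<^sup>2 * (norm ((cos t / (real \<alpha> + 1)) *\<^sub>R w2))\<^sup>2 = (cos t)^2"
    using assms by (simp add: power_divide)
  ultimately have r: "rho \<alpha> (polar \<alpha> (t,w1,w2)) = 1"
    using assms s unfolding polar_def rho_def by simp
  then show "polar \<alpha> (t,w1,w2) \<in> (Omega \<alpha> :: ((real^'n) \<times> (real^'m)) set)" by (simp add: Omega_def)
  have "t \<le> pi" using assms pi_gt_zero by auto
  then show "phi \<alpha> (polar \<alpha> (t,w1,w2)) = t"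
    unfolding phi_def r using assms s  by (simp add: polar_def arccos_cos)
qed

lemma measurable_polar: "(polar \<alpha> :: _ \<Rightarrow> (real^'n) \<times> (real^'m)) \<in> restrict_space lborel {0..pi/2} \<Otimes>\<^sub>M (surface_measure \<Otimes>\<^sub>M surface_measure)
  \<rightarrow>\<^sub>M restrict_space borel (Omega \<alpha>)"
proof (rule measurable_restrict_space2)
  show "polar \<alpha> \<in> space (restrict_space lborel {0..pi/2} \<Otimes>\<^sub>M (surface_measure \<Otimes>\<^sub>M surface_measure)) \<rightarrow> (Omega \<alpha>:: ((real^'n) \<times> (real^'m)) set)"
    by (auto simp: space_pair_measure space_restrict_space surface_measure_sets intro!: polar_Omega)
  have 1: "(\<lambda>x::real. x) \<in> borel_measurable (restrict_space lborel {0..pi/2})"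
    by (rule measurable_restrict_space1) simp
  have 2: "(\<lambda>x::'b::euclidean_space. x) \<in> borel_measurable surface_measure"
    by (subst measurable_cong_sets[OF surface_measure_sets(1) refl]) (rule measurable_restrict_space1, simp)
  let ?M = "restrict_space lborel {0..pi/2} \<Otimes>\<^sub>M (surface_measure \<Otimes>\<^sub>M surface_measure) :: (real \<times> (real^'n) \<times> (real^'m)) measure"
  have [measurable]: "fst \<in> borel_measurable ?M"
    by (rule measurable_compose[OF measurable_fst 1])
  have [measurable]: "(\<lambda>x. fst (snd x)) \<in> borel_measurable ?M"
    by (rule measurable_compose[OF measurable_compose[OF measurable_snd measurable_fst] 2])
  have [measurable]: "(\<lambda>x. snd (snd x)) \<in> borel_measurable ?M"
    by (rule measurable_compose[OF measurable_compose[OF measurable_snd measurable_snd] 2])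
  have "(\<lambda>x. ((sin (fst x) powr (1 / (real \<alpha> + 1))) *\<^sub>R fst (snd x), (cos (fst x) / (real \<alpha> + 1)) *\<^sub>R snd (snd x))) \<in> borel_measurable ?M"
    by (subst borel_prod[symmetric]) measurable
  then show "polar \<alpha> \<in> borel_measurable ?M" by (simp add: polar_def case_prod_beta')
qed

text \<open>\<open>d\<Omega>\<close> is the image under \<open>polar\<close> of its expression in polar coordinates.\<close>

definition dOmega :: "nat \<Rightarrow> ((real^'n) \<times> (real^'m)) measure" where
  "dOmega \<alpha> =
     distr
       (density
          (restrict_space lborel {0..pi/2} \<Otimes>\<^sub>M (surface_measure \<Otimes>\<^sub>M surface_measure))
          (\<lambda>(t, w). ennreal
             (sin t powr ((real CARD('n) - 2) / (real \<alpha> + 1) + 1) * cos t ^ (CARD('m) - 1))))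
       (restrict_space borel (Omega \<alpha>))
       (polar \<alpha>)"


section \<open>The spaces \<open>\<H>\<^sub>k\<^sup>\<alpha>\<close> and the projections \<open>P\<^sub>k\<close>\<close>

definition ktilde :: "nat \<Rightarrow> nat \<Rightarrow> nat \<Rightarrow> nat \<Rightarrow> real" where
  "ktilde \<alpha> k l j = (real k - real l - real j * (real \<alpha> + 1)) / (2 * (real \<alpha> + 1))"

text \<open>\<open>h_fun\<close> takes the dimensions \<open>n\<close>, \<open>m\<close> and the Jacobi degree \<open>N\<close> as arguments;
  it is the function \<open>h\<close> of index \<open>k\<close>, \<open>l\<close>, \<open>j\<close> when \<open>N = ktilde \<alpha> k l j\<close>.\<close>

definition h_fun :: "nat \<Rightarrow> nat \<Rightarrow> nat \<Rightarrow> nat \<Rightarrow> nat \<Rightarrow> nat \<Rightarrow> real \<Rightarrow> real" where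
  "h_fun n m \<alpha> N l j t =
     cos t ^ j * sin t powr (real l / (real \<alpha> + 1)) *
     jacobi N ((real n - 2 + 2 * real l) / (2 * (real \<alpha> + 1))) (real j + real m / 2 - 1)
       (cos (2 * t))"

text \<open>Functions on \<open>\<Omega>\<close> are extended by \<open>0\<close>. The polar coordinates are undefined
  where \<open>x = 0\<close> or \<open>y = 0\<close>; there \<open>sgn\<close> is \<open>0\<close> and hence the generators below
  vanish. This is a null set of \<open>\<Omega>\<close>.\<close>

definition H_space :: "nat \<Rightarrow> (nat \<Rightarrow> nat \<Rightarrow> real^'n \<Rightarrow> complex) \<Rightarrow>
    (nat \<Rightarrow> nat \<Rightarrow> real^'m \<Rightarrow> complex) \<Rightarrow> nat \<Rightarrow> ((real^'n) \<times> (real^'m) \<Rightarrow> complex) set" where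
  "H_space \<alpha> Y Z k = cspan
     {\<lambda>w. if w \<in> Omega \<alpha>
           then of_real (h_fun CARD('n) CARD('m) \<alpha> N l j (phi \<alpha> w)) *
                Y l a (sgn (fst w)) * Z j b (sgn (snd w))
           else 0 | N l j a b.
        l \<le> k \<and> j \<le> k \<and> ktilde \<alpha> k l j = real N \<and>
        a \<in> {1..cdim (spherical_harmonics l :: (real^'n \<Rightarrow> complex) set)} \<and>
        b \<in> {1..cdim (spherical_harmonics j :: (real^'m \<Rightarrow> complex) set)}}"

text \<open>The kernel does not depend on the orthonormal basis; one is chosen.\<close>

definition G_kernel :: "nat \<Rightarrow> (nat \<Rightarrow> nat \<Rightarrow> real^'n \<Rightarrow> complex) \<Rightarrow>
    (nat \<Rightarrow> nat \<Rightarrow> real^'m \<Rightarrow> complex) \<Rightarrow> nat \<Rightarrow>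
    (real^'n) \<times> (real^'m) \<Rightarrow> (real^'n) \<times> (real^'m) \<Rightarrow> complex" where
  "G_kernel \<alpha> Y Z k z \<zeta> =
     (let I = {1..cdim (H_space \<alpha> Y Z k)};
          e = (SOME e. orthonormal_basis (dOmega \<alpha>) (H_space \<alpha> Y Z k) I e)
      in \<Sum>i\<in>I. e i z * cnj (e i \<zeta>))"

definition proj :: "nat \<Rightarrow> (nat \<Rightarrow> nat \<Rightarrow> real^'n \<Rightarrow> complex) \<Rightarrow>
    (nat \<Rightarrow> nat \<Rightarrow> real^'m \<Rightarrow> complex) \<Rightarrow> nat \<Rightarrow>
    ((real^'n) \<times> (real^'m) \<Rightarrow> complex) \<Rightarrow> (real^'n) \<times> (real^'m) \<Rightarrow> complex" where
  "proj \<alpha> Y Z k g z = (LINT \<zeta>|dOmega \<alpha>. G_kernel \<alpha> Y Z k z \<zeta> * g \<zeta>)"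

end

theory Submission
  imports Defs "HOL-Computational_Algebra.Polynomial"
begin

text \<open>For \<open>f\<close> in \<open>\<H>\<^sub>k\<close> with \<open>L\<^sup>2\<close> norm squared \<open>E\<close>, Cauchy-Schwarz gives
  \<open>|f|\<^sup>q \<le> (E G)\<^sup>\<theta> |f|\<^sup>2\<close>, where \<open>\<theta> = (q - 2) / 2\<close> and \<open>G\<close> is the diagonal of the reproducing
  kernel, which is bounded by a function of \<open>\<phi>\<close> alone because the sum of \<open>|Y|\<^sup>2\<close> over a basis of
  spherical harmonics is constant (infinitesimal rotations act skew-adjointly on them).
  Orthogonality in the spherical variables then reduces the weighted \<open>L\<^sup>q\<close> norm of \<open>f\<close> to moments
  of squared Jacobi functions. In the variable \<open>s = sin\<^sup>2 \<phi>\<close> their differential equation yields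
  both the pointwise bounds (Sonin's method) and the moment bounds. Near \<open>s = 0\<close> the
  kernel is too large to be used for all degrees \<open>l\<close> at once, so \<open>f\<close> is cut into dyadic blocks in
  \<open>l\<close>; each block gains a power of \<open>k + 1\<close>, which pays for the logarithmic number of blocks. The
  resulting bound from \<open>L\<^sup>2\<close> to weighted \<open>L\<^sup>q\<close> is dualised, and composed with its adjoint it is
  the claim.\<close>

section \<open>Jacobi polynomials on the unit interval\<close>

text \<open>The balance behind the dyadic blocks, with \<epsilon> = 1/(\<alpha>+1): for l + 1
  between L and 2L the diagonal kernel grows like L^(n-1), whereas a negative moment s^(-\<kappa>)
  of a squared Jacobi function costs only about (KK/L)^\<kappa>, KK being of size k + 1, because the
  Jacobi parameter \<mu> is of size L. A block thus costs L^x KK^y, which is largest at L = 1 or at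
  L of size KK; both ends give a power KK^r with r < 1. Without blocks the worst kernel (L of size
  KK) would meet the worst moment (L = 1), and the exponents could add up to more than 1. The end L
  = 1 near s = 0 is where \<beta> < 1/q is spent: in terms of \<tau> =
  \<alpha>\<beta>q/(\<alpha>+1), for which the weight raised to the power q is s^(-\<tau>), it reads
  \<tau> + \<epsilon> < 1. The target in this form is the first power of k + 1 for the q-th power of
  the norm from \<open>L2\<close> to weighted \<open>Lq\<close>; since 2/q =
  (n+m-2)/(n+m-2+\<epsilon>), composition with the adjoint turns it into the exponent of the
  claim.\<close>

definition jac_coeff :: "nat \<Rightarrow> real \<Rightarrow> real \<Rightarrow> nat \<Rightarrow> real" where
  "jac_coeff N a b i = ((real N + a) gchoose (N - i)) * ((real N + b) gchoose i) * (-1) ^ i"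

definition jac_poly :: "nat \<Rightarrow> real \<Rightarrow> real \<Rightarrow> real poly" where
  "jac_poly N a b = (\<Sum>i\<le>N. smult (jac_coeff N a b i) ([:0, 1:] ^ i * [:1, -1:] ^ (N - i)))"

lemma poly_jac_poly: "poly (jac_poly N a b) v = jacobi N a b (1 - 2 * v)"
proof -
  have 1: "(1 - 2 * v - 1) / 2 = (-1) * v" "(1 - 2 * v + 1) / 2 = 1 - v" by auto
  show ?thesis
    unfolding jac_poly_def jacobi_def poly_sum 1 power_mult_distrib
    by (rule sum.cong) (simp_all add: jac_coeff_def algebra_simps)
qed

lemma degree_jac_poly: "degree (jac_poly N a b) \<le> N"
  unfolding jac_poly_def
proof (rule degree_sum_le)
  fix i assume i: "i \<in> {..N}"
  have "degree ([:0, 1:] ^ i * [:1, -1::real:] ^ (N - i)) \<le> i + (N - i)"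
    by (rule order_trans[OF degree_mult_le add_mono]; rule order_trans[OF degree_power_le]; simp)
  then show "degree (smult (jac_coeff N a b i) ([:0, 1:] ^ i * [:1, -1:] ^ (N - i))) \<le> N"
    using i by (intro order_trans[OF degree_smult_le]) simp
qed simp

text \<open>The coefficients are hypergeometric: consecutive ones have a rational ratio. This
  two-term recurrence is all that the differential equation needs, since it moves a term of the
  expansion to its neighbour.\<close>

lemma jac_coeff_Suc:
  assumes "i < N"
  shows "jac_coeff N a b (Suc i) * (real i + 1) * (real i + 1 + a) =
         - (jac_coeff N a b i * (real N - real i) * (real N - real i + b))"
proof -
  define k where "k = N - Suc i"
  have Nk: "N - i = Suc k" "N - Suc i = k" "real N = real k + 1 + real i" using assms by (auto simp: k_def)
  have A: "(x gchoose Suc m) * (real m + 1) = (x gchoose m) * (x - real m)" for x :: real and m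
    using gbinomial_mult_1[of x m] by (simp add: algebra_simps)
  have "jac_coeff N a b (Suc i) * (real i + 1) * (real i + 1 + a) =
     (real N + a gchoose k) * (real i + 1 + a) * ((real N + b gchoose Suc i) * (real i + 1)) * (-1) ^ Suc i"
    by (simp add: jac_coeff_def Nk(2))
  also have "(real N + b gchoose Suc i) * (real i + 1) = (real N + b gchoose i) * (real N + b - real i)"
    by (rule A)
  also have "(real N + a gchoose k) * (real i + 1 + a) = (real N + a gchoose Suc k) * (real k + 1)"
    unfolding A using Nk by (simp add: algebra_simps)
  finally show ?thesis by (simp add: jac_coeff_def Nk algebra_simps)
qed

lemma poly_pderiv_basis:
  fixes v :: real
  shows "poly (pderiv ([:0, 1:] ^ i * [:1, -1:] ^ k)) v =
     real i * v ^ (i - 1) * (1 - v) ^ k - real k * v ^ i * (1 - v) ^ (k - 1)"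
  by (cases i; cases k) (simp_all add: pderiv_mult pderiv_power_Suc pderiv_pCons algebra_simps del: power_Suc)

text \<open>In the basis v^i (1-v)^k with i + k fixed the hypergeometric operator is tridiagonal: it
  produces the element itself and its two neighbours. The truncated exponents \<open>i - 1\<close>
  and \<open>k - 1\<close> do no harm, because their coefficients vanish when i or k is 0.\<close>

lemma jac_basis_ode:
  fixes v a b :: real
  assumes "y = [:0, 1:] ^ i * [:1, -1::real:] ^ k"
  shows "v * (1 - v) * poly (pderiv (pderiv y)) v + ((a + 1) * (1 - v) - (b + 1) * v) * poly (pderiv y) v =
     real i * (real i + a) * (v ^ (i - 1) * (1 - v) ^ (k + 1))
     - (2 * real i * real k + (a + 1) * real k + (b + 1) * real i) * (v ^ i * (1 - v) ^ k)
     + real k * (real k + b) * (v ^ (i + 1) * (1 - v) ^ (k - 1))"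
proof -
  have D: "pderiv ([:0, 1:] ^ i * [:1, -1::real:] ^ k) =
      smult (real i) ([:0, 1:] ^ (i - 1) * [:1, -1:] ^ k) - smult (real k) ([:0, 1:] ^ i * [:1, -1:] ^ (k - 1))" for i k
    by (rule poly_eq_poly_eq_iff[THEN iffD1]) (auto simp: poly_pderiv_basis simp del: pderiv_mult)
  have DD: "poly (pderiv (pderiv y)) v =
      real i * (real (i - 1) * v ^ (i - 1 - 1) * (1 - v) ^ k - real k * v ^ (i - 1) * (1 - v) ^ (k - 1))
      - real k * (real i * v ^ (i - 1) * (1 - v) ^ (k - 1) - real (k - 1) * v ^ i * (1 - v) ^ (k - 1 - 1))"
    by (simp add: assms D pderiv_diff pderiv_smult mult.assoc)
  have i: "i = 0 \<or> i = 1 \<or> (\<exists>i'. i = Suc (Suc i'))" and k: "k = 0 \<or> k = 1 \<or> (\<exists>k'. k = Suc (Suc k'))"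
    by presburger+
  show ?thesis
    unfolding DD unfolding assms poly_pderiv_basis
    using i k by (elim disjE exE; ((simp add: algebra_simps; fail) | (simp, algebra)))
qed

lemma pderiv_sum': "pderiv (\<Sum>i\<in>A. f i) = (\<Sum>i\<in>A. pderiv (f i :: 'a::{comm_semiring_1,semiring_no_zero_divisors} poly))"
  by (induction A rule: infinite_finite_induct) (simp_all add: pderiv_add)

text \<open>The two neighbour sums are shifted by one index, one up and one down, and
  \<open>jac_coeff_Suc\<close> turns each into a sum with the original coefficients; what is left on
  every basis element is the constant -N(N+a+b+1).\<close>

lemma jac_poly_ode_eval:
  "v * (1 - v) * poly (pderiv (pderiv (jac_poly N a b))) v
     + ((a + 1) * (1 - v) - (b + 1) * v) * poly (pderiv (jac_poly N a b)) v
     + real N * (real N + a + b + 1) * poly (jac_poly N a b) v = 0"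
proof -
  let ?c = "jac_coeff N a b"
  let ?y = "\<lambda>i. [:0, 1:] ^ i * [:1, -1::real:] ^ (N - i)"
  let ?Y = "\<lambda>i. v ^ i * (1 - v) ^ (N - i)"
  have y: "poly (?y i) v = ?Y i" for i by simp
  have d1: "pderiv (jac_poly N a b) = (\<Sum>i\<le>N. smult (?c i) (pderiv (?y i)))"
    by (simp only: jac_poly_def pderiv_sum' pderiv_smult)
  have d2: "pderiv (pderiv (jac_poly N a b)) = (\<Sum>i\<le>N. smult (?c i) (pderiv (pderiv (?y i))))"
    unfolding d1 by (simp only: pderiv_sum' pderiv_smult)
  let ?T1 = "\<lambda>i. ?c i * (real i * (real i + a) * (v ^ (i - 1) * (1 - v) ^ (N - i + 1)))"
  let ?T3 = "\<lambda>i. ?c i * ((real N - real i) * (real N - real i + b) * (v ^ (i + 1) * (1 - v) ^ (N - i - 1)))"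
  let ?T2 = "\<lambda>i. ?c i * (2 * real i * (real N - real i) + (a + 1) * (real N - real i) + (b + 1) * real i) * ?Y i"
  have E: "v * (1 - v) * (\<Sum>i\<le>N. ?c i * poly (pderiv (pderiv (?y i))) v)
      + ((a + 1) * (1 - v) - (b + 1) * v) * (\<Sum>i\<le>N. ?c i * poly (pderiv (?y i)) v)
      = (\<Sum>i\<le>N. ?T1 i - ?T2 i + ?T3 i)"
    unfolding sum_distrib_left sum.distrib[symmetric]
  proof (rule sum.cong[OF refl])
    fix i assume "i \<in> {..N}"
    then have r: "real (N - i) = real N - real i" by (simp add: of_nat_diff)
    show "v * (1 - v) * (?c i * poly (pderiv (pderiv (?y i))) v)
        + ((a + 1) * (1 - v) - (b + 1) * v) * (?c i * poly (pderiv (?y i)) v) = ?T1 i - ?T2 i + ?T3 i"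
      using arg_cong[OF jac_basis_ode[OF refl, of v i "N - i" a b], of "\<lambda>x. ?c i * x"]
      unfolding r by (simp add: algebra_simps)
  qed
  have S1: "(\<Sum>i\<le>N. ?T1 i) = (\<Sum>i\<le>N. - (?c i * (real N - real i) * (real N - real i + b)) * ?Y i)"
  proof -
    have "(\<Sum>i\<le>N. ?T1 i) = (\<Sum>i<N. ?T1 (Suc i))"
      by (subst sum.atMost_shift) simp
    also have "\<dots> = (\<Sum>i<N. - (?c i * (real N - real i) * (real N - real i + b)) * ?Y i)"
    proof (rule sum.cong[OF refl])
      fix i assume "i \<in> {..<N}"
      then have "i < N" and e: "N - Suc i + 1 = N - i" by auto
      show "?T1 (Suc i) = - (?c i * (real N - real i) * (real N - real i + b)) * ?Y i"
        unfolding jac_coeff_Suc[OF \<open>i < N\<close>, symmetric] e by (simp add: algebra_simps)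
    qed
    also have "\<dots> = (\<Sum>i\<le>N. - (?c i * (real N - real i) * (real N - real i + b)) * ?Y i)"
      unfolding lessThan_Suc_atMost[symmetric] by simp
    finally show ?thesis .
  qed
  have S3: "(\<Sum>i\<le>N. ?T3 i) = (\<Sum>i\<le>N. - (?c i * real i * (real i + a)) * ?Y i)"
  proof -
    have "(\<Sum>i\<le>N. ?T3 i) = (\<Sum>i<N. ?T3 i)"
      unfolding lessThan_Suc_atMost[symmetric] by simp
    also have "\<dots> = (\<Sum>i<N. - (?c (Suc i) * real (Suc i) * (real (Suc i) + a)) * ?Y (Suc i))"
    proof (rule sum.cong[OF refl])
      fix i assume "i \<in> {..<N}"
      then have "i < N" by auto
      have c: "?c i * (real N - real i) * (real N - real i + b) = - (?c (Suc i) * real (Suc i) * (real (Suc i) + a))"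
        using jac_coeff_Suc[OF \<open>i < N\<close>, of a b] by (simp add: add.commute)
      have "?T3 i = ?c i * (real N - real i) * (real N - real i + b) * ?Y (Suc i)" by simp
      then show "?T3 i = - (?c (Suc i) * real (Suc i) * (real (Suc i) + a)) * ?Y (Suc i)"
        unfolding c .
    qed
    also have "\<dots> = (\<Sum>i\<le>N. - (?c i * real i * (real i + a)) * ?Y i)"
      by (subst sum.atMost_shift) simp
    finally show ?thesis .
  qed
  have "(\<Sum>i\<le>N. ?T1 i - ?T2 i + ?T3 i) = - (\<Sum>i\<le>N. real N * (real N + a + b + 1) * (?c i * ?Y i))"
    unfolding sum.distrib sum_subtractf S1 S3 unfolding sum_subtractf[symmetric] sum.distrib[symmetric] sum_negf[symmetric]
    by (rule sum.cong[OF refl]) algebra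
  then have Z: "v * (1 - v) * (\<Sum>i\<le>N. ?c i * poly (pderiv (pderiv (?y i))) v)
      + ((a + 1) * (1 - v) - (b + 1) * v) * (\<Sum>i\<le>N. ?c i * poly (pderiv (?y i)) v)
      + real N * (real N + a + b + 1) * (\<Sum>i\<le>N. ?c i * ?Y i) = 0"
    unfolding E by (simp add: sum_distrib_left)
  have e: "poly (pderiv (pderiv (jac_poly N a b))) v = (\<Sum>i\<le>N. ?c i * poly (pderiv (pderiv (?y i))) v)"
    "poly (pderiv (jac_poly N a b)) v = (\<Sum>i\<le>N. ?c i * poly (pderiv (?y i)) v)"
    "poly (jac_poly N a b) v = (\<Sum>i\<le>N. ?c i * ?Y i)"
    unfolding d2 unfolding d1 unfolding jac_poly_def by (simp_all only: poly_sum poly_smult y)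
  show ?thesis unfolding e by (rule Z)
qed

section \<open>The Jacobi weight, orthogonality and the norm\<close>

text \<open>Agrees with \<open>powr\<close> at positive arguments, but with exponent 0 it is 1 even
  at 0, where \<open>powr\<close> gives 0. The weight v^a (1-v)^b is then continuous on the closed
  interval also for a = 0 or b = 0, and its boundary values are the true ones.\<close>

definition rpow :: "real \<Rightarrow> real \<Rightarrow> real" where
  "rpow a x = (if a = 0 then 1 else x powr a)"

lemma rpow_eq_powr: "x > 0 \<Longrightarrow> rpow a x = x powr a"
  by (simp add: rpow_def)

lemma rpow_nonneg [simp]: "rpow a x \<ge> 0"
  by (simp add: rpow_def)

lemma rpow_pos: "x > 0 \<Longrightarrow> rpow a x > 0"
  by (simp add: rpow_def)

lemma continuous_on_rpow: "a \<ge> 0 \<Longrightarrow> continuous_on {0..} (rpow a)"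
  unfolding rpow_def[abs_def] by (cases "a = 0") (auto intro!: continuous_on_powr'[OF continuous_on_id continuous_on_const])

lemma DERIV_rpow:
  assumes "x > 0"
  shows "(rpow a has_real_derivative rpow a x * (a / x)) (at x)"
proof (cases "a = 0")
  case False
  then have "rpow a = (\<lambda>x. x powr a)" by (auto simp: rpow_def)
  moreover have "((\<lambda>x. x powr a) has_real_derivative (x powr a * (a / x))) (at x)"
    using assms by (auto intro!: derivative_eq_intros simp: powr_diff)
  ultimately show ?thesis by simp
qed (simp add: rpow_def[abs_def])

definition jw :: "real \<Rightarrow> real \<Rightarrow> real \<Rightarrow> real" where
  "jw a b v = rpow a v * rpow b (1 - v)"

lemma jw_nonneg [simp]: "jw a b v \<ge> 0"
  by (simp add: jw_def)

lemma jw_pos: "0 < v \<Longrightarrow> v < 1 \<Longrightarrow> jw a b v > 0"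
  by (simp add: jw_def rpow_pos)

lemma continuous_on_jw: "a \<ge> 0 \<Longrightarrow> b \<ge> 0 \<Longrightarrow> continuous_on {0..1} (jw a b)"
  unfolding jw_def
  by (intro continuous_on_mult continuous_on_subset[OF continuous_on_rpow]
      continuous_on_compose2[OF continuous_on_rpow]) (auto intro!: continuous_intros)

lemma DERIV_jw:
  assumes "0 < v" "v < 1"
  shows "(jw a b has_real_derivative jw a b v * (a / v - b / (1 - v))) (at v)"
proof -
  have 1: "((\<lambda>v. rpow b (1 - v)) has_real_derivative rpow b (1 - v) * (b / (1 - v)) * (-1)) (at v)"
    by (rule DERIV_chain2[OF DERIV_rpow]) (use assms in \<open>auto intro!: derivative_eq_intros\<close>)
  show ?thesis unfolding jw_def
    by (rule DERIV_cong[OF DERIV_mult[OF DERIV_rpow 1]]) (use assms in \<open>auto simp: field_simps\<close>)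
qed

definition jf :: "nat \<Rightarrow> real \<Rightarrow> real \<Rightarrow> real \<Rightarrow> real" where
  "jf N a b v = jw a b v * (jacobi N a b (1 - 2 * v))\<^sup>2"

definition jI :: "nat \<Rightarrow> real \<Rightarrow> real \<Rightarrow> real" where
  "jI N a b = integral {0..1} (jf N a b)"

text \<open>With W = v^a (1-v)^b this is r mapped to (1/W) (v (1-v) W r)', written so that it stays
  within polynomials. Jacobi's equation becomes \<open>jac_div\<close> p' = - \<open>lam\<close> p,
  and most integrations by parts on the unit interval are the fundamental theorem for this
  operator.\<close>

definition jac_div :: "real \<Rightarrow> real \<Rightarrow> real poly \<Rightarrow> real poly" where
  "jac_div a b r = [:a + 1, - (a + b + 2):] * r + [:0, 1, -1:] * pderiv r"

locale jac =
  fixes N :: nat and a b :: real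
  assumes a0: "a \<ge> 0" and b0: "b \<ge> 0"
begin

abbreviation "W \<equiv> jw a b"
abbreviation "p \<equiv> jac_poly N a b"
abbreviation "f \<equiv> jf N a b"
abbreviation "I0 \<equiv> jI N a b"
text \<open>The large parameter of all estimates; it is tied to the eigenvalue by K^2 = 4
  \<open>lam\<close> + (a+b+1)^2.\<close>

definition "K = 2 * real N + a + b + 1"
definition "lam = real N * (real N + a + b + 1)"

lemma f_eq: "f v = W v * (poly p v)\<^sup>2"
  by (simp add: jf_def poly_jac_poly)

lemma f_nonneg [simp]: "f v \<ge> 0"
  by (simp add: jf_def)

lemma K_ge: "K \<ge> 1" "2 * real N \<le> K"  "K > 0" "real N < K"
  using a0 b0 by (auto simp: K_def)

lemma lam_le: "lam \<le> real N * K"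
  unfolding lam_def K_def by (intro mult_left_mono) auto

lemma ode: "jac_div a b (pderiv p) = smult (- lam) p"
proof (rule poly_eq_poly_eq_iff[THEN iffD1], rule ext)
  fix v show "poly (jac_div a b (pderiv p)) v = poly (smult (- lam) p) v"
    using jac_poly_ode_eval[of v N a b] by (simp add: jac_div_def lam_def algebra_simps)
qed

lemma cont_W: "continuous_on {0..1} W"
  using a0 b0 by (rule continuous_on_jw)

lemma cont_Wpoly: "continuous_on {0..1} (\<lambda>v. W v * poly r v)"
  by (intro continuous_intros cont_W)

lemma cont_f: "continuous_on {0..1} f"
  unfolding f_eq[abs_def] by (intro continuous_intros cont_W)

lemma int_Wpoly: "0 \<le> x \<Longrightarrow> y \<le> 1 \<Longrightarrow> (\<lambda>v. W v * poly r v) integrable_on {x..y}"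
  by (intro integrable_continuous_real continuous_on_subset[OF cont_Wpoly]) auto

lemma int_f: "0 \<le> x \<Longrightarrow> y \<le> 1 \<Longrightarrow> f integrable_on {x..y}"
  by (intro integrable_continuous_real continuous_on_subset[OF cont_f]) auto

lemma DERIV_pW:
  assumes "0 < v" "v < 1"
  shows "((\<lambda>s. s * (1 - s) * W s * poly r s) has_real_derivative W v * poly (jac_div a b r) v) (at v)"
  by (rule derivative_eq_intros DERIV_jw[OF assms] refl)+
     (use assms in \<open>simp add: jac_div_def field_simps, algebra?\<close>)

text \<open>The boundary term at 0 is killed by the factor s (1 - s), even when a = 0 and the weight
  does not vanish there.\<close>

lemma ftc:
  assumes "0 \<le> s" "s \<le> 1"
  shows "((\<lambda>v. W v * poly (jac_div a b r) v) has_integral (s * (1 - s) * W s * poly r s)) {0..s}"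
proof -
  have "((\<lambda>v. W v * poly (jac_div a b r) v) has_integral
      (s * (1 - s) * W s * poly r s - 0 * (1 - 0) * W 0 * poly r 0)) {0..s}"
  proof (rule fundamental_theorem_of_calculus_interior[OF assms(1)])
    show "continuous_on {0..s} (\<lambda>s. s * (1 - s) * W s * poly r s)"
      by (intro continuous_intros continuous_on_subset[OF cont_W]) (use assms in auto)
    fix v assume "v \<in> {0<..<s}"
    then show "((\<lambda>s. s * (1 - s) * W s * poly r s) has_vector_derivative W v * poly (jac_div a b r) v) (at v)"
      using DERIV_pW[of v r] assms by (simp add: has_real_derivative_iff_has_vector_derivative)
  qed
  then show ?thesis by simp
qed

definition "L r = integral {0..1} (\<lambda>v. W v * poly r v)"

lemma L_add: "L (r + q) = L r + L q"
  unfolding L_def by (subst integral_add[symmetric]) (auto intro!: int_Wpoly simp: distrib_left)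

lemma L_smult: "L (smult c r) = c * L r"
  unfolding L_def by (subst integral_mult_right[symmetric]) (simp add: algebra_simps)

lemma L_diff: "L (r - q) = L r - L q"
  using L_add[of r "smult (-1) q"] L_smult[of "-1" q] by simp

lemma L_div: "L (jac_div a b r) = 0"
  using ftc[of 1 r] by (simp add: L_def integral_unique)

lemma div_mult: "jac_div a b (q * r) = jac_div a b q * r + [:0, 1, -1:] * q * pderiv r"
  by (simp add: jac_div_def pderiv_mult algebra_simps)

text \<open>Self-adjointness of the Jacobi operator for the weight, tested against the eigenfunction
  p: the integrand is a difference of two exact derivatives.\<close>

lemma L_ode: "L (p * (jac_div a b (pderiv r) + smult lam r)) = 0"
proof -
  have "p * (jac_div a b (pderiv r) + smult lam r) =
      jac_div a b (p * pderiv r) - jac_div a b (pderiv p * r)"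
    unfolding mult.commute[of p "pderiv r"] div_mult ode by (simp add: algebra_simps)
  then show ?thesis by (simp add: L_diff L_div)
qed

text \<open>Inserting the monomial of degree d into \<open>L_ode\<close> expresses (lam_N - lam_d)
  times its pairing with p as a multiple of the pairing in degree d - 1. The eigenvalues lam_d = d
  (d + a + b + 1) increase strictly with the degree, so induction applies.\<close>

lemma L_monom: "d < N \<Longrightarrow> L (p * monom 1 d) = 0"
proof (induction d)
  case 0
  have "L (p * (jac_div a b (pderiv 1) + smult lam 1)) = 0" by (rule L_ode)
  then have "lam * L p = 0" by (simp add: jac_div_def L_smult)
  moreover have "lam > 0" using 0 a0 b0 by (simp add: lam_def)
  ultimately show ?case by simp
next
  case (Suc d)
  have e: "jac_div a b (pderiv (monom 1 (Suc d))) =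
     smult (real (Suc d) * (real (Suc d) + a)) (monom 1 d)
     - smult (real (Suc d) * (real (Suc d) + a + b + 1)) (monom 1 (Suc d))"
    by (rule poly_eq_poly_eq_iff[THEN iffD1], rule ext, cases d)
      (simp_all add: jac_div_def pderiv_monom poly_monom algebra_simps)
  have "L (p * (jac_div a b (pderiv (monom 1 (Suc d))) + smult lam (monom 1 (Suc d)))) = 0"
    by (rule L_ode)
  then have "(lam - real (Suc d) * (real (Suc d) + a + b + 1)) * L (p * monom 1 (Suc d)) = 0"
    using Suc by (simp add: e L_add L_diff L_smult algebra_simps)
  moreover have "real (Suc d) * (real (Suc d) + a + b + 1) < lam"
    unfolding lam_def using Suc.prems a0 b0 by (intro mult_strict_mono) auto
  ultimately show ?case by simp
qed

lemma L_orth: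
  assumes "degree r < N"
  shows "L (p * r) = 0"
proof -
  have "L (p * r) = L (\<Sum>i\<le>degree r. smult (coeff r i) (p * monom 1 i))"
    by (subst poly_as_sum_of_monoms[of r, symmetric]) (simp add: sum_distrib_left smult_monom mult_smult_right[symmetric] del: mult_smult_right)
  also have "\<dots> = (\<Sum>i\<le>degree r. coeff r i * L (p * monom 1 i))"
  proof -
    have "L (sum g A) = (\<Sum>i\<in>A. L (g i))" if "finite A" for g :: "nat \<Rightarrow> real poly" and A
      using that by (induction A) (simp_all add: L_add, simp add: L_def)
    then show ?thesis by (simp add: L_smult)
  qed
  also have "\<dots> = 0" using assms by (intro sum.neutral) (auto simp: L_monom)
  finally show ?thesis .
qed

lemma I0_eq: "I0 = L (p * p)"
  unfolding jI_def L_def by (intro arg_cong[where f = "integral {0..1}"] ext) (simp add: f_eq power2_eq_square)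

lemma L_pp': "L (p * pderiv p) = 0"
proof (cases "degree p = 0")
  case True
  then have "pderiv p = 0" by (simp add: pderiv_eq_0_iff)
  then show ?thesis by (simp add: L_def)
next
  case False
  then have "degree (pderiv p) < N" using degree_jac_poly[of N a b] by (simp add: degree_pderiv)
  then show ?thesis by (rule L_orth)
qed

text \<open>In v p' - N p the terms of degree N cancel, so this polynomial is orthogonal to
  p.\<close>

lemma L_Xpp': "L (p * (pCons 0 (pderiv p))) = real N * I0"
proof -
  define r where "r = pCons 0 (pderiv p) - smult (real N) p"
  have "L (p * r) = 0"
  proof (cases "r = 0")
    case False
    have "degree (pCons 0 (pderiv p)) \<le> N" 
      using degree_jac_poly[of N a b] by (cases "pderiv p = 0") (auto simp: degree_pderiv pderiv_eq_0_iff)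
    then have le: "degree r \<le> N" unfolding r_def
      by (intro degree_diff_le) (use degree_jac_poly[of N a b] in auto)
    have "coeff r N = 0" unfolding r_def by (cases N) (simp_all add: coeff_pderiv)
    with le False have "degree r < N"
      by (metis le_neq_implies_less leading_coeff_0_iff)
    then show ?thesis by (rule L_orth)
  qed (simp add: L_def)
  then show ?thesis by (simp add: r_def right_diff_distrib L_diff L_smult I0_eq)
qed

lemma p0: "poly p 0 = (real N + a) gchoose N"
proof -
  have "poly p 0 = (\<Sum>i\<le>N. if i = 0 then jac_coeff N a b 0 else 0)"
    unfolding jac_poly_def poly_sum by (rule sum.cong) (auto simp: power_0_left)
  then show ?thesis by (simp add: jac_coeff_def)
qed

lemma p0_pos: "poly p 0 > 0"
  unfolding p0 gbinomial_prod_rev using a0 by (auto intro!: divide_pos_pos prod_pos)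

lemma I0_pos: "I0 > 0"
proof -
  have "I0 \<noteq> 0"
  proof
    assume "I0 = 0"
    then have z: "f x = 0" if "x \<in> {0..1}" for x
      using integral_eq_0_iff[of 0 1 f] cont_f that by (simp add: jI_def)
    have "poly p x = 0" if "x \<in> {0<..<1}" for x
    proof -
      have "f x = 0" "W x > 0" using that z by (auto intro!: jw_pos)
      then show ?thesis by (simp add: f_eq)
    qed
    then have "{0<..<1} \<subseteq> {x. poly p x = 0}" by auto
    moreover have "finite {x. poly p x = 0}"
      using p0_pos by (intro poly_roots_finite) auto
    ultimately show False using infinite_Ioo[of "0::real" 1] finite_subset by (metis zero_less_one)
  qed
  moreover have "I0 \<ge> 0" unfolding jI_def by (intro integral_nonneg int_f) auto
  ultimately show ?thesis by simp
qed

end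

section \<open>Energy and mass identities and the first pointwise bounds\<close>

context jac
begin

lemma int_le_01:
  assumes "g integrable_on {0..1}" "\<And>v. v \<in> {0..1} \<Longrightarrow> g v \<ge> 0" "0 \<le> s" "s \<le> 1"
  shows "integral {0..s} g \<le> integral {0..1::real} (g :: real \<Rightarrow> real)" "g integrable_on {0..s}"
proof -
  show "g integrable_on {0..s}"
    by (rule integrable_on_subinterval[OF assms(1)]) (use assms in auto)
  then show "integral {0..s} g \<le> integral {0..1} g"
    by (intro integral_subset_le) (use assms in auto)
qed

lemma int_f_le: "0 \<le> s \<Longrightarrow> s \<le> 1 \<Longrightarrow> integral {0..s} f \<le> I0"
  unfolding jI_def by (rule int_le_01(1)[OF int_f]) auto

text \<open>Multiply the Jacobi equation by p and integrate: \<open>jac_div\<close> of the product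
  p' p has integral 0, and the product rule splits it into the two quantities compared here.\<close>

lemma energy: "((\<lambda>v. v * (1 - v) * W v * (poly (pderiv p) v)\<^sup>2) has_integral lam * I0) {0..1}"
proof -
  let ?r = "[:0, 1, -1:] * pderiv p * pderiv p"
  have "jac_div a b (pderiv p * p) = smult (- lam) (p * p) + ?r"
    by (simp add: div_mult ode)
  then have "L (smult (- lam) (p * p) + ?r) = 0" by (metis L_div)
  then have "L ?r = lam * I0" unfolding L_add L_smult I0_eq by simp
  moreover have "((\<lambda>v. W v * poly ?r v) has_integral L ?r) {0..1}"
    unfolding L_def using int_Wpoly[of 0 1 ?r] by (simp add: has_integral_iff)
  moreover have "(\<lambda>v. W v * poly ?r v) = (\<lambda>v. v * (1 - v) * W v * (poly (pderiv p) v)\<^sup>2)"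
  proof
    fix v :: real
    have "poly [:0, 1, -1:] v = v * (1 - v)" by (simp add: algebra_simps)
    then show "W v * poly ?r v = v * (1 - v) * W v * (poly (pderiv p) v)\<^sup>2"
      by (simp only: poly_mult power2_eq_square mult_ac)
  qed
  ultimately show ?thesis by metis
qed

lemma energy_le:
  assumes "0 \<le> s" "s \<le> 1"
  shows "(\<lambda>v. v * (1 - v) * W v * (poly (pderiv p) v)\<^sup>2) integrable_on {0..s}"
    "integral {0..s} (\<lambda>v. v * (1 - v) * W v * (poly (pderiv p) v)\<^sup>2) \<le> lam * I0"
proof -
  have nn: "0 \<le> v * (1 - v) * W v * (poly (pderiv p) v)\<^sup>2" if "v \<in> {0..1}" for v using that by simp
  note int_le_01[OF has_integral_integrable[OF energy] nn assms]
  then show "(\<lambda>v. v * (1 - v) * W v * (poly (pderiv p) v)\<^sup>2) integrable_on {0..s}"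
    "integral {0..s} (\<lambda>v. v * (1 - v) * W v * (poly (pderiv p) v)\<^sup>2) \<le> lam * I0"
    unfolding integral_unique[OF energy] by blast+
qed

text \<open>Integrates the derivative of v^a (1-v)^(b+1) p^2. The cross terms p p' and v p p' are
  known exactly from orthogonality, so the identity has no error term; the last summand is the
  boundary value at 0. It serves twice: for a > 0 it is the first negative moment, and for a = 0 its
  left side vanishes and it computes the norm, \<open>K * I0 = 1\<close>.\<close>

lemma mass_aux:
  "((\<lambda>v. a * (f v / v)) has_integral K * I0 - (if a = 0 then 1 else 0)) {0..1}"
proof -
  let ?F = "\<lambda>v. jw a (b + 1) v * (poly p v)\<^sup>2"
  have c: "x - y + z + y - z = x" for x y z :: real by simp
  let ?D = "\<lambda>v. a * (f v / v) - (a + b + 1) * f v + 2 * (W v * poly (p * pderiv p - p * pCons 0 (pderiv p)) v)"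
  have "(?D has_integral (?F 1 - ?F 0)) {0..1}"
  proof (rule fundamental_theorem_of_calculus_interior)
    show "continuous_on {0..1} ?F"
      by (intro continuous_intros continuous_on_jw) (use a0 b0 in auto)
    fix v :: real assume "v \<in> {0<..<1}"
    then have v: "0 < v" "v < 1" by auto
    have w: "jw a (b + 1) v = (1 - v) * W v"
      using v by (simp add: jw_def rpow_eq_powr powr_add)
    then have w': "jw a (1 + b) v = (1 - v) * W v" by (simp add: add.commute)
    have "(?F has_real_derivative ?D v) (at v)"
      by (rule derivative_eq_intros DERIV_jw[OF v] refl)+
         (use v in \<open>simp add: f_eq w w' field_simps power2_eq_square\<close>)
    then show "(?F has_vector_derivative ?D v) (at v)"
      by (simp add: has_real_derivative_iff_has_vector_derivative)
  qed simp
  moreover have "?F 1 = 0" using b0 by (simp add: jw_def rpow_def)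
  moreover have "?F 0 = (if a = 0 then 1 else 0)"
    using p0 by (simp add: jw_def rpow_def binomial_gbinomial[symmetric])
  ultimately have D: "(?D has_integral - (if a = 0 then 1 else 0)) {0..1}" by simp
  have f: "(f has_integral I0) {0..1}" unfolding jI_def using int_f[of 0 1] by (simp add: has_integral_iff)
  have r: "((\<lambda>v. W v * poly r v) has_integral L r) {0..1}" for r
    unfolding L_def using int_Wpoly[of 0 1 r] by (simp add: has_integral_iff)
  have "((\<lambda>v. ?D v + (a + b + 1) * f v - 2 * (W v * poly (p * pderiv p - p * pCons 0 (pderiv p)) v))
     has_integral (- (if a = 0 then 1 else 0) + (a + b + 1) * I0 - 2 * L (p * pderiv p - p * pCons 0 (pderiv p)))) {0..1}"
    by (intro has_integral_diff has_integral_add D has_integral_mult_right f r)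
  also have "- (if a = 0 then 1 else 0) + (a + b + 1) * I0 - 2 * L (p * pderiv p - p * pCons 0 (pderiv p))
     = K * I0 - (if a = 0 then 1 else 0)"
    unfolding L_diff L_pp' L_Xpp' K_def by (simp add: algebra_simps)
  also have "(\<lambda>v. ?D v + (a + b + 1) * f v - 2 * (W v * poly (p * pderiv p - p * pCons 0 (pderiv p)) v)) = (\<lambda>v. a * (f v / v))"
    unfolding c ..
  finally show ?thesis .
qed

lemma mass:
  assumes "a > 0"
  shows "((\<lambda>v. f v / v) has_integral K / a * I0) {0..1}"
proof -
  have "((\<lambda>v. 1 / a * (a * (f v / v))) has_integral 1 / a * (K * I0 - (if a = 0 then 1 else 0))) {0..1}"
    by (intro has_integral_mult_right mass_aux)
  moreover have "(\<lambda>v. 1 / a * (a * (f v / v))) = (\<lambda>v. f v / v)" using assms by auto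
  moreover have "1 / a * (K * I0 - (if a = 0 then 1 else 0)) = K / a * I0" using assms by simp
  ultimately show ?thesis by metis
qed

lemma K_I0:
  assumes "a = 0"
  shows "K * I0 = 1"
proof -
  have "((\<lambda>v. a * (f v / v)) has_integral 0) {0..1}" using assms by simp
  from has_integral_unique[OF this mass_aux] assms show ?thesis by simp
qed

lemma f_deriv:
  assumes "0 < v" "v < 1"
  shows "(f has_real_derivative W v * (a / v - b / (1 - v)) * (poly p v)\<^sup>2 + 2 * W v * poly p v * poly (pderiv p) v) (at v)"
proof -
  have "((\<lambda>v. W v * (poly p v)\<^sup>2) has_real_derivative
      W v * (a / v - b / (1 - v)) * (poly p v)\<^sup>2 + 2 * poly p v * poly (pderiv p) v * W v) (at v)"
    by (rule derivative_eq_intros DERIV_jw[OF assms] refl)+ simp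
  moreover have "f = (\<lambda>v. W v * (poly p v)\<^sup>2)" by (rule ext) (rule f_eq)
  ultimately show ?thesis by (simp add: mult_ac)
qed

text \<open>f(s) is the integral of f' over [0, s], as f(0) = 0. The negative part of the derivative
  of the weight is dropped, and the cross term 2 p p' is split by the inequality of means into the
  mass density f / v and the energy density; x is the free parameter of this splitting.\<close>

lemma head_bound:
  assumes "a > 0" "0 \<le> s" "s < 1" "x > 0"
  shows "f s \<le> K * I0 * (1 + x / (a * (1 - s)) + real N / x)"
proof -
  let ?e = "\<lambda>v. v * (1 - v) * W v * (poly (pderiv p) v)\<^sup>2"
  let ?D = "\<lambda>v. W v * (a / v - b / (1 - v)) * (poly p v)\<^sup>2 + 2 * W v * poly p v * poly (pderiv p) v"
  let ?B = "\<lambda>v. a * (f v / v) + x / (1 - s) * (f v / v) + 1 / x * ?e v"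
  have m: "(\<lambda>v. f v / v) integrable_on {0..s}" "integral {0..s} (\<lambda>v. f v / v) \<le> K / a * I0"
    using int_le_01[OF has_integral_integrable[OF mass[OF assms(1)]], of s] mass[OF assms(1)] assms
    by (auto simp: integral_unique)
  have e: "?e integrable_on {0..s}" "integral {0..s} ?e \<le> lam * I0" using energy_le assms by auto
  have e': "integral {0..s} ?e \<le> real N * K * I0"
    using e(2) mult_right_mono[OF lam_le, of I0] I0_pos by linarith
  have D: "(?D has_integral (f s - f 0)) {0..s}"
  proof (rule fundamental_theorem_of_calculus_interior[OF assms(2)])
    show "continuous_on {0..s} f" by (rule continuous_on_subset[OF cont_f]) (use assms in auto)
    fix v assume "v \<in> {0<..<s}"
    then show "(f has_vector_derivative ?D v) (at v)"
      using f_deriv[of v] assms by (simp add: has_real_derivative_iff_has_vector_derivative)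
  qed
  have le: "?D v \<le> ?B v" if "v \<in> {0<..<s}" for v
  proof -
    have v: "0 < v" "v < s" "v < 1" using that assms by auto
    have "2 * (poly p v * poly (pderiv p) v) \<le> x / (v * (1 - v)) * (poly p v)\<^sup>2 + v * (1 - v) / x * (poly (pderiv p) v)\<^sup>2"
    proof -
      \<comment> \<open>With this constant c p^2 is a multiple of the mass density, up to replacing
        1 - v by 1 - s, and p'^2 / c is a multiple of the energy density.\<close>
      define c where "c = x / (v * (1 - v))"
      have c: "c > 0" using v assms by (simp add: c_def)
      have "0 \<le> (c * poly p v - poly (pderiv p) v)\<^sup>2 / c" using c by simp
      also have "\<dots> = c * (poly p v)\<^sup>2 + 1 / c * (poly (pderiv p) v)\<^sup>2 - 2 * (poly p v * poly (pderiv p) v)"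
        using c by (simp add: field_simps power2_eq_square)
      finally show ?thesis by (simp add: c_def)
    qed
    also have "x / (v * (1 - v)) * (poly p v)\<^sup>2 \<le> x / (1 - s) * ((poly p v)\<^sup>2 / v)"
    proof -
      have "x / (1 - v) \<le> x / (1 - s)" using v assms by (intro divide_left_mono) auto
      from mult_right_mono[OF this, of "(poly p v)\<^sup>2 / v"] v show ?thesis by (simp add: field_simps)
    qed
    finally have "2 * (poly p v * poly (pderiv p) v) \<le> x / (1 - s) * ((poly p v)\<^sup>2 / v) + v * (1 - v) / x * (poly (pderiv p) v)\<^sup>2"
      by simp
    from mult_left_mono[OF this, of "W v"]
    have "2 * W v * poly p v * poly (pderiv p) v \<le>
        W v * (x / (1 - s) * ((poly p v)\<^sup>2 / v) + v * (1 - v) / x * (poly (pderiv p) v)\<^sup>2)"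
      by (simp add: mult_ac)
    also have "\<dots> = x / (1 - s) * (f v / v) + 1 / x * ?e v"
      by (simp only: f_eq distrib_left) (simp add: mult_ac)
    finally have 1: "2 * W v * poly p v * poly (pderiv p) v \<le> x / (1 - s) * (f v / v) + 1 / x * ?e v" .
    have "W v * (a / v - b / (1 - v)) * (poly p v)\<^sup>2 \<le> W v * (a / v) * (poly p v)\<^sup>2"
      using v b0 by (intro mult_right_mono mult_left_mono) auto
    also have "\<dots> = a * (f v / v)" by (simp add: f_eq)
    finally show ?thesis using 1 by simp
  qed
  have B: "(?B has_integral (a * integral {0..s} (\<lambda>v. f v / v) + x / (1 - s) * integral {0..s} (\<lambda>v. f v / v)
      + 1 / x * integral {0..s} ?e)) {0..s}"
    by (intro has_integral_add has_integral_mult_right integrable_integral m e)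
  have "f 0 = 0" using assms(1) by (simp add: f_eq jw_def rpow_def)
  then have "(?D has_integral f s) {0<..<s}" using D by (simp add: has_integral_Icc_iff_Ioo)
  moreover have "(?B has_integral (a * integral {0..s} (\<lambda>v. f v / v) + x / (1 - s) * integral {0..s} (\<lambda>v. f v / v)
      + 1 / x * integral {0..s} ?e)) {0<..<s}"
    using B by (simp only: has_integral_Icc_iff_Ioo)
  ultimately have "f s \<le> a * integral {0..s} (\<lambda>v. f v / v) + x / (1 - s) * integral {0..s} (\<lambda>v. f v / v)
      + 1 / x * integral {0..s} ?e"
    by (rule has_integral_le) (rule le)
  also have "\<dots> \<le> a * (K / a * I0) + x / (1 - s) * (K / a * I0) + 1 / x * (real N * K * I0)"
    using m e' assms
    by (intro add_mono mult_left_mono) auto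
  also have "\<dots> = K * I0 * (1 + x / (a * (1 - s)) + real N / x)"
    using assms by (simp add: field_simps)
  finally show ?thesis .
qed

text \<open>The same splitting, now with constant K and for the derivative of s (1 - s) f. The
  factor s (1 - s) makes a = 0 admissible, at the price of a weak bound near the endpoints.\<close>

lemma global_bound:
  assumes "0 \<le> s" "s \<le> 1"
  shows "s * (1 - s) * f s \<le> 2 * K * I0"
proof -
  let ?e = "\<lambda>v. v * (1 - v) * W v * (poly (pderiv p) v)\<^sup>2"
  let ?B = "\<lambda>v. (a + 1 + K / 4) * f v + 1 / K * ?e v"
  have e: "?e integrable_on {0..s}" "integral {0..s} ?e \<le> lam * I0" using energy_le assms by auto
  have e': "integral {0..s} ?e \<le> real N * K * I0"
    using e(2) mult_right_mono[OF lam_le, of I0] I0_pos by linarith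
  have D: "((\<lambda>v. W v * poly (jac_div a b (p * p)) v) has_integral s * (1 - s) * f s) {0..s}"
    using ftc[OF assms, of "p * p"] by (simp add: f_eq power2_eq_square mult.assoc)
  have "s * (1 - s) * f s \<le> (a + 1 + K / 4) * integral {0..s} f + 1 / K * integral {0..s} ?e"
  proof (rule has_integral_le[OF D])
    show "(?B has_integral (a + 1 + K / 4) * integral {0..s} f + 1 / K * integral {0..s} ?e) {0..s}"
      using e int_f[of 0 s] assms by (intro has_integral_add has_integral_mult_right integrable_integral) auto
    fix v assume v: "v \<in> {0..s}"
    then have v': "0 \<le> v" "v \<le> 1" using assms by auto
    let ?y = "poly p v" and ?z = "poly (pderiv p) v"
    have q: "v * (1 - v) \<ge> 0" "v * (1 - v) \<le> 1 / 4" using v' zero_le_power2[of "v - 1/2"]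
      by (auto simp: power2_eq_square algebra_simps mult_left_le)
    have "2 * ?y * ?z \<le> K * ?y\<^sup>2 + ?z\<^sup>2 / K"
    proof -
      have "0 \<le> (K * ?y - ?z)\<^sup>2 / K" using K_ge by simp
      also have "\<dots> = K * ?y\<^sup>2 + ?z\<^sup>2 / K - 2 * ?y * ?z"
        using K_ge by (simp add: field_simps power2_eq_square)
      finally show ?thesis by simp
    qed
    from mult_left_mono[OF this q(1)]
    have "v * (1 - v) * (2 * ?y * ?z) \<le> v * (1 - v) * (K * ?y\<^sup>2) + v * (1 - v) * ?z\<^sup>2 / K" by (simp add: distrib_left)
    also have "v * (1 - v) * (K * ?y\<^sup>2) \<le> 1 / 4 * (K * ?y\<^sup>2)" using q K_ge by (intro mult_right_mono) auto
    finally have 1: "v * (1 - v) * (2 * ?y * ?z) \<le> K / 4 * ?y\<^sup>2 + 1 / K * (v * (1 - v) * ?z\<^sup>2)" by simp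
    have "(a + 1 - (a + b + 2) * v) * ?y\<^sup>2 \<le> (a + 1) * ?y\<^sup>2"
      using a0 b0 v' by (intro mult_right_mono) auto
    with 1 have "(a + 1 - (a + b + 2) * v) * ?y\<^sup>2 + v * (1 - v) * (2 * ?y * ?z) \<le> (a + 1 + K / 4) * ?y\<^sup>2 + 1 / K * (v * (1 - v) * ?z\<^sup>2)"
      by (simp add: distrib_right)
    from mult_left_mono[OF this, of "W v"]
    show "W v * poly (jac_div a b (p * p)) v \<le> ?B v"
      by (simp add: f_eq jac_div_def pderiv_mult power2_eq_square algebra_simps)
  qed
  also have "\<dots> \<le> (a + 1 + K / 4) * I0 + 1 / K * (real N * K * I0)"
    using e' int_f_le[OF assms] a0 K_ge
    by (intro add_mono mult_left_mono) auto
  also have "\<dots> = (a + 1 + K / 4 + real N) * I0" using K_ge by (simp add: field_simps)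
  also have "\<dots> \<le> (2 * K) * I0" using I0_pos K_ge b0 by (intro mult_right_mono) (auto simp: K_def)
  finally show ?thesis .
qed

section \<open>Sonin's function for the Jacobi equation\<close>

text \<open>In the variable t = ln (v / (1 - v)) the function y = W^(1/2) p satisfies y'' + q y = 0,
  and \<open>A\<close> is the coefficient of v in the quadratic q. \<open>R\<close> is dy/dt without
  the factor W^(1/2), and \<open>rE\<close> is the polynomial for which v (1 - v) W rE is Sonin's
  function E = (dy/dt)^2 + q y^2.\<close>

definition "A = (K\<^sup>2 - 1 + a\<^sup>2 - b\<^sup>2) / 4"
definition "q v = A * v - (K\<^sup>2 - 1) / 4 * v\<^sup>2 - a\<^sup>2 / 4"
definition "q' v = A - (K\<^sup>2 - 1) / 2 * v"
definition "R v = (a - (a + b) * v) / 2 * poly p v + v * (1 - v) * poly (pderiv p) v"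
definition "rE = [:0, 1, -1:] * pderiv p * pderiv p + [:a, - (a + b):] * p * pderiv p + smult (lam + (a + b) / 2) (p * p)"

lemma K_sq: "K\<^sup>2 = 4 * lam + 2 * (a + b) + 1 + (a + b)\<^sup>2"
  unfolding K_def lam_def by (simp add: power2_eq_square algebra_simps)

text \<open>This is dE/dv = q' f in polynomial form. The second derivative of p occurs only as v (1
  - v) p'', which the Jacobi equation eliminates; the rest is algebra.\<close>

lemma div_rE: "poly (jac_div a b rE) v = q' v * (poly p v)\<^sup>2"
proof -
  define y y1 y2 where "y = poly p v" and "y1 = poly (pderiv p) v" and "y2 = poly (pderiv (pderiv p)) v"
  define z where "z = v * (1 - v) * y2"
  have z: "z = - (((a + 1) * (1 - v) - (b + 1) * v) * y1) - lam * y"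
    using jac_poly_ode_eval[of v N a b] by (simp add: z_def y_def y1_def y2_def lam_def)
  define X T :: "real poly" where "X = [:0, 1, -1:]" and "T = [:a, - (a + b):]"
  have X: "poly X v = v * (1 - v)" "poly (pderiv X) v = 1 - 2 * v"
    by (simp_all add: X_def pderiv_pCons algebra_simps)
  have T: "poly T v = a - (a + b) * v" "poly (pderiv T) v = - (a + b)"
    by (simp_all add: T_def pderiv_pCons algebra_simps)
  have r: "rE = X * pderiv p * pderiv p + T * p * pderiv p + smult (lam + (a + b) / 2) (p * p)"
    by (simp only: rE_def X_def T_def)
  have r0: "poly rE v = v * (1 - v) * y1 * y1 + (a - (a + b) * v) * y * y1 + (lam + (a + b) / 2) * y * y"
    unfolding r by (simp add: X T y_def y1_def mult.assoc)
  have r1: "poly (pderiv rE) v = (1 - 2 * v) * y1 * y1 + 2 * v * (1 - v) * y1 * y2 - (a + b) * y * y1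
        + (a - (a + b) * v) * (y1 * y1 + y * y2) + 2 * (lam + (a + b) / 2) * y * y1"
    unfolding r pderiv_add pderiv_mult pderiv_smult
    by (simp only: poly_add poly_mult poly_smult X T y_def[symmetric] y1_def[symmetric] y2_def[symmetric]) algebra
  have "poly (jac_div a b rE) v = ((a + 1) - (a + b + 2) * v) * poly rE v + v * (1 - v) * poly (pderiv rE) v"
    by (simp add: jac_div_def algebra_simps)
  also have "\<dots> =
     ((a + 1) - (a + b + 2) * v) * (v * (1 - v) * y1 * y1 + (a - (a + b) * v) * y * y1 + (lam + (a + b) / 2) * y * y)
     + v * (1 - v) * ((1 - 2 * v) * y1 * y1 + 2 * v * (1 - v) * y1 * y2 - (a + b) * y * y1
        + (a - (a + b) * v) * (y1 * y1 + y * y2) + 2 * (lam + (a + b) / 2) * y * y1)"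
    unfolding r0 r1 ..
  also have "\<dots> = ((a + 1) - (a + b + 2) * v) * (v * (1 - v) * y1 * y1 + (a - (a + b) * v) * y * y1 + (lam + (a + b) / 2) * y * y)
     + v * (1 - v) * ((1 - 2 * v) * y1 * y1 - (a + b) * y * y1 + (a - (a + b) * v) * y1 * y1
        + 2 * (lam + (a + b) / 2) * y * y1) + 2 * v * (1 - v) * y1 * z + (a - (a + b) * v) * y * z"
    unfolding z_def by (simp add: algebra_simps)
  also have "\<dots> = ((K\<^sup>2 - 1 + a\<^sup>2 - b\<^sup>2) / 4 - (K\<^sup>2 - 1) / 2 * v) * y\<^sup>2"
    unfolding K_sq z by (simp add: power2_eq_square field_simps)
  finally show ?thesis by (simp add: q'_def A_def y_def)
qed

lemma rE_eq: "v * (1 - v) * poly rE v = (R v)\<^sup>2 + q v * (poly p v)\<^sup>2"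
proof -
  define y y1 where "y = poly p v" and "y1 = poly (pderiv p) v"
  have "4 * (v * (1 - v) * (v * (1 - v) * y1 * y1 + (a - (a + b) * v) * y * y1 + (lam + (a + b) / 2) * y * y))
    = ((a - (a + b) * v) * y + 2 * v * (1 - v) * y1)\<^sup>2 + 4 * q v * y\<^sup>2"
    unfolding q_def A_def K_sq by (simp add: field_simps power2_eq_square)
  moreover have "(R v)\<^sup>2 = ((a - (a + b) * v) * y + 2 * v * (1 - v) * y1)\<^sup>2 / 4"
    unfolding R_def y_def y1_def by (simp add: field_simps power2_eq_square)
  moreover have "poly rE v = v * (1 - v) * y1 * y1 + (a - (a + b) * v) * y * y1 + (lam + (a + b) / 2) * y * y"
    unfolding rE_def y_def y1_def by (simp add: algebra_simps)
  ultimately show ?thesis by (simp add: y_def)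
qed

lemma E_int:
  assumes "0 \<le> s" "s \<le> 1"
  shows "((\<lambda>v. q' v * f v) has_integral W s * (R s)\<^sup>2 + q s * f s) {0..s}"
proof -
  have "s * (1 - s) * W s * poly rE s = W s * (s * (1 - s) * poly rE s)" by simp
  also have "\<dots> = W s * (R s)\<^sup>2 + q s * f s" unfolding rE_eq by (simp add: f_eq distrib_left)
  finally have 1: "s * (1 - s) * W s * poly rE s = W s * (R s)\<^sup>2 + q s * f s" .
  have 2: "(\<lambda>v. W v * poly (jac_div a b rE) v) = (\<lambda>v. q' v * f v)"
    by (simp add: div_rE f_eq mult_ac)
  show ?thesis using ftc[OF assms, of rE] unfolding 1 2 .
qed

text \<open>Expanded in N, a and b, 4 \<open>A\<close> has only nonnegative coefficients.\<close>

lemma A_ge: "4 * A \<ge> 4 * real N * b + 2 * b" "4 * A \<ge> real N" "A \<ge> 0" "K\<^sup>2 - 1 \<ge> 0"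
proof -
  have e: "4 * A = 4 * real N * real N + 4 * real N + 4 * real N * a + 2 * a * a + 2 * a + 4 * real N * b + 2 * b + 2 * a * b"
    unfolding A_def K_def by (simp add: power2_eq_square algebra_simps)
  have nn: "real N * real N \<ge> 0" "real N * a \<ge> 0" "a * a \<ge> 0" "real N * b \<ge> 0" "a * b \<ge> 0" "real N \<ge> 0"
    using a0 b0 by auto
  show "4 * A \<ge> 4 * real N * b + 2 * b" "4 * A \<ge> real N" using a0 b0 nn unfolding e mult.assoc by linarith+
  then show "A \<ge> 0" by simp
  show "K\<^sup>2 - 1 \<ge> 0" using K_ge by simp
qed

lemma q'_mono: "u \<le> s \<Longrightarrow> q' s \<le> q' u"
  unfolding q'_def using A_ge(4) by (simp add: mult_left_mono)

lemma E_le: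
  assumes "0 \<le> u" "u \<le> 1"
  shows "W u * (R u)\<^sup>2 + q u * f u \<le> A * I0"
proof -
  have "W u * (R u)\<^sup>2 + q u * f u \<le> A * integral {0..u} f"
  proof (rule has_integral_le[OF E_int[OF assms]])
    show "((\<lambda>v. A * f v) has_integral A * integral {0..u} f) {0..u}"
      using int_f[of 0 u] assms by (intro has_integral_mult_right integrable_integral) auto
    show "q' v * f v \<le> A * f v" if "v \<in> {0..u}" for v
      using that A_ge by (intro mult_right_mono) (auto simp: q'_def)
  qed
  also have "\<dots> \<le> A * I0" using int_f_le[OF assms] A_ge by (intro mult_left_mono) auto
  finally show ?thesis .
qed

lemma q_ge:
  assumes "q' u \<ge> 0" "0 \<le> u"
  shows "q u \<ge> A * u / 2 - a\<^sup>2 / 4"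
proof -
  have "(K\<^sup>2 - 1) / 2 * u \<le> A" using assms by (simp add: q'_def)
  from mult_right_mono[OF this, of "u / 2"] assms show ?thesis
    by (simp add: q_def power2_eq_square field_simps)
qed

text \<open>While q increases there are two ranges. Where A s \<ge> a^2, q is at least A s / 4 and
  the bound on E controls f directly. Where A s < a^2, q may be negative, but not below -a^2/4;
  there (v f)' is expressed through f and W p R and integrated up to s, and A s < a^2 makes the
  contribution of E of order a I0.\<close>

lemma left_bound:
  assumes "0 < s" "s \<le> 1 / 2" "q' s \<ge> 0"
  shows "s * f s \<le> 5 * (1 + a) * I0"
proof (cases "A * s \<ge> a\<^sup>2")
  case True
  have q: "q s \<ge> A * s / 4" using q_ge[of s] assms True by simp
  show ?thesis
  \<comment> \<open>A = 0 forces N = a = b = 0. Then E carries no information, and the global bound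
    with K = 1 takes over.\<close>
  proof (cases "A = 0")
    case True
    then have "b = 0" "N = 0" "a = 0" using A_ge b0 \<open>A * s \<ge> a\<^sup>2\<close> by (auto simp: zero_le_mult_iff)
    then have "K = 1" unfolding K_def by simp
    have "s * f s * (1 / 2) \<le> s * f s * (1 - s)" using assms by (intro mult_left_mono) auto
    also have "\<dots> \<le> 2 * I0" using global_bound[of s] assms \<open>K = 1\<close> by (simp add: algebra_simps)
    finally show ?thesis using I0_pos a0 \<open>a = 0\<close> by simp
  next
    case False
    then have A: "A > 0" using A_ge by simp
    have "A * s / 4 * f s \<le> q s * f s" using q by (intro mult_right_mono) auto
    also have "\<dots> \<le> W s * (R s)\<^sup>2 + q s * f s" by simp
    also have "\<dots> \<le> A * I0" using E_le[of s] assms by simp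
    finally have "A * (s * f s) \<le> A * (4 * I0)" by simp
    then have "s * f s \<le> 4 * I0" using A by simp
    also have "\<dots> \<le> 5 * (1 + a) * I0" using I0_pos a0 by (intro mult_right_mono) auto
    finally show ?thesis .
  qed
next
  case False
  moreover have "A * s \<ge> 0" using A_ge(3) assms by simp
  ultimately have "a \<noteq> 0" by auto
  then have a: "a > 0" using a0 by simp
  let ?D = "\<lambda>v. f v + v * (W v * (a / v - b / (1 - v)) * (poly p v)\<^sup>2 + 2 * W v * poly p v * poly (pderiv p) v)"
  let ?B = "\<lambda>v. (1 + 3 * a) * f v + 2 * A * I0 / a"
  have D: "(?D has_integral (s * f s - 0 * f 0)) {0..s}"
  proof (rule fundamental_theorem_of_calculus_interior)
    show "continuous_on {0..s} (\<lambda>v. v * f v)"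
      by (intro continuous_intros continuous_on_subset[OF cont_f]) (use assms in auto)
    fix v assume "v \<in> {0<..<s}"
    then have v: "0 < v" "v < 1" using assms by auto
    have "((\<lambda>v. v * f v) has_real_derivative ?D v) (at v)"
      by (rule derivative_eq_intros f_deriv[OF v] refl)+ simp
    then show "((\<lambda>v. v * f v) has_vector_derivative ?D v) (at v)"
      by (simp add: has_real_derivative_iff_has_vector_derivative)
  qed (use assms in simp)
  have B: "(?B has_integral (1 + 3 * a) * integral {0..s} f + 2 * A * I0 / a * s) {0..s}"
    using int_f[of 0 s] assms has_integral_const_real[of "2 * A * I0 / a" 0 s]
    by (intro has_integral_add has_integral_mult_right) (auto simp: integrable_integral algebra_simps)
  have le: "?D v \<le> ?B v" if "v \<in> {0<..<s}" for v
  proof -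
    have v: "0 < v" "v < 1 / 2" "v < s" using that assms by auto
    let ?y = "poly p v"
    have q'v: "q' v \<ge> 0" using q'_mono[of v s] v assms by simp
    have "A * v / 2 \<ge> 0" using v A_ge by simp
    then have "q v \<ge> - (a\<^sup>2 / 4)" using q_ge[OF q'v] v by simp
    then have "q v * f v \<ge> - (a\<^sup>2 / 4) * f v" by (intro mult_right_mono) auto
    then have WR: "W v * (R v)\<^sup>2 \<le> A * I0 + a\<^sup>2 / 4 * f v" using E_le[of v] v by simp
    have "?D v = f v + 2 / (1 - v) * (W v * ?y * R v)"
      using v by (simp add: R_def f_eq field_simps power2_eq_square)
    also have "2 / (1 - v) * (W v * ?y * R v) \<le> 4 * (W v * \<bar>?y\<bar> * \<bar>R v\<bar>)"
    proof -
      have "2 / (1 - v) * (W v * ?y * R v) \<le> 2 / (1 - v) * (W v * (\<bar>?y\<bar> * \<bar>R v\<bar>))"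
        unfolding mult.assoc using v abs_ge_self[of "?y * R v"] by (intro mult_left_mono) (auto simp: abs_mult)
      also have "\<dots> \<le> 4 * (W v * (\<bar>?y\<bar> * \<bar>R v\<bar>))"
        using v by (intro mult_right_mono) (auto simp: field_simps)
      finally show ?thesis by (simp add: mult.assoc)
    qed
    \<comment> \<open>The inequality of means with parameter a balances the two terms: after
      division by a, the part a^2/4 f of the bound \<open>WR\<close> is again of order a f.\<close>
    also have "4 * (W v * \<bar>?y\<bar> * \<bar>R v\<bar>) \<le> 2 * a * f v + 2 * (W v * (R v)\<^sup>2) / a"
    proof -
      have "0 \<le> (a * \<bar>?y\<bar> - \<bar>R v\<bar>)\<^sup>2 / a" using a by simp
      also have "\<dots> = a * ?y\<^sup>2 + (R v)\<^sup>2 / a - 2 * (\<bar>?y\<bar> * \<bar>R v\<bar>)"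
        using a by (simp add: power2_diff field_simps power2_eq_square)
      finally have "2 * (\<bar>?y\<bar> * \<bar>R v\<bar>) \<le> a * ?y\<^sup>2 + (R v)\<^sup>2 / a" by simp
      from mult_left_mono[OF this, of "2 * W v"] show ?thesis by (simp add: f_eq algebra_simps)
    qed
    also have "2 * (W v * (R v)\<^sup>2) / a \<le> 2 * (A * I0 + a\<^sup>2 / 4 * f v) / a"
      using mult_left_mono[OF WR, of 2] a by (intro divide_right_mono) auto
    also have "f v + (2 * a * f v + 2 * (A * I0 + a\<^sup>2 / 4 * f v) / a) \<le> ?B v"
      using a by (simp add: field_simps power2_eq_square)
    finally show ?thesis by simp
  qed
  have "(?D has_integral (s * f s)) {0<..<s}" using D by (simp add: has_integral_Icc_iff_Ioo)
  moreover have "(?B has_integral (1 + 3 * a) * integral {0..s} f + 2 * A * I0 / a * s) {0<..<s}"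
    using B by (simp only: has_integral_Icc_iff_Ioo)
  ultimately have "s * f s \<le> (1 + 3 * a) * integral {0..s} f + 2 * A * I0 / a * s"
    by (rule has_integral_le) (rule le)
  also have "\<dots> = (1 + 3 * a) * integral {0..s} f + 2 * (A * s) * I0 / a" by simp
  also have "\<dots> \<le> (1 + 3 * a) * I0 + 2 * a\<^sup>2 * I0 / a"
    using False a I0_pos int_f_le[of s] assms
    by (intro add_mono mult_left_mono divide_right_mono mult_right_mono) auto
  also have "\<dots> = (1 + 5 * a) * I0" using a by (simp add: power2_eq_square algebra_simps)
  also have "\<dots> \<le> 5 * (1 + a) * I0" using I0_pos by (intro mult_right_mono) auto
  finally show ?thesis .
qed

text \<open>For a = 0 the quotient E / q = y^2 + (dy/dt)^2 / q is the classical Sonin majorant of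
  y^2: it decreases while q increases. Since q and E both carry the factor v, the quotient extends
  to v = 0 with the value p(0)^2 = 1, which equals K I0. This removes the factor 1 / s of
  \<open>left_bound\<close>.\<close>

lemma first_sonin:
  assumes "a = 0" "0 < s" "s \<le> 1 / 2" "q' s \<ge> 0"
  shows "f s \<le> K * I0"
proof (cases "A = 0")
  case True
  then have "b = 0" "N = 0" using A_ge b0 by (auto simp: zero_le_mult_iff)
  then have "f s = 1" using assms(1) by (simp add: jf_def jacobi_def jw_def rpow_def)
  then show ?thesis using K_I0[OF assms(1)] by simp
next
  case False
  then have A: "A > 0" using A_ge(3) by simp
  let ?d = "\<lambda>v. A - (K\<^sup>2 - 1) / 4 * v"
  \<comment> \<open>E / q with the common factor v cancelled, so that it is continuous at 0.\<close>
  let ?\<Phi> = "\<lambda>v. (1 - v) * W v * poly rE v / ?d v"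
  have d: "?d v > 0" if "0 \<le> v" "v \<le> s" for v
  proof -
    have "q' v \<ge> 0" using q'_mono[OF that(2)] assms by simp
    then have "(K\<^sup>2 - 1) / 4 * v \<le> A / 2" by (simp add: q'_def mult.commute)
    then show ?thesis using A by linarith
  qed
  have qd: "q v = v * ?d v" for v unfolding q_def using assms(1) by (simp add: power2_eq_square algebra_simps)
  have E: "v * (1 - v) * W v * poly rE v = W v * (R v)\<^sup>2 + q v * f v" for v
  proof -
    have "v * (1 - v) * W v * poly rE v = W v * (v * (1 - v) * poly rE v)" by simp
    then show ?thesis unfolding rE_eq by (simp add: f_eq distrib_left)
  qed
  have \<Phi>: "?\<Phi> v = (v * (1 - v) * W v * poly rE v) / q v" if "0 < v" "v \<le> s" for v
    unfolding qd using that d[of v] by simp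
  have "?\<Phi> s \<le> ?\<Phi> 0"
  proof (rule DERIV_nonpos_imp_decreasing_open[OF less_imp_le[OF assms(2)]])
    show "continuous_on {0..s} ?\<Phi>"
      using d assms by (intro continuous_intros continuous_on_subset[OF cont_W]) (auto simp: less_le)
    fix v assume v: "0 < v" "v < s"
    then have v1: "v < 1" using assms by auto
    have qv: "q v > 0" unfolding qd using v d[of v] by simp
    have dq: "(q has_real_derivative q' v) (at v)"
      unfolding q_def[abs_def] q'_def by (rule derivative_eq_intros refl)+ simp
    have "((\<lambda>v. (v * (1 - v) * W v * poly rE v) / q v) has_real_derivative
        ((W v * poly (jac_div a b rE) v) * q v - (v * (1 - v) * W v * poly rE v) * q' v) / (q v * q v)) (at v)"
      by (rule DERIV_divide[OF DERIV_pW[OF v(1) v1] dq]) (use qv in simp)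
    also have "(W v * poly (jac_div a b rE) v) * q v - (v * (1 - v) * W v * poly rE v) * q' v = - (q' v * (W v * (R v)\<^sup>2))"
      unfolding E div_rE by (simp add: f_eq algebra_simps)
    finally have "(?\<Phi> has_real_derivative - (q' v * (W v * (R v)\<^sup>2)) / (q v * q v)) (at v)"
      by (rule has_field_derivative_transform_within_open[where S = "{0<..<s}"]) (use v \<Phi> in auto)
    moreover have "- (q' v * (W v * (R v)\<^sup>2)) / (q v * q v) \<le> 0"
      using q'_mono[of v s] v assms by (intro divide_nonpos_nonneg) auto
    ultimately show "\<exists>y. (?\<Phi> has_real_derivative y) (at v) \<and> y \<le> 0" by blast
  qed
  moreover have "?\<Phi> 0 = 1"
  proof -
    have "4 * A = 4 * lam + 2 * b" unfolding A_def K_sq using assms(1) by (simp add: power2_eq_square algebra_simps)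
    then have "lam + b / 2 = A" by simp
    moreover have "poly p 0 = 1" unfolding p0 using assms(1) by (simp add: binomial_gbinomial[symmetric])
    moreover have "W 0 = 1" using assms(1) by (simp add: jw_def rpow_def)
    moreover have "poly rE 0 = (lam + b / 2) * (poly p 0)\<^sup>2"
      unfolding rE_def using assms(1) by (simp add: power2_eq_square)
    ultimately show ?thesis using A by simp
  qed
  moreover have "f s \<le> ?\<Phi> s"
  proof -
    have q: "q s > 0" unfolding qd using d[of s] assms by simp
    have "q s * f s \<le> s * (1 - s) * W s * poly rE s" unfolding E by simp
    then show ?thesis using q assms unfolding \<Phi>[OF assms(2) order_refl] by (simp add: field_simps)
  qed
  ultimately have "f s \<le> 1" by linarith
  then show ?thesis using K_I0[OF assms(1)] by simp
qed

end

section \<open>Reflection and bounds on both halves of the interval\<close>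

lemma jacobi_minus: "jacobi N b a (- x) = (-1) ^ N * jacobi N a b x"
proof -
  have "jacobi N b a (- x) = (\<Sum>s\<le>N. ((real N + b) gchoose s) * ((real N + a) gchoose (N - s)) *
      ((- x - 1) / 2) ^ (N - s) * ((- x + 1) / 2) ^ s)"
    unfolding jacobi_def
    by (rule sum.reindex_bij_witness[of _ "\<lambda>s. N - s" "\<lambda>s. N - s"]) auto
  also have "\<dots> = (-1) ^ N * jacobi N a b x"
    unfolding jacobi_def sum_distrib_left
  proof (rule sum.cong[OF refl])
    fix s assume "s \<in> {..N}"
    then have N: "(-1::real) ^ N = (-1) ^ (N - s) * (-1) ^ s" by (simp flip: power_add)
    have 1: "(- x - 1) / 2 = (-1) * ((x + 1) / 2)" "(- x + 1) / 2 = (-1) * ((x - 1) / 2)" by auto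
    show "(real N + b gchoose s) * (real N + a gchoose (N - s)) * ((- x - 1) / 2) ^ (N - s) * ((- x + 1) / 2) ^ s =
      (-1) ^ N * ((real N + a gchoose (N - s)) * (real N + b gchoose s) * ((x - 1) / 2) ^ s * ((x + 1) / 2) ^ (N - s))"
      unfolding 1 power_mult_distrib N by simp
  qed
  finally show ?thesis .
qed

lemma jf_reflect: "jf N b a (1 - v) = jf N a b v"
proof -
  have "1 - 2 * (1 - v) = - (1 - 2 * v)" by simp
  then show ?thesis
    unfolding jf_def jw_def by (simp only: jacobi_minus) (simp add: power_mult_distrib flip: power_mult)
qed

lemma has_integral_reflect_01:
  assumes "(g has_integral (i::real)) {0..1::real}"
  shows "((\<lambda>v. g (1 - v)) has_integral i) {0..1}"
  using has_integral_affinity[of g i 0 1 "-1" 1] assms by (simp add: cbox_interval image_affinity_atLeastAtMost_diff)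

lemma jI_reflect: "a \<ge> 0 \<Longrightarrow> b \<ge> 0 \<Longrightarrow> jI N b a = jI N a b"
proof -
  assume ab: "a \<ge> 0" "b \<ge> 0"
  interpret J: jac N a b using ab by unfold_locales
  have "(jf N a b has_integral jI N a b) {0..1}"
    unfolding jI_def using J.int_f[of 0 1] by (simp add: has_integral_iff)
  from has_integral_reflect_01[OF this] have "(jf N b a has_integral jI N a b) {0..1}"
    by (simp add: jf_reflect)
  then show ?thesis by (simp add: jI_def integral_unique)
qed

context jac
begin

lemma tail_bound:
  assumes "b > 0" "0 < s" "s \<le> 1" "x > 0"
  shows "f s \<le> K * I0 * (1 + x / (b * s) + real N / x)"
proof -
  interpret J: jac N b a using a0 b0 by unfold_locales
  have "jf N b a (1 - s) \<le> J.K * jI N b a * (1 + x / (b * (1 - (1 - s))) + real N / x)"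
    using assms by (intro J.head_bound) auto
  then show ?thesis using a0 b0 by (simp add: jf_reflect jI_reflect J.K_def K_def add_ac)
qed

text \<open>Concerns points of the left half beyond the maximum of q. For s \<ge> 1/4 the global
  bound is enough. Otherwise a maximum so far to the left forces b^2 > (K^2 - 1) / 2, and the bound
  from the endpoint 1, \<open>tail_bound\<close> with x = b s, is strong because b is large.\<close>

lemma right_bound:
  assumes "0 < s" "s \<le> 1 / 2" "q' s < 0"
  shows "f s \<le> 11 * K * I0"
proof (cases "s \<ge> 1 / 4")
  case True
  have "0 \<le> (s - 1 / 4) * (3 / 4 - s)" using True assms by (intro mult_nonneg_nonneg) auto
  then have "3 / 16 \<le> s * (1 - s)" by (simp add: field_simps)
  then have "3 / 16 * f s \<le> s * (1 - s) * f s" by (intro mult_right_mono) auto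
  also have "\<dots> \<le> 2 * K * I0" using global_bound[of s] assms by simp
  finally have "f s \<le> 32 / 3 * (K * I0)" by simp
  moreover have "K * I0 > 0" using K_ge I0_pos by simp
  ultimately show ?thesis unfolding mult.assoc by linarith
next
  case False
  have KI: "K * I0 > 0" using K_ge I0_pos by simp
  have 1: "(K\<^sup>2 - 1) * (1 - 2 * s) < b\<^sup>2 - a\<^sup>2" using assms(3) unfolding q'_def A_def by (simp add: field_simps)
  have 2: "(K\<^sup>2 - 1) * (1 / 2) \<le> (K\<^sup>2 - 1) * (1 - 2 * s)" using False A_ge(4) by (intro mult_left_mono) auto
  have b2: "(K\<^sup>2 - 1) / 2 < b\<^sup>2" using 1 2 zero_le_power2[of a] by linarith
  then have "b \<noteq> 0" using A_ge(4) by auto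
  then have b: "b > 0" using b0 by simp
  \<comment> \<open>The inequalities q' < 0 and 2 A \<ge> 2 N b, with the lower bound on b^2, give N
    \<le> b s.\<close>
  have "real N / (b * s) \<le> 9 / 8"
  proof (cases "N = 0")
    case False
    then have K3: "K \<ge> 3" unfolding K_def using a0 b0 by simp
    then have "9 \<le> K\<^sup>2" using power_mono[of 3 K 2] by simp
    then have K9: "K\<^sup>2 - 1 > 0" "K\<^sup>2 \<le> 9 / 8 * (K\<^sup>2 - 1)" by auto
    have "2 * real N * b \<le> 2 * A" using A_ge(1) b by simp
    also have "\<dots> \<le> (K\<^sup>2 - 1) * s" using assms(3) by (simp add: q'_def)
    finally have "2 * real N * b * b \<le> (K\<^sup>2 - 1) * s * b" using b by simp
    moreover have "2 * real N * ((K\<^sup>2 - 1) / 2) \<le> 2 * real N * (b * b)"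
      using b2 by (intro mult_left_mono) (auto simp: power2_eq_square)
    ultimately have "(K\<^sup>2 - 1) * real N \<le> (K\<^sup>2 - 1) * (b * s)" by (simp add: algebra_simps)
    then have "real N \<le> b * s" using K9(1) by simp
    then show ?thesis using b assms by (simp add: field_simps)
  qed simp
  moreover have "f s \<le> K * I0 * (1 + (b * s) / (b * s) + real N / (b * s))"
    using b assms by (intro tail_bound) auto
  then have "f s \<le> K * I0 * (2 + real N / (b * s))" using b assms by simp
  ultimately have "f s \<le> K * I0 * (2 + 9 / 8)"
    using KI by (meson add_left_mono mult_left_mono less_imp_le order_trans)
  then show ?thesis using KI by simp
qed

lemma bound_left:
  assumes "0 < s" "s \<le> 1 / 2"
  shows "f s \<le> 11 * K * I0 * (1 + (1 + a) / (K * s))"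
proof (cases "q' s \<ge> 0")
  case True
  have "f s \<le> 5 * (1 + a) * I0 / s" using left_bound[OF assms True] assms by (simp add: field_simps)
  also have "\<dots> = 5 * K * I0 * ((1 + a) / (K * s))" using K_ge by simp
  also have "\<dots> \<le> 11 * K * I0 * (1 + (1 + a) / (K * s))"
    using K_ge I0_pos a0 assms by (intro mult_mono) auto
  finally show ?thesis .
next
  case False
  then have "f s \<le> 11 * K * I0 * 1" using right_bound[OF assms] by simp
  also have "\<dots> \<le> 11 * K * I0 * (1 + (1 + a) / (K * s))"
    using K_ge I0_pos a0 assms by (intro mult_left_mono) auto
  finally show ?thesis .
qed

lemma bound_left_0:
  assumes "0 < s" "s \<le> 1 / 2" "a = 0"
  shows "f s \<le> 11 * K * I0"
proof (cases "q' s \<ge> 0")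
  case True
  have "f s \<le> K * I0" using first_sonin[OF assms(3,1,2) True] .
  also have "\<dots> \<le> 11 * K * I0" using K_ge I0_pos by simp
  finally show ?thesis .
qed (use right_bound[OF assms(1,2)] in simp)

text \<open>Cruder than the left half: x = sqrt K in \<open>tail_bound\<close> loses a factor sqrt
  K, which the exponents can afford because the weight is bounded near s = 1. For b = 0 the
  reflected \<open>bound_left_0\<close> applies without this loss.\<close>

lemma bound_right:
  assumes "1 / 2 \<le> s" "s < 1" "b = 0 \<or> b \<ge> 1 / 2"
  shows "f s \<le> 11 * K * I0 * sqrt K"
proof -
  have K1: "sqrt K \<ge> 1" using K_ge by simp
  show ?thesis
  proof (cases "b = 0")
    case True
    interpret J: jac N b a using a0 b0 by unfold_locales
    have "jf N b a (1 - s) \<le> 11 * J.K * jI N b a" using assms True by (intro J.bound_left_0) auto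
    then have "f s \<le> 11 * K * I0 * 1" using a0 b0 by (simp add: jf_reflect jI_reflect J.K_def K_def add_ac)
    also have "\<dots> \<le> 11 * K * I0 * sqrt K" using K1 K_ge I0_pos by (intro mult_left_mono) auto
    finally show ?thesis .
  next
    case False
    then have b: "b \<ge> 1 / 2" using assms by simp
    have "f s \<le> K * I0 * (1 + sqrt K / (b * s) + real N / sqrt K)"
      using b assms K_ge by (intro tail_bound) auto
    also have "\<dots> \<le> K * I0 * (sqrt K + 4 * sqrt K + sqrt K)"
    proof (intro mult_left_mono add_mono)
      have "1 / 2 * (1 / 2) \<le> b * s" using b assms by (intro mult_mono) auto
      then have "sqrt K / (b * s) \<le> sqrt K / (1 / 4)" using K_ge by (intro divide_left_mono) auto
      then show "sqrt K / (b * s) \<le> 4 * sqrt K" by simp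
      have "real N \<le> sqrt K * sqrt K" using K_ge by simp
      then show "real N / sqrt K \<le> sqrt K" using K1 by (simp add: divide_le_eq)
    qed (use K1 K_ge I0_pos in auto)
    also have "\<dots> = 6 * (K * I0 * sqrt K)" by (simp add: algebra_simps)
    also have "\<dots> \<le> 11 * (K * I0 * sqrt K)" using K1 K_ge I0_pos by (intro mult_right_mono) auto
    finally show ?thesis by simp
  qed
qed

section \<open>Moments of squared Jacobi functions\<close>

lemma borel_f [measurable]: "f \<in> borel_measurable borel"
  unfolding jf_def[abs_def] jw_def rpow_def jacobi_def by measurable

lemma nn_f: "(\<integral>\<^sup>+v. ennreal (indicator {0..1} v * f v) \<partial>lborel) = ennreal I0"
  by (rule nn_integral_has_integral_lebesgue) (use int_f[of 0 1] in \<open>auto simp: jI_def has_integral_iff\<close>)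

text \<open>Interpolation between the moments of order 0 and 1 by Young's inequality. The scale x =
  K / a is the ratio of these two moments, so the two weights 1 - \<kappa> and \<kappa> add up to 1
  and no constant is lost.\<close>

lemma nn_mass_powr:
  assumes "a > 0" "0 \<le> \<kappa>" "\<kappa> \<le> 1"
  shows "(\<integral>\<^sup>+v. ennreal (indicator {0..1} v * (v powr (- \<kappa>) * f v)) \<partial>lborel) \<le> ennreal ((K / a) powr \<kappa> * I0)"
proof -
  define x where "x = K / a"
  have x: "x > 0" using assms K_ge by (simp add: x_def)
  let ?B = "\<lambda>v. x powr \<kappa> * ((1 - \<kappa>) * f v + \<kappa> / x * (f v / v))"
  have B: "(?B has_integral (x powr \<kappa> * ((1 - \<kappa>) * I0 + \<kappa> / x * (K / a * I0)))) {0..1}"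
    using int_f[of 0 1] by (intro has_integral_mult_right has_integral_add mass assms) (auto simp: jI_def has_integral_iff)
  have le: "v powr (- \<kappa>) * f v \<le> ?B v" if "v > 0" for v
  proof -
    have "(1 / (x * v)) powr \<kappa> * 1 powr (1 - \<kappa>) \<le> \<kappa> * (1 / (x * v)) + (1 - \<kappa>) * 1"
      using assms that x by (intro Youngs_inequality_0) auto
    then have "(1 / (x * v)) powr \<kappa> \<le> (1 - \<kappa>) + \<kappa> / x * (1 / v)" by simp
    from mult_left_mono[OF this, of "x powr \<kappa>"]
    have "x powr \<kappa> * (1 / (x * v)) powr \<kappa> \<le> x powr \<kappa> * ((1 - \<kappa>) + \<kappa> / x * (1 / v))" by simp
    also have "x powr \<kappa> * (1 / (x * v)) powr \<kappa> = v powr (- \<kappa>)"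
      using x that by (simp add: powr_divide powr_mult powr_minus field_simps)
    finally have "v powr (- \<kappa>) * f v \<le> x powr \<kappa> * ((1 - \<kappa>) + \<kappa> / x * (1 / v)) * f v"
      by (intro mult_right_mono) auto
    then show ?thesis by (simp add: algebra_simps)
  qed
  have "(\<integral>\<^sup>+v. ennreal (indicator {0..1} v * (v powr (- \<kappa>) * f v)) \<partial>lborel)
      \<le> (\<integral>\<^sup>+v. ennreal (indicator {0..1} v * ?B v) \<partial>lborel)"
  proof (intro nn_integral_mono ennreal_leI)
    fix v :: real
    show "indicator {0..1} v * (v powr (- \<kappa>) * f v) \<le> indicator {0..1} v * ?B v"
      using le[of v] assms by (cases "v > 0"; cases "v = 0") (auto simp: indicator_def)
  qed
  also have "\<dots> = ennreal (x powr \<kappa> * ((1 - \<kappa>) * I0 + \<kappa> / x * (K / a * I0)))"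
    by (rule nn_integral_has_integral_lebesgue[OF _ B]) (use assms x in auto)
  also have "x powr \<kappa> * ((1 - \<kappa>) * I0 + \<kappa> / x * (K / a * I0)) = (K / a) powr \<kappa> * I0"
    using x unfolding x_def[symmetric] by (simp add: algebra_simps)
  finally show ?thesis .
qed

lemma nn_mass_powr_right:
  assumes "b > 0" "0 \<le> \<kappa>" "\<kappa> \<le> 1"
  shows "(\<integral>\<^sup>+v. ennreal (indicator {0..1} v * ((1 - v) powr (- \<kappa>) * f v)) \<partial>lborel) \<le> ennreal ((K / b) powr \<kappa> * I0)"
proof -
  interpret J: jac N b a using a0 b0 by unfold_locales
  have "(\<integral>\<^sup>+v. ennreal (indicator {0..1} v * ((1 - v) powr (- \<kappa>) * f v)) \<partial>lborel) =
      (\<integral>\<^sup>+v. ennreal (indicator {0..1} (1 + (-1) * v) * ((1 - (1 + (-1) * v)) powr (- \<kappa>) * f (1 + (-1) * v))) \<partial>lborel)"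
    by (subst nn_integral_real_affine[where c = "-1" and t = 1]) auto
  also have "\<dots> = (\<integral>\<^sup>+v. ennreal (indicator {0..1} v * (v powr (- \<kappa>) * jf N b a v)) \<partial>lborel)"
    by (intro nn_integral_cong) (auto simp: indicator_def jf_reflect)
  also have "\<dots> \<le> ennreal ((J.K / b) powr \<kappa> * jI N b a)" by (rule J.nn_mass_powr[OF assms])
  finally show ?thesis using a0 b0 by (simp add: jI_reflect J.K_def K_def add_ac)
qed

text \<open>For a = 0 the function does not vanish at 0, the moment of order 1 diverges there, and
  interpolation is impossible. Below 1 / K the pointwise bound 11 K I0 is integrated against
  v^(-\<kappa>); above 1 / K the power is at most K^\<kappa>. Only the left half is covered, where
  \<open>bound_left_0\<close> holds.\<close>

lemma nn_mass_powr_0: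
  assumes "a = 0" "0 \<le> \<kappa>" "\<kappa> < 1"
  shows "(\<integral>\<^sup>+v. ennreal (indicator {0..1/2} v * (v powr (- \<kappa>) * f v)) \<partial>lborel) \<le> ennreal ((11 / (1 - \<kappa>) + 1) * (K powr \<kappa> * I0))"
proof -
  let ?B = "\<lambda>v. indicator {0..1 / K} v * (11 * K * I0 * v powr (- \<kappa>))"
  let ?C = "\<lambda>v. indicator {0..1} v * (K powr \<kappa> * f v)"
  have K: "K > 0" using K_ge by simp
  have B: "(\<integral>\<^sup>+v. ennreal (?B v) \<partial>lborel) = ennreal (11 * K * I0 * ((1 / K) powr (1 - \<kappa>) / (1 - \<kappa>)))"
  proof (rule nn_integral_has_integral_lebesgue)
    have "((\<lambda>v. v powr (- \<kappa>)) has_integral ((1 / K) powr (- \<kappa> + 1) / (- \<kappa> + 1))) {0..1 / K}"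
      using assms K by (intro has_integral_powr_from_0) auto
    then show "((\<lambda>v. 11 * K * I0 * v powr (- \<kappa>)) has_integral 11 * K * I0 * ((1 / K) powr (1 - \<kappa>) / (1 - \<kappa>))) {0..1 / K}"
      by (intro has_integral_mult_right) simp
  qed (use K I0_pos in auto)
  have C: "(\<integral>\<^sup>+v. ennreal (?C v) \<partial>lborel) = ennreal (K powr \<kappa> * I0)"
  proof (rule nn_integral_has_integral_lebesgue)
    have "(f has_integral I0) {0..1}" using int_f[of 0 1] by (simp add: jI_def has_integral_iff)
    then show "((\<lambda>v. K powr \<kappa> * f v) has_integral K powr \<kappa> * I0) {0..1}" by (rule has_integral_mult_right)
  qed simp
  have "(\<integral>\<^sup>+v. ennreal (indicator {0..1/2} v * (v powr (- \<kappa>) * f v)) \<partial>lborel)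
      \<le> (\<integral>\<^sup>+v. ennreal (?B v) + ennreal (?C v) \<partial>lborel)"
  proof (intro nn_integral_mono)
    fix v :: real
    have B0: "?B v \<ge> 0" and C0: "?C v \<ge> 0" using K I0_pos by (auto simp: indicator_def)
    have "indicator {0..1/2} v * (v powr (- \<kappa>) * f v) \<le> ?B v + ?C v"
    proof (cases "0 < v \<and> v \<le> 1 / 2")
      case True
      show ?thesis
      proof (cases "v \<le> 1 / K")
        case le: True
        have "v powr (- \<kappa>) * f v \<le> v powr (- \<kappa>) * (11 * K * I0)"
          using bound_left_0[of v] True assms by (intro mult_left_mono) auto
        moreover have "?B v = v powr (- \<kappa>) * (11 * K * I0)" using True le by simp
        moreover have "indicator {0..1/2} v * (v powr (- \<kappa>) * f v) = v powr (- \<kappa>) * f v" using True by simp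
        ultimately show ?thesis using C0 by linarith
      next
        case False
        have "v powr (- \<kappa>) \<le> (1 / K) powr (- \<kappa>)"
          using False K assms by (intro powr_mono2') auto
        also have "\<dots> = K powr \<kappa>" using K by (simp add: powr_divide powr_minus)
        finally have "v powr (- \<kappa>) * f v \<le> K powr \<kappa> * f v" by (intro mult_right_mono) auto
        moreover have "?C v = K powr \<kappa> * f v" using True by simp
        moreover have "indicator {0..1/2} v * (v powr (- \<kappa>) * f v) = v powr (- \<kappa>) * f v" using True by simp
        ultimately show ?thesis using B0 by linarith
      qed
    next
      case False
      then have "indicator {0..1/2} v * (v powr (- \<kappa>) * f v) = 0" by (cases "v = 0") (auto simp: indicator_def)
      then show ?thesis using B0 C0 by linarith
    qed
    then show "ennreal (indicator {0..1/2} v * (v powr (- \<kappa>) * f v)) \<le> ennreal (?B v) + ennreal (?C v)"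
      using B0 C0 by (simp add: ennreal_leI flip: ennreal_plus)
  qed
  also have "\<dots> = (\<integral>\<^sup>+v. ennreal (?B v) \<partial>lborel) + (\<integral>\<^sup>+v. ennreal (?C v) \<partial>lborel)"
    by (rule nn_integral_add) auto
  also have "\<dots> = ennreal (11 * K * I0 * ((1 / K) powr (1 - \<kappa>) / (1 - \<kappa>)) + K powr \<kappa> * I0)"
    unfolding B C using K I0_pos assms by (simp add: ennreal_plus)
  also have "11 * K * I0 * ((1 / K) powr (1 - \<kappa>) / (1 - \<kappa>)) + K powr \<kappa> * I0 = (11 / (1 - \<kappa>) + 1) * (K powr \<kappa> * I0)"
  proof -
    have "K * (1 / K) powr (1 - \<kappa>) = K powr \<kappa>"
      using K by (simp add: powr_divide powr_diff)
    then show ?thesis by (simp add: algebra_simps)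
  qed
  finally show ?thesis .
qed

end

section \<open>Complex polynomial functions and their directional derivatives\<close>

text \<open>Complex polynomials with an induction principle over the ring operations, from which the
  rules for derivatives, conjugates and commuting derivatives follow.
  \<open>polynomial_function\<close>, in which the spherical harmonics are defined, goes through
  real-valued components; the two notions are shown to agree.\<close>

inductive cpoly :: "('a::euclidean_space \<Rightarrow> complex) \<Rightarrow> bool" where
  cpoly_const: "cpoly (\<lambda>_. c)"
| cpoly_coord: "cpoly (\<lambda>x. of_real (x \<bullet> v))"
| cpoly_add: "cpoly f \<Longrightarrow> cpoly g \<Longrightarrow> cpoly (\<lambda>x. f x + g x)"
| cpoly_mult: "cpoly f \<Longrightarrow> cpoly g \<Longrightarrow> cpoly (\<lambda>x. f x * g x)"

lemmas cpoly_intros = cpoly_const cpoly_coord cpoly_add cpoly_mult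

definition pd :: "'a::euclidean_space \<Rightarrow> ('a \<Rightarrow> complex) \<Rightarrow> 'a \<Rightarrow> complex" where
  "pd v f x = vector_derivative (\<lambda>t. f (x + t *\<^sub>R v)) (at 0)"

text \<open>Demands the derivative at every point of every line in direction v, so that one fact
  serves the Laplacian, constancy along lines and integration by parts.\<close>

definition has_pd :: "'a::euclidean_space \<Rightarrow> ('a \<Rightarrow> complex) \<Rightarrow> ('a \<Rightarrow> complex) \<Rightarrow> bool" where
  "has_pd v f g \<longleftrightarrow> (\<forall>x s. ((\<lambda>t. f (x + t *\<^sub>R v)) has_vector_derivative g (x + s *\<^sub>R v)) (at s))"

lemma has_pd_imp_pd: "has_pd v f g \<Longrightarrow> pd v f = g"
  unfolding has_pd_def pd_def
proof (rule ext)
  fix x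
  assume "\<forall>x s. ((\<lambda>t. f (x + t *\<^sub>R v)) has_vector_derivative g (x + s *\<^sub>R v)) (at s)"
  then have "((\<lambda>t. f (x + t *\<^sub>R v)) has_vector_derivative g (x + 0 *\<^sub>R v)) (at 0)" by blast
  then show "vector_derivative (\<lambda>t. f (x + t *\<^sub>R v)) (at 0) = g x" by (simp add: vector_derivative_at)
qed

lemma has_pd_const: "has_pd v (\<lambda>_. c) (\<lambda>_. 0)"
  by (simp add: has_pd_def)

lemma has_pd_coord: "has_pd v (\<lambda>x. of_real (x \<bullet> w)) (\<lambda>_. of_real (v \<bullet> w))"
  unfolding has_pd_def inner_add_left inner_scaleR_left
  by (auto intro!: derivative_eq_intros simp: has_vector_derivative_def scaleR_conv_of_real)

lemma has_pd_add: "has_pd v f f' \<Longrightarrow> has_pd v g g' \<Longrightarrow> has_pd v (\<lambda>x. f x + g x) (\<lambda>x. f' x + g' x)"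
  by (simp add: has_pd_def has_vector_derivative_add)

lemma has_pd_mult: "has_pd v f f' \<Longrightarrow> has_pd v g g' \<Longrightarrow> has_pd v (\<lambda>x. f x * g x) (\<lambda>x. f x * g' x + f' x * g x)"
  unfolding has_pd_def by (intro allI has_vector_derivative_mult) blast+

lemma cpoly_has_pd_ex: "cpoly f \<Longrightarrow> \<exists>g. cpoly g \<and> has_pd v f g"
proof (induction rule: cpoly.induct)
  case (cpoly_const c)
  show ?case by (intro exI[of _ "\<lambda>_. 0"] conjI has_pd_const cpoly.cpoly_const)
next
  case (cpoly_coord w)
  show ?case by (intro exI[of _ "\<lambda>_. of_real (v \<bullet> w)"] conjI has_pd_coord cpoly.cpoly_const)
next
  case (cpoly_add f g)
  then obtain f' g' where "cpoly f'" "has_pd v f f'" "cpoly g'" "has_pd v g g'" by auto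
  then show ?case
    by (intro exI[of _ "\<lambda>x. f' x + g' x"] conjI has_pd_add cpoly.cpoly_add)
next
  case (cpoly_mult f g)
  then obtain f' g' where "cpoly f'" "has_pd v f f'" "cpoly g'" "has_pd v g g'" by auto
  with cpoly_mult.hyps show ?case
    by (intro exI[of _ "\<lambda>x. f x * g' x + f' x * g x"] conjI has_pd_mult cpoly.cpoly_add cpoly.cpoly_mult)
qed

lemma cpoly_has_pd: "cpoly f \<Longrightarrow> has_pd v f (pd v f)"
  using cpoly_has_pd_ex[of f v] has_pd_imp_pd by blast

lemma has_vector_derivative_pd:
  assumes "cpoly f"
  shows "((\<lambda>t. f (x + t *\<^sub>R v)) has_vector_derivative pd v f x) (at 0)"
proof -
  have "((\<lambda>t. f (x + t *\<^sub>R v)) has_vector_derivative pd v f (x + 0 *\<^sub>R v)) (at 0)"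
    using cpoly_has_pd[OF assms, of v] unfolding has_pd_def by blast
  then show ?thesis by simp
qed

lemma cpoly_pd [intro]: "cpoly f \<Longrightarrow> cpoly (pd v f)"
  using cpoly_has_pd_ex[of f v] has_pd_imp_pd by blast

lemma pd_const [simp]: "pd v (\<lambda>_. c) = (\<lambda>_. 0)"
  by (rule has_pd_imp_pd[OF has_pd_const])

lemma pd_coord [simp]: "pd v (\<lambda>x. of_real (x \<bullet> w)) = (\<lambda>_. of_real (v \<bullet> w))"
  by (rule has_pd_imp_pd[OF has_pd_coord])

lemma pd_add: "cpoly f \<Longrightarrow> cpoly g \<Longrightarrow> pd v (\<lambda>x. f x + g x) = (\<lambda>x. pd v f x + pd v g x)"
  by (intro has_pd_imp_pd has_pd_add cpoly_has_pd)

lemma pd_mult: "cpoly f \<Longrightarrow> cpoly g \<Longrightarrow> pd v (\<lambda>x. f x * g x) = (\<lambda>x. f x * pd v g x + pd v f x * g x)"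
  by (intro has_pd_imp_pd has_pd_mult cpoly_has_pd)

lemma pd_cmult: "cpoly f \<Longrightarrow> pd v (\<lambda>x. c * f x) = (\<lambda>x. c * pd v f x)"
  using pd_mult[OF cpoly_const, of f v c] by simp

lemma cpoly_cmult [intro]: "cpoly f \<Longrightarrow> cpoly (\<lambda>x. c * f x)"
  by (intro cpoly_intros)

lemma cpoly_uminus [intro]: "cpoly f \<Longrightarrow> cpoly (\<lambda>x. - f x)"
  using cpoly_cmult[of f "-1"] by simp

lemma cpoly_diff [intro]: "cpoly f \<Longrightarrow> cpoly g \<Longrightarrow> cpoly (\<lambda>x. f x - g x)"
  using cpoly_add[OF _ cpoly_uminus, of f g] by simp

lemma cpoly_sum [intro]: "(\<And>i. i \<in> A \<Longrightarrow> cpoly (f i)) \<Longrightarrow> cpoly (\<lambda>x. \<Sum>i\<in>A. f i x)"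
  by (induction A rule: infinite_finite_induct) (auto intro: cpoly_intros)

lemma cpoly_cnj [intro]: "cpoly f \<Longrightarrow> cpoly (\<lambda>x. cnj (f x))"
  by (induction rule: cpoly.induct) (auto intro: cpoly_intros)

lemma pd_diff: "cpoly f \<Longrightarrow> cpoly g \<Longrightarrow> pd v (\<lambda>x. f x - g x) = (\<lambda>x. pd v f x - pd v g x)"
  using pd_add[of f "\<lambda>x. (-1) * g x" v] pd_cmult[of g v "-1"] by (simp add: cpoly_uminus)

lemma pd_sum: "(\<And>i. i \<in> A \<Longrightarrow> cpoly (f i)) \<Longrightarrow> pd v (\<lambda>x. \<Sum>i\<in>A. f i x) = (\<lambda>x. \<Sum>i\<in>A. pd v (f i) x)"
  by (induction A rule: infinite_finite_induct) (auto simp: pd_add cpoly_sum)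

lemma cpoly_continuous: "cpoly f \<Longrightarrow> continuous_on UNIV f"
  by (induction rule: cpoly.induct) (auto intro!: continuous_intros)

lemma cpoly_borel [measurable]: "cpoly f \<Longrightarrow> f \<in> borel_measurable borel"
  using cpoly_continuous borel_measurable_continuous_onI by blast

lemma pd_cnj: "cpoly f \<Longrightarrow> pd v (\<lambda>x. cnj (f x)) = (\<lambda>x. cnj (pd v f x))"
proof (induction rule: cpoly.induct)
  case (cpoly_add f g)
  then show ?case by (simp add: pd_add cpoly_cnj)
next
  case (cpoly_mult f g)
  then show ?case by (simp add: pd_mult cpoly_cnj)
qed simp_all

lemma pd_commute: "cpoly f \<Longrightarrow> pd v (pd w f) = pd w (pd v f)"
proof (induction rule: cpoly.induct)
  case (cpoly_add f g)
  then show ?case by (simp add: pd_add cpoly_pd)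
next
  case (cpoly_mult f g)
  then show ?case by (simp add: pd_add pd_mult cpoly_pd cpoly_intros algebra_simps)
qed simp_all

lemma pd_linear: "cpoly f \<Longrightarrow> pd v f x = (\<Sum>b\<in>Basis. of_real (v \<bullet> b) * pd b f x)"
proof (induction rule: cpoly.induct)
  case (cpoly_coord w)
  have "of_real (v \<bullet> w) = (of_real (\<Sum>b\<in>Basis. (v \<bullet> b) * (b \<bullet> w)) :: complex)"
    by (simp add: euclidean_inner[of v w] inner_commute)
  then show ?case by simp
next
  case (cpoly_add f g)
  then show ?case by (simp add: pd_add sum.distrib distrib_left)
next
  case (cpoly_mult f g)
  then show ?case by (simp add: pd_mult sum.distrib distrib_left sum_distrib_left sum_distrib_right mult_ac)
qed simp

lemma laplacian_eq:
  assumes "cpoly f"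
  shows "laplacian f x = (\<Sum>b\<in>Basis. pd b (pd b f) x)"
proof -
  have "vector_derivative (\<lambda>t. f (x + t *\<^sub>R b)) (at s) = pd b f (x + s *\<^sub>R b)" for b s
    using cpoly_has_pd[OF assms, of b] by (auto simp: has_pd_def vector_derivative_at)
  then show ?thesis by (simp add: laplacian_def pd_def)
qed

lemma cpoly_of_real_poly: "real_polynomial_function p \<Longrightarrow> cpoly (\<lambda>x. of_real (p x))"
proof (induction rule: real_polynomial_function.induct)
  case (linear h)
  then interpret bounded_linear h .
  have hx: "h x = (\<Sum>b\<in>Basis. (x \<bullet> b) * h b)" for x
  proof -
    have "h x = h (\<Sum>b\<in>Basis. (x \<bullet> b) *\<^sub>R b)" by (simp only: euclidean_representation)
    also have "\<dots> = (\<Sum>b\<in>Basis. (x \<bullet> b) * h b)" by (simp add: sum scaleR)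
    finally show ?thesis .
  qed
  have "(\<lambda>x. complex_of_real (h x)) = (\<lambda>x. \<Sum>b\<in>Basis. of_real (x \<bullet> b) * of_real (h b))"
    by (rule ext, subst hx) simp
  moreover have "cpoly (\<lambda>x. \<Sum>b\<in>Basis. of_real (x \<bullet> b) * of_real (h b))"
    by (intro cpoly_sum cpoly_intros)
  ultimately show ?case by simp
qed (auto intro: cpoly_intros)

lemma polynomial_function_cpoly:
  assumes "polynomial_function (P :: 'a::euclidean_space \<Rightarrow> complex)"
  shows "cpoly P"
proof -
  have "real_polynomial_function (Re \<circ> P)" "real_polynomial_function (Im \<circ> P)"
    using assms by (auto simp: polynomial_function_def bounded_linear_Re bounded_linear_Im)
  then have "cpoly (\<lambda>x. of_real ((Re \<circ> P) x) + \<i> * of_real ((Im \<circ> P) x))"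
    by (intro cpoly_intros cpoly_of_real_poly)
  then show ?thesis by (simp flip: complex_eq)
qed

section \<open>Homogeneous harmonic polynomials and infinitesimal rotations\<close>

definition homogeneous :: "nat \<Rightarrow> ('a::euclidean_space \<Rightarrow> complex) \<Rightarrow> bool" where
  "homogeneous l f \<longleftrightarrow> (\<forall>t x. f (t *\<^sub>R x) = of_real (t ^ l) * f x)"

definition HP :: "nat \<Rightarrow> ('a::euclidean_space \<Rightarrow> complex) set" where
  "HP l = {f. cpoly f \<and> homogeneous l f \<and> (\<forall>x. laplacian f x = 0)}"

text \<open>Both sides are the derivative at 0 of s mapped to f (t x + t s v), once by the chain
  rule and once by homogeneity. The factor t stays on the left, so that neither t = 0 nor degree 0
  is an exception.\<close>

lemma homogeneous_pd:
  assumes "cpoly f" "homogeneous l f"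
  shows "of_real t * pd v f (t *\<^sub>R x) = of_real (t ^ l) * pd v f x"
proof -
  have "((\<lambda>s. f (t *\<^sub>R x + s *\<^sub>R v)) has_vector_derivative pd v f (t *\<^sub>R x)) (at 0)"
    by (rule has_vector_derivative_pd[OF assms(1)])
  then have 0: "((\<lambda>s. f (t *\<^sub>R x + s *\<^sub>R v)) has_vector_derivative pd v f (t *\<^sub>R x)) (at (t * 0))" by simp
  have "((\<lambda>s. t * s) has_vector_derivative t) (at 0)"
    by (auto intro!: derivative_eq_intros)
  from vector_diff_chain_at[OF this 0]
  have 1: "((\<lambda>s. f (t *\<^sub>R x + (t * s) *\<^sub>R v)) has_vector_derivative t *\<^sub>R pd v f (t *\<^sub>R x)) (at 0)"
    by (simp add: o_def)
  have "f (t *\<^sub>R x + (t * s) *\<^sub>R v) = of_real (t ^ l) * f (x + s *\<^sub>R v)" for s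
    using assms(2)[unfolded homogeneous_def, rule_format, of t "x + s *\<^sub>R v"] by (simp add: scaleR_add_right)
  then have "((\<lambda>s. of_real (t ^ l) * f (x + s *\<^sub>R v)) has_vector_derivative t *\<^sub>R pd v f (t *\<^sub>R x)) (at 0)"
    using 1 by simp
  moreover have "((\<lambda>s. of_real (t ^ l) * f (x + s *\<^sub>R v)) has_vector_derivative of_real (t ^ l) * pd v f x) (at 0)"
    by (intro has_vector_derivative_mult_right has_vector_derivative_pd assms(1))
  ultimately have "t *\<^sub>R pd v f (t *\<^sub>R x) = of_real (t ^ l) * pd v f x"
    by (rule vector_derivative_unique_at)
  then show ?thesis by (simp only: scaleR_conv_of_real)
qed

lemma homogeneous_pd_Suc:
  assumes "cpoly f" "homogeneous (Suc l) f"
  shows "homogeneous l (pd v f)"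
  unfolding homogeneous_def
proof (intro allI)
  fix t :: real and x
  have nz: "pd v f (t *\<^sub>R x) = of_real (t ^ l) * pd v f x" if "t \<noteq> 0" for t
    using homogeneous_pd[OF assms, of t v x] that by simp
  have c: "continuous_on UNIV (\<lambda>t. pd v f (t *\<^sub>R x) - of_real (t ^ l) * pd v f x)"
    by (intro continuous_intros continuous_on_compose2[OF cpoly_continuous[OF cpoly_pd[OF assms(1)]]]) auto
  show "pd v f (t *\<^sub>R x) = of_real (t ^ l) * pd v f x"
  \<comment> \<open>At t = 0 the factor t cannot be cancelled; both sides are continuous in
    t.\<close>
  proof (cases "t = 0")
    case True
    let ?g = "\<lambda>t. pd v f (t *\<^sub>R x) - of_real (t ^ l) * pd v f x"
    have "(?g \<longlongrightarrow> ?g 0) (at 0)"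
      using bspec[OF c[unfolded continuous_on_def], of 0] by simp
    moreover have "(?g \<longlongrightarrow> 0) (at 0)"
      by (rule tendsto_eventually) (auto simp: eventually_at_filter nz)
    ultimately have "?g 0 = 0" by (rule tendsto_unique[rotated]) simp
    with True show ?thesis by simp
  qed (rule nz)
qed

lemma euler:
  assumes "cpoly f" "homogeneous l f"
  shows "pd x f x = of_nat l * f x"
proof -
  have "((\<lambda>s. f (x + s *\<^sub>R x)) has_vector_derivative pd x f x) (at 0)"
    by (rule has_vector_derivative_pd[OF assms(1)])
  moreover have "f (x + s *\<^sub>R x) = of_real ((1 + s) ^ l) * f x" for s
    using assms(2)[unfolded homogeneous_def, rule_format, of "1 + s" x] by (simp add: scaleR_add_left)
  then have "(\<lambda>s. f (x + s *\<^sub>R x)) = (\<lambda>s. of_real ((1 + s) ^ l) * f x)" by (rule ext)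
  moreover have "((\<lambda>s. of_real ((1 + s) ^ l) * f x) has_vector_derivative of_real (real l) * f x) (at 0)"
    by (rule has_vector_derivative_mult_left, rule has_vector_derivative_of_real)
      (auto intro!: derivative_eq_intros)
  ultimately have "pd x f x = of_real (real l) * f x" using vector_derivative_unique_at by simp
  then show ?thesis by simp
qed

text \<open>The derivative along the linear field x mapped to (x.a) c - (x.c) a, which generates the
  rotations of the plane of a and c when these are orthonormal.\<close>

definition rot :: "'a::euclidean_space \<Rightarrow> 'a \<Rightarrow> ('a \<Rightarrow> complex) \<Rightarrow> 'a \<Rightarrow> complex" where
  "rot a c f x = of_real (x \<bullet> a) * pd c f x - of_real (x \<bullet> c) * pd a f x"

lemma cpoly_rot [intro]: "cpoly f \<Longrightarrow> cpoly (rot a c f)"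
  unfolding rot_def[abs_def] by (intro cpoly_diff cpoly_intros cpoly_pd)

text \<open>The operator commutes with the Laplacian: on each half of \<open>rot\<close> the
  Laplacian leaves twice a mixed second derivative of f, and the two cancel.\<close>

lemma rot_HP:
  assumes f: "f \<in> HP l"
  shows "rot a c f \<in> HP l"
proof -
  have cf: "cpoly f" and hf: "homogeneous l f" and L: "\<And>x. (\<Sum>b\<in>Basis. pd b (pd b f) x) = 0"
    using f by (auto simp: HP_def laplacian_eq)
  have "homogeneous l (rot a c f)"
    unfolding homogeneous_def rot_def
  proof (intro allI)
    fix t x
    have "of_real (t *\<^sub>R x \<bullet> a) * pd c f (t *\<^sub>R x) - of_real (t *\<^sub>R x \<bullet> c) * pd a f (t *\<^sub>R x) =
       of_real (x \<bullet> a) * (of_real t * pd c f (t *\<^sub>R x)) - of_real (x \<bullet> c) * (of_real t * pd a f (t *\<^sub>R x))"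
      by simp
    also have "\<dots> = of_real (t ^ l) * (of_real (x \<bullet> a) * pd c f x - of_real (x \<bullet> c) * pd a f x)"
      unfolding homogeneous_pd[OF cf hf] by (simp add: algebra_simps)
    finally show "of_real (t *\<^sub>R x \<bullet> a) * pd c f (t *\<^sub>R x) - of_real (t *\<^sub>R x \<bullet> c) * pd a f (t *\<^sub>R x) =
      of_real (t ^ l) * (of_real (x \<bullet> a) * pd c f x - of_real (x \<bullet> c) * pd a f x)" .
  qed
  moreover have "laplacian (rot a c f) x = 0" for x
  proof -
    have P: "pd b (pd b (\<lambda>x. of_real (x \<bullet> v) * g x)) x = of_real (x \<bullet> v) * pd b (pd b g) x + 2 * (of_real (b \<bullet> v) * pd b g x)"
      if "cpoly g" for b v g and x :: 'a
      using that by (simp add: pd_mult pd_add cpoly_pd cpoly_intros)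
    have Q: "(\<Sum>b\<in>Basis. pd b (pd b (\<lambda>x. of_real (x \<bullet> v) * pd w f x)) x) = 2 * pd v (pd w f) x" for v w
    proof -
      have "(\<Sum>b\<in>Basis. pd b (pd b (\<lambda>x. of_real (x \<bullet> v) * pd w f x)) x) =
         of_real (x \<bullet> v) * (\<Sum>b\<in>Basis. pd b (pd b (pd w f)) x) + 2 * (\<Sum>b\<in>Basis. of_real (b \<bullet> v) * pd b (pd w f) x)"
        using cf by (simp add: P cpoly_pd sum.distrib sum_distrib_left)
      also have "(\<Sum>b\<in>Basis. pd b (pd b (pd w f)) x) = pd w (\<lambda>x. \<Sum>b\<in>Basis. pd b (pd b f) x) x"
        using cf by (simp add: pd_sum cpoly_pd pd_commute[of _ w])
      also have "\<dots> = 0" by (simp add: L)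
      also have "(\<Sum>b\<in>Basis. of_real (b \<bullet> v) * pd b (pd w f) x) = pd v (pd w f) x"
        using pd_linear[OF cpoly_pd[OF cf], of v w x] by (simp add: inner_commute)
      finally show ?thesis by simp
    qed
    have "laplacian (rot a c f) x = (\<Sum>b\<in>Basis. pd b (pd b (\<lambda>x. of_real (x \<bullet> a) * pd c f x)) x)
        - (\<Sum>b\<in>Basis. pd b (pd b (\<lambda>x. of_real (x \<bullet> c) * pd a f x)) x)"
      using cf by (simp add: laplacian_eq cpoly_rot) (simp add: rot_def[abs_def] pd_diff cpoly_intros cpoly_pd sum_subtractf)
    also have "\<dots> = 0" unfolding Q using cf by (simp add: pd_commute[of f a c])
    finally show ?thesis .
  qed
  ultimately show ?thesis using cf by (auto simp: HP_def cpoly_rot)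
qed

section \<open>Integration of homogeneous functions over the ball and the sphere\<close>

abbreviation "punct \<equiv> ball 0 1 - {0 :: 'a::euclidean_space}"

text \<open>Stands in for polar coordinates in the ambient space. A function h of the direction has
  integral r^n J over the ball of radius r by scaling, and 1 - |x|^i is the integral of i r^(i-1)
  over r from |x| to 1; exchanging the integrals evaluates J - I. The subtraction in
  \<open>ennreal\<close> is legitimate because J is finite.\<close>

lemma radial_cone:
  fixes A :: "'a::euclidean_space set"
  assumes [measurable]: "A \<in> sets borel" and i: "i > 0"
  shows "of_nat (DIM('a) + i) * (\<integral>\<^sup>+x. ennreal (norm x ^ i) * (indicator punct x * indicator A (sgn x)) \<partial>lborel)
    = of_nat DIM('a) * (\<integral>\<^sup>+x. indicator punct x * indicator A (sgn x) \<partial>(lborel :: 'a measure))"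
proof -
  let ?n = "DIM('a)"
  define h :: "'a \<Rightarrow> ennreal" where "h x = indicator punct x * indicator A (sgn x)" for x
  have sgnm [measurable]: "(sgn :: 'a \<Rightarrow> 'a) \<in> borel_measurable borel"
    unfolding sgn_div_norm [abs_def] by measurable
  have pm [measurable]: "punct \<in> sets (borel :: 'a measure)" by simp
  have hm [measurable]: "h \<in> borel_measurable borel" unfolding h_def
    by (intro borel_measurable_times_ennreal borel_measurable_indicator pm
        measurable_compose[OF sgnm borel_measurable_indicator] assms)
  define J where "J = (\<integral>\<^sup>+x. h x \<partial>lborel)"
  define I where "I = (\<integral>\<^sup>+x. ennreal (norm x ^ i) * h x \<partial>lborel)"
  have fin: "J < \<infinity>"
  proof -
    have "J \<le> (\<integral>\<^sup>+x. indicator (ball 0 1) x \<partial>(lborel :: 'a measure))"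
      unfolding J_def h_def by (intro nn_integral_mono) (auto simp: indicator_def)
    also have "\<dots> < \<infinity>" using emeasure_lborel_ball_finite[of "0 :: 'a" 1] by simp
    finally show ?thesis .
  qed
  have IJ: "I \<le> J" unfolding I_def J_def
  proof (rule nn_integral_mono)
    fix x :: 'a
    show "ennreal (norm x ^ i) * h x \<le> h x"
      by (cases "x \<in> punct") (auto simp: h_def indicator_def power_le_one)
  qed
  have scale: "(\<integral>\<^sup>+x. indicator {x. norm x < r} x * h x \<partial>lborel) = ennreal (r ^ ?n) * J" if r: "0 < r" "r \<le> 1" for r
  proof -
    have "(\<integral>\<^sup>+x. indicator {x. norm x < r} x * h x \<partial>lborel)
       = (\<integral>\<^sup>+x. indicator {x. norm x < r} x * h x \<partial>(density (distr lborel borel (\<lambda>x. 0 + r *\<^sub>R x)) (\<lambda>_. \<bar>r\<bar> ^ ?n)))"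
      using r by (intro arg_cong2[where f = nn_integral] lborel_affine refl) auto
    also have "\<dots> = (\<integral>\<^sup>+x. ennreal (r ^ ?n) * (indicator {x. norm x < r} (r *\<^sub>R x) * h (r *\<^sub>R x)) \<partial>lborel)"
      using r by (subst nn_integral_density) (simp_all add: nn_integral_distr)
    also have "\<dots> = (\<integral>\<^sup>+x. ennreal (r ^ ?n) * h x \<partial>lborel)"
    proof (intro nn_integral_cong arg_cong2[where f = "(*)"] refl)
      fix x :: 'a
      show "indicator {x. norm x < r} (r *\<^sub>R x) * h (r *\<^sub>R x) = h x"
      proof (cases "norm x < 1")
        case True
        have "r * norm x \<le> norm x" using r by (simp add: mult_left_le_one_le)
        then have "r * norm x < 1" using True by linarith
        then have "indicator punct (r *\<^sub>R x) = (indicator punct x :: ennreal)"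
          using True r by (cases "x = 0") (simp_all add: indicator_def)
        then show ?thesis using True r by (simp add: h_def sgn_scaleR)
      next
        case False
        then have "r \<le> r * norm x" using r by simp
        then show ?thesis using False r by (simp add: h_def indicator_def)
      qed
    qed
    also have "\<dots> = ennreal (r ^ ?n) * J" unfolding J_def by (rule nn_integral_cmult) simp
    finally show ?thesis .
  qed
  have layer: "ennreal (1 - norm x ^ i) = (\<integral>\<^sup>+r. ennreal (indicator {0<..1} r * (real i * r ^ (i - 1))) * indicator {x. norm x < r} x \<partial>lborel)"
    if "norm x < 1" for x :: 'a
  proof -
    have "((\<lambda>r. real i * r ^ (i - 1)) has_integral (1 ^ i - norm x ^ i)) {norm x..1}"
      using that by (intro fundamental_theorem_of_calculus)
        (auto intro!: derivative_eq_intros simp flip: has_real_derivative_iff_has_vector_derivative)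
    then have "(\<integral>\<^sup>+r. ennreal (indicator {norm x..1} r * (real i * r ^ (i - 1))) \<partial>lborel) = ennreal (1 - norm x ^ i)"
    proof (intro nn_integral_has_integral_lebesgue)
      fix r assume "r \<in> {norm x..1}"
      then have "norm x \<le> r" by simp
      then have "0 \<le> r" using norm_ge_zero[of x] by linarith
      then show "0 \<le> real i * r ^ (i - 1)" by simp
    qed simp
    also have "(\<integral>\<^sup>+r. ennreal (indicator {norm x..1} r * (real i * r ^ (i - 1))) \<partial>lborel) =
       (\<integral>\<^sup>+r. ennreal (indicator {0<..1} r * (real i * r ^ (i - 1))) * indicator {x. norm x < r} x \<partial>lborel)"
    proof (rule nn_integral_cong_AE)
      show "AE r in lborel. ennreal (indicator {norm x..1} r * (real i * r ^ (i - 1))) =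
        ennreal (indicator {0<..1} r * (real i * r ^ (i - 1))) * indicator {x. norm x < r} x"
        using AE_lborel_singleton[of "norm x"]
      proof eventually_elim
        case (elim r)
        show ?case
        proof (cases "norm x < r \<and> r \<le> 1")
          case True
          then have "0 < r" using norm_ge_zero[of x] by linarith
          then show ?thesis using True by simp
        next
          case False
          then have "r \<notin> {norm x..1}" "r \<notin> {0<..1} \<or> \<not> norm x < r" using elim by auto
          then show ?thesis by auto
        qed
      qed
    qed
    finally show ?thesis by simp
  qed
  have "J - I = (\<integral>\<^sup>+x. ennreal (1 - norm x ^ i) * h x \<partial>lborel)"
  proof -
    have "I + (\<integral>\<^sup>+x. ennreal (1 - norm x ^ i) * h x \<partial>lborel) = (\<integral>\<^sup>+x. ennreal (norm x ^ i) * h x + ennreal (1 - norm x ^ i) * h x \<partial>lborel)"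
      unfolding I_def by (rule nn_integral_add[symmetric]) auto
    also have "\<dots> = J" unfolding J_def
    proof (rule nn_integral_cong)
      fix x :: 'a
      show "ennreal (norm x ^ i) * h x + ennreal (1 - norm x ^ i) * h x = h x"
      proof (cases "x \<in> punct")
        case True
        then have "norm x ^ i \<le> 1" by (auto simp: power_le_one)
        then show ?thesis by (simp flip: distrib_right ennreal_plus)
      qed (simp add: h_def)
    qed
    finally show ?thesis using fin IJ by (metis ennreal_add_diff_cancel_left top.not_eq_extremum infinity_ennreal_def order_le_less_trans)
  qed
  also have "\<dots> = (\<integral>\<^sup>+x. (\<integral>\<^sup>+r. ennreal (indicator {0<..1} r * (real i * r ^ (i - 1))) * indicator {x. norm x < r} x * h x \<partial>lborel) \<partial>lborel)"
  proof (rule nn_integral_cong)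
    fix x :: 'a
    show "ennreal (1 - norm x ^ i) * h x = (\<integral>\<^sup>+r. ennreal (indicator {0<..1} r * (real i * r ^ (i - 1))) * indicator {x. norm x < r} x * h x \<partial>lborel)"
      by (cases "norm x < 1") (simp_all add: layer nn_integral_multc, simp add: h_def)
  qed
  also have "\<dots> = (\<integral>\<^sup>+r. (\<integral>\<^sup>+x. ennreal (indicator {0<..1} r * (real i * r ^ (i - 1))) * indicator {x. norm x < r} x * h x \<partial>lborel) \<partial>lborel)"
    by (rule lborel_pair.Fubini'[symmetric]) simp
  also have "\<dots> = (\<integral>\<^sup>+r. ennreal (indicator {0..1} r * (real i * r ^ (i - 1 + ?n))) * J \<partial>lborel)"
  proof (rule nn_integral_cong)
    fix r :: real
    have "(\<integral>\<^sup>+x. ennreal (indicator {0<..1} r * (real i * r ^ (i - 1))) * indicator {x. norm x < r} x * h x \<partial>lborel)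
      = ennreal (indicator {0<..1} r * (real i * r ^ (i - 1))) * (\<integral>\<^sup>+x. indicator {x. norm x < r} x * h x \<partial>lborel)"
      unfolding mult.assoc by (rule nn_integral_cmult) simp
    also have "\<dots> = ennreal (indicator {0..1} r * (real i * r ^ (i - 1 + ?n))) * J"
    proof (cases "0 < r \<and> r \<le> 1")
      case True
      then have r: "0 < r" "r \<le> 1" by auto
      have "ennreal (real i * r ^ (i - 1)) * (ennreal (r ^ ?n) * J) = ennreal (real i * r ^ (i - 1) * r ^ ?n) * J"
        using r by (subst ennreal_mult[where b = "r ^ ?n"]) (simp_all add: mult.assoc)
      then show ?thesis using r by (simp add: scale power_add mult.assoc)
    next
      case False
      then show ?thesis using DIM_positive[where 'a='a] by (cases "r = 0") (auto simp: indicator_def)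
    qed
    finally show "(\<integral>\<^sup>+x. ennreal (indicator {0<..1} r * (real i * r ^ (i - 1))) * indicator {x. norm x < r} x * h x \<partial>lborel)
      = ennreal (indicator {0..1} r * (real i * r ^ (i - 1 + ?n))) * J" .
  qed
  also have "\<dots> = ennreal (real i / real (i + ?n)) * J"
  proof -
    have "((\<lambda>r. real i * r ^ (i - 1 + ?n)) has_integral (real i / real (i + ?n) * 1 ^ (i + ?n) - real i / real (i + ?n) * 0 ^ (i + ?n))) {0..1}"
    proof (rule fundamental_theorem_of_calculus)
      fix r :: real
      have "i + ?n - Suc 0 = i - 1 + ?n" using i by simp
      then show "((\<lambda>r. real i / real (i + ?n) * r ^ (i + ?n)) has_vector_derivative real i * r ^ (i - 1 + ?n)) (at r within {0..1})"
        unfolding has_real_derivative_iff_has_vector_derivative[symmetric]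
        using i by (intro DERIV_cong[OF DERIV_cmult[OF DERIV_pow]]) (simp del: of_nat_add)
    qed simp
    then have "(\<integral>\<^sup>+r. ennreal (indicator {0..1} r * (real i * r ^ (i - 1 + ?n))) \<partial>lborel) = ennreal (real i / real (i + ?n))"
      using i by (intro nn_integral_has_integral_lebesgue) (auto simp: power_0_left)
    then show ?thesis by (simp add: nn_integral_multc)
  qed
  finally have e: "J - I = ennreal (real i / real (i + ?n)) * J" .
  obtain j where j: "J = ennreal j" "j \<ge> 0" using fin by (cases J) auto
  obtain k where k: "I = ennreal k" "k \<ge> 0" using IJ fin by (cases I) (auto simp: top_unique)
  have "j - k = real i / real (i + ?n) * j"
    using e IJ j k i by (simp add: ennreal_minus flip: ennreal_mult)
  then have "real (?n + i) * k = real ?n * j" using i by (simp add: field_simps)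
  then have "ennreal (real (?n + i) * k) = ennreal (real ?n * j)" by simp
  then have "of_nat (?n + i) * I = of_nat ?n * J"
    unfolding j(1) k(1) by (simp add: ennreal_mult k j ennreal_of_nat_eq_real_of_nat del: of_nat_add)
  then show ?thesis by (simp add: I_def J_def h_def)
qed

text \<open>The cone measure may be weighted by |x|^i if the normalising factor becomes the
  dimension plus i. With i the degree of a homogeneous integrand this turns a surface integral into
  an integral over the ball, where integration by parts is available.\<close>

lemma surface_measure_eq:
  "(surface_measure :: 'a::euclidean_space measure) =
     distr (density (restrict_space lborel punct) (\<lambda>x. ennreal (real (DIM('a) + i) * norm x ^ i)))
       (restrict_space borel (sphere 0 1)) sgn" (is "_ = ?M")
proof (rule measure_eqI)
  show "sets surface_measure = sets ?M" by (simp add: surface_measure_sets)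
  fix A :: "'a set" assume A: "A \<in> sets surface_measure"
  have A': "A \<in> sets (restrict_space borel (sphere 0 1))" using A by (simp add: surface_measure_sets)
  then have Ab [measurable]: "A \<in> sets borel"
    by (metis sets_restrict_space_iff borel_closed closed_sphere inf_top.right_neutral space_borel)
  have sgnm [measurable]: "(sgn :: 'a \<Rightarrow> 'a) \<in> borel_measurable borel"
    unfolding sgn_div_norm [abs_def] by measurable
  have pm [measurable]: "punct \<in> sets (borel :: 'a measure)" by simp
  have m: "sgn -` A \<inter> space (restrict_space lborel punct) \<in> sets (restrict_space lborel punct)"
    using measurable_sets[OF measurable_sgn_sphere A'] .
  have "emeasure ?M A = (\<integral>\<^sup>+x. ennreal (real (DIM('a) + i) * norm x ^ i) * indicator (sgn -` A \<inter> punct) x \<partial>restrict_space lborel punct)"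
    using m A' by (subst emeasure_distr)
      (auto intro!: emeasure_density measurable_restrict_space1 simp: space_restrict_space measurable_sgn_sphere)
  also have "\<dots> = (\<integral>\<^sup>+x. of_nat (DIM('a) + i) * (ennreal (norm x ^ i) * (indicator punct x * indicator A (sgn x))) \<partial>lborel)"
    by (subst nn_integral_restrict_space)
      (auto simp: indicator_def ennreal_mult ennreal_of_nat_eq_real_of_nat intro!: nn_integral_cong)
  also have "\<dots> = of_nat (DIM('a) + i) * (\<integral>\<^sup>+x. ennreal (norm x ^ i) * (indicator punct x * indicator A (sgn x)) \<partial>lborel)"
    by (rule nn_integral_cmult) simp
  also have "\<dots> = of_nat DIM('a) * (\<integral>\<^sup>+x. indicator punct x * indicator A (sgn x) \<partial>(lborel :: 'a measure))"
    using radial_cone[OF Ab, of i] by (cases "i = 0") simp_all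
  also have "(\<integral>\<^sup>+x. indicator punct x * indicator A (sgn x) \<partial>(lborel :: 'a measure)) = emeasure (restrict_space lborel punct) (sgn -` A \<inter> punct)"
  proof -
    have "emeasure (restrict_space lborel punct) (sgn -` A \<inter> punct) = emeasure lborel (sgn -` A \<inter> (punct :: 'a set))"
      by (rule emeasure_restrict_space) auto
    also have "\<dots> = (\<integral>\<^sup>+x. indicator (sgn -` A \<inter> punct) x \<partial>lborel)"
      using m by (intro nn_integral_indicator[symmetric]) (auto simp: sets_restrict_space_iff space_restrict_space)
    also have "\<dots> = (\<integral>\<^sup>+x. indicator punct x * indicator A (sgn x) \<partial>(lborel :: 'a measure))"
      by (intro nn_integral_cong) (auto simp: indicator_def)
    finally show ?thesis by simp
  qed
  also have "of_nat DIM('a) * \<dots> = emeasure surface_measure A"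
    unfolding surface_measure_def emeasure_scale_measure using A'
    by (subst emeasure_distr) (auto simp: measurable_sgn_sphere space_restrict_space)
  finally show "emeasure surface_measure A = emeasure ?M A" by simp
qed

definition BI :: "('a::euclidean_space \<Rightarrow> complex) \<Rightarrow> complex" where
  "BI F = (LINT x|lborel. indicator (ball 0 1) x *\<^sub>R F x)"

lemma surface_integral_homogeneous:
  assumes F: "cpoly (F :: 'a::euclidean_space \<Rightarrow> complex)" "homogeneous i F"
  shows "(LINT x|surface_measure. F x) = of_nat (DIM('a) + i) * BI F"
proof -
  have [measurable]: "F \<in> borel_measurable borel" by (rule cpoly_borel[OF F(1)])
  have pm: "punct \<in> sets (borel :: 'a measure)" by simp
  have "(LINT x|surface_measure. F x) =
    (LINT x|density (restrict_space lborel punct) (\<lambda>x. ennreal (real (DIM('a) + i) * norm x ^ i)). F (sgn x))"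
    unfolding surface_measure_eq[of i]
    by (rule integral_distr) (auto intro!: measurable_restrict_space1 simp: measurable_sgn_sphere)
  also have "\<dots> = (LINT x|restrict_space lborel punct. (real (DIM('a) + i) * norm x ^ i) *\<^sub>R F (sgn x))"
  proof (rule integral_density)
    show "(\<lambda>x. F (sgn x)) \<in> borel_measurable (restrict_space lborel punct)"
      by (rule measurable_compose[OF measurable_sgn_sphere]) (rule measurable_restrict_space1, simp)
  qed (auto intro!: measurable_restrict_space1)
  also have "\<dots> = (LINT x|lborel. indicator punct x *\<^sub>R (real (DIM('a) + i) * norm x ^ i) *\<^sub>R F (sgn x))"
    using pm by (intro integral_restrict_space) auto
  also have "\<dots> = (LINT x|lborel. real (DIM('a) + i) *\<^sub>R (indicator (ball 0 1) x *\<^sub>R F x))"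
  proof (rule integral_cong_AE)
    show "AE x in lborel. indicator punct x *\<^sub>R (real (DIM('a) + i) * norm x ^ i) *\<^sub>R F (sgn x) =
        real (DIM('a) + i) *\<^sub>R (indicator (ball 0 1) x *\<^sub>R F x)"
      using AE_lborel_singleton[of "0 :: 'a"]
    proof eventually_elim
      case (elim x)
      have "F (norm x *\<^sub>R sgn x) = of_real (norm x ^ i) * F (sgn x)"
        using F(2) unfolding homogeneous_def by blast
      also have "norm x *\<^sub>R sgn x = x" using elim by (simp add: sgn_div_norm)
      finally show ?case using elim by (simp add: indicator_def scaleR_conv_of_real)
    qed
    have "(sgn :: 'a \<Rightarrow> 'a) \<in> borel_measurable borel"
      unfolding sgn_div_norm [abs_def] by measurable
    then show "(\<lambda>x. indicat_real punct x *\<^sub>R (real (DIM('a) + i) * norm x ^ i) *\<^sub>R F (sgn x)) \<in> borel_measurable lborel"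
      using pm by measurable
    have [measurable]: "ball 0 1 \<in> sets (borel :: 'a measure)" by simp
    show "(\<lambda>x. real (DIM('a) + i) *\<^sub>R (indicat_real (ball 0 1) x *\<^sub>R F x)) \<in> borel_measurable lborel"
      by measurable
  qed
  also have "\<dots> = of_nat (DIM('a) + i) * BI F"
    unfolding BI_def by (subst integral_scaleR_right) (auto simp: scaleR_conv_of_real simp del: of_nat_add)
  finally show ?thesis .
qed


text \<open>The square of this cut-off is continuously differentiable, which is what integration by
  parts against it needs.\<close>

definition gw :: "'a::euclidean_space \<Rightarrow> real" where
  "gw x = max 0 (1 - x \<bullet> x)"

lemma gw_outside: "norm x \<ge> 1 \<Longrightarrow> gw x = 0"
  by (simp add: gw_def dot_square_norm)

lemma gw_continuous: "continuous_on S gw"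
  unfolding gw_def[abs_def] by (intro continuous_intros)

lemma compact_support_bounded:
  fixes F :: "'a::euclidean_space \<Rightarrow> complex"
  assumes "continuous_on UNIV F" "\<And>x. norm x \<ge> 1 \<Longrightarrow> F x = 0"
  obtains M where "M \<ge> 0" "\<And>x. norm (F x) \<le> M"
proof -
  have "bounded (F ` cball 0 1)"
    by (intro compact_imp_bounded compact_continuous_image continuous_on_subset[OF assms(1)]) auto
  then obtain M where M: "\<And>x. x \<in> cball 0 1 \<Longrightarrow> norm (F x) \<le> M" unfolding bounded_iff by blast
  then have "M \<ge> 0" using order_trans[OF norm_ge_zero M[of 0]] by simp
  moreover have "norm (F x) \<le> M" for x
    using M[of x] assms(2)[of x] \<open>M \<ge> 0\<close> by (cases "norm x \<le> 1") auto
  ultimately show ?thesis by (rule that)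
qed

lemma compact_support_integrable:
  fixes F :: "'a::euclidean_space \<Rightarrow> complex"
  assumes "continuous_on UNIV F" "\<And>x. norm x \<ge> 1 \<Longrightarrow> F x = 0"
  shows "integrable lborel F"
proof -
  obtain M where M: "\<And>x. norm (F x) \<le> M" using compact_support_bounded[OF assms] by blast
  show ?thesis
    by (rule integrableI_bounded_set[where A = "ball 0 1" and B = M])
       (use M assms emeasure_lborel_ball_finite[of "0 :: 'a" 1] in \<open>auto simp: borel_measurable_continuous_onI\<close>)
qed

text \<open>By translation invariance each difference quotient has integral 0; the mean value
  inequality dominates the quotients by a constant on a fixed ball, and they converge to D.\<close>

lemma integral_derivative_zero:
  fixes G D :: "'a::euclidean_space \<Rightarrow> complex"
  assumes D: "\<And>x s. ((\<lambda>t. G (x + t *\<^sub>R v)) has_vector_derivative D (x + s *\<^sub>R v)) (at s)"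
    and cG: "continuous_on UNIV G" and cD: "continuous_on UNIV D"
    and sG: "\<And>x. norm x \<ge> 1 \<Longrightarrow> G x = 0" and sD: "\<And>x. norm x \<ge> 1 \<Longrightarrow> D x = 0"
  shows "(LINT x|lborel. D x) = 0"
proof -
  obtain M where M: "M \<ge> 0" "\<And>x. norm (D x) \<le> M" using compact_support_bounded[OF cD sD] by blast
  have [measurable]: "G \<in> borel_measurable borel" "D \<in> borel_measurable borel"
    using cG cD by (auto intro: borel_measurable_continuous_onI)
  define q where "q n x = (G (x + inverse (real (Suc n)) *\<^sub>R v) - G x) /\<^sub>R inverse (real (Suc n))" for n :: nat and x
  have "(\<lambda>n. LINT x|lborel. q n x) \<longlonglongrightarrow> (LINT x|lborel. D x)"
  proof (rule integral_dominated_convergence)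
    show "integrable lborel (\<lambda>x::'a. indicator (cball 0 (1 + norm v)) x *\<^sub>R M)"
      by (intro integrable_scaleR_left integrable_real_indicator) (use emeasure_lborel_cball_finite[of "0 :: 'a" "1 + norm v"] in simp_all)
    show "AE x in lborel. (\<lambda>n. q n x) \<longlonglongrightarrow> D x"
    proof (rule AE_I2)
      fix x
      have "((\<lambda>t. G (x + t *\<^sub>R v)) has_vector_derivative D x) (at 0)" using D[of x 0] by simp
      then have "((\<lambda>t. norm (G (x + t *\<^sub>R v) - G x - t *\<^sub>R D x) / norm t)) \<midarrow>0\<rightarrow> 0"
        unfolding has_vector_derivative_def has_derivative_at by simp
      moreover have "filterlim (\<lambda>n. inverse (real (Suc n))) (at 0) sequentially"
        using LIMSEQ_inverse_real_of_nat by (auto simp: filterlim_at)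
      ultimately have lim: "(\<lambda>n. norm (G (x + inverse (real (Suc n)) *\<^sub>R v) - G x - inverse (real (Suc n)) *\<^sub>R D x)
          / norm (inverse (real (Suc n)))) \<longlonglongrightarrow> 0"
        by (rule filterlim_compose)
      have E: "norm (G (x + inverse (real (Suc n)) *\<^sub>R v) - G x - inverse (real (Suc n)) *\<^sub>R D x)
          / norm (inverse (real (Suc n))) = norm (q n x - D x)" for n
      proof -
        have "q n x - D x = (G (x + inverse (real (Suc n)) *\<^sub>R v) - G x - inverse (real (Suc n)) *\<^sub>R D x) /\<^sub>R inverse (real (Suc n))"
          by (simp add: q_def scaleR_diff_right del: of_nat_Suc)
        then show ?thesis by (simp add: divide_inverse mult.commute del: of_nat_Suc)
      qed
      have "(\<lambda>n. norm (q n x - D x)) \<longlonglongrightarrow> 0" using lim unfolding E .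
      then show "(\<lambda>n. q n x) \<longlonglongrightarrow> D x"
        by (rule LIM_zero_cancel[OF tendsto_norm_zero_cancel])
    qed
    show "AE x in lborel. norm (q n x) \<le> indicator (cball 0 (1 + norm v)) x *\<^sub>R M" for n
    proof (rule AE_I2)
      fix x
      define h where "h = inverse (real (Suc n))"
      have qh: "q n x = (G (x + h *\<^sub>R v) - G x) /\<^sub>R h" by (simp only: q_def h_def)
      have h: "0 < h" "h \<le> 1" by (auto simp: h_def field_simps)
      have "norm (G (x + h *\<^sub>R v) - G (x + 0 *\<^sub>R v)) \<le> M * norm (h - 0)"
      proof (rule differentiable_bound[where S = UNIV and f = "\<lambda>t. G (x + t *\<^sub>R v)" and f' = "\<lambda>s t. t *\<^sub>R D (x + s *\<^sub>R v)"])
        show "((\<lambda>t. G (x + t *\<^sub>R v)) has_derivative (\<lambda>t. t *\<^sub>R D (x + s *\<^sub>R v))) (at s within UNIV)" for s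
          using D[of x s] by (simp add: has_vector_derivative_def)
        show "onorm (\<lambda>t. t *\<^sub>R D (x + s *\<^sub>R v)) \<le> M" for s
          by (rule onorm_le) (use M in \<open>simp add: mult.commute[of M] mult_left_mono\<close>)
      qed auto
      then have 1: "norm (q n x) \<le> M"
        using h unfolding qh norm_scaleR by (simp add: inverse_eq_divide pos_divide_le_eq)
      show "norm (q n x) \<le> indicator (cball 0 (1 + norm v)) x *\<^sub>R M"
      \<comment> \<open>Outside this ball both x and x + h v have norm at least 1, where G
        vanishes.\<close>
      proof (cases "norm x \<le> 1 + norm v")
        case False
        have "norm (h *\<^sub>R v) \<le> norm v" using h by (simp add: mult_left_le_one_le)
        then have "norm (x + h *\<^sub>R v) \<ge> 1" using False norm_diff_ineq[of x "h *\<^sub>R v"] by linarith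
        moreover have "norm x \<ge> 1" using False norm_ge_zero[of v] by linarith
        ultimately show ?thesis using M by (simp add: qh sG)
      qed (use 1 in simp)
    qed
  qed (simp_all add: q_def)
  moreover have "(LINT x|lborel. q n x) = 0" for n
  proof -
    have i: "integrable lborel G" by (rule compact_support_integrable[OF cG sG])
    have d: "distr lborel borel ((+) (inverse (real (Suc n)) *\<^sub>R v)) = (lborel :: 'a measure)" by (rule lborel_distr_plus)
    have "integrable (distr lborel borel ((+) (inverse (real (Suc n)) *\<^sub>R v))) G" unfolding d by (rule i)
    then have i': "integrable lborel (\<lambda>x. G (x + inverse (real (Suc n)) *\<^sub>R v))"
      by (subst (asm) integrable_distr_eq) (auto simp: add.commute)
    have "(LINT x|lborel. G x) = (LINT x|distr lborel borel ((+) (inverse (real (Suc n)) *\<^sub>R v)). G x)" unfolding d ..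
    also have "\<dots> = (LINT x|lborel. G (x + inverse (real (Suc n)) *\<^sub>R v))"
      by (subst integral_distr) (auto simp: add.commute)
    finally show ?thesis using i i' by (simp add: q_def)
  qed
  ultimately have "(\<lambda>n. 0) \<longlonglongrightarrow> (LINT x|lborel. D x)" by (simp only:)
  then show ?thesis by (simp add: LIMSEQ_const_iff)
qed

lemma gw_line_deriv:
  fixes x v :: "'a::euclidean_space"
  shows "((\<lambda>t. (gw (x + t *\<^sub>R v))\<^sup>2) has_real_derivative - 4 * gw (x + s *\<^sub>R v) * ((x + s *\<^sub>R v) \<bullet> v)) (at s)"
proof -
  define u where "u t = 1 - (x + t *\<^sub>R v) \<bullet> (x + t *\<^sub>R v)" for t
  have u: "(u has_real_derivative - 2 * ((x + s *\<^sub>R v) \<bullet> v)) (at s)"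
  proof -
    have "u = (\<lambda>t. 1 - (x \<bullet> x + 2 * t * (x \<bullet> v) + t\<^sup>2 * (v \<bullet> v)))"
      by (auto simp: u_def fun_eq_iff inner_add_left inner_add_right inner_commute power2_eq_square algebra_simps)
    then show ?thesis
      by (auto intro!: derivative_eq_intros simp: inner_add_left algebra_simps)
  qed
  have m: "((\<lambda>y::real. (max 0 y)\<^sup>2) has_real_derivative 2 * max 0 y) (at y)" for y
  proof (cases y "0::real" rule: linorder_cases)
    case less
    have "((\<lambda>y::real. 0) has_real_derivative 2 * max 0 y) (at y)" using less by simp
    then show ?thesis
      by (rule has_field_derivative_transform_within_open[where S = "{..<0}"]) (use less in auto)
  next
    case greater
    have "((\<lambda>y::real. y\<^sup>2) has_real_derivative 2 * max 0 y) (at y)"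
      using greater by (auto intro!: derivative_eq_intros)
    then show ?thesis
      by (rule has_field_derivative_transform_within_open[where S = "{0<..}"]) (use greater in auto)
  next
    case equal
    have "((\<lambda>h::real. ((max 0 (0 + h))\<^sup>2 - (max 0 0)\<^sup>2) / h) \<longlongrightarrow> 0) (at 0)"
    proof (rule Lim_null_comparison)
      show "\<forall>\<^sub>F h in at 0. norm (((max 0 (0 + h))\<^sup>2 - (max 0 0)\<^sup>2) / h) \<le> \<bar>h::real\<bar>"
        by (auto simp: eventually_at_filter max_def power2_eq_square)
      show "((\<lambda>h::real. \<bar>h\<bar>) \<longlongrightarrow> 0) (at 0)" by (auto intro!: tendsto_eq_intros)
    qed
    then show ?thesis using equal by (simp add: DERIV_def)
  qed
  have "((\<lambda>t. (max 0 (u t))\<^sup>2) has_real_derivative 2 * max 0 (u s) * (- 2 * ((x + s *\<^sub>R v) \<bullet> v))) (at s)"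
    by (rule DERIV_chain2[OF m u])
  then show ?thesis by (simp add: gw_def u_def mult_ac)
qed

text \<open>There is no boundary term, as the cut-off vanishes on the sphere. The gradient -4
  \<open>gw\<close> x of its square is radial, which is what makes tangential operators skew-adjoint
  and brings Euler's relation into play.\<close>

lemma ball_ibp:
  fixes F :: "'a::euclidean_space \<Rightarrow> complex"
  assumes F: "cpoly F"
  shows "(LINT x|lborel. of_real ((gw x)\<^sup>2) * pd v F x) = (LINT x|lborel. of_real (gw x) * (4 * of_real (x \<bullet> v) * F x))"
    "integrable lborel (\<lambda>x. of_real ((gw x)\<^sup>2) * F x)" "integrable lborel (\<lambda>x. of_real (gw x) * F x)"
proof -
  have int2: "integrable lborel (\<lambda>x. of_real ((gw x)\<^sup>2) * G x)" "integrable lborel (\<lambda>x. of_real (gw x) * G x)"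
    if "cpoly G" for G :: "'a \<Rightarrow> complex"
  proof -
    have "continuous_on UNIV (\<lambda>x. of_real ((gw x)\<^sup>2) * G x)" "continuous_on UNIV (\<lambda>x. of_real (gw x) * G x)"
      by (intro continuous_intros gw_continuous cpoly_continuous that)+
    then show "integrable lborel (\<lambda>x. of_real ((gw x)\<^sup>2) * G x)" "integrable lborel (\<lambda>x. of_real (gw x) * G x)"
      by (auto intro!: compact_support_integrable simp: gw_outside simp del: of_real_power)
  qed
  show "integrable lborel (\<lambda>x. of_real ((gw x)\<^sup>2) * F x)" "integrable lborel (\<lambda>x. of_real (gw x) * F x)"
    by (intro int2 F)+
  define D where "D x = of_real ((gw x)\<^sup>2) * pd v F x + of_real (- 4 * gw x * (x \<bullet> v)) * F x" for x
  have "(LINT x|lborel. D x) = 0"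
  proof (rule integral_derivative_zero[where G = "\<lambda>x. of_real ((gw x)\<^sup>2) * F x" and v = v])
    fix x s
    show "((\<lambda>t. of_real ((gw (x + t *\<^sub>R v))\<^sup>2) * F (x + t *\<^sub>R v)) has_vector_derivative D (x + s *\<^sub>R v)) (at s)"
      unfolding D_def
    proof (rule has_vector_derivative_mult)
      show "((\<lambda>t. complex_of_real ((gw (x + t *\<^sub>R v))\<^sup>2)) has_vector_derivative of_real (- 4 * gw (x + s *\<^sub>R v) * ((x + s *\<^sub>R v) \<bullet> v))) (at s)"
        by (rule has_vector_derivative_of_real[OF gw_line_deriv])
      show "((\<lambda>t. F (x + t *\<^sub>R v)) has_vector_derivative pd v F (x + s *\<^sub>R v)) (at s)"
        using cpoly_has_pd[OF F, of v] unfolding has_pd_def by blast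
    qed
  next
    show "continuous_on UNIV (\<lambda>x. of_real ((gw x)\<^sup>2) * F x)" "continuous_on UNIV D"
      unfolding D_def[abs_def]
      by (intro continuous_intros gw_continuous cpoly_continuous[OF F] cpoly_continuous[OF cpoly_pd[OF F]])+
  qed (simp_all add: gw_outside D_def)
  also have "(LINT x|lborel. D x) = (LINT x|lborel. of_real ((gw x)\<^sup>2) * pd v F x) - (LINT x|lborel. of_real (gw x) * (4 * of_real (x \<bullet> v) * F x))"
  proof (subst Bochner_Integration.integral_diff[symmetric])
    show "integrable lborel (\<lambda>x. of_real ((gw x)\<^sup>2) * pd v F x)" by (intro int2 cpoly_pd F)
    show "integrable lborel (\<lambda>x. of_real (gw x) * (4 * of_real (x \<bullet> v) * F x))"
      by (intro int2 cpoly_intros F)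
  qed (intro Bochner_Integration.integral_cong refl, simp add: D_def mult_ac)
  finally show "(LINT x|lborel. of_real ((gw x)\<^sup>2) * pd v F x) = (LINT x|lborel. of_real (gw x) * (4 * of_real (x \<bullet> v) * F x))" by simp
qed

lemma cpoly_norm_sq: "cpoly (\<lambda>x :: 'a::euclidean_space. of_real (x \<bullet> x))"
proof -
  have "(\<lambda>x :: 'a. complex_of_real (x \<bullet> x)) = (\<lambda>x. \<Sum>b\<in>Basis. of_real (x \<bullet> b) * of_real (x \<bullet> b))"
    by (rule ext) (subst euclidean_inner, simp)
  moreover have "cpoly (\<lambda>x :: 'a. \<Sum>b\<in>Basis. of_real (x \<bullet> b) * of_real (x \<bullet> b))"
    by (intro cpoly_sum cpoly_intros)
  ultimately show ?thesis by simp
qed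

lemma integrable_ball_cpoly:
  "cpoly (F :: 'a::euclidean_space \<Rightarrow> complex) \<Longrightarrow> integrable lborel (\<lambda>x. indicator (ball 0 1) x *\<^sub>R F x)"
proof -
  assume F: "cpoly F"
  have "bounded (F ` cball 0 1)"
    by (intro compact_imp_bounded compact_continuous_image continuous_on_subset[OF cpoly_continuous[OF F]]) auto
  then obtain M where M: "\<And>x. x \<in> cball 0 1 \<Longrightarrow> norm (F x) \<le> M" unfolding bounded_iff by blast
  show ?thesis
    by (rule integrableI_bounded_set_indicator[where B = M])
       (use M cpoly_borel[OF F] emeasure_lborel_ball_finite[of "0 :: 'a" 1] in auto)
qed

text \<open>On the sphere a homogeneous polynomial agrees with its product by \<open>|x|\<^sup>2\<close>, so that
  its weighted integrals over the ball are positive multiples of the surface integral.\<close>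

lemma gw_integral_homogeneous:
  assumes F: "cpoly (F :: 'a::euclidean_space \<Rightarrow> complex)" "homogeneous i F"
  defines "d \<equiv> real (DIM('a) + i)"
  shows "(LINT x|lborel. of_real (gw x) * F x) = of_real (1 / d - 1 / (d + 2)) * (LINT x|surface_measure. F x)"
    "(LINT x|lborel. of_real ((gw x)\<^sup>2) * F x) = of_real (1 / d - 2 / (d + 2) + 1 / (d + 4)) * (LINT x|surface_measure. F x)"
proof -
  have d: "d > 0" unfolding d_def of_nat_0_less_iff using DIM_positive[where 'a='a] by (rule trans_less_add1)
  let ?N = "\<lambda>x::'a. complex_of_real (x \<bullet> x)"
  have mult: "cpoly (\<lambda>x. ?N x * G x) \<and> homogeneous (j + 2) (\<lambda>x. ?N x * G x) \<and>
      (LINT x|surface_measure. ?N x * G x) = (LINT x|surface_measure. G x)"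
    if "cpoly G" "homogeneous j G" for G j
  proof (intro conjI)
    show "cpoly (\<lambda>x. ?N x * G x)" by (intro cpoly_mult cpoly_norm_sq that)
    show "homogeneous (j + 2) (\<lambda>x. ?N x * G x)"
      using that(2) by (auto simp: homogeneous_def power_add power2_eq_square mult_ac)
    show "(LINT x|surface_measure. ?N x * G x) = (LINT x|surface_measure. G x)"
      by (rule Bochner_Integration.integral_cong[OF refl]) (simp add: surface_measure_sets dot_square_norm)
  qed
  have BI: "BI G = of_real (1 / real (DIM('a) + j)) * (LINT x|surface_measure. G x)" if "cpoly G" "homogeneous j G" for G :: "'a \<Rightarrow> complex" and j
    using surface_integral_homogeneous[OF that] DIM_positive[where 'a='a] by (simp add: field_simps del: of_nat_add)
  note m1 = mult[OF F] note m2 = mult[OF m1[THEN conjunct1] m1[THEN conjunct2, THEN conjunct1]]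
  let ?S = "LINT x|surface_measure. F x"
  have B0: "BI F = of_real (1 / d) * ?S" using BI[OF F] by (simp add: d_def)
  have B1: "BI (\<lambda>x. ?N x * F x) = of_real (1 / (d + 2)) * ?S" using BI[of _ "i + 2"] m1 by (simp add: d_def add_ac)
  have B2: "BI (\<lambda>x. ?N x * (?N x * F x)) = of_real (1 / (d + 4)) * ?S" using BI[of _ "i + 2 + 2"] m1 m2 by (simp add: d_def add_ac)
  note i0 = integrable_ball_cpoly[OF F(1)] and i1 = integrable_ball_cpoly[OF m1[THEN conjunct1]]
    and i2 = integrable_ball_cpoly[OF m2[THEN conjunct1]]
  have "(LINT x|lborel. of_real (gw x) * F x) = (LINT x|lborel. indicator (ball 0 1) x *\<^sub>R F x - indicator (ball 0 1) x *\<^sub>R (?N x * F x))"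
  proof (rule Bochner_Integration.integral_cong[OF refl])
    fix x :: 'a
    show "of_real (gw x) * F x = indicator (ball 0 1) x *\<^sub>R F x - indicator (ball 0 1) x *\<^sub>R (?N x * F x)"
    proof (cases "norm x < 1")
      case True
      have g: "gw x = 1 - x \<bullet> x" using True by (simp add: gw_def dot_square_norm power_le_one max_def)
      show ?thesis unfolding g using True by (simp add: algebra_simps)
    qed (simp add: gw_outside)
  qed
  also have "\<dots> = BI F - BI (\<lambda>x. ?N x * F x)"
    unfolding BI_def by (rule Bochner_Integration.integral_diff[OF i0 i1])
  also have "\<dots> = of_real (1 / d - 1 / (d + 2)) * ?S"
    unfolding B0 B1 by (simp add: algebra_simps)
  finally show "(LINT x|lborel. of_real (gw x) * F x) = of_real (1 / d - 1 / (d + 2)) * ?S" .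
  have "(LINT x|lborel. of_real ((gw x)\<^sup>2) * F x) = (LINT x|lborel. indicator (ball 0 1) x *\<^sub>R F x - 2 * (indicator (ball 0 1) x *\<^sub>R (?N x * F x))
      + indicator (ball 0 1) x *\<^sub>R (?N x * (?N x * F x)))"
  proof (rule Bochner_Integration.integral_cong[OF refl])
    fix x :: 'a
    show "of_real ((gw x)\<^sup>2) * F x = indicator (ball 0 1) x *\<^sub>R F x - 2 * (indicator (ball 0 1) x *\<^sub>R (?N x * F x))
      + indicator (ball 0 1) x *\<^sub>R (?N x * (?N x * F x))"
    proof (cases "norm x < 1")
      case True
      have g: "gw x = 1 - x \<bullet> x" using True by (simp add: gw_def dot_square_norm power_le_one max_def)
      show ?thesis unfolding g using True by (simp add: power2_eq_square algebra_simps)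
    qed (simp add: gw_outside)
  qed
  also have "\<dots> = BI F - 2 * BI (\<lambda>x. ?N x * F x) + BI (\<lambda>x. ?N x * (?N x * F x))"
    unfolding BI_def using i0 i1 i2 by (simp del: mult_scaleR_right)
  also have "\<dots> = of_real (1 / d - 2 / (d + 2) + 1 / (d + 4)) * ?S"
    unfolding B0 B1 B2 by (simp add: algebra_simps)
  finally show "(LINT x|lborel. of_real ((gw x)\<^sup>2) * F x) = of_real (1 / d - 2 / (d + 2) + 1 / (d + 4)) * ?S" .
qed

section \<open>Orthogonality of degrees and skew-adjointness of rotations\<close>

lemma homogeneous_mult: "homogeneous l f \<Longrightarrow> homogeneous l' g \<Longrightarrow> homogeneous (l + l') (\<lambda>x. f x * g x)"
  by (simp add: homogeneous_def power_add mult_ac)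

lemma homogeneous_cnj: "homogeneous l f \<Longrightarrow> homogeneous l (\<lambda>x. cnj (f x))"
  by (simp add: homogeneous_def)

lemma HP_cnj:
  assumes "f \<in> HP l"
  shows "(\<lambda>x. cnj (f x)) \<in> HP l"
proof -
  have c: "cpoly f" and h: "homogeneous l f" and L: "\<And>x. laplacian f x = 0" using assms by (auto simp: HP_def)
  have "laplacian (\<lambda>x. cnj (f x)) x = cnj (laplacian f x)" for x
    using c by (simp add: laplacian_eq cpoly_cnj pd_cnj cpoly_pd)
  then show ?thesis using c h L by (simp add: HP_def cpoly_cnj homogeneous_cnj)
qed

text \<open>Green's identity against the cut-off: Euler's relation and harmonicity of P equate 4 l
  times the integral of \<open>gw\<close> P Q with an integral that is symmetric in P and Q. Hence l
  may be replaced by l', and the integral vanishes when they differ.\<close>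

lemma HP_orthogonal:
  assumes P: "P \<in> HP l" and Q: "Q \<in> HP l'" and ne: "l \<noteq> l'"
  shows "(LINT x|surface_measure. P x * Q (x :: 'a::euclidean_space)) = 0"
proof -
  have key: "4 * of_nat l * (LINT x|lborel. of_real (gw x) * (P x * Q x)) =
     (LINT x|lborel. of_real ((gw x)\<^sup>2) * (\<Sum>b\<in>Basis. pd b P x * pd b Q x))"
    if P: "P \<in> HP l" and Q: "Q \<in> HP l'" for P Q :: "'a \<Rightarrow> complex" and l l'
  proof -
    have c: "cpoly P" "cpoly Q" and h: "homogeneous l P" and L: "\<And>x. (\<Sum>b\<in>Basis. pd b (pd b P) x) = 0"
      using P Q by (auto simp: HP_def laplacian_eq)
    have cq: "cpoly (\<lambda>x. Q x * pd b P x)" for b by (intro cpoly_mult cpoly_pd c)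
    have 1: "(\<lambda>x. (\<Sum>b\<in>Basis. of_real (gw x) * (4 * of_real (x \<bullet> b) * (Q x * pd b P x)))) =
        (\<lambda>x. (4 * of_nat l) * (of_real (gw x) * (P x * Q x)))"
    proof
      fix x :: 'a
      have "(\<Sum>b\<in>Basis. of_real (x \<bullet> b) * pd b P x) = of_nat l * P x"
        using euler[OF c(1) h, of x] pd_linear[OF c(1), of x x] by simp
      then have "4 * of_real (gw x) * Q x * (\<Sum>b\<in>Basis. of_real (x \<bullet> b) * pd b P x) = 4 * of_real (gw x) * Q x * (of_nat l * P x)" by simp
      then show "(\<Sum>b\<in>Basis. of_real (gw x) * (4 * of_real (x \<bullet> b) * (Q x * pd b P x))) = (4 * of_nat l) * (of_real (gw x) * (P x * Q x))"
        by (simp add: sum_distrib_left mult_ac)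
    qed
    have 2: "(\<lambda>x. (\<Sum>b\<in>Basis. of_real ((gw x)\<^sup>2) * pd b (\<lambda>x. Q x * pd b P x) x)) =
        (\<lambda>x. of_real ((gw x)\<^sup>2) * (\<Sum>b\<in>Basis. pd b P x * pd b Q x))"
    proof
      fix x :: 'a
      have "(\<Sum>b\<in>Basis. pd b (\<lambda>x. Q x * pd b P x) x) = Q x * (\<Sum>b\<in>Basis. pd b (pd b P) x) + (\<Sum>b\<in>Basis. pd b P x * pd b Q x)"
        using c by (simp add: pd_mult cpoly_pd sum.distrib sum_distrib_left mult_ac)
      then show "(\<Sum>b\<in>Basis. of_real ((gw x)\<^sup>2) * pd b (\<lambda>x. Q x * pd b P x) x) = of_real ((gw x)\<^sup>2) * (\<Sum>b\<in>Basis. pd b P x * pd b Q x)"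
        by (simp add: L flip: sum_distrib_left)
    qed
    have "(LINT x|lborel. of_real ((gw x)\<^sup>2) * (\<Sum>b\<in>Basis. pd b P x * pd b Q x)) =
        (\<Sum>b\<in>Basis. (LINT x|lborel. of_real ((gw x)\<^sup>2) * pd b (\<lambda>x. Q x * pd b P x) x))"
      unfolding 2[symmetric] by (rule Bochner_Integration.integral_sum) (intro ball_ibp(2) cpoly_pd cq)
    also have "\<dots> = (\<Sum>b\<in>Basis. (LINT x|lborel. of_real (gw x) * (4 * of_real (x \<bullet> b) * (Q x * pd b P x))))"
      by (intro sum.cong refl ball_ibp(1) cq)
    also have "\<dots> = (LINT x|lborel. (4 * of_nat l) * (of_real (gw x) * (P x * Q x)))"
      unfolding 1[symmetric] by (rule Bochner_Integration.integral_sum[symmetric]) (intro ball_ibp(3) cpoly_intros cpoly_pd c)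
    also have "\<dots> = 4 * of_nat l * (LINT x|lborel. of_real (gw x) * (P x * Q x))"
      by (rule Bochner_Integration.integral_mult_right) (intro ball_ibp(3) cpoly_mult c)
    finally show ?thesis by simp
  qed
  have "4 * of_nat l * (LINT x|lborel. of_real (gw x) * (P x * Q x)) = 4 * of_nat l' * (LINT x|lborel. of_real (gw x) * (P x * Q x))"
    using key[OF P Q] key[OF Q P] by (simp add: mult.commute)
  then have z: "(LINT x|lborel. of_real (gw x) * (P x * Q x)) = 0" using ne by simp
  \<comment> \<open>The factor between the weighted ball integral and the surface integral is not
    0.\<close>
  define d where "d = real (DIM('a) + (l + l'))"
  have "d > 0" unfolding d_def of_nat_0_less_iff using DIM_positive[where 'a='a] by (rule trans_less_add1)
  then have nz: "complex_of_real (1 / d - 1 / (d + 2)) \<noteq> 0"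
    unfolding of_real_eq_0_iff by (simp add: divide_simps)
  have "cpoly (\<lambda>x. P x * Q x)" "homogeneous (l + l') (\<lambda>x. P x * Q x)"
    using P Q by (auto simp: HP_def intro: cpoly_mult homogeneous_mult)
  from gw_integral_homogeneous(1)[OF this, folded d_def] z
  have "complex_of_real (1 / d - 1 / (d + 2)) * (LINT x|surface_measure. P x * Q x) = 0" by (simp only:)
  with nz show ?thesis by (simp only: mult_eq_0_iff) blast
qed

lemma finite_surface_measure: "finite_measure (surface_measure :: 'a::euclidean_space measure)"
proof
  let ?U = "sphere 0 1 :: 'a set"
  have U: "?U \<in> sets (restrict_space borel ?U)" using sets.top[of "restrict_space borel ?U"] by (simp add: space_restrict_space)
  have "emeasure (surface_measure :: 'a measure) ?U = of_nat DIM('a) * emeasure (restrict_space lborel punct) (sgn -` ?U \<inter> (punct :: 'a set))"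
    unfolding surface_measure_def emeasure_scale_measure using U
    by (subst emeasure_distr) (auto simp: measurable_sgn_sphere space_restrict_space)
  also have "\<dots> \<le> of_nat DIM('a) * emeasure lborel (ball (0::'a) 1)"
  proof (intro mult_left_mono)
    have "emeasure (restrict_space lborel punct) (sgn -` ?U \<inter> (punct :: 'a set)) \<le> emeasure (restrict_space lborel punct) (punct :: 'a set)"
      by (rule emeasure_mono) (auto simp: sets_restrict_space_iff)
    also have "\<dots> = emeasure lborel (punct :: 'a set)" by (rule emeasure_restrict_space) auto
    also have "\<dots> \<le> emeasure lborel (ball (0::'a) 1)" by (rule emeasure_mono) auto
    finally show "emeasure (restrict_space lborel punct) (sgn -` ?U \<inter> (punct :: 'a set)) \<le> emeasure lborel (ball (0::'a) 1)" .
  qed simp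
  also have "\<dots> < \<infinity>" using emeasure_lborel_ball_finite[of "0 :: 'a" 1]
    by (simp add: ennreal_mult_less_top of_nat_less_top)
  finally show "emeasure (surface_measure :: 'a measure) (space surface_measure) \<noteq> \<infinity>"
    by (simp add: surface_measure_sets)
qed

interpretation surface: finite_measure "surface_measure :: 'a::euclidean_space measure"
  by (rule finite_surface_measure)

lemma borel_surface_measure: "f \<in> borel_measurable borel \<Longrightarrow> f \<in> borel_measurable (surface_measure :: 'a::euclidean_space measure)"
  by (subst measurable_cong_sets[OF surface_measure_sets(1) refl]) (rule measurable_restrict_space1)

lemma cpoly_bounded_sphere:
  fixes F :: "'a::euclidean_space \<Rightarrow> complex"
  assumes "cpoly F"
  obtains M where "\<And>x. x \<in> sphere 0 1 \<Longrightarrow> norm (F x) \<le> M"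
proof -
  have "bounded (F ` sphere 0 1)"
    by (intro compact_imp_bounded compact_continuous_image continuous_on_subset[OF cpoly_continuous[OF assms]]) auto
  then show ?thesis using that unfolding bounded_iff by blast
qed

lemma sphere_integrable:
  fixes F :: "'a::euclidean_space \<Rightarrow> complex"
  assumes "cpoly F"
  shows "integrable surface_measure F"
proof -
  obtain M where M: "\<And>x. x \<in> sphere 0 1 \<Longrightarrow> norm (F x) \<le> M" using cpoly_bounded_sphere[OF assms] by blast
  show ?thesis
    by (rule surface.integrable_const_bound[where B = M])
       (use M cpoly_borel[OF assms] in \<open>auto simp: surface_measure_sets intro: borel_surface_measure\<close>)
qed

text \<open>For a orthogonal to c, \<open>rot\<close> is the difference of two full derivatives, of
  (x.a) F and (x.c) F. Parts against the radial cut-off give the same integral, with the factor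
  (x.a)(x.c), for both. Since f times the conjugate of g is homogeneous, the vanishing passes from
  the ball to the sphere.\<close>

lemma rot_skew:
  assumes f: "f \<in> HP l" and g: "g \<in> HP l" and ac: "a \<bullet> (c :: 'a::euclidean_space) = 0"
  shows "(LINT x|surface_measure. rot a c f x * cnj (g x)) + (LINT x|surface_measure. f x * cnj (rot a c g x)) = 0"
proof -
  have cf: "cpoly f" "cpoly g" "cpoly (\<lambda>x. cnj (g x))" using f g by (auto simp: HP_def cpoly_cnj)
  let ?F = "\<lambda>x. f x * cnj (g x)"
  have cF: "cpoly ?F" by (intro cpoly_mult cf)
  have e: "rot a c ?F = (\<lambda>x. rot a c f x * cnj (g x) + f x * cnj (rot a c g x))"
    unfolding rot_def[abs_def] using cf by (simp add: pd_mult pd_cnj algebra_simps)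
  have r: "rot a c ?F = (\<lambda>x. pd c (\<lambda>x. of_real (x \<bullet> a) * ?F x) x - pd a (\<lambda>x. of_real (x \<bullet> c) * ?F x) x)"
    unfolding rot_def[abs_def] pd_mult[OF cpoly_coord cF] using ac by (simp add: inner_commute)
  have "(LINT x|lborel. of_real ((gw x)\<^sup>2) * rot a c ?F x) =
     (LINT x|lborel. of_real ((gw x)\<^sup>2) * pd c (\<lambda>x. of_real (x \<bullet> a) * ?F x) x) -
     (LINT x|lborel. of_real ((gw x)\<^sup>2) * pd a (\<lambda>x. of_real (x \<bullet> c) * ?F x) x)"
    unfolding r right_diff_distrib
    by (intro Bochner_Integration.integral_diff ball_ibp(2) cpoly_pd cpoly_mult[OF cpoly_coord cF])
  also have "\<dots> = 0"
    unfolding ball_ibp(1)[OF cpoly_mult[OF cpoly_coord cF]] by (simp add: mult_ac)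
  finally have z: "(LINT x|lborel. of_real ((gw x)\<^sup>2) * rot a c ?F x) = 0" .
  have rf: "rot a c f \<in> HP l" "rot a c g \<in> HP l" by (intro rot_HP f g)+
  have h: "homogeneous (l + l) (rot a c ?F)"
  proof -
    have "homogeneous (l + l) (\<lambda>x. rot a c f x * cnj (g x))" "homogeneous (l + l) (\<lambda>x. f x * cnj (rot a c g x))"
      using f g rf by (auto simp: HP_def intro!: homogeneous_mult homogeneous_cnj)
    then show ?thesis unfolding e by (auto simp: homogeneous_def distrib_left)
  qed
  define d where "d = real (DIM('a) + (l + l))"
  have d: "d > 0" unfolding d_def of_nat_0_less_iff using DIM_positive[where 'a='a] by (rule trans_less_add1)
  have "1 / d - 2 / (d + 2) + 1 / (d + 4) = 8 / (d * (d + 2) * (d + 4))"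
    using d by (simp add: divide_simps) (simp add: algebra_simps)
  moreover have "8 / (d * (d + 2) * (d + 4)) \<noteq> 0" using d by simp
  ultimately have nz: "complex_of_real (1 / d - 2 / (d + 2) + 1 / (d + 4)) \<noteq> 0"
    unfolding of_real_eq_0_iff by simp
  from gw_integral_homogeneous(2)[OF cpoly_rot[OF cF] h, folded d_def] z
  have "complex_of_real (1 / d - 2 / (d + 2) + 1 / (d + 4)) * (LINT x|surface_measure. rot a c ?F x) = 0" by (simp only:)
  with nz have "(LINT x|surface_measure. rot a c ?F x) = 0" by (simp only: mult_eq_0_iff) blast
  moreover have "(LINT x|surface_measure. rot a c ?F x) = (LINT x|surface_measure. rot a c f x * cnj (g x)) + (LINT x|surface_measure. f x * cnj (rot a c g x))"
    unfolding e by (intro Bochner_Integration.integral_add sphere_integrable cpoly_mult cpoly_cnj cpoly_rot cf)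
  ultimately show ?thesis by simp
qed

lemma cpoly_chain:
  assumes "(\<gamma> has_vector_derivative v) (at t)" "cpoly f"
  shows "((\<lambda>s. f (\<gamma> s)) has_vector_derivative pd v f (\<gamma> t)) (at t)"
  using assms(2)
proof (induction rule: cpoly.induct)
  case (cpoly_coord w)
  have "((\<lambda>s. \<gamma> s \<bullet> w) has_vector_derivative v \<bullet> w) (at t)"
    using has_derivative_inner_left[OF assms(1)[unfolded has_vector_derivative_def], of w]
    by (simp add: has_vector_derivative_def)
  then show ?case unfolding pd_coord by (rule has_vector_derivative_of_real[unfolded has_real_derivative_iff_has_vector_derivative])
next
  case (cpoly_add f g)
  then show ?case by (simp add: pd_add has_vector_derivative_add)
next
  case (cpoly_mult f g)
  then show ?case unfolding pd_mult[OF cpoly_mult.hyps] by (intro has_vector_derivative_mult)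
qed simp

text \<open>A great circle leads from u to w, and its velocity at each point is the rotation field
  of the plane of u and c. If w is u or -u, any c orthogonal to u will do; its existence uses that
  the dimension is at least 2.\<close>

lemma rot_zero_constant_on_sphere:
  fixes K :: "'a::euclidean_space \<Rightarrow> complex"
  assumes K: "cpoly K" and z: "\<And>a c x. a \<bullet> c = 0 \<Longrightarrow> rot a c K x = 0"
    and D: "2 \<le> DIM('a)" and u: "norm u = 1" and w: "norm w = 1"
  shows "K w = K u"
proof -
  define y where "y = w - (w \<bullet> u) *\<^sub>R u"
  have uu: "u \<bullet> u = 1" and ww: "w \<bullet> w = 1" using u w by (simp_all add: dot_square_norm)
  have yu: "y \<bullet> u = 0" by (simp add: y_def inner_diff_left uu)
  have wy: "w \<bullet> y = (norm y)\<^sup>2"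
  proof -
    have "y \<bullet> y = w \<bullet> y - (w \<bullet> u) * (u \<bullet> y)" by (simp add: y_def inner_diff_left)
    then show ?thesis using yu by (simp add: inner_commute dot_square_norm)
  qed
  obtain c where c: "norm c = 1" "u \<bullet> c = 0" "y = norm y *\<^sub>R c"
  proof (cases "y = 0")
    case True
    obtain e where e: "e \<noteq> 0" "orthogonal u e"
      using orthogonal_to_vector_exists[OF D] by blast
    show ?thesis by (rule that[of "sgn e"]) (use e True in \<open>auto simp: norm_sgn orthogonal_def sgn_div_norm\<close>)
  next
    case False
    show ?thesis by (rule that[of "sgn y"]) (use False yu in \<open>auto simp: norm_sgn sgn_div_norm inner_commute\<close>)
  qed
  have sq: "(w \<bullet> u)\<^sup>2 + (norm y)\<^sup>2 = 1"
  proof -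
    have "1 = w \<bullet> ((w \<bullet> u) *\<^sub>R u + y)" using ww by (simp add: y_def)
    then show ?thesis by (simp add: inner_add_right wy power2_eq_square)
  qed
  obtain \<theta> where \<theta>: "w \<bullet> u = cos \<theta>" "norm y = sin \<theta>" using sincos_total_2pi[OF sq] by blast
  define \<gamma> where "\<gamma> t = cos t *\<^sub>R u + sin t *\<^sub>R c" for t
  have "(\<gamma> has_vector_derivative (- sin t *\<^sub>R u + cos t *\<^sub>R c)) (at t)" for t
    unfolding \<gamma>_def by (auto intro!: derivative_eq_intros simp: has_vector_derivative_def algebra_simps scaleR_left_diff_distrib)
  note chain = cpoly_chain[OF this K]
  have cc: "c \<bullet> c = 1" using c by (simp add: dot_square_norm)
  have "pd (- sin t *\<^sub>R u + cos t *\<^sub>R c) K (\<gamma> t) = 0" for t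
  proof -
    have "pd (- sin t *\<^sub>R u + cos t *\<^sub>R c) K (\<gamma> t) =
        (\<Sum>b\<in>Basis. of_real ((- sin t *\<^sub>R u + cos t *\<^sub>R c) \<bullet> b) * pd b K (\<gamma> t))"
      by (rule pd_linear[OF K])
    also have "\<dots> = (\<Sum>b\<in>Basis. of_real (cos t) * (of_real (c \<bullet> b) * pd b K (\<gamma> t))
        - of_real (sin t) * (of_real (u \<bullet> b) * pd b K (\<gamma> t)))"
      unfolding inner_add_left inner_scaleR_left by (intro sum.cong refl) (simp add: algebra_simps)
    also have "\<dots> = of_real (cos t) * pd c K (\<gamma> t) - of_real (sin t) * pd u K (\<gamma> t)"
      by (simp add: sum_subtractf pd_linear[OF K, of c] pd_linear[OF K, of u] flip: sum_distrib_left)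
    also have "\<dots> = rot u c K (\<gamma> t)"
    proof -
      have cu: "c \<bullet> u = 0" using c(2) by (simp add: inner_commute)
      have "\<gamma> t \<bullet> u = cos t" "\<gamma> t \<bullet> c = sin t" by (simp_all add: \<gamma>_def inner_add_left uu cc c(2) cu)
      then show ?thesis by (simp add: rot_def)
    qed
    finally show ?thesis using z[OF c(2)] by simp
  qed
  then have d: "((\<lambda>s. K (\<gamma> s)) has_vector_derivative 0) (at t)" for t using chain[of t] by simp
  obtain k where "\<And>t. t \<in> UNIV \<Longrightarrow> K (\<gamma> t) = k"
    by (rule has_vector_derivative_zero_constant[OF convex_UNIV, of "\<lambda>t. K (\<gamma> t)"]) (use d in auto)
  then have "K (\<gamma> \<theta>) = K (\<gamma> 0)" by simp
  moreover have "\<gamma> 0 = u" by (simp add: \<gamma>_def)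
  moreover have "\<gamma> \<theta> = w"
  proof -
    have "\<gamma> \<theta> = (w \<bullet> u) *\<^sub>R u + norm y *\<^sub>R c" unfolding \<gamma>_def \<theta> ..
    also have "\<dots> = (w \<bullet> u) *\<^sub>R u + y" by (rule arg_cong[OF c(3)[symmetric]])
    finally show ?thesis by (simp add: y_def)
  qed
  ultimately show ?thesis by simp
qed

lemma real_polynomial_cpoly: "cpoly f \<Longrightarrow> real_polynomial_function (\<lambda>x. Re (f x)) \<and> real_polynomial_function (\<lambda>x. Im (f x))"
proof (induction rule: cpoly.induct)
  case (cpoly_coord v)
  have "bounded_linear (\<lambda>x::'a. x \<bullet> v)" by (rule bounded_linear_inner_left)
  then show ?case by auto
next
  case (cpoly_mult f g)
  then show ?case
    by (simp add: real_polynomial_function.intros(3,4) real_polynomial_function_diff)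
qed auto

lemma cpoly_polynomial_function:
  assumes "cpoly f"
  shows "polynomial_function f"
  unfolding polynomial_function_iff_Basis_inner using real_polynomial_cpoly[OF assms]
  by (auto simp: Basis_complex_def inner_complex_def)

definition sph_restrict :: "('a::euclidean_space \<Rightarrow> complex) \<Rightarrow> 'a \<Rightarrow> complex" where
  "sph_restrict f = (\<lambda>w. if w \<in> sphere 0 1 then f w else 0)"

lemma spherical_harmonics_eq: "spherical_harmonics l = sph_restrict ` HP l"
  unfolding spherical_harmonics_def HP_def sph_restrict_def homogeneous_def
  by (auto simp: polynomial_function_cpoly cpoly_polynomial_function)

interpretation cvs: vector_space cscale
  by (rule vector_space_cscale)

section \<open>Dimension of the space of spherical harmonics\<close>

text \<open>Rank and nullity for spanning sets: lift a basis of the image and add a spanning set of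
  the kernel. T is required to be linear on S only, because the derivative as a total function is
  linear only where it exists.\<close>

lemma span_kernel_image:
  fixes T :: "('a \<Rightarrow> complex) \<Rightarrow> ('a \<Rightarrow> complex)"
  assumes S: "cvs.subspace S"
    and add: "\<And>f g. f \<in> S \<Longrightarrow> g \<in> S \<Longrightarrow> T (f + g) = T f + T g"
    and scale: "\<And>c f. f \<in> S \<Longrightarrow> T (cscale c f) = cscale c (T f)"
    and B1: "finite B1" "T ` S \<subseteq> cspan B1"
    and B2: "finite B2" "{f \<in> S. T f = 0} \<subseteq> cspan B2"
  shows "\<exists>B. finite B \<and> card B \<le> card B1 + card B2 \<and> S \<subseteq> cspan B"
proof -
  obtain C where C: "C \<subseteq> T ` S" "cvs.independent C" "T ` S \<subseteq> cspan C"
    using cvs.maximal_independent_subset[of "T ` S"] by blast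
  have fC: "finite C" "card C \<le> card B1"
    using cvs.independent_span_bound[OF B1(1) C(2)] C(1) B1(2) by auto
  have "\<forall>c\<in>C. \<exists>f. f \<in> S \<and> T f = c" using C(1) by blast
  then obtain g where g: "\<And>c. c \<in> C \<Longrightarrow> g c \<in> S \<and> T (g c) = c" by metis
  let ?B = "g ` C \<union> B2"
  have T0: "T 0 = 0" using scale[of 0 0] cvs.subspace_0[OF S] by (simp add: cscale_def zero_fun_def)
  have Tsum: "(\<Sum>c\<in>D. cscale (u c) (g c)) \<in> S \<and> T (\<Sum>c\<in>D. cscale (u c) (g c)) = (\<Sum>c\<in>D. cscale (u c) c)"
    if "D \<subseteq> C" for D u
  proof -
    have "finite D" using that fC finite_subset by blast
    then show ?thesis using that
    proof (induction D)
      case empty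
      then show ?case using T0 cvs.subspace_0[OF S] by (simp add: zero_fun_def)
    next
      case (insert c D)
      have 1: "cscale (u c) (g c) \<in> S" using g insert.prems cvs.subspace_scale[OF S] by auto
      have "T (cscale (u c) (g c) + (\<Sum>c\<in>D. cscale (u c) (g c))) = cscale (u c) c + (\<Sum>c\<in>D. cscale (u c) c)"
        using add[OF 1] insert scale[of "g c"] g[of c] by auto
      moreover have "cscale (u c) (g c) + (\<Sum>c\<in>D. cscale (u c) (g c)) \<in> S"
        using insert.IH insert.prems by (intro cvs.subspace_add[OF S 1]) blast
      ultimately show ?case unfolding sum.insert[OF insert.hyps] by (rule conjI[rotated])
    qed
  qed
  have "f \<in> cspan ?B" if f: "f \<in> S" for f
  proof -
    have "T f \<in> cspan C" using C(3) f by blast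
    then obtain u where u: "T f = (\<Sum>c\<in>C. cscale (u c) c)"
      using fC(1) by (auto simp: cvs.span_finite)
    define h where "h = (\<Sum>c\<in>C. cscale (u c) (g c))"
    have h: "h \<in> S" "T h = T f" using Tsum[of C u] u by (auto simp: h_def)
    have fh: "f - h \<in> S" using cvs.subspace_diff[OF S f h(1)] .
    have "T f = T (f - h) + T h" using add[OF fh h(1)] by simp
    then have "T (f - h) = 0" using h by simp
    then have "f - h \<in> cspan B2" using B2(2) fh by blast
    then have "f - h \<in> cspan ?B" using cvs.span_mono[of B2 ?B] by blast
    moreover have "h \<in> cspan ?B" unfolding h_def
      by (intro cvs.span_sum cvs.span_scale cvs.span_base) auto
    ultimately have "f - h + h \<in> cspan ?B" by (rule cvs.span_add)
    then show ?thesis by simp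
  qed
  moreover have "card ?B \<le> card B1 + card B2"
    using card_Un_le[of "g ` C" B2] card_image_le[OF fC(1), of g] fC(2) by linarith
  ultimately show ?thesis using fC(1) B2(1) by (intro exI[of _ ?B]) auto
qed

text \<open>Harmonic polynomials in the variables of J only, but as functions on the whole space, so
  that an induction can add one variable at a time.\<close>

definition HPJ :: "'a set \<Rightarrow> nat \<Rightarrow> ('a::euclidean_space \<Rightarrow> complex) set" where
  "HPJ J l = {f \<in> HP l. \<forall>b\<in>Basis - J. pd b f = (\<lambda>_. 0)}"

lemma HPJ_D:
  assumes "f \<in> HPJ J l"
  shows "cpoly f" "homogeneous l f" "\<And>x. (\<Sum>b\<in>Basis. pd b (pd b f) x) = 0" "\<And>b. b \<in> Basis - J \<Longrightarrow> pd b f = (\<lambda>_. 0)"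
  using assms by (auto simp: HPJ_def HP_def laplacian_eq)

lemma HPJ_I:
  assumes "cpoly f" "homogeneous l f" "\<And>x. (\<Sum>b\<in>Basis. pd b (pd b f) x) = 0" "\<And>b. b \<in> Basis - J \<Longrightarrow> pd b f = (\<lambda>_. 0)"
  shows "f \<in> HPJ J l"
  using assms by (auto simp: HPJ_def HP_def laplacian_eq)

lemma subspace_HPJ: "cvs.subspace (HPJ J l)"
proof (rule cvs.subspaceI)
  show "0 \<in> HPJ J l"
    by (rule HPJ_I) (auto simp: zero_fun_def homogeneous_def intro: cpoly_const)
  fix f g :: "'a \<Rightarrow> complex" and c
  assume f: "f \<in> HPJ J l"
  note f' = HPJ_D[OF f]
  show "cscale c f \<in> HPJ J l"
  proof (rule HPJ_I)
    show "cpoly (cscale c f)" unfolding cscale_def by (intro cpoly_cmult f')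
    show "homogeneous l (cscale c f)" using f'(2) by (simp add: homogeneous_def cscale_def)
    show "(\<Sum>b\<in>Basis. pd b (pd b (cscale c f)) x) = 0" for x
      using f'(3)[of x] f'(1) by (simp add: cscale_def pd_cmult cpoly_pd flip: sum_distrib_left)
    show "pd b (cscale c f) = (\<lambda>_. 0)" if "b \<in> Basis - J" for b
      using f'(4)[OF that] f'(1) by (simp add: cscale_def pd_cmult)
  qed
  assume g: "g \<in> HPJ J l"
  note g' = HPJ_D[OF g]
  show "f + g \<in> HPJ J l"
  proof (rule HPJ_I)
    show "cpoly (f + g)" unfolding plus_fun_def by (intro cpoly_add f' g')
    show "homogeneous l (f + g)" using f'(2) g'(2) by (simp add: homogeneous_def distrib_left)
    show "(\<Sum>b\<in>Basis. pd b (pd b (f + g)) x) = 0" for x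
      using f'(3)[of x] g'(3)[of x] f'(1) g'(1) by (simp add: plus_fun_def pd_add cpoly_pd sum.distrib)
    show "pd b (f + g) = (\<lambda>_. 0)" if "b \<in> Basis - J" for b
      using f'(4)[OF that] g'(4)[OF that] f'(1) g'(1) by (simp add: plus_fun_def pd_add)
  qed
qed

text \<open>In one variable homogeneity leaves only multiples of a power, and harmonicity excludes
  the powers from the second on. This start of the induction is what brings the growth exponent from
  n - 1, valid for all homogeneous polynomials, down to n - 2.\<close>

lemma HPJ_single:
  assumes b: "b \<in> Basis" and f: "f \<in> HPJ {b} l"
  shows "f = cscale (f b) (\<lambda>x. of_real ((x \<bullet> b) ^ l))" "l \<ge> 2 \<Longrightarrow> f b = 0"
proof -
  note f' = HPJ_D[OF f]
  show "f = cscale (f b) (\<lambda>x. of_real ((x \<bullet> b) ^ l))"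
  proof
    fix x
    \<comment> \<open>The direction v has no component along b, so f is constant along it, and x can
      be moved to its projection on the axis of b.\<close>
    define v where "v = x - (x \<bullet> b) *\<^sub>R b"
    have "v \<bullet> b = 0" using b by (simp add: v_def inner_diff_left)
    then have "pd v f y = 0" for y
    proof (subst pd_linear[OF f'(1)], intro sum.neutral ballI)
      fix c assume "c \<in> (Basis :: 'a set)"
      then show "of_real (v \<bullet> c) * pd c f y = 0" using \<open>v \<bullet> b = 0\<close> f'(4)[of c] by (cases "c = b") auto
    qed
    then have d: "((\<lambda>t. f ((x \<bullet> b) *\<^sub>R b + t *\<^sub>R v)) has_vector_derivative 0) (at s)" for s
      using cpoly_has_pd[OF f'(1), of v] unfolding has_pd_def by metis
    obtain k where k: "\<And>t. t \<in> UNIV \<Longrightarrow> f ((x \<bullet> b) *\<^sub>R b + t *\<^sub>R v) = k"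
      by (rule has_vector_derivative_zero_constant[OF convex_UNIV, of "\<lambda>t. f ((x \<bullet> b) *\<^sub>R b + t *\<^sub>R v)"]) (use d in auto)
    have "f ((x \<bullet> b) *\<^sub>R b + 1 *\<^sub>R v) = f ((x \<bullet> b) *\<^sub>R b + 0 *\<^sub>R v)"
      using k[of 0] k[of 1] by simp
    then have "f x = f ((x \<bullet> b) *\<^sub>R b)" by (simp add: v_def)
    also have "\<dots> = of_real ((x \<bullet> b) ^ l) * f b" using f'(2) unfolding homogeneous_def by blast
    finally show "f x = cscale (f b) (\<lambda>x. of_real ((x \<bullet> b) ^ l)) x" by (simp add: cscale_def mult.commute)
  qed
  assume l: "l \<ge> 2"
  then obtain k where k: "l = Suc k" "k > 0" by (cases l) auto
  have "(\<Sum>c\<in>Basis. pd c (pd c f) b) = (\<Sum>c\<in>Basis. if c = b then pd b (pd b f) b else 0)"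
    by (rule sum.cong[OF refl]) (auto simp: f'(4))
  then have "pd b (pd b f) b = 0" using f'(3)[of b] b by simp
  moreover have "pd b (pd b f) b = of_nat k * (of_nat l * f b)"
    using euler[OF cpoly_pd[OF f'(1)] homogeneous_pd_Suc[OF f'(1)], of k b b] euler[OF f'(1,2), of b] f'(2) k by simp
  ultimately have "complex_of_nat k * (of_nat l * f b) = 0" by simp
  moreover have "complex_of_nat k \<noteq> 0" "complex_of_nat l \<noteq> 0" unfolding of_nat_eq_0_iff using l k by auto
  ultimately show "f b = 0" by (simp only: mult_eq_0_iff) blast
qed

text \<open>The derivative in the new variable b lowers the degree by one, and its kernel consists
  of polynomials without b; induction on the degree adds up the kernels.\<close>

lemma HPJ_step:
  assumes b: "b \<in> Basis" "b \<notin> J"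
    and J: "\<And>i. \<exists>B. finite B \<and> card B \<le> g i \<and> HPJ J i \<subseteq> cspan B"
  shows "\<exists>B. finite B \<and> card B \<le> (\<Sum>i\<le>l. g i) \<and> HPJ (insert b J) l \<subseteq> cspan B"
proof (induction l)
  case 0
  have "HPJ (insert b J) 0 \<subseteq> HPJ J 0"
  proof
    fix f assume f: "f \<in> HPJ (insert b J) 0"
    note f' = HPJ_D[OF f]
    have "f x = f 0" for x using f'(2) by (metis homogeneous_def mult_1 of_real_1 power_0 scale_zero_left)
    then have "f = (\<lambda>_. f 0)" by (rule ext)
    then have "pd c f = (\<lambda>_. 0)" for c by (metis pd_const)
    then show "f \<in> HPJ J 0" using f' by (intro HPJ_I) auto
  qed
  then show ?case using J[of 0] by auto
next
  case (Suc l)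
  then obtain B1 where B1: "finite B1" "card B1 \<le> (\<Sum>i\<le>l. g i)" "HPJ (insert b J) l \<subseteq> cspan B1" by blast
  obtain B2 where B2: "finite B2" "card B2 \<le> g (Suc l)" "HPJ J (Suc l) \<subseteq> cspan B2" using J by blast
  have "\<exists>B. finite B \<and> card B \<le> card B1 + card B2 \<and> HPJ (insert b J) (Suc l) \<subseteq> cspan B"
  proof (rule span_kernel_image[where T = "pd b", OF subspace_HPJ _ _ B1(1) _ B2(1)])
    fix f h :: "'a \<Rightarrow> complex" and c
    assume f: "f \<in> HPJ (insert b J) (Suc l)"
    note f' = HPJ_D[OF f]
    show "pd b (cscale c f) = cscale c (pd b f)" using f'(1) by (simp add: cscale_def pd_cmult)
    assume h: "h \<in> HPJ (insert b J) (Suc l)"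
    show "pd b (f + h) = pd b f + pd b h"
      using f'(1) HPJ_D(1)[OF h] by (simp add: plus_fun_def pd_add)
  next
    have "pd b f \<in> HPJ (insert b J) l" if f: "f \<in> HPJ (insert b J) (Suc l)" for f
    proof (rule HPJ_I)
      note f' = HPJ_D[OF f]
      show "cpoly (pd b f)" by (intro cpoly_pd f')
      show "homogeneous l (pd b f)" by (intro homogeneous_pd_Suc f')
      have "(\<Sum>c\<in>Basis. pd c (pd c (pd b f)) x) = pd b (\<lambda>x. \<Sum>c\<in>Basis. pd c (pd c f) x) x" for x
        using f'(1) by (simp add: pd_sum cpoly_pd pd_commute[of _ b])
      then show "(\<Sum>c\<in>Basis. pd c (pd c (pd b f)) x) = 0" for x by (simp add: f'(3))
      show "pd c (pd b f) = (\<lambda>_. 0)" if "c \<in> Basis - insert b J" for c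
        using f'(4)[OF that] pd_commute[OF f'(1), of c b] by simp
    qed
    then show "pd b ` HPJ (insert b J) (Suc l) \<subseteq> cspan B1" using B1(3) by blast
    have "{f \<in> HPJ (insert b J) (Suc l). pd b f = 0} \<subseteq> HPJ J (Suc l)"
      using b by (auto simp: HPJ_def zero_fun_def)
    then show "{f \<in> HPJ (insert b J) (Suc l). pd b f = 0} \<subseteq> cspan B2" using B2(3) by blast
  qed
  then show ?case using B1(2) B2(2) by (auto intro: order_trans[OF _ add_mono])
qed

text \<open>Starts with two variables, where only the degrees 0 and 1 of the one-variable spaces
  contribute, which gives the factor 2. Each further variable sums (i+1)^k over i \<le> l and raises
  the exponent by one.\<close>

lemma HPJ_dim:
  assumes "J \<subseteq> Basis" "card J = Suc (Suc k)"
  shows "\<exists>B. finite B \<and> card B \<le> 2 * (l + 1) ^ k \<and> HPJ J (l :: nat) \<subseteq> cspan B"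
  using assms
proof (induction k arbitrary: J l)
  case 0
  then obtain b c where J: "J = insert b {c}" "b \<noteq> c" "b \<in> Basis" "c \<in> Basis"
    by (auto simp: card_Suc_eq numeral_2_eq_2)
  let ?g = "\<lambda>i. if i < 2 then 1 else 0 :: nat"
  have "\<exists>B. finite B \<and> card B \<le> ?g i \<and> HPJ {c} i \<subseteq> cspan B" for i
  proof (cases "i < 2")
    case True
    have "HPJ {c} i \<subseteq> cspan {\<lambda>x. of_real ((x \<bullet> c) ^ i)}"
      using HPJ_single(1)[OF J(4)] by (metis cvs.span_base cvs.span_scale singletonI subsetI)
    then show ?thesis using True by (intro exI[of _ "{\<lambda>x. of_real ((x \<bullet> c) ^ i)}"]) auto
  next
    case False
    have "HPJ {c} i \<subseteq> cspan {}"
    proof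
      fix f assume f: "f \<in> HPJ {c} i"
      have "f = 0" using HPJ_single[OF J(4) f] False by (simp add: cscale_def zero_fun_def)
      then show "f \<in> cspan {}" by simp
    qed
    then show ?thesis by (intro exI[of _ "{}"]) auto
  qed
  from HPJ_step[OF J(3) _ this, of l] J have "\<exists>B. finite B \<and> card B \<le> (\<Sum>i\<le>l. ?g i) \<and> HPJ J l \<subseteq> cspan B" by auto
  moreover have "(\<Sum>i\<le>l. ?g i) \<le> 2"
  proof -
    have "(\<Sum>i\<le>l. ?g i) = card ({..l} \<inter> {..<2})"
      by (simp add: sum.If_cases lessThan_def)
    also have "\<dots> \<le> card {..<2::nat}" by (rule card_mono) auto
    finally show ?thesis by simp
  qed
  ultimately show ?case by (auto intro: order_trans)
next
  case (Suc k)
  then obtain b J' where J: "J = insert b J'" "b \<notin> J'" "card J' = Suc (Suc k)"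
    by (metis card_Suc_eq)
  have "\<exists>B. finite B \<and> card B \<le> 2 * (i + 1) ^ k \<and> HPJ J' i \<subseteq> cspan B" for i
    using Suc.IH[of J' i] Suc.prems J by auto
  from HPJ_step[OF _ J(2) this, of l] J Suc.prems
  have "\<exists>B. finite B \<and> card B \<le> (\<Sum>i\<le>l. 2 * (i + 1) ^ k) \<and> HPJ J l \<subseteq> cspan B" by auto
  moreover have "(\<Sum>i\<le>l. 2 * (i + 1) ^ k) \<le> (\<Sum>i\<le>l. 2 * (l + 1) ^ k)"
    by (intro sum_mono mult_left_mono power_mono) auto
  ultimately show ?case by (auto intro: order_trans)
qed

lemma cdim_spherical_harmonics:
  assumes "DIM('a::euclidean_space) \<ge> 2"
  shows "cdim (spherical_harmonics l :: ('a \<Rightarrow> complex) set) \<le> 2 * (l + 1) ^ (DIM('a) - 2)"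
proof -
  have "DIM('a) = Suc (Suc (DIM('a) - 2))" using assms by simp
  from HPJ_dim[OF order_refl this, of l]
  obtain B where B: "finite B" "card B \<le> 2 * (l + 1) ^ (DIM('a) - 2)" "HPJ Basis l \<subseteq> cspan (B :: ('a \<Rightarrow> complex) set)" by blast
  have "cspan B \<subseteq> {f. sph_restrict f \<in> cspan (sph_restrict ` B)}"
  proof (rule cvs.span_minimal)
    show "B \<subseteq> {f. sph_restrict f \<in> cspan (sph_restrict ` B)}" by (auto intro: cvs.span_base)
    have 0: "sph_restrict (0 :: 'a \<Rightarrow> complex) = 0" by (simp add: sph_restrict_def fun_eq_iff)
    have 1: "sph_restrict (f + g) = sph_restrict f + sph_restrict g" for f g :: "'a \<Rightarrow> complex"
      by (simp add: sph_restrict_def fun_eq_iff)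
    have 2: "sph_restrict (cscale c f) = cscale c (sph_restrict f)" for c and f :: "'a \<Rightarrow> complex"
      by (simp add: sph_restrict_def fun_eq_iff cscale_def)
    show "cvs.subspace {f. sph_restrict f \<in> cspan (sph_restrict ` B)}"
      by (rule cvs.subspaceI) (simp_all add: 0 1 2 cvs.span_zero cvs.span_add cvs.span_scale)
  qed
  then have "spherical_harmonics l \<subseteq> cspan (sph_restrict ` B)"
    using B(3) unfolding spherical_harmonics_eq by (auto simp: HPJ_def)
  then have "cdim (spherical_harmonics l :: ('a \<Rightarrow> complex) set) \<le> card (sph_restrict ` B)"
    using B(1) by (intro cvs.dim_le_card) auto
  also have "\<dots> \<le> card B" by (rule card_image_le[OF B(1)])
  finally show ?thesis using B(2) by simp
qed


text \<open>Restriction to the sphere loses nothing, so that expansions in a basis \<open>Y\<close>,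
  known on the sphere only, hold for the ambient polynomials. At x = 0 any unit vector serves as
  w.\<close>

lemma homogeneous_sphere_ext:
  assumes "homogeneous l f" "homogeneous l g" "\<And>w. w \<in> sphere 0 1 \<Longrightarrow> f w = g (w :: 'a::euclidean_space)"
  shows "f = g"
proof
  fix x :: 'a
  obtain w where w: "w \<in> sphere 0 1" "x = norm x *\<^sub>R w"
  proof (cases "x = 0")
    case True
    obtain b where "b \<in> (Basis :: 'a set)" using nonempty_Basis by blast
    with True show ?thesis by (intro that[of b]) auto
  next
    case False
    then show ?thesis by (intro that[of "sgn x"]) (auto simp: norm_sgn sgn_div_norm)
  qed
  show "f x = g x"
    using assms(1)[unfolded homogeneous_def, rule_format, of "norm x" w]
      assms(2)[unfolded homogeneous_def, rule_format, of "norm x" w] assms(3)[OF w(1)] w(2) by metis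
qed

section \<open>The diagonal kernel of a basis of spherical harmonics\<close>

text \<open>The sum of |Y|^2 is the dimension divided by the total mass; the 2 is the factor of
  \<open>cdim_spherical_harmonics\<close>.\<close>

definition surface_bound :: "'a::euclidean_space itself \<Rightarrow> real" where
  "surface_bound _ = 2 / measure (surface_measure :: 'a measure) (sphere 0 1)"

lemma surface_bound_nonneg: "surface_bound t \<ge> 0"
  by (simp add: surface_bound_def)

context
  fixes Y :: "nat \<Rightarrow> nat \<Rightarrow> 'a::euclidean_space \<Rightarrow> complex"
  assumes Y: "spherical_harmonic_bases Y"
begin

lemma Y_basis: "orthonormal_basis surface_measure (spherical_harmonics l) {1..cdim (spherical_harmonics l :: ('a \<Rightarrow> complex) set)} (Y l)"
  using Y by (simp add: spherical_harmonic_bases_def)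

lemma Y_ext:
  assumes "i \<in> {1..cdim (spherical_harmonics l :: ('a \<Rightarrow> complex) set)}"
  shows "\<exists>P\<in>HP l. Y l i = sph_restrict P"
proof -
  have "Y l i \<in> cspan (Y l ` {1..cdim (spherical_harmonics l :: ('a \<Rightarrow> complex) set)})" using assms by (intro cvs.span_base) blast
  also have "\<dots> = spherical_harmonics l" using Y_basis[of l] by (simp add: orthonormal_basis_def)
  finally show ?thesis unfolding spherical_harmonics_eq by blast
qed

lemma Y_orthonormal:
  assumes "i \<in> {1..cdim (spherical_harmonics l :: ('a \<Rightarrow> complex) set)}" "j \<in> {1..cdim (spherical_harmonics l' :: ('a \<Rightarrow> complex) set)}"
  shows "(LINT x|surface_measure. Y l i x * cnj (Y l' j x)) = (if l = l' \<and> i = j then 1 else 0)"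
proof (cases "l = l'")
  case True
  then show ?thesis using Y_basis[of l] assms by (auto simp: orthonormal_basis_def)
next
  case False
  obtain P Q where P: "P \<in> HP l" "Y l i = sph_restrict P" and Q: "Q \<in> HP l'" "Y l' j = sph_restrict Q"
    using Y_ext assms by blast
  have "(LINT x|surface_measure. Y l i x * cnj (Y l' j x)) = (LINT x|surface_measure. P x * cnj (Q x))"
    by (rule Bochner_Integration.integral_cong[OF refl]) (simp add: P Q sph_restrict_def surface_measure_sets)
  also have "\<dots> = 0" by (rule HP_orthogonal[OF P(1) HP_cnj[OF Q(1)] False])
  finally show ?thesis using False by simp
qed

lemma Y_borel:
  assumes "i \<in> {1..cdim (spherical_harmonics l :: ('a \<Rightarrow> complex) set)}"
  shows "Y l i \<in> borel_measurable borel"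
proof -
  obtain P where P: "P \<in> HP l" "Y l i = sph_restrict P" using Y_ext[OF assms] by blast
  have "P \<in> borel_measurable borel" using P(1) by (intro cpoly_borel) (simp add: HP_def)
  moreover have "sph_restrict P = (\<lambda>w. indicator (sphere 0 1) w * P w)"
    by (auto simp: sph_restrict_def fun_eq_iff indicator_def)
  ultimately show ?thesis unfolding P(2)
    by (auto intro!: borel_measurable_times borel_measurable_indicator)
qed

lemma Y_bounded:
  assumes "i \<in> {1..cdim (spherical_harmonics l :: ('a \<Rightarrow> complex) set)}"
  shows "\<exists>M. \<forall>w. norm (Y l i w) \<le> M"
proof -
  obtain P where P: "P \<in> HP l" "Y l i = sph_restrict P" using Y_ext[OF assms] by blast
  obtain M where "\<And>x. x \<in> sphere 0 1 \<Longrightarrow> norm (P x) \<le> M"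
    using cpoly_bounded_sphere[of P] P(1) by (auto simp: HP_def)
  then have "norm (Y l i w) \<le> max M 0" for w by (force simp: P sph_restrict_def le_max_iff_disj)
  then show ?thesis by blast
qed

text \<open>An infinitesimal rotation acts on the basis by a matrix m, and \<open>rot_skew\<close>
  makes it skew-Hermitian. Differentiating the sum of P_i times its conjugate produces the
  coefficients of m plus its adjoint, which are 0. The value of the constant comes from integration:
  multiplied by the total mass it is the number of basis elements.\<close>

lemma Y_kernel_bound:
  assumes D: "2 \<le> DIM('a)"
  shows "(\<Sum>i\<in>{1..cdim (spherical_harmonics l :: ('a \<Rightarrow> complex) set)}. (norm (Y l i w))\<^sup>2) \<le> surface_bound TYPE('a) * real (l + 1) ^ (DIM('a) - 2)"
proof (cases "w \<in> sphere 0 1")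
  case False
  have "Y l i w = 0" if i: "i \<in> {1..cdim (spherical_harmonics l :: ('a \<Rightarrow> complex) set)}" for i using Y_ext[OF i] False by (auto simp: sph_restrict_def)
  then show ?thesis by (simp add: surface_bound_nonneg)
next
  case w: True
  define A where "A = {1..cdim (spherical_harmonics l :: ('a \<Rightarrow> complex) set)}"
  have fA: "finite A" by (simp add: A_def)
  let ?S = "measure (surface_measure :: 'a measure) (sphere 0 1)"
  obtain P where P: "\<And>i. i \<in> A \<Longrightarrow> P i \<in> HP l" "\<And>i. i \<in> A \<Longrightarrow> Y l i = sph_restrict (P i)"
    using Y_ext[of _ l] unfolding A_def by metis
  have cP: "cpoly (P i)" and hP: "homogeneous l (P i)" if "i \<in> A" for i using P(1)[OF that] by (auto simp: HP_def)
  have PP: "(LINT x|surface_measure. P i x * cnj (P j x)) = (if i = j then 1 else 0)" if "i \<in> A" "j \<in> A" for i j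
  proof -
    have "(LINT x|surface_measure. P i x * cnj (P j x)) = (LINT x|surface_measure. Y l i x * cnj (Y l j x))"
      unfolding P(2)[OF that(1)] P(2)[OF that(2)]
      by (rule Bochner_Integration.integral_cong[OF refl]) (simp add: sph_restrict_def surface_measure_sets)
    then show ?thesis using Y_orthonormal[of i l j l] that by (simp add: A_def)
  qed
  \<comment> \<open>The coefficients are found on the sphere and carried to the whole space by
    homogeneity, since \<open>rot\<close> is made of ambient derivatives.\<close>
  have expand: "\<exists>u. f = (\<lambda>x. \<Sum>j\<in>A. u j * P j x)" if f: "f \<in> HP l" for f
  proof -
    have "sph_restrict f \<in> cspan (Y l ` A)"
      using Y_basis[of l] f by (auto simp: orthonormal_basis_def spherical_harmonics_eq A_def)
    also have "cspan (Y l ` A) \<subseteq> {g. \<exists>u. g = (\<lambda>x. \<Sum>j\<in>A. u j * Y l j x)}"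
    proof (rule cvs.span_minimal)
      show "Y l ` A \<subseteq> {g. \<exists>u. g = (\<lambda>x. \<Sum>j\<in>A. u j * Y l j x)}"
      proof clarify
        fix i assume "i \<in> A"
        then have "Y l i = (\<lambda>x. \<Sum>j\<in>A. (if j = i then 1 else 0) * Y l j x)"
          using fA by (auto simp: fun_eq_iff if_distrib[of "\<lambda>u. u * _"] cong: if_cong)
        then show "\<exists>u. Y l i = (\<lambda>x. \<Sum>j\<in>A. u j * Y l j x)" by (rule exI[of _ "\<lambda>j. if j = i then 1 else 0"])
      qed
      show "cvs.subspace {g. \<exists>u. g = (\<lambda>x. \<Sum>j\<in>A. u j * Y l j x)}"
      proof (rule cvs.subspaceI)
        show "0 \<in> {g. \<exists>u. g = (\<lambda>x. \<Sum>j\<in>A. u j * Y l j x)}"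
          by (auto simp: zero_fun_def intro!: exI[of _ "\<lambda>_. 0"])
        fix g h c assume "g \<in> {g. \<exists>u. g = (\<lambda>x. \<Sum>j\<in>A. u j * Y l j x)}"
        then obtain u where g: "g = (\<lambda>x. \<Sum>j\<in>A. u j * Y l j x)" by blast
        show "cscale c g \<in> {g. \<exists>u. g = (\<lambda>x. \<Sum>j\<in>A. u j * Y l j x)}"
          unfolding g cscale_def by (auto simp: sum_distrib_left mult.assoc intro!: exI[of _ "\<lambda>j. c * u j"])
        assume "h \<in> {g. \<exists>u. g = (\<lambda>x. \<Sum>j\<in>A. u j * Y l j x)}"
        then obtain v where h: "h = (\<lambda>x. \<Sum>j\<in>A. v j * Y l j x)" by blast
        show "g + h \<in> {g. \<exists>u. g = (\<lambda>x. \<Sum>j\<in>A. u j * Y l j x)}"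
          unfolding g h plus_fun_def by (auto simp: sum.distrib distrib_right intro!: exI[of _ "\<lambda>j. u j + v j"])
      qed
    qed
    finally obtain u where u: "sph_restrict f = (\<lambda>x. \<Sum>j\<in>A. u j * Y l j x)" by blast
    have "f = (\<lambda>x. \<Sum>j\<in>A. u j * P j x)"
    proof (rule homogeneous_sphere_ext[where l = l])
      show "homogeneous l f" using f by (simp add: HP_def)
      show "homogeneous l (\<lambda>x. \<Sum>j\<in>A. u j * P j x)"
        using hP by (simp add: homogeneous_def sum_distrib_left mult_ac)
      show "f x = (\<Sum>j\<in>A. u j * P j x)" if x: "x \<in> sphere 0 1" for x
        using fun_cong[OF u, of x] x by (simp add: sph_restrict_def P(2))
    qed
    then show ?thesis by blast
  qed
  define K where "K x = (\<Sum>i\<in>A. P i x * cnj (P i x))" for x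
  have cK: "cpoly K" unfolding K_def[abs_def] by (intro cpoly_sum cpoly_mult cpoly_cnj cP)
  have rotK: "rot a c K x = 0" if ac: "a \<bullet> c = 0" for a c x
  proof -
    have "\<forall>i\<in>A. \<exists>u. rot a c (P i) = (\<lambda>x. \<Sum>j\<in>A. u j * P j x)"
      using expand rot_HP P(1) by blast
    then obtain m where m: "\<And>i. i \<in> A \<Longrightarrow> rot a c (P i) = (\<lambda>x. \<Sum>j\<in>A. m i j * P j x)" by metis
    have ip: "(LINT x|surface_measure. rot a c (P i) x * cnj (P j x)) = m i j" if "i \<in> A" "j \<in> A" for i j
    proof -
      have "(LINT x|surface_measure. rot a c (P i) x * cnj (P j x)) = (LINT x|surface_measure. (\<Sum>k\<in>A. m i k * (P k x * cnj (P j x))))"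
        by (simp add: m[OF that(1)] sum_distrib_right mult.assoc)
      also have "\<dots> = (\<Sum>k\<in>A. (LINT x|surface_measure. m i k * (P k x * cnj (P j x))))"
        by (rule Bochner_Integration.integral_sum) (intro sphere_integrable cpoly_cmult cpoly_mult cpoly_cnj cP that)
      also have "\<dots> = (\<Sum>k\<in>A. m i k * (if k = j then 1 else 0))"
        by (rule sum.cong[OF refl]) (simp add: PP that)
      also have "\<dots> = m i j" using that fA by (simp add: if_distrib cong: if_cong)
      finally show ?thesis .
    qed
    have skew: "m i j + cnj (m j i) = 0" if "i \<in> A" "j \<in> A" for i j
    proof -
      have "(LINT x|surface_measure. P i x * cnj (rot a c (P j) x)) = cnj (LINT x|surface_measure. rot a c (P j) x * cnj (P i x))"
        by (subst Bochner_Integration.integral_cnj[symmetric]) (simp add: mult.commute)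
      then show ?thesis using rot_skew[OF P(1)[OF that(1)] P(1)[OF that(2)] ac] ip that by simp
    qed
    have "rot a c K x = (\<Sum>i\<in>A. rot a c (P i) x * cnj (P i x) + P i x * cnj (rot a c (P i) x))"
    proof -
      have "rot a c K x = (\<Sum>i\<in>A. of_real (x \<bullet> a) * pd c (\<lambda>x. P i x * cnj (P i x)) x - of_real (x \<bullet> c) * pd a (\<lambda>x. P i x * cnj (P i x)) x)"
      proof -
        have cq: "cpoly (\<lambda>x. P i x * cnj (P i x))" if "i \<in> A" for i by (intro cpoly_mult cpoly_cnj cP that)
        have "pd v K = (\<lambda>x. \<Sum>i\<in>A. pd v (\<lambda>x. P i x * cnj (P i x)) x)" for v
          unfolding K_def[abs_def] by (rule pd_sum[OF cq])
        then show ?thesis by (simp add: rot_def sum_distrib_left sum_subtractf)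
      qed
      also have "\<dots> = (\<Sum>i\<in>A. rot a c (P i) x * cnj (P i x) + P i x * cnj (rot a c (P i) x))"
        by (rule sum.cong[OF refl]) (simp add: cP pd_mult cpoly_cnj pd_cnj rot_def algebra_simps)
      finally show ?thesis .
    qed
    also have "\<dots> = (\<Sum>i\<in>A. (\<Sum>j\<in>A. m i j * (P j x * cnj (P i x))) + (\<Sum>j\<in>A. cnj (m i j) * (P i x * cnj (P j x))))"
      by (rule sum.cong[OF refl]) (simp add: m sum_distrib_left sum_distrib_right mult_ac)
    also have "\<dots> = (\<Sum>i\<in>A. \<Sum>j\<in>A. m i j * (P j x * cnj (P i x))) + (\<Sum>j\<in>A. \<Sum>i\<in>A. cnj (m i j) * (P i x * cnj (P j x)))"
      unfolding sum.distrib by (subst (2) sum.swap) simp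
    also have "\<dots> = (\<Sum>i\<in>A. \<Sum>j\<in>A. (m i j + cnj (m j i)) * (P j x * cnj (P i x)))"
      by (simp add: sum.distrib distrib_right)
    also have "\<dots> = 0" by (intro sum.neutral ballI) (simp add: skew)
    finally show ?thesis .
  qed
  have Kc: "K x = K w" if "x \<in> sphere 0 1" for x
    using rot_zero_constant_on_sphere[OF cK rotK D, of w x] that w by simp
  have "(LINT x|surface_measure. K x) = (\<Sum>i\<in>A. (LINT x|surface_measure. P i x * cnj (P i x)))"
    unfolding K_def by (rule Bochner_Integration.integral_sum) (intro sphere_integrable cpoly_mult cpoly_cnj cP)
  also have "\<dots> = of_nat (card A)" using PP by simp
  finally have 1: "(LINT x|surface_measure. K x) = of_nat (card A)" .
  have "(LINT x|surface_measure. K x) = (LINT x|(surface_measure :: 'a measure). K w)"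
    by (rule Bochner_Integration.integral_cong[OF refl]) (simp add: Kc surface_measure_sets)
  also have "\<dots> = of_real ?S * K w" by (simp add: surface_measure_sets scaleR_conv_of_real)
  finally have 2: "of_real ?S * K w = of_nat (card A)" using 1 by simp
  let ?k = "\<Sum>i\<in>A. (norm (Y l i w))\<^sup>2"
  have K: "K w = of_real ?k"
    unfolding K_def of_real_sum
  proof (rule sum.cong[OF refl])
    fix i assume "i \<in> A"
    then have "Y l i w = P i w" using w P(2) by (simp add: sph_restrict_def)
    then show "P i w * cnj (P i w) = of_real ((norm (Y l i w))\<^sup>2)" by (simp only: complex_norm_square)
  qed
  have "complex_of_real (?S * ?k) = of_real (real (card A))" using 2 unfolding K by simp
  then have 3: "?S * ?k = real (card A)" unfolding of_real_eq_iff .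
  have "?k \<le> surface_bound TYPE('a) * real (l + 1) ^ (DIM('a) - 2)"
  \<comment> \<open>With total mass 0, \<open>surface_bound\<close> would be 0 by division by zero;
    but then the basis is empty.\<close>
  proof (cases "?S = 0")
    case True
    then have "A = {}" using 3 fA by simp
    then show ?thesis unfolding surface_bound_def by simp
  next
    case False
    have S: "?S > 0" using False measure_nonneg[of "surface_measure :: 'a measure" "sphere 0 1"] by linarith
    have "card A \<le> 2 * (l + 1) ^ (DIM('a) - 2)" using cdim_spherical_harmonics[OF D, of l] by (simp add: A_def)
    then have "real (card A) \<le> real (2 * (l + 1) ^ (DIM('a) - 2))" by (rule of_nat_mono)
    then have "?S * ?k \<le> 2 * real (l + 1) ^ (DIM('a) - 2)" unfolding 3 by simp
    then show ?thesis using S by (simp add: surface_bound_def field_simps)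
  qed
  then show ?thesis by (simp only: A_def)
qed

end

section \<open>The measure on \<open>\<Omega>\<close> in polar coordinates\<close>

definition wt :: "nat \<Rightarrow> nat \<Rightarrow> nat \<Rightarrow> real \<Rightarrow> real" where
  "wt n m \<alpha> t = sin t powr ((real n - 2) / (real \<alpha> + 1) + 1) * cos t ^ (m - 1)"

definition nu :: "nat \<Rightarrow> nat \<Rightarrow> nat \<Rightarrow> real measure" where
  "nu n m \<alpha> = density (restrict_space lborel {0..pi/2}) (\<lambda>t. ennreal (wt n m \<alpha> t))"

abbreviation SS :: "((real^'n) \<times> (real^'m)) measure" where
  "SS \<equiv> surface_measure \<Otimes>\<^sub>M surface_measure"

lemma borel_measurable_nu: "f \<in> borel_measurable borel \<Longrightarrow> f \<in> borel_measurable (nu n m \<alpha>)"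
  by (auto simp: nu_def intro: measurable_restrict_space1)

lemma wt_borel [measurable]: "wt n m \<alpha> \<in> borel_measurable borel"
  unfolding wt_def[abs_def] by measurable

lemma nn_integral_nu:
  assumes [measurable]: "f \<in> borel_measurable borel"
  shows "(\<integral>\<^sup>+t. f t \<partial>nu n m \<alpha>) = (\<integral>\<^sup>+t. indicator {0..pi/2} t * (ennreal (wt n m \<alpha> t) * f t) \<partial>lborel)"
  unfolding nu_def
  by (subst nn_integral_density)
    (auto intro!: measurable_restrict_space1 nn_integral_cong simp: nn_integral_restrict_space mult_ac)

lemma wt_le:
  assumes "t \<in> {0..pi/2}" "n \<ge> 2"
  shows "0 \<le> wt n m \<alpha> t" "wt n m \<alpha> t \<le> 1"
proof -
  have s: "0 \<le> sin t" "sin t \<le> 1" "0 \<le> cos t" "cos t \<le> 1"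
    using assms by (auto intro: sin_ge_zero cos_ge_zero)
  then show "0 \<le> wt n m \<alpha> t" by (simp add: wt_def)
  have "sin t powr ((real n - 2) / (real \<alpha> + 1) + 1) \<le> 1" using s assms by (intro powr_le1) auto
  then show "wt n m \<alpha> t \<le> 1" unfolding wt_def using s by (intro mult_le_one power_le_one) auto
qed

lemma finite_nu: assumes "n \<ge> 2" shows "finite_measure (nu n m \<alpha>)"
proof
  have "emeasure (nu n m \<alpha>) (space (nu n m \<alpha>)) = (\<integral>\<^sup>+t. 1 \<partial>nu n m \<alpha>)" by simp
  also have "\<dots> = (\<integral>\<^sup>+t. indicator {0..pi/2} t * (ennreal (wt n m \<alpha> t) * 1) \<partial>lborel)"
    by (rule nn_integral_nu) simp
  also have "\<dots> \<le> (\<integral>\<^sup>+t. indicator {0..pi/2} t \<partial>lborel)"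
    using wt_le(2)[OF _ assms] by (intro nn_integral_mono) (auto simp: indicator_def)
  also have "\<dots> < \<infinity>" by simp
  finally show "emeasure (nu n m \<alpha>) (space (nu n m \<alpha>)) \<noteq> \<infinity>" by simp
qed

lemma AE_nu: "AE t in nu n m \<alpha>. 0 < t \<and> t < pi / 2"
proof -
  have "AE t in lborel. t \<noteq> 0 \<and> t \<noteq> pi / 2"
    using AE_lborel_singleton[of 0] AE_lborel_singleton[of "pi / 2"] by eventually_elim simp
  then have "AE t in lborel. t \<in> {0..pi/2} \<longrightarrow> 0 < t \<and> t < pi / 2"
  proof eventually_elim
    case (elim t)
    then show ?case by (auto simp only: atLeastAtMost_iff less_le)
  qed
  then have "AE t in restrict_space lborel {0..pi/2}. 0 < t \<and> t < pi / 2"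
    by (subst AE_restrict_space_iff) auto
  note ae = this
  have "(\<lambda>t. ennreal (wt n m \<alpha> t)) \<in> borel_measurable (restrict_space lborel {0..pi/2})"
    by (intro measurable_restrict_space1) simp
  then show ?thesis unfolding nu_def AE_density[OF \<open>_ \<in> borel_measurable _\<close>] using ae by eventually_elim blast
qed

lemma finite_SS: "finite_measure (SS :: ((real^'n) \<times> (real^'m)) measure)"
proof -
  have "emeasure (SS :: ((real^'n) \<times> (real^'m)) measure) (space SS) =
      emeasure (surface_measure :: (real^'n) measure) (space surface_measure) * emeasure (surface_measure :: (real^'m) measure) (space surface_measure)"
    unfolding space_pair_measure by (rule surface.emeasure_pair_measure_Times) auto
  then show ?thesis
    by (intro finite_measureI) (simp add: surface.emeasure_eq_measure ennreal_mult_eq_top_iff)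
qed

text \<open>The density depends on the angle only, so the measure is the image of a product, and the
  integral over the two spheres can be done first, at a fixed angle.\<close>

lemma dOmega_eq:
  "(dOmega \<alpha> :: ((real^'n) \<times> (real^'m)) measure) =
    distr (nu CARD('n) CARD('m) \<alpha> \<Otimes>\<^sub>M SS) (restrict_space borel (Omega \<alpha>)) (polar \<alpha>)"
proof -
  interpret S: finite_measure "SS :: ((real^'n) \<times> (real^'m)) measure" by (rule finite_SS)
  have "nu CARD('n) CARD('m) \<alpha> \<Otimes>\<^sub>M density (SS :: ((real^'n) \<times> (real^'m)) measure) (\<lambda>_. 1) =
     density (restrict_space lborel {0..pi/2} \<Otimes>\<^sub>M SS) (\<lambda>(t, w). ennreal (wt CARD('n) CARD('m) \<alpha> t) * 1)"
    unfolding nu_def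
    by (rule pair_measure_density) (auto intro!: measurable_restrict_space1 S.sigma_finite_measure_axioms simp: density_1)
  then have "nu CARD('n) CARD('m) \<alpha> \<Otimes>\<^sub>M (SS :: ((real^'n) \<times> (real^'m)) measure) =
     density (restrict_space lborel {0..pi/2} \<Otimes>\<^sub>M SS) (\<lambda>(t, w). ennreal (wt CARD('n) CARD('m) \<alpha> t))"
    by (simp add: density_1)
  then show ?thesis unfolding dOmega_def wt_def by simp
qed

lemma sets_dOmega: "sets (dOmega \<alpha>) = sets (restrict_space borel (Omega \<alpha>))" "space (dOmega \<alpha>) = Omega \<alpha>"
  by (auto simp: dOmega_def space_restrict_space)

lemma polar_measurable':
  "polar \<alpha> \<in> nu CARD('n) CARD('m) \<alpha> \<Otimes>\<^sub>M (SS :: ((real^'n) \<times> (real^'m)) measure) \<rightarrow>\<^sub>M restrict_space borel (Omega \<alpha>)"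
proof -
  have "sets (nu CARD('n) CARD('m) \<alpha> \<Otimes>\<^sub>M (SS :: ((real^'n) \<times> (real^'m)) measure)) = sets (restrict_space lborel {0..pi/2} \<Otimes>\<^sub>M SS)"
    by (intro sets_pair_measure_cong) (auto simp: nu_def)
  from measurable_cong_sets[OF this refl] show ?thesis using measurable_polar by blast
qed

lemma nn_integral_dOmega:
  fixes f :: "(real^'n) \<times> (real^'m) \<Rightarrow> ennreal"
  assumes f: "f \<in> borel_measurable (dOmega \<alpha>)" 
  shows "(\<integral>\<^sup>+z. f z \<partial>dOmega \<alpha>) = (\<integral>\<^sup>+t. (\<integral>\<^sup>+w. f (polar \<alpha> (t, w)) \<partial>SS) \<partial>nu CARD('n) CARD('m) \<alpha>)"
proof -
  interpret S: finite_measure "SS :: ((real^'n) \<times> (real^'m)) measure" by (rule finite_SS)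
  have f': "f \<in> borel_measurable (restrict_space borel (Omega \<alpha>))"
    using f by (simp add: measurable_cong_sets[OF sets_dOmega(1) refl])
  have "(\<integral>\<^sup>+z. f z \<partial>dOmega \<alpha>) = (\<integral>\<^sup>+p. f (polar \<alpha> p) \<partial>(nu CARD('n) CARD('m) \<alpha> \<Otimes>\<^sub>M SS))"
    unfolding dOmega_eq by (rule nn_integral_distr[OF polar_measurable']) (use f' in simp)
  also have "\<dots> = (\<integral>\<^sup>+t. (\<integral>\<^sup>+w. f (polar \<alpha> (t, w)) \<partial>SS) \<partial>nu CARD('n) CARD('m) \<alpha>)"
    by (rule S.nn_integral_fst[symmetric]) (rule measurable_compose[OF polar_measurable' f'])
  finally show ?thesis .
qed

lemma polar_coords:
  assumes "0 < t" "t < pi / 2" "norm w1 = 1" "norm w2 = 1"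
  shows "polar \<alpha> (t, w1, w2) \<in> (Omega \<alpha> :: ((real^'n) \<times> (real^'m)) set)"
    "phi \<alpha> (polar \<alpha> (t, w1 :: real^'n, w2 :: real^'m)) = t"
    "sgn (fst (polar \<alpha> (t, w1, w2))) = w1" "sgn (snd (polar \<alpha> (t, w1, w2))) = w2"
proof -
  have t: "t \<in> {0..pi/2}" using assms by auto
  show "polar \<alpha> (t, w1, w2) \<in> (Omega \<alpha> :: ((real^'n) \<times> (real^'m)) set)"
    "phi \<alpha> (polar \<alpha> (t, w1 :: real^'n, w2 :: real^'m)) = t"
    using polar_Omega[OF t assms(3,4)] by auto
  have "sin t > 0" "cos t > 0" using assms by (auto intro: sin_gt_zero cos_gt_zero)
  then show "sgn (fst (polar \<alpha> (t, w1, w2))) = w1" "sgn (snd (polar \<alpha> (t, w1, w2))) = w2"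
    using assms by (auto simp: polar_def sgn_scaleR sgn_div_norm)
qed

text \<open>Allows the integrand to be rewritten for angles strictly inside the interval only. At
  the two endpoints x or y vanishes and a spherical coordinate is lost, but they form a null
  set.\<close>

lemma nn_integral_dOmega':
  fixes f :: "(real^'n) \<times> (real^'m) \<Rightarrow> ennreal"
  assumes f: "f \<in> borel_measurable (dOmega \<alpha>)"
    and g: "\<And>t w1 w2. 0 < t \<Longrightarrow> t < pi / 2 \<Longrightarrow> norm w1 = 1 \<Longrightarrow> norm w2 = 1 \<Longrightarrow> f (polar \<alpha> (t, w1, w2)) = g t (w1, w2)"
  shows "(\<integral>\<^sup>+z. f z \<partial>dOmega \<alpha>) = (\<integral>\<^sup>+t. (\<integral>\<^sup>+w. g t w \<partial>SS) \<partial>nu CARD('n) CARD('m) \<alpha>)"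
  unfolding nn_integral_dOmega[OF f]
proof (rule nn_integral_cong_AE)
  show "AE t in nu CARD('n) CARD('m) \<alpha>. (\<integral>\<^sup>+w. f (polar \<alpha> (t, w)) \<partial>SS) = (\<integral>\<^sup>+w. g t w \<partial>SS)"
    using AE_nu
  proof eventually_elim
    case (elim t)
    then show ?case by (intro nn_integral_cong) (auto simp: space_pair_measure surface_measure_sets g)
  qed
qed

lemma parseval_finite:
  fixes V :: "'i \<Rightarrow> 'a \<Rightarrow> complex"
  assumes A: "finite A"
    and int: "\<And>i j. i \<in> A \<Longrightarrow> j \<in> A \<Longrightarrow> integrable M (\<lambda>w. V i w * cnj (V j w))"
    and orth: "\<And>i j. i \<in> A \<Longrightarrow> j \<in> A \<Longrightarrow> (LINT w|M. V i w * cnj (V j w)) = (if i = j then 1 else 0)"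
  shows "integrable M (\<lambda>w. (cmod (\<Sum>i\<in>A. c i * V i w))\<^sup>2)"
    "(LINT w|M. (cmod (\<Sum>i\<in>A. c i * V i w))\<^sup>2) = (\<Sum>i\<in>A. (cmod (c i))\<^sup>2)"
proof -
  let ?g = "\<lambda>w. \<Sum>i\<in>A. \<Sum>j\<in>A. (c i * cnj (c j)) * (V i w * cnj (V j w))"
  have e: "complex_of_real ((cmod (\<Sum>i\<in>A. c i * V i w))\<^sup>2) = ?g w" for w
  proof -
    have "complex_of_real ((cmod (\<Sum>i\<in>A. c i * V i w))\<^sup>2) = (\<Sum>i\<in>A. c i * V i w) * cnj (\<Sum>i\<in>A. c i * V i w)"
      by (rule complex_norm_square)
    then show ?thesis by (simp add: sum_product mult_ac)
  qed
  have i: "integrable M ?g"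
    by (intro Bochner_Integration.integrable_sum Bochner_Integration.integrable_mult_right int) auto
  have r: "(cmod (\<Sum>i\<in>A. c i * V i w))\<^sup>2 = Re (?g w)" for w
    unfolding e[symmetric] by simp
  show "integrable M (\<lambda>w. (cmod (\<Sum>i\<in>A. c i * V i w))\<^sup>2)" unfolding r by (rule integrable_Re[OF i])
  have "(LINT w|M. ?g w) = (\<Sum>i\<in>A. LINT w|M. (\<Sum>j\<in>A. (c i * cnj (c j)) * (V i w * cnj (V j w))))"
    by (rule Bochner_Integration.integral_sum) (intro Bochner_Integration.integrable_sum Bochner_Integration.integrable_mult_right int)
  also have "\<dots> = (\<Sum>i\<in>A. \<Sum>j\<in>A. LINT w|M. (c i * cnj (c j)) * (V i w * cnj (V j w)))"
    by (intro sum.cong refl Bochner_Integration.integral_sum Bochner_Integration.integrable_mult_right int)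
  also have "\<dots> = (\<Sum>i\<in>A. \<Sum>j\<in>A. (c i * cnj (c j)) * (if i = j then 1 else 0))"
    by (intro sum.cong refl) (simp add: orth)
  also have "\<dots> = (\<Sum>i\<in>A. of_real ((cmod (c i))\<^sup>2))"
    by (intro sum.cong refl) (simp add: A if_distrib complex_norm_square del: of_real_power cong: if_cong)
  finally have "(LINT w|M. ?g w) = of_real (\<Sum>i\<in>A. (cmod (c i))\<^sup>2)" by simp
  then show "(LINT w|M. (cmod (\<Sum>i\<in>A. c i * V i w))\<^sup>2) = (\<Sum>i\<in>A. (cmod (c i))\<^sup>2)"
    unfolding r using integral_Re[OF i] by simp
qed

section \<open>The functions \<open>h\<close>\<close>

lemma jacobi_continuous: "continuous_on UNIV (jacobi N a b)"
  unfolding jacobi_def[abs_def] by (intro continuous_intros) auto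

lemma h_fun_borel [measurable]: "h_fun n m \<alpha> N l j \<in> borel_measurable borel"
proof -
  have [measurable]: "jacobi N a b \<in> borel_measurable borel" for a b
    by (rule borel_measurable_continuous_onI[OF jacobi_continuous])
  show ?thesis unfolding h_fun_def[abs_def] by measurable
qed

lemma h_fun_bounded: "\<exists>B\<ge>0. \<forall>t\<in>{0..pi/2}. \<bar>h_fun n m \<alpha> N l j t\<bar> \<le> B"
proof -
  define J where "J = jacobi N ((real n - 2 + 2 * real l) / (2 * (real \<alpha> + 1))) (real j + real m / 2 - 1)"
  have "compact (J ` {-1..1})" unfolding J_def
    by (intro compact_continuous_image continuous_on_subset[OF jacobi_continuous]) auto
  then have "bounded (J ` {-1..1})" by (rule compact_imp_bounded)
  then obtain B where "\<forall>y\<in>J ` {-1..1}. norm y \<le> B" unfolding bounded_iff by blast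
  then have B: "\<bar>J x\<bar> \<le> B" if "x \<in> {-1..1}" for x using that by simp
  have "\<bar>h_fun n m \<alpha> N l j t\<bar> \<le> B" if t: "t \<in> {0..pi/2}" for t
  proof -
    have "0 \<le> sin t" using t by (intro sin_ge_zero) auto
    then have 2: "\<bar>sin t powr (real l / (real \<alpha> + 1))\<bar> \<le> 1" by (simp add: powr_le1)
    have 1: "\<bar>cos t ^ j\<bar> \<le> 1" by (simp add: power_abs power_le_one)
    have "\<bar>h_fun n m \<alpha> N l j t\<bar> = \<bar>cos t ^ j\<bar> * \<bar>sin t powr (real l / (real \<alpha> + 1))\<bar> * \<bar>J (cos (2 * t))\<bar>"
      by (simp add: h_fun_def J_def abs_mult)
    also have "\<dots> \<le> 1 * 1 * B" using B[of "cos (2 * t)"] 1 2 by (intro mult_mono) auto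
    finally show ?thesis by simp
  qed
  moreover have "B \<ge> 0" using B[of 0] by simp
  ultimately show ?thesis by blast
qed

lemma Omega_le:
  fixes z :: "(real^'n) \<times> (real^'m)"
  assumes "z \<in> Omega \<alpha>"
  shows "(real \<alpha> + 1) * norm (snd z) \<le> 1"
proof -
  obtain x y where z: "z = (x, y)" by (cases z)
  have r: "rho \<alpha> z = 1" using assms by (simp add: Omega_def)
  define b where "b = norm x ^ (2 * (\<alpha> + 1)) + (real \<alpha> + 1)\<^sup>2 * (norm y)\<^sup>2"
  have b: "b powr (1 / (2 * (real \<alpha> + 1))) = 1" using r by (simp add: z rho_def b_def)
  have "b \<ge> 0" by (simp add: b_def)
  moreover have "b \<noteq> 0" using b by auto
  ultimately have "b > 0" by simp
  then have "ln b = 0" using b by (simp add: powr_def)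
  then have "b = 1" using \<open>b > 0\<close> by simp
  then have "(real \<alpha> + 1)\<^sup>2 * (norm y)\<^sup>2 \<le> 1"
    using zero_le_power[OF norm_ge_zero, of x "2 * (\<alpha> + 1)"] unfolding b_def by linarith
  then have "((real \<alpha> + 1) * norm y)\<^sup>2 \<le> 1\<^sup>2" by (simp add: power_mult_distrib)
  then have "(real \<alpha> + 1) * norm y \<le> 1" by (rule power2_le_imp_le) simp
  then show ?thesis by (simp add: z)
qed

lemma phi_range:
  assumes "z \<in> Omega \<alpha>"
  shows "phi \<alpha> z \<in> {0..pi/2}"
proof -
  define u where "u = (real \<alpha> + 1) * norm (snd z)"
  have u: "0 \<le> u" "u \<le> 1" using Omega_le[OF assms] by (auto simp: u_def)
  have "rho \<alpha> z = 1" using assms by (simp add: Omega_def)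
  then have "phi \<alpha> z = arccos u" unfolding phi_def by (simp add: u_def)
  then show ?thesis using arccos_lbound[of u] arccos_le_pi2[of u] u by simp
qed

definition mu_par :: "nat \<Rightarrow> nat \<Rightarrow> nat \<Rightarrow> real" where
  "mu_par n \<alpha> l = (real n - 2 + 2 * real l) / (2 * (real \<alpha> + 1))"

definition nu_par :: "nat \<Rightarrow> nat \<Rightarrow> real" where
  "nu_par m j = real j + real m / 2 - 1"

text \<open>In s = sin^2 \<phi> the powers of sin and cos in h^2 and in the density combine to the
  Jacobi weight with the very parameters of the polynomial. The factor sin \<phi> cos \<phi> of the
  density that is left over in \<open>wt_eq\<close> is ds / 2.\<close>

lemma h_sq_eq:
  assumes t: "0 < t" "t < pi / 2"
  shows "(h_fun n m \<alpha> N l j t)\<^sup>2 * (((sin t)\<^sup>2) powr ((real n - 2) / (2 * (real \<alpha> + 1))) * (1 - (sin t)\<^sup>2) powr ((real m - 2) / 2))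
     = jf N (mu_par n \<alpha> l) (nu_par m j) ((sin t)\<^sup>2)"
proof -
  have sc: "sin t > 0" "cos t > 0" using t by (auto intro: sin_gt_zero cos_gt_zero)
  have s1: "1 - (sin t)\<^sup>2 = (cos t)\<^sup>2" by (simp add: cos_squared_eq)
  have c2: "cos (2 * t) = 1 - 2 * (sin t)\<^sup>2" by (simp add: cos_double_sin)
  have pw: "(x\<^sup>2) powr y = x powr (2 * y)" if "x > 0" for x y :: real
  proof -
    have "x\<^sup>2 = x powr 2" using that by simp
    then show ?thesis by (simp only: powr_powr)
  qed
  have "(cos t ^ j)\<^sup>2 = cos t powr (2 * real j)"
  proof -
    have "cos t ^ j = cos t powr real j" using sc by (simp add: powr_realpow)
    then show ?thesis by (simp add: power2_eq_square flip: powr_add)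
  qed
  moreover have "(sin t powr (real l / (real \<alpha> + 1)))\<^sup>2 = sin t powr (2 * real l / (real \<alpha> + 1))"
    by (simp add: power2_eq_square flip: powr_add)
  ultimately have "(h_fun n m \<alpha> N l j t)\<^sup>2 = cos t powr (2 * real j) * sin t powr (2 * real l / (real \<alpha> + 1)) * (jacobi N (mu_par n \<alpha> l) (nu_par m j) (1 - 2 * (sin t)\<^sup>2))\<^sup>2"
    by (simp only: h_fun_def mu_par_def nu_par_def power_mult_distrib c2)
  then have "(h_fun n m \<alpha> N l j t)\<^sup>2 * ((sin t)\<^sup>2 powr ((real n - 2) / (2 * (real \<alpha> + 1))) * (1 - (sin t)\<^sup>2) powr ((real m - 2) / 2))
     = (sin t powr (2 * real l / (real \<alpha> + 1)) * sin t powr (2 * ((real n - 2) / (2 * (real \<alpha> + 1))))) *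
       (cos t powr (2 * real j) * cos t powr (2 * ((real m - 2) / 2))) * (jacobi N (mu_par n \<alpha> l) (nu_par m j) (1 - 2 * (sin t)\<^sup>2))\<^sup>2"
    unfolding s1 pw[OF sc(1)] pw[OF sc(2)] by (simp add: mult_ac)
  also have "sin t powr (2 * real l / (real \<alpha> + 1)) * sin t powr (2 * ((real n - 2) / (2 * (real \<alpha> + 1)))) = sin t powr (2 * mu_par n \<alpha> l)"
  proof -
    have "2 * real l / (real \<alpha> + 1) = 2 * (2 * real l / (2 * (real \<alpha> + 1)))"
      unfolding mult_divide_mult_cancel_left[OF zero_neq_numeral[symmetric]] by simp
    then have "2 * real l / (real \<alpha> + 1) + 2 * ((real n - 2) / (2 * (real \<alpha> + 1))) = 2 * mu_par n \<alpha> l"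
      unfolding mu_par_def add_divide_distrib distrib_left by (simp only: add.commute)
    then show ?thesis unfolding powr_add[symmetric] by simp
  qed
  also have "cos t powr (2 * real j) * cos t powr (2 * ((real m - 2) / 2)) = cos t powr (2 * nu_par m j)"
    unfolding powr_add[symmetric] nu_par_def by (rule arg_cong[where f = "\<lambda>x. cos t powr x"]) (simp add: field_simps)
  also have "sin t powr (2 * mu_par n \<alpha> l) * cos t powr (2 * nu_par m j) * (jacobi N (mu_par n \<alpha> l) (nu_par m j) (1 - 2 * (sin t)\<^sup>2))\<^sup>2
      = jf N (mu_par n \<alpha> l) (nu_par m j) ((sin t)\<^sup>2)"
    unfolding jf_def jw_def s1 using sc by (simp add: rpow_eq_powr pw)
  finally show ?thesis .
qed

lemma wt_eq:
  assumes t: "0 < t" "t < pi / 2" and m: "m \<ge> 2"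
  shows "wt n m \<alpha> t = ((sin t)\<^sup>2) powr ((real n - 2) / (2 * (real \<alpha> + 1))) * (1 - (sin t)\<^sup>2) powr ((real m - 2) / 2) * (sin t * cos t)"
proof -
  have sc: "sin t > 0" "cos t > 0" using t by (auto intro: sin_gt_zero cos_gt_zero)
  have s1: "1 - (sin t)\<^sup>2 = (cos t)\<^sup>2" by (simp add: cos_squared_eq)
  have pw: "(x\<^sup>2) powr y = x powr (2 * y)" if "x > 0" for x y :: real
  proof -
    have "x\<^sup>2 = x powr 2" using that by simp
    then show ?thesis by (simp only: powr_powr)
  qed
  have "cos t ^ (m - 1) = cos t powr real (m - 1)" using sc by (simp add: powr_realpow)
  also have "real (m - 1) = 2 * ((real m - 2) / 2) + 1" using m by (simp add: field_simps)
  finally have 1: "cos t ^ (m - 1) = cos t powr (2 * ((real m - 2) / 2)) * cos t" using sc by (simp add: powr_add)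
  have 2: "sin t powr ((real n - 2) / (real \<alpha> + 1) + 1) = sin t powr (2 * ((real n - 2) / (2 * (real \<alpha> + 1)))) * sin t"
  proof -
    have "2 * ((real n - 2) / (2 * (real \<alpha> + 1))) = (real n - 2) / (real \<alpha> + 1)" by (simp add: field_simps)
    then show ?thesis using sc by (simp add: powr_add)
  qed
  show ?thesis unfolding wt_def 1 2 s1 pw[OF sc(1)] pw[OF sc(2)] by simp
qed

lemma nn_integral_sin_sq:
  assumes [measurable]: "g \<in> borel_measurable borel"
  shows "(\<integral>\<^sup>+t. indicator {0..pi/2} t * (g ((sin t)\<^sup>2) * ennreal (2 * sin t * cos t)) \<partial>lborel)
    = (\<integral>\<^sup>+s. indicator {0..1} s * g s \<partial>lborel)"
proof -
  have "(\<integral>\<^sup>+s. g s * indicator {(sin 0)\<^sup>2..(sin (pi / 2))\<^sup>2} s \<partial>lborel) =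
     (\<integral>\<^sup>+t. g ((sin t)\<^sup>2) * ennreal (2 * sin t * cos t) * indicator {0..pi / 2} t \<partial>lborel)"
  proof (rule nn_integral_substitution_aux)
    show "((\<lambda>t. (sin t)\<^sup>2) has_real_derivative 2 * sin t * cos t) (at t)" for t :: real
      by (auto intro!: derivative_eq_intros)
    show "0 \<le> 2 * sin t * cos t" if "t \<in> {0..pi / 2}" for t :: real
      using that by (auto intro!: mult_nonneg_nonneg sin_ge_zero cos_ge_zero)
  qed (auto intro!: continuous_intros)
  then show ?thesis by (simp add: mult_ac)
qed

lemma nn_integral_h_sq:
  assumes [measurable]: "G \<in> borel_measurable borel" and m: "m \<ge> 2"
  shows "(\<integral>\<^sup>+t. G ((sin t)\<^sup>2) * ennreal ((h_fun n m \<alpha> N l j t)\<^sup>2) \<partial>nu n m \<alpha>)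
    = ennreal (1 / 2) * (\<integral>\<^sup>+s. indicator {0..1} s * (G s * ennreal (jf N (mu_par n \<alpha> l) (nu_par m j) s)) \<partial>lborel)"
proof -
  let ?f = "jf N (mu_par n \<alpha> l) (nu_par m j)"
  have [measurable]: "?f \<in> borel_measurable borel"
    unfolding jf_def[abs_def] jw_def rpow_def jacobi_def by measurable
  have "(\<integral>\<^sup>+t. G ((sin t)\<^sup>2) * ennreal ((h_fun n m \<alpha> N l j t)\<^sup>2) \<partial>nu n m \<alpha>)
     = (\<integral>\<^sup>+t. indicator {0..pi/2} t * (ennreal (wt n m \<alpha> t) * (G ((sin t)\<^sup>2) * ennreal ((h_fun n m \<alpha> N l j t)\<^sup>2))) \<partial>lborel)"
    by (rule nn_integral_nu) measurable
  also have "\<dots> = (\<integral>\<^sup>+t. ennreal (1 / 2) * (indicator {0..pi/2} t * ((G ((sin t)\<^sup>2) * ennreal (?f ((sin t)\<^sup>2))) * ennreal (2 * sin t * cos t))) \<partial>lborel)"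
  proof (rule nn_integral_cong_AE)
    have "AE t in lborel. t \<noteq> 0 \<and> t \<noteq> pi / 2"
      using AE_lborel_singleton[of 0] AE_lborel_singleton[of "pi / 2"] by eventually_elim simp
    then show "AE t in lborel. indicator {0..pi/2} t * (ennreal (wt n m \<alpha> t) * (G ((sin t)\<^sup>2) * ennreal ((h_fun n m \<alpha> N l j t)\<^sup>2)))
      = ennreal (1 / 2) * (indicator {0..pi/2} t * ((G ((sin t)\<^sup>2) * ennreal (?f ((sin t)\<^sup>2))) * ennreal (2 * sin t * cos t)))"
    proof eventually_elim
      case (elim t)
      show ?case
      proof (cases "0 < t \<and> t < pi / 2")
        case True
        then have t: "0 < t" "t < pi / 2" by auto
        have sc: "sin t > 0" "cos t > 0" using t by (auto intro: sin_gt_zero cos_gt_zero)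
        have "wt n m \<alpha> t * (h_fun n m \<alpha> N l j t)\<^sup>2 = 1 / 2 * (?f ((sin t)\<^sup>2) * (2 * sin t * cos t))"
          unfolding wt_eq[OF t m] h_sq_eq[OF t, symmetric] by simp
        note e = this
        have f0: "?f ((sin t)\<^sup>2) \<ge> 0" by (simp add: jf_def)
        have "ennreal (wt n m \<alpha> t) * ennreal ((h_fun n m \<alpha> N l j t)\<^sup>2) = ennreal (wt n m \<alpha> t * (h_fun n m \<alpha> N l j t)\<^sup>2)"
          by (rule ennreal_mult[symmetric]) (use sc in \<open>auto simp: wt_def\<close>)
        also have "\<dots> = ennreal (1 / 2) * ennreal (?f ((sin t)\<^sup>2) * (2 * sin t * cos t))"
          unfolding e by (rule ennreal_mult) (use sc f0 in auto)
        also have "ennreal (?f ((sin t)\<^sup>2) * (2 * sin t * cos t)) = ennreal (?f ((sin t)\<^sup>2)) * ennreal (2 * sin t * cos t)"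
          by (rule ennreal_mult) (use sc f0 in auto)
        finally have "ennreal (wt n m \<alpha> t) * ennreal ((h_fun n m \<alpha> N l j t)\<^sup>2) = ennreal (1 / 2) * (ennreal (?f ((sin t)\<^sup>2)) * ennreal (2 * sin t * cos t))" .
        then have "G ((sin t)\<^sup>2) * (ennreal (wt n m \<alpha> t) * ennreal ((h_fun n m \<alpha> N l j t)\<^sup>2)) = G ((sin t)\<^sup>2) * (ennreal (1 / 2) * (ennreal (?f ((sin t)\<^sup>2)) * ennreal (2 * sin t * cos t)))"
          by simp
        then show ?thesis using t by (simp add: mult_ac)
      next
        case False
        then have "t \<notin> {0..pi/2}" using elim by auto
        then show ?thesis by simp
      qed
    qed
  qed
  also have "\<dots> = ennreal (1 / 2) * (\<integral>\<^sup>+t. (indicator {0..pi/2} t * ((G ((sin t)\<^sup>2) * ennreal (?f ((sin t)\<^sup>2))) * ennreal (2 * sin t * cos t))) \<partial>lborel)"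
    by (rule nn_integral_cmult) measurable
  also have "(\<integral>\<^sup>+t. (indicator {0..pi/2} t * ((G ((sin t)\<^sup>2) * ennreal (?f ((sin t)\<^sup>2))) * ennreal (2 * sin t * cos t))) \<partial>lborel)
     = (\<integral>\<^sup>+s. indicator {0..1} s * (G s * ennreal (?f s)) \<partial>lborel)"
    by (rule nn_integral_sin_sq[of "\<lambda>s. G s * ennreal (?f s)"]) measurable
  finally show ?thesis .
qed

text \<open>The function arccos is continuous on [-1, 1] only. Its clamped version is continuous
  everywhere and agrees with it at the arguments that occur on \<Omega>.\<close>

lemma phi_borel: "phi \<alpha> \<in> borel_measurable (dOmega \<alpha> :: ((real^'n) \<times> (real^'m)) measure)"
proof -
  define c :: "real \<Rightarrow> real" where "c u = arccos (max (-1) (min 1 u))" for u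
  have "continuous_on UNIV c" unfolding c_def[abs_def]
    by (intro continuous_on_arccos continuous_intros) auto
  then have [measurable]: "c \<in> borel_measurable borel" by (rule borel_measurable_continuous_onI)
  have [measurable]: "(\<lambda>z :: (real^'n) \<times> (real^'m). norm (snd z)) \<in> borel_measurable borel"
    "(\<lambda>z :: (real^'n) \<times> (real^'m). norm (fst z)) \<in> borel_measurable borel"
    by (intro borel_measurable_continuous_onI continuous_intros)+
  have "(\<lambda>z :: (real^'n) \<times> (real^'m). c ((real \<alpha> + 1) * norm (snd z) / rho \<alpha> z ^ (\<alpha> + 1))) \<in> borel_measurable borel"
    unfolding rho_def case_prod_beta by measurable
  then have m: "(\<lambda>z :: (real^'n) \<times> (real^'m). c ((real \<alpha> + 1) * norm (snd z) / rho \<alpha> z ^ (\<alpha> + 1))) \<in> borel_measurable (restrict_space borel (Omega \<alpha>))"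
    by (rule measurable_restrict_space1)
  have "phi \<alpha> \<in> borel_measurable (restrict_space borel (Omega \<alpha> :: ((real^'n) \<times> (real^'m)) set))"
  proof (rule measurable_cong[THEN iffD1, OF _ m])
    fix z :: "(real^'n) \<times> (real^'m)" assume "z \<in> space (restrict_space borel (Omega \<alpha>))"
    then have z: "z \<in> Omega \<alpha>" by (simp add: space_restrict_space)
    define u where "u = (real \<alpha> + 1) * norm (snd z) / rho \<alpha> z ^ (\<alpha> + 1)"
    have r: "rho \<alpha> z = 1" using z by (simp add: Omega_def)
    have u: "u \<le> 1" "u \<ge> 0" using Omega_le[OF z] unfolding u_def r by auto
    then have "max (-1) (min 1 u) = u" by simp
    then show "c ((real \<alpha> + 1) * norm (snd z) / rho \<alpha> z ^ (\<alpha> + 1)) = phi \<alpha> z"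
      unfolding u_def[symmetric] by (simp add: c_def phi_def u_def)
  qed
  then show ?thesis by (simp add: measurable_cong_sets[OF sets_dOmega(1) refl])
qed

lemma borel_measurable_dOmega: "f \<in> borel_measurable borel \<Longrightarrow> f \<in> borel_measurable (dOmega \<alpha>)"
  by (simp add: measurable_cong_sets[OF sets_dOmega(1) refl] measurable_restrict_space1)

lemma finite_dOmega:
  assumes "CARD('n) \<ge> 2"
  shows "finite_measure (dOmega \<alpha> :: ((real^'n::finite) \<times> (real^'m::finite)) measure)"
proof (rule finite_measureI)
  interpret S: finite_measure "SS :: ((real^'n) \<times> (real^'m)) measure" by (rule finite_SS)
  interpret N: finite_measure "nu CARD('n) CARD('m) \<alpha>" by (rule finite_nu[OF assms])
  have "emeasure (dOmega \<alpha> :: ((real^'n) \<times> (real^'m)) measure) (space (dOmega \<alpha>)) = (\<integral>\<^sup>+z. 1 \<partial>(dOmega \<alpha> :: ((real^'n) \<times> (real^'m)) measure))" by simp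
  also have "\<dots> = (\<integral>\<^sup>+t. (\<integral>\<^sup>+w. 1 \<partial>(SS :: ((real^'n) \<times> (real^'m)) measure)) \<partial>nu CARD('n) CARD('m) \<alpha>)"
    by (rule nn_integral_dOmega) simp
  also have "\<dots> = emeasure (SS :: ((real^'n) \<times> (real^'m)) measure) (space SS) * emeasure (nu CARD('n) CARD('m) \<alpha>) (space (nu CARD('n) CARD('m) \<alpha>))"
    by simp
  also have "\<dots> \<noteq> \<infinity>" by (simp add: S.emeasure_eq_measure N.emeasure_eq_measure ennreal_mult_eq_top_iff)
  finally show "emeasure (dOmega \<alpha> :: ((real^'n) \<times> (real^'m)) measure) (space (dOmega \<alpha>)) \<noteq> \<infinity>" .
qed

lemma SS_product_integral:
  fixes f :: "real^'n \<Rightarrow> complex" and g :: "real^'m \<Rightarrow> complex"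
  assumes [measurable]: "f \<in> borel_measurable surface_measure" "g \<in> borel_measurable surface_measure"
    and bf: "\<And>x. norm (f x) \<le> A" and bg: "\<And>y. norm (g y) \<le> B"
  shows "integrable SS (\<lambda>(x, y). f x * g y)"
    "(LINT w|SS. (case w of (x, y) \<Rightarrow> f x * g y)) = (LINT x|surface_measure. f x) * (LINT y|surface_measure. g y)"
proof -
  interpret S: finite_measure "SS :: ((real^'n) \<times> (real^'m)) measure" by (rule finite_SS)
  interpret P: pair_sigma_finite "surface_measure :: (real^'n) measure" "surface_measure :: (real^'m) measure"
    by unfold_locales
  show i: "integrable SS (\<lambda>(x, y). f x * g y)"
  proof (rule S.integrable_const_bound[where B = "A * B"])
    have "norm (f x * g y) \<le> A * B" for x y
      unfolding norm_mult using bf bg order_trans[OF norm_ge_zero bf] by (intro mult_mono) auto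
    then show "AE w in SS. norm (case w of (x, y) \<Rightarrow> f x * g y) \<le> A * B" by (intro AE_I2) (auto split: prod.split)
  qed measurable
  have "(LINT w|SS. (case w of (x, y) \<Rightarrow> f x * g y)) = (LINT x|surface_measure. (LINT y|surface_measure. f x * g y))"
    using P.integral_fst'[OF i] by simp
  then show "(LINT w|SS. (case w of (x, y) \<Rightarrow> f x * g y)) = (LINT x|surface_measure. f x) * (LINT y|surface_measure. g y)"
    by simp
qed

text \<open>Recovers inner products from the norms of two-term sums, with the scalars 1 and i for
  the real and the imaginary part. Norms are what the nonnegative integral in polar coordinates
  delivers.\<close>

lemma polarization_orthonormal:
  fixes u :: "'i \<Rightarrow> 'a \<Rightarrow> complex"
  assumes ij: "i \<noteq> j" and m: "u i \<in> borel_measurable M" "u j \<in> borel_measurable M"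
    and P: "\<And>c A. A \<subseteq> {i, j} \<Longrightarrow> (\<integral>\<^sup>+z. ennreal ((cmod (\<Sum>i\<in>A. c i * u i z))\<^sup>2) \<partial>M) = ennreal (\<Sum>i\<in>A. (cmod (c i))\<^sup>2)"
    and int: "integrable M (\<lambda>z. u i z * cnj (u j z))"
  shows "(LINT z|M. u i z * cnj (u j z)) = 0"
proof -
  have L: "integrable M (\<lambda>z. (cmod (\<Sum>i\<in>A. c i * u i z))\<^sup>2) \<and> (LINT z|M. (cmod (\<Sum>i\<in>A. c i * u i z))\<^sup>2) = (\<Sum>i\<in>A. (cmod (c i))\<^sup>2)"
    if A: "A \<subseteq> {i, j}" for c A
  proof -
    have "finite A" using A finite_subset by blast
    have meas: "(\<lambda>z. (cmod (\<Sum>i\<in>A. c i * u i z))\<^sup>2) \<in> borel_measurable M"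
    proof -
      have "(\<lambda>z. \<Sum>i\<in>A. c i * u i z) \<in> borel_measurable M"
      proof (intro borel_measurable_sum borel_measurable_times borel_measurable_const)
        fix l assume "l \<in> A"
        then show "u l \<in> borel_measurable M" using m A by auto
      qed
      then show ?thesis by measurable
    qed
    show ?thesis
      using P[OF A, of c] by (intro nn_integral_eq_integrable[THEN iffD1, OF meas]) (auto intro: sum_nonneg)
  qed
  have key: "Re (cnj z0 * (LINT z|M. u i z * cnj (u j z))) = 0" if z0: "cmod z0 = 1" for z0
  proof -
    let ?c = "\<lambda>k. if k = i then 1 else z0"
    have e: "(cmod (\<Sum>k\<in>{i, j}. ?c k * u k z))\<^sup>2 = (cmod (\<Sum>k\<in>{i}. 1 * u k z))\<^sup>2 + (cmod (\<Sum>k\<in>{j}. 1 * u k z))\<^sup>2 + 2 * Re (cnj z0 * (u i z * cnj (u j z)))" for z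
    proof -
      have "complex_of_real ((cmod (u i z + z0 * u j z))\<^sup>2) = (u i z + z0 * u j z) * cnj (u i z + z0 * u j z)"
        by (rule complex_norm_square)
      also have "\<dots> = u i z * cnj (u i z) + (z0 * cnj z0) * (u j z * cnj (u j z)) + (cnj z0 * (u i z * cnj (u j z)) + cnj (cnj z0 * (u i z * cnj (u j z))))"
        by (simp add: algebra_simps)
      also have "\<dots> = of_real ((cmod (u i z))\<^sup>2) + of_real ((cmod z0)\<^sup>2) * of_real ((cmod (u j z))\<^sup>2) + of_real (2 * Re (cnj z0 * (u i z * cnj (u j z))))"
        unfolding complex_norm_square[symmetric] complex_add_cnj ..
      also have "\<dots> = of_real ((cmod (u i z))\<^sup>2 + (cmod (u j z))\<^sup>2 + 2 * Re (cnj z0 * (u i z * cnj (u j z))))"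
        using z0 by simp
      finally have "(cmod (u i z + z0 * u j z))\<^sup>2 = (cmod (u i z))\<^sup>2 + (cmod (u j z))\<^sup>2 + 2 * Re (cnj z0 * (u i z * cnj (u j z)))"
        unfolding of_real_eq_iff .
      then show ?thesis using ij by simp
    qed
    have i3: "integrable M (\<lambda>z. 2 * Re (cnj z0 * (u i z * cnj (u j z))))"
      using int by (intro integrable_mult_right integrable_Re) auto
    have "(LINT z|M. (cmod (\<Sum>k\<in>{i, j}. ?c k * u k z))\<^sup>2) = 1 + 1 + (LINT z|M. 2 * Re (cnj z0 * (u i z * cnj (u j z))))"
      unfolding e using L[of "{i}" "\<lambda>_. 1"] L[of "{j}" "\<lambda>_. 1"] i3
      by (subst Bochner_Integration.integral_add) auto
    moreover have "(LINT z|M. (cmod (\<Sum>k\<in>{i, j}. ?c k * u k z))\<^sup>2) = 2"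
      using L[of "{i, j}" ?c] ij z0 by simp
    moreover have "(LINT z|M. 2 * Re (cnj z0 * (u i z * cnj (u j z)))) = 2 * Re (cnj z0 * (LINT z|M. u i z * cnj (u j z)))"
      using int by (simp only: integral_mult_right_zero integral_Re integrable_mult_right)
    ultimately show ?thesis by simp
  qed
  show ?thesis using key[of 1] key[of \<i>] by (simp add: complex_eq_iff)
qed

section \<open>An orthonormal basis of \<open>\<H>\<^sub>k\<close>\<close>

lemma fun_sum_apply: "(\<Sum>a\<in>A. f a) x = (\<Sum>a\<in>A. f a x :: 'b::comm_monoid_add)"
  by (induction A rule: infinite_finite_induct) auto

lemma cnj_measurable: "f \<in> borel_measurable M \<Longrightarrow> (\<lambda>x. cnj (f x)) \<in> borel_measurable M"
  by (rule measurable_compose[OF _ borel_measurable_continuous_onI[OF continuous_on_cnj]]) (auto intro: continuous_intros)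

lemma mu_par_nonneg: "n \<ge> 2 \<Longrightarrow> mu_par n \<alpha> l \<ge> 0"
  by (simp add: mu_par_def)

lemma nu_par_nonneg: "m \<ge> 2 \<Longrightarrow> nu_par m j \<ge> 0"
  by (simp add: nu_par_def)

locale grushin =
  fixes \<alpha> k :: nat
    and Y :: "nat \<Rightarrow> nat \<Rightarrow> real^'n::finite \<Rightarrow> complex"
    and Z :: "nat \<Rightarrow> nat \<Rightarrow> real^'m::finite \<Rightarrow> complex"
  assumes Y: "spherical_harmonic_bases Y" and Z: "spherical_harmonic_bases Z"
    and n2: "CARD('n) \<ge> 2" and m2: "CARD('m) \<ge> 2"
begin

definition dY :: "nat \<Rightarrow> nat set" where
  "dY l = {1..cdim (spherical_harmonics l :: (real^'n \<Rightarrow> complex) set)}"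

definition dZ :: "nat \<Rightarrow> nat set" where
  "dZ j = {1..cdim (spherical_harmonics j :: (real^'m \<Rightarrow> complex) set)}"

definition adm :: "nat \<Rightarrow> nat \<Rightarrow> bool" where
  "adm l j \<longleftrightarrow> l \<le> k \<and> j \<le> k \<and> (\<exists>N. ktilde \<alpha> k l j = real N)"

text \<open>The floor only turns a real number into a natural one; on admissible pairs
  \<open>ktilde\<close> is already natural.\<close>

definition deg :: "nat \<Rightarrow> nat \<Rightarrow> nat" where
  "deg l j = nat \<lfloor>ktilde \<alpha> k l j\<rfloor>"

definition idx :: "(nat \<times> nat \<times> nat \<times> nat) set" where
  "idx = {(l, j, a, b). adm l j \<and> a \<in> dY l \<and> b \<in> dZ j}"

definition mul :: "nat \<Rightarrow> real" where "mul l = mu_par CARD('n) \<alpha> l"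
definition nuj :: "nat \<Rightarrow> real" where "nuj j = nu_par CARD('m) j"

definition Jc :: "nat \<Rightarrow> nat \<Rightarrow> real" where
  "Jc l j = jI (deg l j) (mul l) (nuj j)"

text \<open>\<open>Jc l j / 2\<close> is the squared norm of h in the angular measure; the half
  comes from ds = 2 sin \<phi> cos \<phi> d\<phi>.\<close>

definition hn :: "nat \<Rightarrow> nat \<Rightarrow> real \<Rightarrow> real" where
  "hn l j t = h_fun CARD('n) CARD('m) \<alpha> (deg l j) l j t / sqrt (Jc l j / 2)"

definition u :: "nat \<times> nat \<times> nat \<times> nat \<Rightarrow> (real^'n) \<times> (real^'m) \<Rightarrow> complex" where
  "u = (\<lambda>(l, j, a, b) w. if w \<in> Omega \<alpha>
     then of_real (hn l j (phi \<alpha> w)) * Y l a (sgn (fst w)) * Z j b (sgn (snd w)) else 0)"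

abbreviation DD :: "((real^'n) \<times> (real^'m)) measure" where "DD \<equiv> dOmega \<alpha>"

lemma jac: "jac (mul l) (nuj j)"
  unfolding mul_def nuj_def by unfold_locales (auto intro: mu_par_nonneg nu_par_nonneg n2 m2)

lemma Jc_pos: "Jc l j > 0"
  unfolding Jc_def by (rule jac.I0_pos[OF jac])

lemma finite_idx: "finite idx"
proof (rule finite_subset)
  show "idx \<subseteq> (SIGMA l:{..k}. SIGMA j:{..k}. dY l \<times> dZ j)" by (auto simp: idx_def adm_def)
qed (auto simp: dY_def dZ_def)

lemma finite_DD: "finite_measure DD"
  by (rule finite_dOmega[OF n2])

lemma u_borel:
  assumes "\<iota> \<in> idx"
  shows "u \<iota> \<in> borel_measurable DD"
proof -
  obtain l j a b where i: "\<iota> = (l, j, a, b)" by (metis prod_cases4)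
  have a: "a \<in> dY l" "b \<in> dZ j" using assms by (auto simp: idx_def i)
  have Yb: "Y l a \<in> borel_measurable borel" using Y_borel[OF Y, of a l] a by (simp add: dY_def)
  have Zb: "Z j b \<in> borel_measurable borel" using Y_borel[OF Z, of b j] a by (simp add: dZ_def)
  have sb: "(sgn :: 'e::euclidean_space \<Rightarrow> 'e) \<in> borel_measurable borel"
    unfolding sgn_div_norm[abs_def] by measurable
  have f: "(fst :: (real^'n) \<times> (real^'m) \<Rightarrow> _) \<in> borel_measurable borel" "(snd :: (real^'n) \<times> (real^'m) \<Rightarrow> _) \<in> borel_measurable borel"
    by (intro borel_measurable_continuous_onI continuous_intros)+
  have 1: "(\<lambda>w. Y l a (sgn (fst w))) \<in> borel_measurable DD"
    by (rule borel_measurable_dOmega) (rule measurable_compose[OF measurable_compose[OF f(1) sb] Yb])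
  have 2: "(\<lambda>w. Z j b (sgn (snd w))) \<in> borel_measurable DD"
    by (rule borel_measurable_dOmega) (rule measurable_compose[OF measurable_compose[OF f(2) sb] Zb])
  have "hn l j \<in> borel_measurable borel" unfolding hn_def[abs_def] by measurable
  then have 3: "(\<lambda>w. hn l j (phi \<alpha> w)) \<in> borel_measurable DD"
    by (rule measurable_compose[OF phi_borel])
  have m: "(\<lambda>w. of_real (hn l j (phi \<alpha> w)) * Y l a (sgn (fst w)) * Z j b (sgn (snd w))) \<in> borel_measurable DD"
    using 1 2 3 by measurable
  show ?thesis
    by (rule measurable_cong[THEN iffD1, OF _ m]) (simp add: u_def i sets_dOmega)
qed

lemma u_bounded:
  assumes "\<iota> \<in> idx"
  shows "\<exists>B. \<forall>w. cmod (u \<iota> w) \<le> B"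
proof -
  obtain l j a b where i: "\<iota> = (l, j, a, b)" by (metis prod_cases4)
  have a: "a \<in> dY l" "b \<in> dZ j" using assms by (auto simp: idx_def i)
  obtain B1 where B1: "\<And>w. cmod (Y l a w) \<le> B1" using Y_bounded[OF Y, of a l] a by (auto simp: dY_def)
  obtain B2 where B2: "\<And>w. cmod (Z j b w) \<le> B2" using Y_bounded[OF Z, of b j] a by (auto simp: dZ_def)
  obtain B0 where B0: "B0 \<ge> 0" "\<And>t. t \<in> {0..pi/2} \<Longrightarrow> \<bar>h_fun CARD('n) CARD('m) \<alpha> (deg l j) l j t\<bar> \<le> B0"
    using h_fun_bounded by metis
  let ?B = "B0 / sqrt (Jc l j / 2)"
  have s: "sqrt (Jc l j / 2) > 0" using Jc_pos[of l j] by simp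
  have pos: "0 \<le> B1" "0 \<le> B2" using order_trans[OF norm_ge_zero B1] order_trans[OF norm_ge_zero B2] by auto
  have "cmod (u \<iota> w) \<le> ?B * B1 * B2" for w
  proof (cases "w \<in> Omega \<alpha>")
    case True
    have "\<bar>hn l j (phi \<alpha> w)\<bar> \<le> ?B"
      unfolding hn_def abs_divide using B0(2)[OF phi_range[OF True]] s by (simp add: divide_right_mono)
    moreover have "cmod (u \<iota> w) = \<bar>hn l j (phi \<alpha> w)\<bar> * cmod (Y l a (sgn (fst w))) * cmod (Z j b (sgn (snd w)))"
      using True by (simp add: u_def i norm_mult)
    moreover have "?B \<ge> 0" using B0 s by simp
    ultimately show ?thesis using B1 B2 pos by (simp only:) (intro mult_mono mult_nonneg_nonneg, auto)
  next
    case False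
    then show ?thesis using pos B0 s by (simp add: u_def i)
  qed
  then show ?thesis by blast
qed

lemma u_polar:
  assumes "0 < t" "t < pi / 2" "norm w1 = 1" "norm w2 = 1"
  shows "u (l, j, a, b) (polar \<alpha> (t, w1, w2)) = of_real (hn l j t) * (Y l a w1 * Z j b w2)"
  using polar_coords[OF assms, of \<alpha>] by (simp add: u_def)

text \<open>The integral of G(sin^2 \<phi>) against the square of \<open>hn\<close> in the angular
  measure, written in the variable s.\<close>

definition mass :: "(real \<Rightarrow> ennreal) \<Rightarrow> nat \<Rightarrow> nat \<Rightarrow> ennreal" where
  "mass G l j = ennreal (1 / Jc l j) *
     (\<integral>\<^sup>+s. indicator {0..1} s * (G s * ennreal (jf (deg l j) (mul l) (nuj j) s)) \<partial>lborel)"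

lemma mass_1: "mass (\<lambda>_. 1) l j = 1"
proof -
  have "(\<integral>\<^sup>+s. indicator {0..1} s * (1 * ennreal (jf (deg l j) (mul l) (nuj j) s)) \<partial>lborel)
      = (\<integral>\<^sup>+s. ennreal (indicator {0..1} s * jf (deg l j) (mul l) (nuj j) s) \<partial>lborel)"
    by (intro nn_integral_cong) (auto simp: indicator_def)
  also have "\<dots> = ennreal (Jc l j)" unfolding Jc_def by (rule jac.nn_f[OF jac])
  finally show ?thesis using Jc_pos[of l j] by (simp add: mass_def flip: ennreal_mult)
qed

definition VV :: "nat \<times> nat \<times> nat \<times> nat \<Rightarrow> (real^'n) \<times> (real^'m) \<Rightarrow> complex" where
  "VV = (\<lambda>(l, j, a, b) (x, y). Y l a x * Z j b y)"

lemma VV_orthonormal: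
  assumes "\<iota> \<in> idx" "\<kappa> \<in> idx"
  shows "integrable SS (\<lambda>w. VV \<iota> w * cnj (VV \<kappa> w))"
    "(LINT w|SS. VV \<iota> w * cnj (VV \<kappa> w)) = (if \<iota> = \<kappa> then 1 else 0)"
proof -
  obtain l j a b where i: "\<iota> = (l, j, a, b)" by (metis prod_cases4)
  obtain l' j' a' b' where i': "\<kappa> = (l', j', a', b')" by (metis prod_cases4)
  have a: "a \<in> dY l" "b \<in> dZ j" "a' \<in> dY l'" "b' \<in> dZ j'" using assms by (auto simp: idx_def i i')
  obtain A1 where A1: "\<And>w. cmod (Y l a w) \<le> A1" using Y_bounded[OF Y, of a l] a by (auto simp: dY_def)
  obtain A2 where A2: "\<And>w. cmod (Y l' a' w) \<le> A2" using Y_bounded[OF Y, of a' l'] a by (auto simp: dY_def)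
  obtain B1 where B1: "\<And>w. cmod (Z j b w) \<le> B1" using Y_bounded[OF Z, of b j] a by (auto simp: dZ_def)
  obtain B2 where B2: "\<And>w. cmod (Z j' b' w) \<le> B2" using Y_bounded[OF Z, of b' j'] a by (auto simp: dZ_def)
  have Yb: "Y l a \<in> borel_measurable surface_measure" "Y l' a' \<in> borel_measurable surface_measure"
    using Y_borel[OF Y, of a l] Y_borel[OF Y, of a' l'] a by (auto simp: dY_def intro: borel_surface_measure)
  have Zb: "Z j b \<in> borel_measurable surface_measure" "Z j' b' \<in> borel_measurable surface_measure"
    using Y_borel[OF Z, of b j] Y_borel[OF Z, of b' j'] a by (auto simp: dZ_def intro: borel_surface_measure)
  define f where "f x = Y l a x * cnj (Y l' a' x)" for x
  define g where "g y = Z j b y * cnj (Z j' b' y)" for y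
  have fm: "f \<in> borel_measurable surface_measure" "g \<in> borel_measurable surface_measure"
    unfolding f_def[abs_def] g_def[abs_def] using Yb Zb by (auto intro!: borel_measurable_times cnj_measurable)
  have fb: "norm (f x) \<le> A1 * A2" for x
    unfolding f_def norm_mult complex_mod_cnj using A1 A2 order_trans[OF norm_ge_zero A1] by (intro mult_mono) auto
  have gb: "norm (g x) \<le> B1 * B2" for x
    unfolding g_def norm_mult complex_mod_cnj using B1 B2 order_trans[OF norm_ge_zero B1] by (intro mult_mono) auto
  have e: "VV \<iota> w * cnj (VV \<kappa> w) = (case w of (x, y) \<Rightarrow> f x * g y)" for w
    by (cases w) (simp add: VV_def i i' f_def g_def)
  have I: "(LINT x|surface_measure. f x) = (if l = l' \<and> a = a' then 1 else 0)" "(LINT x|surface_measure. g x) = (if j = j' \<and> b = b' then 1 else 0)"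
    unfolding f_def g_def
    by (rule Y_orthonormal[OF Y a(1)[unfolded dY_def] a(3)[unfolded dY_def]], rule Y_orthonormal[OF Z a(2)[unfolded dZ_def] a(4)[unfolded dZ_def]])
  show "integrable SS (\<lambda>w. VV \<iota> w * cnj (VV \<kappa> w))"
    unfolding e by (rule SS_product_integral[OF fm fb gb])
  show "(LINT w|SS. VV \<iota> w * cnj (VV \<kappa> w)) = (if \<iota> = \<kappa> then 1 else 0)"
    unfolding e SS_product_integral(2)[OF fm fb gb] I by (auto simp: i i')
qed

text \<open>A weight depending on \<phi> alone does not mix indices: for fixed k the Jacobi degree
  is determined by l and j, so distinct indices differ in a spherical factor and are orthogonal on
  the product of the spheres at every fixed \<phi>. This diagonal form reduces weighted norms to
  moments.\<close>

lemma parseval: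
  assumes G[measurable]: "G \<in> borel_measurable borel" and A: "A \<subseteq> idx"
  shows "(\<integral>\<^sup>+z. G ((sin (phi \<alpha> z))\<^sup>2) * ennreal ((cmod (\<Sum>\<iota>\<in>A. c \<iota> * u \<iota> z))\<^sup>2) \<partial>DD)
    = (\<Sum>\<iota>\<in>A. ennreal ((cmod (c \<iota>))\<^sup>2) * mass G (fst \<iota>) (fst (snd \<iota>)))"
proof -
  have fA: "finite A" using A finite_idx finite_subset by blast
  define H where "H \<iota> t = hn (fst \<iota>) (fst (snd \<iota>)) t" for \<iota> :: "nat \<times> nat \<times> nat \<times> nat" and t
  have [measurable]: "phi \<alpha> \<in> borel_measurable DD" by (rule phi_borel)
  have "(\<lambda>z. \<Sum>\<iota>\<in>A. c \<iota> * u \<iota> z) \<in> borel_measurable DD"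
    using u_borel A by (intro borel_measurable_sum borel_measurable_times borel_measurable_const) auto
  then have m: "(\<lambda>z. G ((sin (phi \<alpha> z))\<^sup>2) * ennreal ((cmod (\<Sum>\<iota>\<in>A. c \<iota> * u \<iota> z))\<^sup>2)) \<in> borel_measurable DD"
    by measurable
  have "(\<integral>\<^sup>+z. G ((sin (phi \<alpha> z))\<^sup>2) * ennreal ((cmod (\<Sum>\<iota>\<in>A. c \<iota> * u \<iota> z))\<^sup>2) \<partial>DD)
     = (\<integral>\<^sup>+t. (\<integral>\<^sup>+w. G ((sin t)\<^sup>2) * ennreal ((cmod (\<Sum>\<iota>\<in>A. (c \<iota> * of_real (H \<iota> t)) * VV \<iota> w))\<^sup>2) \<partial>SS) \<partial>nu CARD('n) CARD('m) \<alpha>)"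
  proof (rule nn_integral_dOmega'[OF m])
    fix t and w1 :: "real^'n" and w2 :: "real^'m"
    assume t: "0 < t" "t < pi / 2" "norm w1 = 1" "norm w2 = 1"
    have "u \<iota> (polar \<alpha> (t, w1, w2)) = of_real (H \<iota> t) * VV \<iota> (w1, w2)" for \<iota>
      using u_polar[OF t] by (cases \<iota>) (auto simp: H_def VV_def)
    then have s: "(\<Sum>\<iota>\<in>A. c \<iota> * u \<iota> (polar \<alpha> (t, w1, w2))) = (\<Sum>\<iota>\<in>A. (c \<iota> * of_real (H \<iota> t)) * VV \<iota> (w1, w2))"
      by (simp add: mult.assoc)
    show "G ((sin (phi \<alpha> (polar \<alpha> (t, w1, w2))))\<^sup>2) * ennreal ((cmod (\<Sum>\<iota>\<in>A. c \<iota> * u \<iota> (polar \<alpha> (t, w1, w2))))\<^sup>2)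
       = G ((sin t)\<^sup>2) * ennreal ((cmod (\<Sum>\<iota>\<in>A. (c \<iota> * of_real (H \<iota> t)) * VV \<iota> (w1, w2)))\<^sup>2)"
      unfolding s polar_coords(2)[OF t] ..
  qed
  also have "\<dots> = (\<integral>\<^sup>+t. (\<Sum>\<iota>\<in>A. ennreal ((cmod (c \<iota>))\<^sup>2 * (2 / Jc (fst \<iota>) (fst (snd \<iota>)))) * 
        (G ((sin t)\<^sup>2) * ennreal ((h_fun CARD('n) CARD('m) \<alpha> (deg (fst \<iota>) (fst (snd \<iota>))) (fst \<iota>) (fst (snd \<iota>)) t)\<^sup>2))) \<partial>nu CARD('n) CARD('m) \<alpha>)"
  \<comment> \<open>At a fixed angle the values of \<open>hn\<close> are part of the coefficients,
    and Parseval's identity on the product of the spheres applies.\<close>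
  proof (intro nn_integral_cong)
    fix t
    have o: "integrable SS (\<lambda>w. VV \<iota> w * cnj (VV \<kappa> w))" "(LINT w|SS. VV \<iota> w * cnj (VV \<kappa> w)) = (if \<iota> = \<kappa> then 1 else 0)"
      if "\<iota> \<in> A" "\<kappa> \<in> A" for \<iota> \<kappa> using VV_orthonormal that A by blast+
    have P: "integrable SS (\<lambda>w. (cmod (\<Sum>\<iota>\<in>A. (c \<iota> * of_real (H \<iota> t)) * VV \<iota> w))\<^sup>2)"
      "(LINT w|SS. (cmod (\<Sum>\<iota>\<in>A. (c \<iota> * of_real (H \<iota> t)) * VV \<iota> w))\<^sup>2) = (\<Sum>\<iota>\<in>A. (cmod (c \<iota> * of_real (H \<iota> t)))\<^sup>2)"
      using parseval_finite[OF fA o, of "\<lambda>\<iota>. c \<iota> * of_real (H \<iota> t)"] by blast+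
    have "(\<integral>\<^sup>+w. G ((sin t)\<^sup>2) * ennreal ((cmod (\<Sum>\<iota>\<in>A. (c \<iota> * of_real (H \<iota> t)) * VV \<iota> w))\<^sup>2) \<partial>SS)
      = G ((sin t)\<^sup>2) * (\<integral>\<^sup>+w. ennreal ((cmod (\<Sum>\<iota>\<in>A. (c \<iota> * of_real (H \<iota> t)) * VV \<iota> w))\<^sup>2) \<partial>SS)"
      by (intro nn_integral_cmult measurable_compose[OF borel_measurable_integrable[OF P(1)] measurable_ennreal])
    also have "\<dots> = G ((sin t)\<^sup>2) * ennreal (\<Sum>\<iota>\<in>A. (cmod (c \<iota> * of_real (H \<iota> t)))\<^sup>2)"
      using nn_integral_eq_integral[OF P(1)] P(2) by simp
    also have "\<dots> = G ((sin t)\<^sup>2) * (\<Sum>\<iota>\<in>A. ennreal ((cmod (c \<iota> * of_real (H \<iota> t)))\<^sup>2))" by (subst sum_ennreal) auto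
    also have "\<dots> = (\<Sum>\<iota>\<in>A. ennreal ((cmod (c \<iota>))\<^sup>2 * (2 / Jc (fst \<iota>) (fst (snd \<iota>)))) * 
        (G ((sin t)\<^sup>2) * ennreal ((h_fun CARD('n) CARD('m) \<alpha> (deg (fst \<iota>) (fst (snd \<iota>))) (fst \<iota>) (fst (snd \<iota>)) t)\<^sup>2)))"
      unfolding sum_distrib_left
    proof (intro sum.cong refl)
      fix \<iota> :: "nat \<times> nat \<times> nat \<times> nat"
      have "(cmod (c \<iota> * of_real (H \<iota> t)))\<^sup>2 = ((cmod (c \<iota>))\<^sup>2 * (2 / Jc (fst \<iota>) (fst (snd \<iota>)))) * (h_fun CARD('n) CARD('m) \<alpha> (deg (fst \<iota>) (fst (snd \<iota>))) (fst \<iota>) (fst (snd \<iota>)) t)\<^sup>2"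
        using Jc_pos[of "fst \<iota>" "fst (snd \<iota>)"] unfolding norm_mult norm_of_real power_mult_distrib power2_abs
        by (simp add: H_def hn_def power_divide)
      then show "G ((sin t)\<^sup>2) * ennreal ((cmod (c \<iota> * of_real (H \<iota> t)))\<^sup>2) = ennreal ((cmod (c \<iota>))\<^sup>2 * (2 / Jc (fst \<iota>) (fst (snd \<iota>)))) * 
        (G ((sin t)\<^sup>2) * ennreal ((h_fun CARD('n) CARD('m) \<alpha> (deg (fst \<iota>) (fst (snd \<iota>))) (fst \<iota>) (fst (snd \<iota>)) t)\<^sup>2))"
        using Jc_pos[of "fst \<iota>" "fst (snd \<iota>)"] by (simp only:) (subst ennreal_mult, auto simp only: mult_ac, auto)
    qed
    finally show "(\<integral>\<^sup>+w. G ((sin t)\<^sup>2) * ennreal ((cmod (\<Sum>\<iota>\<in>A. (c \<iota> * of_real (H \<iota> t)) * VV \<iota> w))\<^sup>2) \<partial>SS)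
      = (\<Sum>\<iota>\<in>A. ennreal ((cmod (c \<iota>))\<^sup>2 * (2 / Jc (fst \<iota>) (fst (snd \<iota>)))) * 
        (G ((sin t)\<^sup>2) * ennreal ((h_fun CARD('n) CARD('m) \<alpha> (deg (fst \<iota>) (fst (snd \<iota>))) (fst \<iota>) (fst (snd \<iota>)) t)\<^sup>2)))" .
  qed
  also have "\<dots> = (\<Sum>\<iota>\<in>A. ennreal ((cmod (c \<iota>))\<^sup>2) * mass G (fst \<iota>) (fst (snd \<iota>)))"
  proof (subst nn_integral_sum)
    show "(\<Sum>\<iota>\<in>A. (\<integral>\<^sup>+t. ennreal ((cmod (c \<iota>))\<^sup>2 * (2 / Jc (fst \<iota>) (fst (snd \<iota>)))) * 
        (G ((sin t)\<^sup>2) * ennreal ((h_fun CARD('n) CARD('m) \<alpha> (deg (fst \<iota>) (fst (snd \<iota>))) (fst \<iota>) (fst (snd \<iota>)) t)\<^sup>2)) \<partial>nu CARD('n) CARD('m) \<alpha>))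
       = (\<Sum>\<iota>\<in>A. ennreal ((cmod (c \<iota>))\<^sup>2) * mass G (fst \<iota>) (fst (snd \<iota>)))"
    proof (intro sum.cong refl)
      fix \<iota> :: "nat \<times> nat \<times> nat \<times> nat"
      let ?l = "fst \<iota>" and ?j = "fst (snd \<iota>)"
      let ?X = "\<integral>\<^sup>+s. indicator {0..1} s * (G s * ennreal (jf (deg ?l ?j) (mul ?l) (nuj ?j) s)) \<partial>lborel"
      have "(\<integral>\<^sup>+t. ennreal ((cmod (c \<iota>))\<^sup>2 * (2 / Jc ?l ?j)) * 
        (G ((sin t)\<^sup>2) * ennreal ((h_fun CARD('n) CARD('m) \<alpha> (deg ?l ?j) ?l ?j t)\<^sup>2)) \<partial>nu CARD('n) CARD('m) \<alpha>)
        = ennreal ((cmod (c \<iota>))\<^sup>2 * (2 / Jc ?l ?j)) * (ennreal (1 / 2) * ?X)"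
        unfolding mul_def nuj_def nn_integral_h_sq[OF G m2, symmetric]
        by (intro nn_integral_cmult borel_measurable_nu) measurable
      also have "\<dots> = (ennreal ((cmod (c \<iota>))\<^sup>2 * (2 / Jc ?l ?j)) * ennreal (1 / 2)) * ?X" by (simp only: mult.assoc)
      also have "ennreal ((cmod (c \<iota>))\<^sup>2 * (2 / Jc ?l ?j)) * ennreal (1 / 2) = ennreal (((cmod (c \<iota>))\<^sup>2 * (2 / Jc ?l ?j)) * (1 / 2))"
        using Jc_pos[of ?l ?j] by (intro ennreal_mult[symmetric]) auto
      also have "((cmod (c \<iota>))\<^sup>2 * (2 / Jc ?l ?j)) * (1 / 2) = (cmod (c \<iota>))\<^sup>2 * (1 / Jc ?l ?j)" by simp
      also have "ennreal \<dots> = ennreal ((cmod (c \<iota>))\<^sup>2) * ennreal (1 / Jc ?l ?j)"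
        using Jc_pos[of ?l ?j] by (intro ennreal_mult) auto
      finally show "(\<integral>\<^sup>+t. ennreal ((cmod (c \<iota>))\<^sup>2 * (2 / Jc ?l ?j)) * 
        (G ((sin t)\<^sup>2) * ennreal ((h_fun CARD('n) CARD('m) \<alpha> (deg ?l ?j) ?l ?j t)\<^sup>2)) \<partial>nu CARD('n) CARD('m) \<alpha>)
        = ennreal ((cmod (c \<iota>))\<^sup>2) * mass G ?l ?j" by (simp only: mass_def mult.assoc)
    qed
  qed (intro borel_measurable_nu, measurable)
  finally show ?thesis .
qed

lemma parseval_1:
  assumes A: "A \<subseteq> idx"
  shows "(\<integral>\<^sup>+z. ennreal ((cmod (\<Sum>\<iota>\<in>A. c \<iota> * u \<iota> z))\<^sup>2) \<partial>DD) = ennreal (\<Sum>\<iota>\<in>A. (cmod (c \<iota>))\<^sup>2)"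
  using parseval[OF _ A, of "\<lambda>_. 1" c] by (simp add: mass_1 sum_ennreal)

lemma integrable_u:
  assumes "\<iota> \<in> idx" "\<kappa> \<in> idx"
  shows "integrable DD (\<lambda>z. u \<iota> z * cnj (u \<kappa> z))"
proof -
  obtain A where A: "\<And>w. cmod (u \<iota> w) \<le> A" using u_bounded[OF assms(1)] by blast
  obtain B where B: "\<And>w. cmod (u \<kappa> w) \<le> B" using u_bounded[OF assms(2)] by blast
  have [measurable]: "u \<iota> \<in> borel_measurable DD" "u \<kappa> \<in> borel_measurable DD" using assms by (auto intro: u_borel)
  show ?thesis
  proof (rule finite_measure.integrable_const_bound[OF finite_DD, where B = "A * B"])
    have "norm (u \<iota> z * cnj (u \<kappa> z)) \<le> A * B" for z
      unfolding norm_mult complex_mod_cnj using A B order_trans[OF norm_ge_zero A] by (intro mult_mono) auto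
    then show "AE z in DD. norm (u \<iota> z * cnj (u \<kappa> z)) \<le> A * B" by simp
  next
    show "(\<lambda>z. u \<iota> z * cnj (u \<kappa> z)) \<in> borel_measurable DD"
      by (intro borel_measurable_times cnj_measurable) auto
  qed
qed

lemma u_orthonormal:
  assumes "\<iota> \<in> idx" "\<kappa> \<in> idx"
  shows "(LINT z|DD. u \<iota> z * cnj (u \<kappa> z)) = (if \<iota> = \<kappa> then 1 else 0)"
proof (cases "\<iota> = \<kappa>")
  case True
  have [measurable]: "u \<iota> \<in> borel_measurable DD" using assms by (auto intro: u_borel)
  have "(\<integral>\<^sup>+z. ennreal ((cmod (u \<iota> z))\<^sup>2) \<partial>DD) = 1"
    using parseval_1[of "{\<iota>}" "\<lambda>_. 1"] assms by simp
  then have "(LINT z|DD. (cmod (u \<iota> z))\<^sup>2) = 1"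
    by (subst integral_eq_nn_integral) auto
  moreover have "u \<iota> z * cnj (u \<kappa> z) = complex_of_real ((cmod (u \<iota> z))\<^sup>2)" for z
    unfolding True by (rule complex_norm_square[symmetric])
  ultimately show ?thesis using True by (simp only: integral_complex_of_real) simp
next
  case False
  then show ?thesis
    using assms polarization_orthonormal[OF False u_borel u_borel parseval_1 integrable_u] by auto
qed

lemma u_inj: "inj_on u idx"
proof (rule inj_onI, rule ccontr)
  fix \<iota> \<kappa> assume a: "\<iota> \<in> idx" "\<kappa> \<in> idx" "u \<iota> = u \<kappa>" "\<iota> \<noteq> \<kappa>"
  then show False using u_orthonormal[of \<iota> \<kappa>] u_orthonormal[of \<kappa> \<kappa>] by simp
qed

lemma u_independent: "cvs.independent (u ` idx)"
proof (rule cvs.independent_if_scalars_zero)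
  fix f x assume s: "(\<Sum>x\<in>u ` idx. cscale (f x) x) = 0" and x: "x \<in> u ` idx"
  obtain \<iota> where i: "\<iota> \<in> idx" "x = u \<iota>" using x by blast
  have "(\<Sum>\<iota>\<in>idx. cscale (f (u \<iota>)) (u \<iota>)) = 0"
    using s by (simp add: sum.reindex[OF u_inj])
  then have "(\<Sum>\<iota>\<in>idx. cscale (f (u \<iota>)) (u \<iota>)) z = 0" for z by simp
  then have "(\<Sum>\<iota>\<in>idx. f (u \<iota>) * u \<iota> z) = 0" for z by (simp add: cscale_def fun_sum_apply)
  then have "ennreal (\<Sum>\<iota>\<in>idx. (cmod (f (u \<iota>)))\<^sup>2) = 0"
    unfolding parseval_1[OF order_refl, symmetric] by simp
  then have "(\<Sum>\<iota>\<in>idx. (cmod (f (u \<iota>)))\<^sup>2) = 0" by (simp add: sum_nonneg ennreal_eq_0_iff order_antisym)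
  then show "f x = 0" using finite_idx i by (simp add: sum_nonneg_eq_0_iff)
qed (use finite_idx in simp)

lemma H_space_eq: "H_space \<alpha> Y Z k = cspan (u ` idx)"
proof -
  define gen where "gen = (\<lambda>(N, l, j, a, b) (w :: (real^'n) \<times> (real^'m)). if w \<in> Omega \<alpha>
           then of_real (h_fun CARD('n) CARD('m) \<alpha> N l j (phi \<alpha> w)) *
                Y l a (sgn (fst w)) * Z j b (sgn (snd w))
           else 0)"
  define S where "S = {(N, l, j, a, b). l \<le> k \<and> j \<le> k \<and> ktilde \<alpha> k l j = real N \<and> a \<in> dY l \<and> b \<in> dZ j}"
  have H: "H_space \<alpha> Y Z k = cspan (gen ` S)"
    unfolding H_space_def
  proof (rule arg_cong[where f = cspan], rule set_eqI, rule iffI, goal_cases)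
    case (1 x)
    then obtain N l j a b where "x = gen (N, l, j, a, b)" "(N, l, j, a, b) \<in> S"
      unfolding gen_def S_def dY_def dZ_def by auto
    then show ?case by blast
  next
    case (2 x)
    then obtain N l j a b where x: "x = gen (N, l, j, a, b)" and s: "(N, l, j, a, b) \<in> S" by auto
    show ?case
      unfolding mem_Collect_eq
      by (rule exI[of _ N], rule exI[of _ l], rule exI[of _ j], rule exI[of _ a], rule exI[of _ b])
        (use x s in \<open>simp add: gen_def S_def dY_def dZ_def\<close>)
  qed
  have g: "gen (deg l j, l, j, a, b) = cscale (of_real (sqrt (Jc l j / 2))) (u (l, j, a, b))" for l j a b
    using Jc_pos[of l j] by (auto simp: gen_def u_def cscale_def hn_def fun_eq_iff)
  have g': "u (l, j, a, b) = cscale (of_real (1 / sqrt (Jc l j / 2))) (gen (deg l j, l, j, a, b))" for l j a b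
    using Jc_pos[of l j] by (auto simp: gen_def u_def cscale_def hn_def fun_eq_iff)
  have "gen ` S \<subseteq> cspan (u ` idx)"
  proof (rule image_subsetI)
    fix s assume s: "s \<in> S"
    obtain N l j a b where e: "s = (N, l, j, a, b)" by (metis prod_cases5)
    have "N = deg l j" "(l, j, a, b) \<in> idx" using s by (auto simp: e S_def deg_def idx_def adm_def)
    then show "gen s \<in> cspan (u ` idx)" unfolding e using g by (metis cvs.span_base cvs.span_scale imageI)
  qed
  moreover have "u ` idx \<subseteq> cspan (gen ` S)"
  proof (rule image_subsetI)
    fix \<iota> assume s: "\<iota> \<in> idx"
    obtain l j a b where e: "\<iota> = (l, j, a, b)" by (metis prod_cases4)
    have "(deg l j, l, j, a, b) \<in> S" using s by (auto simp: e S_def deg_def idx_def adm_def)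
    then show "u \<iota> \<in> cspan (gen ` S)" unfolding e using g' by (metis cvs.span_base cvs.span_scale imageI)
  qed
  ultimately show ?thesis unfolding H by (simp add: cvs.span_eq)
qed

text \<open>The kernel is built from a basis e obtained by choice, of which only orthonormality and
  span are known. The choice succeeds because the u can be enumerated by its index set, and e is as
  good as u for estimates: combinations of e are combinations of u with the same sum of
  squares.\<close>

lemma G_kernel_basis:
  obtains e :: "nat \<Rightarrow> (real^'n) \<times> (real^'m) \<Rightarrow> complex" and I where "finite I" 
    "\<And>z \<zeta>. G_kernel \<alpha> Y Z k z \<zeta> = (\<Sum>i\<in>I. e i z * cnj (e i \<zeta>))"
    "\<And>b. \<exists>c. (\<forall>z. (\<Sum>i\<in>I. b i * e i z) = (\<Sum>\<iota>\<in>idx. c \<iota> * u \<iota> z)) \<and> (\<Sum>\<iota>\<in>idx. (cmod (c \<iota>))\<^sup>2) = (\<Sum>i\<in>I. (cmod (b i))\<^sup>2)"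
proof -
  define I where "I = {1..cdim (H_space \<alpha> Y Z k)}"
  define P where "P = orthonormal_basis DD (H_space \<alpha> Y Z k) I"
  have "cdim (H_space \<alpha> Y Z k) = card idx"
    unfolding H_space_eq by (simp add: cvs.dim_eq_card[OF refl u_independent] card_image[OF u_inj])
  then have "card I = card idx" by (simp add: I_def)
  then obtain h where h: "bij_betw h I idx"
    using finite_same_card_bij[of I idx] finite_idx by (auto simp: I_def)
  have "P (\<lambda>i. u (h i))"
    unfolding P_def orthonormal_basis_def
  proof (intro conjI ballI)
    fix i assume i: "i \<in> I"
    then have hi: "h i \<in> idx" using h by (auto simp: bij_betw_def)
    have "integrable DD (\<lambda>z. (cmod (u (h i) z))\<^sup>2)"
      using integrable_norm[OF integrable_u[OF hi hi]] by (simp add: norm_mult power2_eq_square)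
    then show "u (h i) \<in> Lp 2 DD" unfolding Lp_def using u_borel[OF hi] by simp
    fix j assume j: "j \<in> I"
    then have hj: "h j \<in> idx" using h by (auto simp: bij_betw_def)
    have "h i = h j \<longleftrightarrow> i = j" using h i j by (auto simp: bij_betw_def inj_on_eq_iff)
    then show "(LINT x|DD. u (h i) x * cnj (u (h j) x)) = (if i = j then 1 else 0)"
      using u_orthonormal[OF hi hj] by simp
  next
    have "(\<lambda>i. u (h i)) ` I = u ` idx" using h by (metis bij_betw_imp_surj_on image_image)
    then show "cspan ((\<lambda>i. u (h i)) ` I) = H_space \<alpha> Y Z k" unfolding H_space_eq by simp
  qed
  define e where "e = (SOME e. P e)"
  have e: "P e" unfolding e_def by (rule someI[of P]) fact
  have fI: "finite I" by (simp add: I_def)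
  have G: "G_kernel \<alpha> Y Z k z \<zeta> = (\<Sum>i\<in>I. e i z * cnj (e i \<zeta>))" for z \<zeta>
    unfolding G_kernel_def Let_def I_def e_def P_def ..
  have rep: "\<exists>c. \<forall>z. f z = (\<Sum>\<iota>\<in>idx. c \<iota> * u \<iota> z)" if "f \<in> H_space \<alpha> Y Z k" for f
  proof -
    have "f \<in> cspan (u ` idx)" using that by (simp add: H_space_eq)
    then obtain d where "f = (\<Sum>v\<in>u ` idx. cscale (d v) v)"
      using cvs.span_finite[of "u ` idx"] finite_idx by auto
    then have "f = (\<Sum>\<iota>\<in>idx. cscale (d (u \<iota>)) (u \<iota>))" by (simp add: sum.reindex[OF u_inj])
    then have "\<forall>z. f z = (\<Sum>\<iota>\<in>idx. d (u \<iota>) * u \<iota> z)" by (simp add: cscale_def fun_sum_apply)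
    then show ?thesis by (rule exI[where x = "\<lambda>\<iota>. d (u \<iota>)"])
  qed
  have B: "\<exists>c. (\<forall>z. (\<Sum>i\<in>I. b i * e i z) = (\<Sum>\<iota>\<in>idx. c \<iota> * u \<iota> z)) \<and> (\<Sum>\<iota>\<in>idx. (cmod (c \<iota>))\<^sup>2) = (\<Sum>i\<in>I. (cmod (b i))\<^sup>2)" for b
  proof -
    have eH: "e i \<in> H_space \<alpha> Y Z k" if "i \<in> I" for i
    proof -
      have "cspan (e ` I) = H_space \<alpha> Y Z k" using e by (simp add: P_def orthonormal_basis_def)
      then show ?thesis using cvs.span_base[of "e i" "e ` I"] that by blast
    qed
    have "(\<Sum>i\<in>I. cscale (b i) (e i)) \<in> H_space \<alpha> Y Z k"
      using eH unfolding H_space_def by (intro cvs.span_sum cvs.span_scale) auto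
    from rep[OF this] obtain c where c: "\<And>z. (\<Sum>i\<in>I. cscale (b i) (e i)) z = (\<Sum>\<iota>\<in>idx. c \<iota> * u \<iota> z)" by blast
    have c': "(\<Sum>i\<in>I. b i * e i z) = (\<Sum>\<iota>\<in>idx. c \<iota> * u \<iota> z)" for z
      using c[of z] by (simp add: cscale_def fun_sum_apply)
    have int: "integrable DD (\<lambda>z. e i z * cnj (e j z))" if ij: "i \<in> I" "j \<in> I" for i j
    proof -
      obtain ci where ci: "\<And>z. e i z = (\<Sum>\<iota>\<in>idx. ci \<iota> * u \<iota> z)" using rep[OF eH[OF ij(1)]] by blast
      obtain cj where cj: "\<And>z. e j z = (\<Sum>\<iota>\<in>idx. cj \<iota> * u \<iota> z)" using rep[OF eH[OF ij(2)]] by blast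
      have "e i z * cnj (e j z) = (\<Sum>\<iota>\<in>idx. \<Sum>\<kappa>\<in>idx. (ci \<iota> * cnj (cj \<kappa>)) * (u \<iota> z * cnj (u \<kappa> z)))" for z
        unfolding ci cj cnj_sum sum_product by (simp add: mult_ac)
      then show ?thesis
        by (simp only:) (intro Bochner_Integration.integrable_sum integrable_mult_right integrable_u)
    qed
    have "(LINT z|DD. (cmod (\<Sum>i\<in>I. b i * e i z))\<^sup>2) = (\<Sum>i\<in>I. (cmod (b i))\<^sup>2)"
      using e by (intro parseval_finite(2)[OF fI int]) (auto simp: P_def orthonormal_basis_def)
    moreover have "(LINT z|DD. (cmod (\<Sum>\<iota>\<in>idx. c \<iota> * u \<iota> z))\<^sup>2) = (\<Sum>\<iota>\<in>idx. (cmod (c \<iota>))\<^sup>2)"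
      by (rule parseval_finite(2)[OF finite_idx integrable_u u_orthonormal])
    ultimately show ?thesis using c' by auto
  qed
  show thesis by (rule that[OF fI G B])
qed

end

section \<open>From \<open>L\<^sup>2\<close>--\<open>L\<^sup>q\<close> to \<open>L\<^sup>p\<close>--\<open>L\<^sup>q\<close> bounds\<close>

text \<open>Let T map coefficients b to w times the sum of b_i e_i, with norm at most A from
  \<open>l2\<close> to \<open>Lq\<close>. Then F is T applied to the adjoint of T applied to g. With
  b the adjoint's value and E its square sum, Hoelder's inequality gives E \<le> A sqrt E times the
  p-norm of g, which bounds the adjoint by A as well.\<close>

lemma kernel_duality:
  fixes e :: "nat \<Rightarrow> 'a \<Rightarrow> complex" and w :: "'a \<Rightarrow> real" and g :: "'a \<Rightarrow> complex"
  assumes pq: "p > 1" "q > 1" "1 / p + 1 / q = 1" and I: "finite I"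
    and em: "\<And>i. i \<in> I \<Longrightarrow> e i \<in> borel_measurable M"
    and w [measurable]: "w \<in> borel_measurable M" and w0: "\<And>z. w z \<ge> 0" and A: "A > 0"
    and est: "\<And>b. (\<integral>\<^sup>+z. ennreal ((w z * cmod (\<Sum>i\<in>I. b i * e i z)) powr q) \<partial>M)
        \<le> ennreal (A powr q * (\<Sum>i\<in>I. (cmod (b i))\<^sup>2) powr (q / 2))"
    and g: "g \<in> Lp p M"
  defines "F \<equiv> \<lambda>z. of_real (w z) * (LINT \<zeta>|M. (\<Sum>i\<in>I. e i z * cnj (e i \<zeta>)) * (of_real (w \<zeta>) * g \<zeta>))"
  shows "F \<in> Lp q M" "Lp_norm q M F \<le> A\<^sup>2 * Lp_norm p M g"
proof -
  have gm [measurable]: "g \<in> borel_measurable M" and gi: "integrable M (\<lambda>z. norm (g z) powr p)"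
    using g by (auto simp: Lp_def)
  have bm: "(\<lambda>z. \<Sum>i\<in>I. b i * e i z) \<in> borel_measurable M" for b
    by (intro borel_measurable_sum borel_measurable_times borel_measurable_const em)
  have bI: "integrable M (\<lambda>z. (w z * cmod (\<Sum>i\<in>I. b i * e i z)) powr q)"
    and bN: "(LINT z|M. (w z * cmod (\<Sum>i\<in>I. b i * e i z)) powr q) \<le> A powr q * (\<Sum>i\<in>I. (cmod (b i))\<^sup>2) powr (q / 2)" for b
  proof -
    have [measurable]: "(\<lambda>z. \<Sum>i\<in>I. b i * e i z) \<in> borel_measurable M" by (rule bm)
    have fin: "(\<integral>\<^sup>+z. ennreal ((w z * cmod (\<Sum>i\<in>I. b i * e i z)) powr q) \<partial>M) < \<infinity>"
      by (rule le_less_trans[OF est]) simp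
    then show i: "integrable M (\<lambda>z. (w z * cmod (\<Sum>i\<in>I. b i * e i z)) powr q)"
      using fin by (intro integrableI_nonneg) auto
    have "ennreal (LINT z|M. (w z * cmod (\<Sum>i\<in>I. b i * e i z)) powr q) \<le> ennreal (A powr q * (\<Sum>i\<in>I. (cmod (b i))\<^sup>2) powr (q / 2))"
      using est[of b] by (subst nn_integral_eq_integral[OF i, symmetric]) auto
    then show "(LINT z|M. (w z * cmod (\<Sum>i\<in>I. b i * e i z)) powr q) \<le> A powr q * (\<Sum>i\<in>I. (cmod (b i))\<^sup>2) powr (q / 2)"
      by (subst (asm) ennreal_le_iff) auto
  qed
  have young: "x * y \<le> x powr q / q + y powr p / p" if "x \<ge> 0" "y \<ge> 0" for x y :: real
    using Youngs_inequality[OF pq(2,1) _ that] pq(3) by (simp add: add.commute)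
  have pairI: "integrable M (\<lambda>z. cnj (\<Sum>i\<in>I. b i * e i z) * (of_real (w z) * g z))" for b
  proof (rule Bochner_Integration.integrable_bound)
    show "integrable M (\<lambda>z. (w z * cmod (\<Sum>i\<in>I. b i * e i z)) powr q / q + cmod (g z) powr p / p)"
      using bI gi by auto
    show "(\<lambda>z. cnj (\<Sum>i\<in>I. b i * e i z) * (of_real (w z) * g z)) \<in> borel_measurable M"
      by (intro borel_measurable_times cnj_measurable bm) measurable
    have "norm (cnj (\<Sum>i\<in>I. b i * e i z) * (of_real (w z) * g z)) \<le> norm ((w z * cmod (\<Sum>i\<in>I. b i * e i z)) powr q / q + cmod (g z) powr p / p)" for z
    proof -
      have "norm (cnj (\<Sum>i\<in>I. b i * e i z) * (of_real (w z) * g z)) = (w z * cmod (\<Sum>i\<in>I. b i * e i z)) * cmod (g z)"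
        unfolding norm_mult complex_mod_cnj norm_of_real using w0[of z] by simp
      also have "\<dots> \<le> (w z * cmod (\<Sum>i\<in>I. b i * e i z)) powr q / q + cmod (g z) powr p / p"
        by (rule young) (auto simp: w0)
      finally show ?thesis by simp
    qed
    then show "AE z in M. norm (cnj (\<Sum>i\<in>I. b i * e i z) * (of_real (w z) * g z)) \<le> norm ((w z * cmod (\<Sum>i\<in>I. b i * e i z)) powr q / q + cmod (g z) powr p / p)"
      by simp
  qed
  have ei: "integrable M (\<lambda>z. cnj (e i z) * (of_real (w z) * g z))" if "i \<in> I" for i
  proof -
    have "(\<Sum>l\<in>I. (if l = i then 1 else 0) * e l z) = e i z" for z
      using that I by (simp add: if_distrib[where f = "\<lambda>x. x * _"] cong: if_cong)
    then show ?thesis using pairI[of "\<lambda>l. if l = i then 1 else 0"] by simp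
  qed
  define b where "b i = (LINT \<zeta>|M. cnj (e i \<zeta>) * (of_real (w \<zeta>) * g \<zeta>))" for i
  define f where "f z = (\<Sum>i\<in>I. b i * e i z)" for z
  define E where "E = (\<Sum>i\<in>I. (cmod (b i))\<^sup>2)"
  have E0: "E \<ge> 0" by (simp add: E_def sum_nonneg)
  have F: "F z = of_real (w z) * f z" for z
  proof -
    have "(LINT \<zeta>|M. (\<Sum>i\<in>I. e i z * cnj (e i \<zeta>)) * (of_real (w \<zeta>) * g \<zeta>)) = (LINT \<zeta>|M. (\<Sum>i\<in>I. e i z * (cnj (e i \<zeta>) * (of_real (w \<zeta>) * g \<zeta>))))"
      by (simp only: sum_distrib_right mult.assoc)
    also have "\<dots> = (\<Sum>i\<in>I. (LINT \<zeta>|M. e i z * (cnj (e i \<zeta>) * (of_real (w \<zeta>) * g \<zeta>))))"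
      by (intro Bochner_Integration.integral_sum integrable_mult_right ei)
    also have "\<dots> = f z" unfolding f_def b_def by (simp add: mult.commute)
    finally show ?thesis unfolding F_def by simp
  qed
  have fm [measurable]: "f \<in> borel_measurable M" unfolding f_def[abs_def] by (rule bm)
  have nF: "norm (F z) powr q = (w z * cmod (\<Sum>i\<in>I. b i * e i z)) powr q" for z
  proof -
    have "norm (F z) = \<bar>w z\<bar> * norm (f z)" by (simp only: F norm_mult norm_of_real)
    then show ?thesis using w0[of z] by (simp only: f_def abs_of_nonneg)
  qed
  have "F = (\<lambda>z. of_real (w z) * f z)" using F by blast
  then have "F \<in> borel_measurable M" by simp
  then show "F \<in> Lp q M" using bI[of b] by (simp add: Lp_def nF)
  let ?\<gamma> = "Lp_norm p M g"
  let ?G = "LINT z|M. norm (g z) powr p"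
  have G0: "?G \<ge> 0" by (intro integral_nonneg_AE) auto
  have \<gamma>: "?\<gamma> powr p = ?G" "?\<gamma> \<ge> 0" using G0 pq unfolding Lp_norm_def by (auto simp: powr_powr)
  have X: "(LINT z|M. (w z * cmod (f z)) powr q) \<le> (A * sqrt E) powr q"
  proof -
    have "(A * sqrt E) powr q = A powr q * E powr (q / 2)"
      using A E0 by (simp add: powr_mult powr_powr powr_half_sqrt[symmetric])
    then show ?thesis using bN[of b] by (simp add: f_def E_def)
  qed
  have fg: "integrable M (\<lambda>z. (w z * cmod (f z)) * cmod (g z))"
  proof -
    have "cmod (cnj (\<Sum>i\<in>I. b i * e i z) * (of_real (w z) * g z)) = (w z * cmod (f z)) * cmod (g z)" for z
      unfolding f_def norm_mult complex_mod_cnj norm_of_real using w0[of z] by simp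
    then show ?thesis using integrable_norm[OF pairI[of b]] by simp
  qed
  have EE: "E \<le> (LINT z|M. (w z * cmod (f z)) * cmod (g z))"
  proof -
    have "complex_of_real E = (\<Sum>i\<in>I. cnj (b i) * b i)"
      unfolding E_def of_real_sum by (intro sum.cong refl) (simp only: complex_norm_square mult.commute)
    also have "\<dots> = (\<Sum>i\<in>I. (LINT \<zeta>|M. cnj (b i) * (cnj (e i \<zeta>) * (of_real (w \<zeta>) * g \<zeta>))))"
      by (subst (2) b_def) simp
    also have "\<dots> = (LINT \<zeta>|M. (\<Sum>i\<in>I. cnj (b i) * (cnj (e i \<zeta>) * (of_real (w \<zeta>) * g \<zeta>))))"
      by (intro Bochner_Integration.integral_sum[symmetric] integrable_mult_right ei)
    also have "\<dots> = (LINT \<zeta>|M. cnj (f \<zeta>) * (of_real (w \<zeta>) * g \<zeta>))"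
      unfolding f_def cnj_sum complex_cnj_mult sum_distrib_right by (simp only: mult.assoc)
    finally have "E = cmod (LINT \<zeta>|M. cnj (f \<zeta>) * (of_real (w \<zeta>) * g \<zeta>))"
      using E0 by (metis norm_of_real abs_of_nonneg)
    also have "\<dots> \<le> (LINT \<zeta>|M. cmod (cnj (f \<zeta>) * (of_real (w \<zeta>) * g \<zeta>)))" by (rule integral_norm_bound)
    also have "\<dots> = (LINT z|M. (w z * cmod (f z)) * cmod (g z))"
      unfolding norm_mult complex_mod_cnj norm_of_real by (intro Bochner_Integration.integral_cong refl) (simp add: w0 mult_ac)
    finally show ?thesis .
  qed
  have sE: "sqrt E \<le> A * ?\<gamma>"
  proof (cases "E = 0")
    case True
    then show ?thesis using A \<gamma> by simp
  next
    case False
    then have Ep: "E > 0" using E0 by simp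
    \<comment> \<open>Hoelder's inequality by Young's inequality for normalised functions; the
      \<epsilon> in \<open>c\<close> keeps the divisor positive when the norm of g is 0.\<close>
    have "sqrt E \<le> A * ?\<gamma> + \<epsilon>" if e: "\<epsilon> > 0" for \<epsilon>
    proof -
      define a where "a = A * sqrt E"
      define c where "c = ?\<gamma> + \<epsilon> / A"
      have ac: "a > 0" "c > 0" using A Ep e \<gamma> by (auto simp: a_def c_def add_nonneg_pos)
      have Xa: "(LINT z|M. (w z * cmod (f z)) powr q) / a powr q \<le> 1"
        using X unfolding a_def[symmetric] by (rule divide_le_eq_1_pos[THEN iffD2, rotated]) (use ac in auto)
      have "?G \<le> c powr p" unfolding \<gamma>(1)[symmetric] using \<gamma>(2) e A pq by (intro powr_mono2) (auto simp: c_def)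
      then have Gc: "?G / c powr p \<le> 1" by (rule divide_le_eq_1_pos[THEN iffD2, rotated]) (use ac in auto)
      have i1: "integrable M (\<lambda>z. (w z * cmod (f z)) powr q)" using bI[of b] by (simp add: f_def)
      have "(LINT z|M. (w z * cmod (f z)) * cmod (g z)) \<le> (LINT z|M. a * c * ((w z * cmod (f z)) powr q / a powr q / q + cmod (g z) powr p / c powr p / p))"
      proof (rule integral_mono[OF fg])
        show "integrable M (\<lambda>z. a * c * ((w z * cmod (f z)) powr q / a powr q / q + cmod (g z) powr p / c powr p / p))"
          using i1 gi by auto
        fix z
        have "(w z * cmod (f z)) * cmod (g z) = a * c * ((w z * cmod (f z)) / a * (cmod (g z) / c))" using ac by simp
        also have "\<dots> \<le> a * c * (((w z * cmod (f z)) / a) powr q / q + (cmod (g z) / c) powr p / p)"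
          using ac w0[of z] by (intro mult_left_mono young) auto
        also have "\<dots> = a * c * ((w z * cmod (f z)) powr q / a powr q / q + cmod (g z) powr p / c powr p / p)"
          using ac w0[of z] by (simp add: powr_divide)
        finally show "(w z * cmod (f z)) * cmod (g z) \<le> a * c * ((w z * cmod (f z)) powr q / a powr q / q + cmod (g z) powr p / c powr p / p)" .
      qed
      also have "\<dots> = a * c * ((LINT z|M. (w z * cmod (f z)) powr q) / a powr q / q + ?G / c powr p / p)"
        using i1 gi by simp
      also have "\<dots> \<le> a * c * (1 / q + 1 / p)"
        using Xa Gc ac pq by (intro mult_left_mono add_mono divide_right_mono) auto
      also have "\<dots> = a * c" using pq by simp
      finally have "E \<le> a * c" using EE by linarith
      then have "sqrt E * sqrt E \<le> sqrt E * (A * c)" using E0 by (simp add: a_def mult_ac)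
      then have "sqrt E \<le> A * c" by (rule mult_left_le_imp_le) (use Ep in simp)
      then show ?thesis using A by (simp add: c_def algebra_simps)
    qed
    then show ?thesis by (rule field_le_epsilon)
  qed
  have "Lp_norm q M F = (LINT z|M. (w z * cmod (f z)) powr q) powr (1 / q)"
    unfolding Lp_norm_def nF f_def ..
  also have "\<dots> \<le> ((A * sqrt E) powr q) powr (1 / q)"
    using X pq by (intro powr_mono2) (auto intro!: integral_nonneg_AE)
  also have "\<dots> = A * sqrt E" using A E0 pq by (simp add: powr_powr)
  also have "\<dots> \<le> A * (A * ?\<gamma>)" using sE A by (intro mult_left_mono) auto
  finally show "Lp_norm q M F \<le> A\<^sup>2 * ?\<gamma>" by (simp add: power2_eq_square mult.assoc)
qed

section \<open>Kernel and moment estimates\<close>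

lemma sum_Sigma_pair:
  assumes "finite A" "\<And>x. x \<in> A \<Longrightarrow> finite (B x)"
  shows "(\<Sum>\<iota>\<in>Sigma A B. g \<iota>) = (\<Sum>x\<in>A. \<Sum>y\<in>B x. g (x, y))"
  using sum.Sigma[of A B "\<lambda>x y. g (x, y)"] assms by simp

lemma cmod_sum_sq_le:
  fixes c v :: "'i \<Rightarrow> complex"
  shows "(cmod (\<Sum>i\<in>A. c i * v i))\<^sup>2 \<le> (\<Sum>i\<in>A. (cmod (c i))\<^sup>2) * (\<Sum>i\<in>A. (cmod (v i))\<^sup>2)"
proof -
  have "cmod (\<Sum>i\<in>A. c i * v i) \<le> (\<Sum>i\<in>A. cmod (c i) * cmod (v i))"
    using norm_sum[of "\<lambda>i. c i * v i" A] by (simp add: norm_mult)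
  then have "(cmod (\<Sum>i\<in>A. c i * v i))\<^sup>2 \<le> (\<Sum>i\<in>A. cmod (c i) * cmod (v i))\<^sup>2"
    by (intro power_mono) auto
  also have "\<dots> \<le> (\<Sum>i\<in>A. (cmod (c i))\<^sup>2) * (\<Sum>i\<in>A. (cmod (v i))\<^sup>2)"
    by (rule Cauchy_Schwarz_ineq_sum)
  finally show ?thesis .
qed

locale grushin_est = grushin \<alpha> k Y Z
  for \<alpha> k :: nat
    and Y :: "nat \<Rightarrow> nat \<Rightarrow> real^'n::finite \<Rightarrow> complex"
    and Z :: "nat \<Rightarrow> nat \<Rightarrow> real^'m::finite \<Rightarrow> complex" +
  fixes \<tau> :: real
  assumes \<alpha>1: "\<alpha> \<ge> 1" and \<tau>0: "\<tau> \<ge> 0" and \<tau>1: "\<tau> + 1 / (real \<alpha> + 1) < 1"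
begin

text \<open>\<open>th\<close> is \<open>(q - 2) / 2\<close>, and \<open>KK\<close> is the value of \<open>2 N + \<mu> + (\<gamma> - 1) + 1\<close>, which is the same for
  all admissible \<open>l\<close> and \<open>j\<close>.\<close>

definition "ep = 1 / (real \<alpha> + 1)"
definition th :: real where "th = ep / (real CARD('n) + real CARD('m) - 2)"
definition KK :: real where "KK = real k * ep + (real CARD('n) - 2) * ep / 2 + real CARD('m) / 2"

lemma dims: "real CARD('n) \<ge> 2" "real CARD('m) \<ge> 2" using n2 m2 by auto

lemma ep: "ep > 0" "ep \<le> 1 / 2"
  using \<alpha>1 by (auto simp: ep_def field_simps)

lemma ep_mult: "(real \<alpha> + 1) * ep = 1"
proof -
  have "real \<alpha> + 1 \<noteq> 0" by linarith
  then show ?thesis by (simp only: ep_def mult_1_right times_divide_eq_right divide_self[OF \<open>real \<alpha> + 1 \<noteq> 0\<close>])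
qed

lemma ep_div: "x / (2 * (real \<alpha> + 1)) = x * ep / 2"
  by (simp add: ep_def mult.commute)

lemma th: "th > 0" "th \<le> 1 / 4" "th * (real CARD('n) + real CARD('m) - 2) = ep"
proof -
  have D: "real CARD('n) + real CARD('m) - 2 \<ge> 2" using dims by linarith
  then show "th > 0" using ep by (simp add: th_def)
  have "th \<le> ep / 2" unfolding th_def using D ep by (intro divide_left_mono) auto
  then show "th \<le> 1 / 4" using ep by simp
  show "th * (real CARD('n) + real CARD('m) - 2) = ep" using D by (simp add: th_def)
qed

lemma KK1: "KK \<ge> 1"
proof -
  have "real k * ep \<ge> 0" "(real CARD('n) - 2) * ep / 2 \<ge> 0" using ep dims by auto
  then show ?thesis using dims unfolding KK_def by linarith
qed

lemma mul_eq: "mul l = (real CARD('n) - 2) * ep / 2 + real l * ep"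
  unfolding mul_def mu_par_def ep_div by (simp add: algebra_simps add_divide_distrib diff_divide_distrib)

lemma nuj_eq: "nuj j = real j + real CARD('m) / 2 - 1"
  by (simp add: nuj_def nu_par_def)

text \<open>Admissibility means 2 N = k \<epsilon> - l \<epsilon> - j, while \<mu> contributes l
  \<epsilon> and the second parameter contributes j, so both indices cancel in \<open>jac.K\<close>.
  As N \<ge> 0, the same identity limits j.\<close>

lemma adm_D:
  assumes "adm l j"
  shows "real j + 1 \<le> KK" "l \<le> k" "jac.K (deg l j) (mul l) (nuj j) = KK"
proof -
  obtain N where N: "ktilde \<alpha> k l j = real N" and l: "l \<le> k" using assms by (auto simp: adm_def)
  have "real k - real l - real j * (real \<alpha> + 1) = real N * (2 * (real \<alpha> + 1))"
    using N unfolding ktilde_def by (simp add: field_simps)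
  then have "(real k - real l - real j * (real \<alpha> + 1)) * ep = real N * (2 * (real \<alpha> + 1)) * ep" by simp
  moreover have A: "(x - y - w * a) * ep = x * ep - y * ep - w * (a * ep)" "v * (2 * a) * ep = 2 * v * (a * ep)" for x y w v a :: real
    by (simp_all add: algebra_simps)
  ultimately have e: "2 * real N = real k * ep - real l * ep - real j"
    unfolding A ep_mult by simp
  show "l \<le> k" by (rule l)
  have "real l * ep \<ge> 0" "(real CARD('n) - 2) * ep / 2 \<ge> 0" using ep dims by auto
  then show "real j + 1 \<le> KK" using e dims unfolding KK_def by linarith
  have "deg l j = N" by (simp add: deg_def N)
  then have "jac.K (deg l j) (mul l) (nuj j) = 2 * real N + mul l + nuj j + 1"
    using jac.K_def[OF jac, of N] by simp
  also have "\<dots> = KK" unfolding e mul_eq nuj_eq KK_def by simp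
  finally show "jac.K (deg l j) (mul l) (nuj j) = KK" .
qed

lemma k_le: "real k + 1 \<le> (real \<alpha> + 1) * KK"
proof -
  have "real k = (real \<alpha> + 1) * (real k * ep)" using ep_mult by (metis mult.left_commute mult_1_right)
  moreover have "(real \<alpha> + 1) * (real k * ep + 1) \<le> (real \<alpha> + 1) * KK"
  proof (rule mult_left_mono)
    have "(real CARD('n) - 2) * ep / 2 \<ge> 0" using ep dims by auto
    then show "real k * ep + 1 \<le> KK" using dims unfolding KK_def by linarith
  qed simp
  ultimately show ?thesis by (simp only: distrib_left mult_1_right)
qed

lemma AE_phi: "AE z in DD. 0 < phi \<alpha> z \<and> phi \<alpha> z < pi / 2"
proof -
  have [measurable]: "phi \<alpha> \<in> borel_measurable DD" by (rule phi_borel)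
  have m: "(\<lambda>z. indicator {z \<in> space DD. \<not> (0 < phi \<alpha> z \<and> phi \<alpha> z < pi / 2)} z :: ennreal) \<in> borel_measurable DD"
    by measurable
  have "(\<integral>\<^sup>+z. indicator {z \<in> space DD. \<not> (0 < phi \<alpha> z \<and> phi \<alpha> z < pi / 2)} z \<partial>DD)
     = (\<integral>\<^sup>+t. (\<integral>\<^sup>+w. 0 \<partial>(SS :: ((real^'n) \<times> (real^'m)) measure)) \<partial>nu CARD('n) CARD('m) \<alpha>)"
    by (rule nn_integral_dOmega'[OF m]) (simp add: polar_coords)
  then have "emeasure DD {z \<in> space DD. \<not> (0 < phi \<alpha> z \<and> phi \<alpha> z < pi / 2)} = 0" by simp
  then show ?thesis by (subst AE_iff_measurable[OF _ refl]) auto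
qed

definition pc :: "nat set \<Rightarrow> (nat \<times> nat \<times> nat \<times> nat) set" where
  "pc \<Lambda> = {\<iota> \<in> idx. fst \<iota> \<in> \<Lambda>}"

lemma pc_sub: "pc \<Lambda> \<subseteq> idx" by (auto simp: pc_def)

lemma hn_sq:
  assumes t: "0 < t" "t < pi / 2" and s: "s = (sin t)\<^sup>2"
    and Q: "jf (deg l j) (mul l) (nuj j) s \<le> Q * Jc l j"
  shows "(hn l j t)\<^sup>2 \<le> 2 * (Q * s powr - ((real CARD('n) - 2) * ep / 2) * (1 - s) powr - ((real CARD('m) - 2) / 2))"
proof -
  have sc: "sin t > 0" "cos t > 0" using t by (auto intro: sin_gt_zero cos_gt_zero)
  have s01: "0 < s" "0 < 1 - s" using sc unfolding s by (auto simp: cos_squared_eq[symmetric])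
  have a: "(real CARD('n) - 2) / (2 * (real \<alpha> + 1)) = (real CARD('n) - 2) * ep / 2" by (rule ep_div)
  define w where "w = s powr ((real CARD('n) - 2) * ep / 2) * (1 - s) powr ((real CARD('m) - 2) / 2)"
  have w: "w > 0" using s01 by (simp add: w_def)
  have wi: "s powr - ((real CARD('n) - 2) * ep / 2) * (1 - s) powr - ((real CARD('m) - 2) / 2) = 1 / w"
    unfolding w_def by (simp add: powr_minus field_simps)
  let ?h = "h_fun CARD('n) CARD('m) \<alpha> (deg l j) l j t"
  have e: "?h\<^sup>2 * w = jf (deg l j) (mul l) (nuj j) s"
    using h_sq_eq[OF t, of "CARD('n)" "CARD('m)" \<alpha> "deg l j" l j] unfolding w_def s mul_def nuj_def a .
  have "(hn l j t)\<^sup>2 = ?h\<^sup>2 / (Jc l j / 2)" using Jc_pos[of l j] by (simp add: hn_def power_divide)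
  also have "\<dots> = 2 * (jf (deg l j) (mul l) (nuj j) s / Jc l j) / w"
    unfolding e[symmetric] using w by simp
  also have "\<dots> \<le> 2 * Q / w"
    using Q w Jc_pos[of l j] by (intro divide_right_mono mult_left_mono) (auto simp: pos_divide_le_eq)
  also have "\<dots> = 2 * (Q * s powr - ((real CARD('n) - 2) * ep / 2) * (1 - s) powr - ((real CARD('m) - 2) / 2))"
    unfolding mult.assoc wi by simp
  finally show ?thesis .
qed

definition SB :: real where "SB = surface_bound TYPE(real^'n) * surface_bound TYPE(real^'m)"

lemma SB0: "SB \<ge> 0" by (simp add: SB_def surface_bound_nonneg)

text \<open>For given l and j the sums over the two spherical bases are of order (l+1)^(n-2) and
  (j+1)^(m-2). Every admissible j has j + 1 \<le> KK, so there are at most KK of them, each with a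
  factor of at most KK^(m-2).\<close>

lemma kernel_sum:
  assumes z: "z \<in> Omega \<alpha>" "0 < phi \<alpha> z" "phi \<alpha> z < pi / 2" and s: "s = (sin (phi \<alpha> z))\<^sup>2"
    and \<Lambda>: "finite \<Lambda>" and Q0: "Q \<ge> 0"
    and Q: "\<And>l j. l \<in> \<Lambda> \<Longrightarrow> adm l j \<Longrightarrow> jf (deg l j) (mul l) (nuj j) s \<le> Q * Jc l j"
  shows "(\<Sum>\<iota>\<in>pc \<Lambda>. (cmod (u \<iota> z))\<^sup>2) \<le>
     2 * SB * (\<Sum>l\<in>\<Lambda>. real (l + 1) ^ (CARD('n) - 2)) * KK ^ (CARD('m) - 1) *
     (Q * s powr - ((real CARD('n) - 2) * ep / 2) * (1 - s) powr - ((real CARD('m) - 2) / 2))"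
proof -
  define R where "R = Q * s powr - ((real CARD('n) - 2) * ep / 2) * (1 - s) powr - ((real CARD('m) - 2) / 2)"
  have R0: "R \<ge> 0" using Q0 by (simp add: R_def)
  let ?S1 = "surface_bound TYPE(real^'n)" and ?S2 = "surface_bound TYPE(real^'m)"
  have fin: "finite {j. adm l j}" for l by (rule finite_subset[of _ "{..k}"]) (auto simp: adm_def)
  have fY: "finite (dY l)" "finite (dZ l)" for l by (auto simp: dY_def dZ_def)
  have "pc \<Lambda> = (SIGMA l:\<Lambda>. SIGMA j:{j. adm l j}. dY l \<times> dZ j)" by (auto simp: pc_def idx_def)
  then have "(\<Sum>\<iota>\<in>pc \<Lambda>. (cmod (u \<iota> z))\<^sup>2) = (\<Sum>l\<in>\<Lambda>. \<Sum>j\<in>{j. adm l j}. \<Sum>a\<in>dY l. \<Sum>b\<in>dZ j. (cmod (u (l, j, a, b) z))\<^sup>2)"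
    using \<Lambda> fin fY by (simp only:) ((subst sum_Sigma_pair, simp, simp)+, rule refl)
  also have "\<dots> \<le> (\<Sum>l\<in>\<Lambda>. \<Sum>j\<in>{j. adm l j}. 2 * R * (?S1 * real (l + 1) ^ (CARD('n) - 2)) * (?S2 * KK ^ (CARD('m) - 2)))"
  proof (intro sum_mono)
    fix l j assume l: "l \<in> \<Lambda>" and "j \<in> {j. adm l j}"
    then have j: "adm l j" by simp
    have "(cmod (u (l, j, a, b) z))\<^sup>2 = (hn l j (phi \<alpha> z))\<^sup>2 * (cmod (Y l a (sgn (fst z))))\<^sup>2 * (cmod (Z j b (sgn (snd z))))\<^sup>2" for a b
      using z by (simp add: u_def norm_mult power_mult_distrib)
    then have "(\<Sum>a\<in>dY l. \<Sum>b\<in>dZ j. (cmod (u (l, j, a, b) z))\<^sup>2) =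
        (hn l j (phi \<alpha> z))\<^sup>2 * (\<Sum>a\<in>dY l. (cmod (Y l a (sgn (fst z))))\<^sup>2) * (\<Sum>b\<in>dZ j. (cmod (Z j b (sgn (snd z))))\<^sup>2)"
      by (simp add: sum_distrib_left sum_distrib_right mult_ac)
    also have "\<dots> \<le> 2 * R * (?S1 * real (l + 1) ^ (CARD('n) - 2)) * (?S2 * KK ^ (CARD('m) - 2))"
    proof (intro mult_mono mult_nonneg_nonneg)
      show "(hn l j (phi \<alpha> z))\<^sup>2 \<le> 2 * R" unfolding R_def by (rule hn_sq[OF z(2,3) s Q[OF l j]])
      show "(\<Sum>a\<in>dY l. (cmod (Y l a (sgn (fst z))))\<^sup>2) \<le> ?S1 * real (l + 1) ^ (CARD('n) - 2)"
        using Y_kernel_bound[OF Y, of l "sgn (fst z)"] n2 by (simp add: dY_def)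
      have "(\<Sum>b\<in>dZ j. (cmod (Z j b (sgn (snd z))))\<^sup>2) \<le> ?S2 * real (j + 1) ^ (CARD('m) - 2)"
        using Y_kernel_bound[OF Z, of j "sgn (snd z)"] m2 by (simp add: dZ_def)
      also have "\<dots> \<le> ?S2 * KK ^ (CARD('m) - 2)"
        using adm_D(1)[OF j] by (intro mult_left_mono power_mono surface_bound_nonneg) auto
      finally show "(\<Sum>b\<in>dZ j. (cmod (Z j b (sgn (snd z))))\<^sup>2) \<le> ?S2 * KK ^ (CARD('m) - 2)" .
    qed (auto intro!: sum_nonneg surface_bound_nonneg R0)
    finally show "(\<Sum>a\<in>dY l. \<Sum>b\<in>dZ j. (cmod (u (l, j, a, b) z))\<^sup>2) \<le> 2 * R * (?S1 * real (l + 1) ^ (CARD('n) - 2)) * (?S2 * KK ^ (CARD('m) - 2))" .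
  qed
  also have "\<dots> \<le> (\<Sum>l\<in>\<Lambda>. KK * (2 * R * (?S1 * real (l + 1) ^ (CARD('n) - 2)) * (?S2 * KK ^ (CARD('m) - 2))))"
  proof (intro sum_mono)
    fix l
    have "{j. adm l j} \<subseteq> {..<nat \<lfloor>KK\<rfloor>}"
    proof
      fix j assume "j \<in> {j. adm l j}"
      then have "real j + 1 \<le> KK" using adm_D by blast
      then have "int j + 1 \<le> \<lfloor>KK\<rfloor>" by (simp add: le_floor_iff)
      then show "j \<in> {..<nat \<lfloor>KK\<rfloor>}" by simp
    qed
    then have "card {j. adm l j} \<le> nat \<lfloor>KK\<rfloor>" using card_mono[of "{..<nat \<lfloor>KK\<rfloor>}"] by simp
    then have "real (card {j. adm l j}) \<le> KK" using KK1 by linarith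
    then show "(\<Sum>j\<in>{j. adm l j}. 2 * R * (?S1 * real (l + 1) ^ (CARD('n) - 2)) * (?S2 * KK ^ (CARD('m) - 2))) \<le>
      KK * (2 * R * (?S1 * real (l + 1) ^ (CARD('n) - 2)) * (?S2 * KK ^ (CARD('m) - 2)))"
      unfolding sum_constant using R0 KK1 by (intro mult_right_mono) (auto intro!: mult_nonneg_nonneg surface_bound_nonneg)
  qed
  also have "\<dots> = 2 * SB * (\<Sum>l\<in>\<Lambda>. real (l + 1) ^ (CARD('n) - 2)) * (KK * KK ^ (CARD('m) - 2)) * R"
    unfolding SB_def sum_distrib_left sum_distrib_right by (intro sum.cong refl) (simp only: mult_ac)
  also have "KK * KK ^ (CARD('m) - 2) = KK ^ (CARD('m) - 1)"
  proof -
    have "CARD('m) - 1 = Suc (CARD('m) - 2)" using m2 by simp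
    then show ?thesis by (simp only: power_Suc)
  qed
  finally show ?thesis unfolding R_def .
qed

text \<open>W absorbs the weight and the power \<open>th\<close> of the kernel as a function of s
  alone. What remains is |f|^2 against W, which \<open>parseval\<close> splits into one moment per
  index.\<close>

lemma kernel_power_estimate:
  assumes W [measurable]: "W \<in> borel_measurable borel" and W0: "\<And>s. W s \<ge> 0" and B: "B \<ge> 0"
    and pw: "\<And>z s. z \<in> Omega \<alpha> \<Longrightarrow> 0 < phi \<alpha> z \<Longrightarrow> phi \<alpha> z < pi / 2 \<Longrightarrow> s = (sin (phi \<alpha> z))\<^sup>2 \<Longrightarrow>
       s powr - \<tau> * (\<Sum>\<iota>\<in>A. (cmod (u \<iota> z))\<^sup>2) powr th \<le> W s"
    and A: "A \<subseteq> idx"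
    and mass: "\<And>\<iota>. \<iota> \<in> A \<Longrightarrow> mass (\<lambda>s. ennreal (W s)) (fst \<iota>) (fst (snd \<iota>)) \<le> ennreal B"
  shows "(\<integral>\<^sup>+z. ennreal (((sin (phi \<alpha> z))\<^sup>2) powr - \<tau> * cmod (\<Sum>\<iota>\<in>A. c \<iota> * u \<iota> z) powr (2 + 2 * th)) \<partial>DD)
     \<le> ennreal (B * (\<Sum>\<iota>\<in>A. (cmod (c \<iota>))\<^sup>2) powr (1 + th))"
proof -
  define E where "E = (\<Sum>\<iota>\<in>A. (cmod (c \<iota>))\<^sup>2)"
  have E0: "E \<ge> 0" by (simp add: E_def sum_nonneg)
  let ?f = "\<lambda>z. cmod (\<Sum>\<iota>\<in>A. c \<iota> * u \<iota> z)"
  have [measurable]: "phi \<alpha> \<in> borel_measurable DD" by (rule phi_borel)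
  have "(\<lambda>z. \<Sum>\<iota>\<in>A. c \<iota> * u \<iota> z) \<in> borel_measurable DD"
    using u_borel A by (intro borel_measurable_sum borel_measurable_times borel_measurable_const) auto
  then have m: "(\<lambda>z. ennreal (W ((sin (phi \<alpha> z))\<^sup>2)) * ennreal ((?f z)\<^sup>2)) \<in> borel_measurable DD"
    by measurable
  have "(\<integral>\<^sup>+z. ennreal (((sin (phi \<alpha> z))\<^sup>2) powr - \<tau> * ?f z powr (2 + 2 * th)) \<partial>DD)
     \<le> (\<integral>\<^sup>+z. ennreal (E powr th) * (ennreal (W ((sin (phi \<alpha> z))\<^sup>2)) * ennreal ((?f z)\<^sup>2)) \<partial>DD)"
  proof (rule nn_integral_mono_AE)
    show "AE z in DD. ennreal (((sin (phi \<alpha> z))\<^sup>2) powr - \<tau> * ?f z powr (2 + 2 * th)) \<le>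
       ennreal (E powr th) * (ennreal (W ((sin (phi \<alpha> z))\<^sup>2)) * ennreal ((?f z)\<^sup>2))"
      using AE_phi AE_space
    proof eventually_elim
      case (elim z)
      define s where "s = (sin (phi \<alpha> z))\<^sup>2"
      define T where "T = (\<Sum>\<iota>\<in>A. (cmod (u \<iota> z))\<^sup>2)"
      have T0: "T \<ge> 0" by (simp add: T_def sum_nonneg)
      have z: "z \<in> Omega \<alpha>" using elim by (simp add: sets_dOmega)
      have p: "s powr - \<tau> * T powr th \<le> W s"
        unfolding T_def by (rule pw[OF z]) (use elim in \<open>auto simp: s_def\<close>)
      have cs: "(?f z)\<^sup>2 \<le> E * T" unfolding E_def T_def by (rule cmod_sum_sq_le)
      have "?f z powr (2 + 2 * th) = ((?f z)\<^sup>2) powr th * (?f z)\<^sup>2"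
      proof (cases "?f z = 0")
        case False
        then have "(?f z)\<^sup>2 = ?f z powr 2" by simp
        then show ?thesis by (simp only: powr_powr powr_add[symmetric]) (simp add: add.commute)
      qed simp
      also have "\<dots> \<le> (E * T) powr th * (?f z)\<^sup>2"
        using cs th by (intro mult_right_mono powr_mono2) auto
      also have "(E * T) powr th = E powr th * T powr th" using E0 T0 by (simp add: powr_mult)
      finally have "s powr - \<tau> * ?f z powr (2 + 2 * th) \<le> s powr - \<tau> * (E powr th * T powr th * (?f z)\<^sup>2)"
        by (intro mult_left_mono) auto
      also have "\<dots> = E powr th * ((s powr - \<tau> * T powr th) * (?f z)\<^sup>2)" by (simp only: mult_ac)
      also have "\<dots> \<le> E powr th * (W s * (?f z)\<^sup>2)"
        using p by (intro mult_left_mono mult_right_mono) auto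
      finally show ?case unfolding s_def using W0
        by (simp only: ennreal_mult[symmetric] powr_ge_zero mult_nonneg_nonneg zero_le_power2) (rule ennreal_leI)
    qed
  qed
  also have "\<dots> = ennreal (E powr th) * (\<integral>\<^sup>+z. ennreal (W ((sin (phi \<alpha> z))\<^sup>2)) * ennreal ((?f z)\<^sup>2) \<partial>DD)"
    by (rule nn_integral_cmult[OF m])
  also have "(\<integral>\<^sup>+z. ennreal (W ((sin (phi \<alpha> z))\<^sup>2)) * ennreal ((?f z)\<^sup>2) \<partial>DD)
     = (\<Sum>\<iota>\<in>A. ennreal ((cmod (c \<iota>))\<^sup>2) * mass (\<lambda>s. ennreal (W s)) (fst \<iota>) (fst (snd \<iota>)))"
    by (rule parseval[OF _ A, of "\<lambda>s. ennreal (W s)"]) measurable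
  also have "\<dots> \<le> (\<Sum>\<iota>\<in>A. ennreal ((cmod (c \<iota>))\<^sup>2) * ennreal B)"
    by (intro sum_mono mult_left_mono mass) auto
  also have "\<dots> = ennreal (E * B)"
    unfolding E_def sum_distrib_right[symmetric] by (subst sum_ennreal) (auto simp: B ennreal_mult sum_nonneg)
  finally have "(\<integral>\<^sup>+z. ennreal (((sin (phi \<alpha> z))\<^sup>2) powr - \<tau> * ?f z powr (2 + 2 * th)) \<partial>DD)
     \<le> ennreal (E powr th) * ennreal (E * B)"
    by (simp add: mult_left_mono)
  also have "\<dots> = ennreal (E powr th * (E * B))" using E0 B by (simp add: ennreal_mult)
  also have "E powr th * (E * B) = B * E powr (1 + th)"
    using E0 by (cases "E = 0") (simp_all add: powr_add)
  finally show ?thesis unfolding E_def .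
qed

lemma mass_powr:
  assumes "adm l j" "mul l > 0" "0 \<le> \<kappa>" "\<kappa> \<le> 1"
  shows "mass (\<lambda>s. ennreal (s powr - \<kappa>)) l j \<le> ennreal ((KK / mul l) powr \<kappa>)"
proof -
  have "(\<integral>\<^sup>+s. indicator {0..1} s * (ennreal (s powr - \<kappa>) * ennreal (jf (deg l j) (mul l) (nuj j) s)) \<partial>lborel)
    = (\<integral>\<^sup>+s. ennreal (indicator {0..1} s * (s powr - \<kappa> * jf (deg l j) (mul l) (nuj j) s)) \<partial>lborel)"
    by (intro nn_integral_cong) (auto simp: indicator_def ennreal_mult jac.f_nonneg[OF jac])
  also have "\<dots> \<le> ennreal ((KK / mul l) powr \<kappa> * Jc l j)"
    using jac.nn_mass_powr[OF jac[of l j] assms(2-4), of "deg l j"] unfolding adm_D(3)[OF assms(1)] Jc_def .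
  finally have "mass (\<lambda>s. ennreal (s powr - \<kappa>)) l j \<le> ennreal (1 / Jc l j) * ennreal ((KK / mul l) powr \<kappa> * Jc l j)"
    unfolding mass_def by (rule mult_left_mono) simp
  then show ?thesis using Jc_pos[of l j] by (simp flip: ennreal_mult)
qed

lemma mass_powr_0:
  assumes "adm l j" "mul l = 0" "0 \<le> \<kappa>" "\<kappa> < 1"
  shows "mass (\<lambda>s. ennreal (indicator {0..1/2} s * s powr - \<kappa>)) l j \<le> ennreal ((11 / (1 - \<kappa>) + 1) * KK powr \<kappa>)"
proof -
  have "(\<integral>\<^sup>+s. indicator {0..1} s * (ennreal (indicator {0..1/2} s * s powr - \<kappa>) * ennreal (jf (deg l j) (mul l) (nuj j) s)) \<partial>lborel)
    = (\<integral>\<^sup>+s. ennreal (indicator {0..1/2} s * (s powr - \<kappa> * jf (deg l j) (mul l) (nuj j) s)) \<partial>lborel)"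
    by (intro nn_integral_cong) (auto simp: indicator_def ennreal_mult jac.f_nonneg[OF jac])
  also have "\<dots> \<le> ennreal ((11 / (1 - \<kappa>) + 1) * (KK powr \<kappa> * Jc l j))"
    using jac.nn_mass_powr_0[OF jac[of l j] assms(2-4), of "deg l j"] unfolding adm_D(3)[OF assms(1)] Jc_def .
  finally have "mass (\<lambda>s. ennreal (indicator {0..1/2} s * s powr - \<kappa>)) l j \<le> ennreal (1 / Jc l j) * ennreal ((11 / (1 - \<kappa>) + 1) * (KK powr \<kappa> * Jc l j))"
    unfolding mass_def by (rule mult_left_mono) simp
  also have "\<dots> = ennreal ((1 / Jc l j) * ((11 / (1 - \<kappa>) + 1) * (KK powr \<kappa> * Jc l j)))"
    using Jc_pos[of l j] assms by (intro ennreal_mult[symmetric]) auto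
  also have "(1 / Jc l j) * ((11 / (1 - \<kappa>) + 1) * (KK powr \<kappa> * Jc l j)) = (11 / (1 - \<kappa>) + 1) * KK powr \<kappa>"
    using Jc_pos[of l j] by simp
  finally show ?thesis .
qed

text \<open>For m \<ge> 3 the Jacobi parameter at s = 1 is at least 1/2, which bounds the moment
  uniformly in j. For m = 2 that parameter is 0 at j = 0, but there the exponent is 0 as
  well.\<close>

lemma mass_powr_right:
  assumes "adm l j" "0 \<le> \<kappa>" "\<kappa> \<le> 1" "real CARD('m) = 2 \<Longrightarrow> \<kappa> = 0"
  shows "mass (\<lambda>s. ennreal ((1 - s) powr - \<kappa>)) l j \<le> ennreal (2 * KK powr \<kappa>)"
proof (cases "real CARD('m) = 2")
  case True
  then have "\<kappa> = 0" using assms by simp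
  have "mass (\<lambda>s. ennreal ((1 - s) powr - \<kappa>)) l j \<le> mass (\<lambda>s. 1) l j"
    unfolding mass_def \<open>\<kappa> = 0\<close> by (intro mult_left_mono nn_integral_mono mult_right_mono) auto
  also have "\<dots> = ennreal 1" by (simp add: mass_1)
  also have "\<dots> \<le> ennreal (2 * KK powr \<kappa>)" using KK1 \<open>\<kappa> = 0\<close> by (intro ennreal_leI) simp
  finally show ?thesis .
next
  case False
  then have "CARD('m) \<noteq> 2" by simp
  then have "CARD('m) \<ge> 3" using m2 by linarith
  then have nu: "nuj j \<ge> 1 / 2" unfolding nuj_eq by linarith
  then have nu0: "nuj j > 0" by linarith
  have "(\<integral>\<^sup>+s. indicator {0..1} s * (ennreal ((1 - s) powr - \<kappa>) * ennreal (jf (deg l j) (mul l) (nuj j) s)) \<partial>lborel)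
    = (\<integral>\<^sup>+s. ennreal (indicator {0..1} s * ((1 - s) powr - \<kappa> * jf (deg l j) (mul l) (nuj j) s)) \<partial>lborel)"
    by (intro nn_integral_cong) (auto simp: indicator_def ennreal_mult jac.f_nonneg[OF jac])
  also have "\<dots> \<le> ennreal ((KK / nuj j) powr \<kappa> * Jc l j)"
    using jac.nn_mass_powr_right[OF jac[of l j] nu0 assms(2,3), of "deg l j"] unfolding adm_D(3)[OF assms(1)] Jc_def .
  finally have "mass (\<lambda>s. ennreal ((1 - s) powr - \<kappa>)) l j \<le> ennreal (1 / Jc l j) * ennreal ((KK / nuj j) powr \<kappa> * Jc l j)"
    unfolding mass_def by (rule mult_left_mono) simp
  also have "\<dots> = ennreal ((KK / nuj j) powr \<kappa>)" using Jc_pos[of l j] by (simp flip: ennreal_mult)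
  also have "\<dots> \<le> ennreal (2 * KK powr \<kappa>)"
  proof (rule ennreal_leI)
    have "1 * KK \<le> (2 * nuj j) * KK" using nu KK1 by (intro mult_right_mono) auto
    then have "KK / nuj j \<le> 2 * KK" using nu0 by (simp add: pos_divide_le_eq mult_ac)
    then have "(KK / nuj j) powr \<kappa> \<le> (2 * KK) powr \<kappa>" using assms KK1 nu0 by (intro powr_mono2) auto
    also have "\<dots> = 2 powr \<kappa> * KK powr \<kappa>" using KK1 by (simp add: powr_mult)
    also have "\<dots> \<le> 2 powr 1 * KK powr \<kappa>" using assms by (intro mult_right_mono powr_mono) auto
    finally show "(KK / nuj j) powr \<kappa> \<le> 2 * KK powr \<kappa>" by simp
  qed
  finally show ?thesis .
qed

end

section \<open>Constants, exponents and kernel bounds on a block\<close>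

lemma one_add_powr_le:
  fixes x t :: real
  assumes "x \<ge> 0" "0 \<le> t" "t \<le> 1"
  shows "(1 + x) powr t \<le> 2 * (1 + x powr t)"
proof -
  define y where "y = max 1 x"
  have y: "y \<ge> 1" "y \<ge> x" "1 + x \<le> 2 * y" by (auto simp: y_def)
  have "(1 + x) powr t \<le> (2 * y) powr t" using assms y by (intro powr_mono2) auto
  also have "\<dots> = 2 powr t * y powr t" using y by (simp add: powr_mult)
  also have "\<dots> \<le> 2 powr 1 * y powr t" using assms by (intro mult_right_mono powr_mono) auto
  also have "y powr t \<le> 1 + x powr t" by (auto simp: y_def max_def)
  finally show ?thesis by simp
qed

lemma half_powr_le:
  fixes s b :: real
  assumes "1 / 2 \<le> s" "s \<le> 1" "0 \<le> b" "b \<le> c"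
  shows "s powr - b \<le> 2 powr c"
proof -
  have "s powr - b \<le> (1 / 2) powr - b" using assms by (intro powr_mono2') auto
  also have "\<dots> = 2 powr b" by (simp add: powr_divide powr_minus field_simps)
  also have "\<dots> \<le> 2 powr c" using assms by (intro powr_mono) auto
  finally show ?thesis .
qed

text \<open>L^x K^y is monotone in L, so the worst L is an end of [1, a K]; the two hypotheses on r
  concern the exponents of K at these ends.\<close>

lemma powr_mult_powr_le:
  fixes L K a x y r :: real
  assumes "1 \<le> L" "L \<le> a * K" "1 \<le> K" "1 \<le> a" "x \<le> 1" "y \<le> r" "x + y \<le> r"
  shows "L powr x * K powr y \<le> a * K powr r"
proof (cases "x \<ge> 0")
  case True
  have "L powr x \<le> (a * K) powr x" using assms True by (intro powr_mono2) auto
  also have "\<dots> = a powr x * K powr x" using assms by (simp add: powr_mult)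
  also have "\<dots> \<le> a powr 1 * K powr x" using assms True by (intro mult_right_mono powr_mono) auto
  finally have "L powr x * K powr y \<le> a powr 1 * K powr x * K powr y" by (rule mult_right_mono) simp
  also have "\<dots> = a * K powr (x + y)" using assms by (simp add: powr_add)
  also have "\<dots> \<le> a * K powr r" using assms by (intro mult_left_mono powr_mono) auto
  finally show ?thesis .
next
  case False
  have "L powr x \<le> L powr 0" using assms False by (intro powr_mono) auto
  then have "L powr x \<le> a" using assms by simp
  moreover have "K powr y \<le> K powr r" using assms by (intro powr_mono) auto
  ultimately show ?thesis using assms by (intro mult_mono) auto
qed

text \<open>Constants are closed expressions outside the locale, because that of the theorem is
  fixed before \<open>Y\<close>, \<open>Z\<close> and \<open>k\<close>. Here 22 = 2 * 11 with 11
  from the pointwise Jacobi bounds, 2^n comes from l + 1 < 2 L, 2^m from the power of 1 - s on the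
  half s \<le> 1/2, and n + 2 from 1 + \<mu> \<le> (n + 2) L.\<close>

definition base_const :: "real \<Rightarrow> nat \<Rightarrow> nat \<Rightarrow> real" where
  "base_const S n m = 22 * S * 2 ^ n * 2 ^ m * (real n + 2)"

text \<open>The first bracket dominates the moment constants of both cases of
  \<open>piece_bound\<close>: 8 (\<alpha>+1) for positive \<mu>, and 11 / (1 - k1) + 1 for \<mu> =
  0. The last summand belongs to the half s \<ge> 1/2.\<close>

definition piece_const :: "real \<Rightarrow> nat \<Rightarrow> nat \<Rightarrow> real \<Rightarrow> real \<Rightarrow> real \<Rightarrow> real" where
  "piece_const S n m \<alpha>1 th k1 = \<alpha>1 * ((8 * \<alpha>1 + 11 / (1 - k1) + 1) * base_const S n m powr th
     + 4 * (base_const S n m * 2 ^ n) powr th)"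

context grushin_est
begin

text \<open>Exponents of the singularities: \<open>k1\<close> at s = 0 collects \<tau> and
  \<open>th\<close> times the exponent of the kernel, \<open>k3\<close> is the analogue at s = 1. In
  \<open>rr\<close>, the value \<tau> + \<epsilon> covers L = 1 near s = 0, and 7/8 covers the other
  ends; the right half attains it for n = m = 2 and \<alpha> = 1.\<close>

definition k1 :: real where "k1 = \<tau> + (real CARD('n) - 2) * ep * th / 2"
definition k3 :: real where "k3 = (real CARD('m) - 2) * th / 2"
definition rr :: real where "rr = max (7 / 8) (\<tau> + ep)"
definition C0 :: real where "C0 = base_const SB CARD('n) CARD('m)"

text \<open>Everything follows from th (n + m - 2) = \<epsilon>, \<epsilon> \<le> 1/2 and th \<le>
  1/4. Near s = 0 the exponent at L = 1 is \<tau> + \<epsilon> - (n-2) th (1 - \<epsilon>/2), and at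
  L of size KK it is \<epsilon> + th \<le> 3/4. On the right half it is at most 3 \<epsilon> / 2 +
  th / 2 \<le> 7/8.\<close>

lemma exponent_bounds:
  shows "k1 \<ge> 0" "k1 + th \<le> 1" "k1 < 1" "0 \<le> k3" "k3 \<le> 1" "rr < 1"
    "(real CARD('n) - 1) * th - k1 \<le> 1" "real CARD('m) * th + k1 \<le> rr"
    "((real CARD('n) - 1) * th - k1) + (real CARD('m) * th + k1) \<le> rr"
    "(real CARD('n) - 1) * th \<le> 1" "(real CARD('m) + 1 / 2) * th + k3 \<le> rr"
    "(real CARD('n) - 1) * th + ((real CARD('m) + 1 / 2) * th + k3) \<le> rr"
proof -
  define n where "n = real CARD('n)"
  define m where "m = real CARD('m)"
  have nm: "n \<ge> 2" "m \<ge> 2" using dims by (auto simp: n_def m_def)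
  have t: "th > 0" "th \<le> 1 / 4" "th * n + th * m - 2 * th = ep" using th by (auto simp: n_def m_def algebra_simps)
  have te: "0 \<le> th * n - 2 * th" "0 \<le> th * m - 2 * th"
    using mult_nonneg_nonneg[of th "n - 2"] mult_nonneg_nonneg[of th "m - 2"] nm t by (auto simp: algebra_simps)
  have t1: "\<tau> + ep < 1" using \<tau>1 by (simp add: ep_def)
  define w where "w = (n - 2) * ep * th / 2"
  have w0: "0 \<le> w" using nm ep t by (simp add: w_def)
  have "((n - 2) * th) * ep \<le> ((n - 2) * th) * 1" using nm ep t by (intro mult_left_mono) auto
  then have "((n - 2) * th) * ep / 2 \<le> ((n - 2) * th) * 1 / 2" by (rule divide_right_mono) simp
  moreover have "w = ((n - 2) * th) * ep / 2" "((n - 2) * th) * 1 = th * n - 2 * th"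
    by (simp_all add: w_def algebra_simps)
  ultimately have w1: "w \<le> (th * n - 2 * th) / 2" by simp
  have k1: "k1 = \<tau> + w" by (simp add: k1_def w_def n_def)
  have k3: "k3 = (th * m - 2 * th) / 2" by (simp add: k3_def m_def algebra_simps)
  have r: "rr \<ge> 7 / 8" "rr \<ge> \<tau> + ep" "rr < 1" using t1 by (auto simp: rr_def)
  have mn: "real CARD('m) * th = th * m" "(real CARD('n) - 1) * th = th * n - th" "(real CARD('m) + 1 / 2) * th = th * m + th / 2"
    by (simp_all add: m_def n_def algebra_simps)
  have "k1 \<ge> 0 \<and>
    k1 + th \<le> 1 \<and>
    k1 < 1 \<and>
    0 \<le> k3 \<and>
    k3 \<le> 1 \<and>
    rr < 1 \<and>
    (real CARD('n) - 1) * th - k1 \<le> 1 \<and>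
    real CARD('m) * th + k1 \<le> rr \<and>
    ((real CARD('n) - 1) * th - k1) + (real CARD('m) * th + k1) \<le> rr \<and>
    (real CARD('n) - 1) * th \<le> 1 \<and>
    (real CARD('m) + 1 / 2) * th + k3 \<le> rr \<and>
    (real CARD('n) - 1) * th + ((real CARD('m) + 1 / 2) * th + k3) \<le> rr"
  proof -
    \<comment> \<open>With the two products as variables all claims are linear.\<close>
    define x where "x = th * n"
    define y where "y = th * m"
    have f: "th > 0" "th \<le> 1 / 4" "x + y - 2 * th = ep" "0 \<le> x - 2 * th" "0 \<le> y - 2 * th" "w \<le> (x - 2 * th) / 2"
      using t te w1 by (simp_all only: x_def y_def)
    show ?thesis
      unfolding mn k1 k3 x_def[symmetric] y_def[symmetric]
      using f w0 r t1 \<tau>0 ep by (intro conjI) (simp_all add: field_simps)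
  qed
  then show "k1 \<ge> 0" "k1 + th \<le> 1" "k1 < 1" "0 \<le> k3" "k3 \<le> 1" "rr < 1"
    "(real CARD('n) - 1) * th - k1 \<le> 1" "real CARD('m) * th + k1 \<le> rr"
    "((real CARD('n) - 1) * th - k1) + (real CARD('m) * th + k1) \<le> rr"
    "(real CARD('n) - 1) * th \<le> 1" "(real CARD('m) + 1 / 2) * th + k3 \<le> rr"
    "(real CARD('n) - 1) * th + ((real CARD('m) + 1 / 2) * th + k3) \<le> rr"
    by (simp_all only:)
qed

lemma C0: "C0 \<ge> 0" using SB0 by (simp add: C0_def base_const_def)

text \<open>A block is L \<le> l + 1 < 2 L; it has L elements, each contributing at most (2
  L)^(n-2).\<close>

lemma sum_l:
  assumes "L \<ge> 1"
  shows "(\<Sum>l\<in>{L - 1..<2 * L - 1}. real (l + 1) ^ (CARD('n) - 2)) \<le> 2 ^ CARD('n) * real L ^ (CARD('n) - 1)"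
proof -
  have "(\<Sum>l\<in>{L - 1..<2 * L - 1}. real (l + 1) ^ (CARD('n) - 2)) \<le> (\<Sum>l\<in>{L - 1..<2 * L - 1}. (2 * real L) ^ (CARD('n) - 2))"
    using assms by (intro sum_mono power_mono) auto
  also have "\<dots> = real L * (2 * real L) ^ (CARD('n) - 2)" using assms by simp
  also have "\<dots> = 2 ^ (CARD('n) - 2) * real L ^ Suc (CARD('n) - 2)" by (simp add: power_mult_distrib)
  also have "Suc (CARD('n) - 2) = CARD('n) - 1" using n2 by simp
  also have "(2::real) ^ (CARD('n) - 2) * real L ^ (CARD('n) - 1) \<le> 2 ^ CARD('n) * real L ^ (CARD('n) - 1)"
    by (intro mult_right_mono power_increasing) auto
  finally show ?thesis .
qed

text \<open>R measures by how much the squared Jacobi functions exceed their generic size 11 KK Jc;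
  that size supplies the last factor of KK^m.\<close>

lemma kernel_bound:
  assumes z: "z \<in> Omega \<alpha>" "0 < phi \<alpha> z" "phi \<alpha> z < pi / 2" and s: "s = (sin (phi \<alpha> z))\<^sup>2"
    and L: "L \<ge> 1" and R: "R \<ge> 0"
    and Q: "\<And>l j. l \<in> {L - 1..<2 * L - 1} \<Longrightarrow> adm l j \<Longrightarrow> jf (deg l j) (mul l) (nuj j) s \<le> (11 * KK * R) * Jc l j"
  shows "(\<Sum>\<iota>\<in>pc {L - 1..<2 * L - 1}. (cmod (u \<iota> z))\<^sup>2) \<le>
     22 * SB * 2 ^ CARD('n) * real L ^ (CARD('n) - 1) * KK ^ CARD('m) *
     (R * s powr - ((real CARD('n) - 2) * ep / 2) * (1 - s) powr - ((real CARD('m) - 2) / 2))"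
proof -
  have Q0: "11 * KK * R \<ge> 0" using R KK1 by simp
  define X where "X = s powr - ((real CARD('n) - 2) * ep / 2) * (1 - s) powr - ((real CARD('m) - 2) / 2)"
  have "(\<Sum>\<iota>\<in>pc {L - 1..<2 * L - 1}. (cmod (u \<iota> z))\<^sup>2) \<le>
     2 * SB * (\<Sum>l\<in>{L - 1..<2 * L - 1}. real (l + 1) ^ (CARD('n) - 2)) * KK ^ (CARD('m) - 1) * ((11 * KK * R) * X)"
    using kernel_sum[OF z s finite_atLeastLessThan Q0 Q] unfolding X_def by (simp only: mult.assoc)
  also have "\<dots> \<le> 2 * SB * (2 ^ CARD('n) * real L ^ (CARD('n) - 1)) * KK ^ (CARD('m) - 1) * ((11 * KK * R) * X)"
    using sum_l[OF L] SB0 KK1 R by (intro mult_right_mono mult_left_mono) (auto simp: X_def)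
  also have "\<dots> = 22 * SB * 2 ^ CARD('n) * real L ^ (CARD('n) - 1) * (KK * KK ^ (CARD('m) - 1)) * (R * X)"
    by simp
  also have "KK * KK ^ (CARD('m) - 1) = KK ^ CARD('m)"
    using power_Suc[of KK "CARD('m) - 1"] m2 by simp
  finally show ?thesis unfolding X_def by (simp only: mult.assoc)
qed

text \<open>The exceptional case \<open>R = 1\<close> concerns \<open>n = 2\<close> and \<open>l = 0\<close>, where the Jacobi parameter \<open>\<mu>\<close>
  vanishes and negative moments up to exponent \<open>1\<close> are no longer bounded by powers of \<open>KK / \<mu>\<close>.\<close>

lemma kernel_left:
  assumes z: "z \<in> Omega \<alpha>" "0 < phi \<alpha> z" "phi \<alpha> z < pi / 2" and s: "s = (sin (phi \<alpha> z))\<^sup>2" "0 < s" "s \<le> 1 / 2"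
    and L: "L \<ge> 1" and R: "R = 1 + real L / (KK * s) \<or> R = 1 \<and> L = 1 \<and> mul 0 = 0"
  shows "(\<Sum>\<iota>\<in>pc {L - 1..<2 * L - 1}. (cmod (u \<iota> z))\<^sup>2) \<le>
     C0 * real L ^ (CARD('n) - 1) * KK ^ CARD('m) * R * s powr - ((real CARD('n) - 2) * ep / 2)"
proof -
  have K0: "KK > 0" using KK1 by simp
  have R1: "R \<ge> 1" using R s K0 by auto
  have "jf (deg l j) (mul l) (nuj j) s \<le> (11 * KK * ((real CARD('n) + 2) * R)) * Jc l j"
    if l: "l \<in> {L - 1..<2 * L - 1}" and j: "adm l j" for l j
  proof (cases "R = 1 \<and> L = 1 \<and> mul 0 = 0")
    case True
    then have "l = 0" using l by simp
    then have "jf (deg l j) (mul l) (nuj j) s \<le> 11 * KK * Jc l j"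
      using jac.bound_left_0[OF jac[of l j] s(2,3), of "deg l j"] True unfolding adm_D(3)[OF j] Jc_def by simp
    also have "\<dots> \<le> (real CARD('n) + 2) * (11 * KK * Jc l j)"
    proof -
      have "0 \<le> 11 * KK * Jc l j" using K0 Jc_pos[of l j] by simp
      then have "1 * (11 * KK * Jc l j) \<le> (real CARD('n) + 2) * (11 * KK * Jc l j)" by (intro mult_right_mono) auto
      then show ?thesis by simp
    qed
    also have "\<dots> = (11 * KK * ((real CARD('n) + 2) * R)) * Jc l j" using True by simp
    finally show ?thesis .
  next
    case False
    then have Re: "R = 1 + real L / (KK * s)" using R by blast
    have "real l + 1 \<le> 2 * real L" using l L by auto
    moreover have "real l * ep \<le> real l * (1 / 2)" "(real CARD('n) - 2) * ep \<le> (real CARD('n) - 2) * (1 / 2)"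
      using ep dims by (intro mult_left_mono; simp)+
    moreover define X where "X = (real CARD('n) - 2) * ep"
    moreover define X' where "X' = real l * ep"
    moreover have "mul l = X / 2 + X'" by (simp add: mul_eq X_def X'_def)
    ultimately have "1 + mul l \<le> real CARD('n) + 1 + real L" by simp
    also have "\<dots> \<le> (real CARD('n) + 1) * real L + real L"
    proof -
      have "(real CARD('n) + 1) * 1 \<le> (real CARD('n) + 1) * real L" using L by (intro mult_left_mono) auto
      then show ?thesis by simp
    qed
    finally have mu: "1 + mul l \<le> (real CARD('n) + 2) * real L" by (simp add: algebra_simps)
    have "jf (deg l j) (mul l) (nuj j) s \<le> 11 * KK * Jc l j * (1 + (1 + mul l) / (KK * s))"
      using jac.bound_left[OF jac[of l j] s(2,3), of "deg l j"] unfolding adm_D(3)[OF j] Jc_def .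
    also have "\<dots> \<le> 11 * KK * Jc l j * ((real CARD('n) + 2) * R)"
    proof (rule mult_left_mono)
      have "(1 + mul l) / (KK * s) \<le> (real CARD('n) + 2) * real L / (KK * s)"
        using mu K0 s by (intro divide_right_mono) auto
      then show "1 + (1 + mul l) / (KK * s) \<le> (real CARD('n) + 2) * R"
        unfolding Re distrib_left by simp
    qed (use K0 Jc_pos[of l j] in simp)
    also have "\<dots> = (11 * KK * ((real CARD('n) + 2) * R)) * Jc l j" by (simp only: mult_ac)
    finally show ?thesis .
  qed
  from kernel_bound[OF z s(1) L _ this]
  have "(\<Sum>\<iota>\<in>pc {L - 1..<2 * L - 1}. (cmod (u \<iota> z))\<^sup>2) \<le>
     22 * SB * 2 ^ CARD('n) * real L ^ (CARD('n) - 1) * KK ^ CARD('m) *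
     (((real CARD('n) + 2) * R) * s powr - ((real CARD('n) - 2) * ep / 2) * (1 - s) powr - ((real CARD('m) - 2) / 2))"
    using R1 by simp
  also have "\<dots> \<le> 22 * SB * 2 ^ CARD('n) * real L ^ (CARD('n) - 1) * KK ^ CARD('m) *
     (((real CARD('n) + 2) * R) * s powr - ((real CARD('n) - 2) * ep / 2) * 2 powr real CARD('m))"
    using SB0 K0 R1 s dims by (intro mult_left_mono half_powr_le) auto
  also have "\<dots> = C0 * real L ^ (CARD('n) - 1) * KK ^ CARD('m) * R * s powr - ((real CARD('n) - 2) * ep / 2)"
    unfolding C0_def base_const_def by (simp add: powr_realpow)
  finally show ?thesis .
qed

text \<open>Away from s = 0 the Jacobi functions obey a bound without l; the extra sqrt KK is the
  loss of \<open>bound_right\<close>.\<close>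

lemma kernel_right:
  assumes z: "z \<in> Omega \<alpha>" "0 < phi \<alpha> z" "phi \<alpha> z < pi / 2" and s: "s = (sin (phi \<alpha> z))\<^sup>2" "1 / 2 \<le> s" "s < 1"
    and L: "L \<ge> 1"
  shows "(\<Sum>\<iota>\<in>pc {L - 1..<2 * L - 1}. (cmod (u \<iota> z))\<^sup>2) \<le>
     C0 * 2 ^ CARD('n) * real L ^ (CARD('n) - 1) * (KK ^ CARD('m) * sqrt KK) * (1 - s) powr - ((real CARD('m) - 2) / 2)"
proof -
  have K0: "KK > 0" using KK1 by simp
  have nu: "nuj j = 0 \<or> nuj j \<ge> 1 / 2" for j
  proof -
    have "CARD('m) = 2 \<or> CARD('m) \<ge> 3" using m2 by linarith
    then show ?thesis unfolding nuj_eq by (cases "j = 0") auto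
  qed
  have "jf (deg l j) (mul l) (nuj j) s \<le> (11 * KK * sqrt KK) * Jc l j"
    if "adm l j" for l j
    using jac.bound_right[OF jac[of l j] s(2,3) nu[of j], of "deg l j"] unfolding adm_D(3)[OF that] Jc_def by (simp add: mult_ac)
  from kernel_bound[OF z s(1) L _ this]
  have "(\<Sum>\<iota>\<in>pc {L - 1..<2 * L - 1}. (cmod (u \<iota> z))\<^sup>2) \<le>
     22 * SB * 2 ^ CARD('n) * real L ^ (CARD('n) - 1) * KK ^ CARD('m) *
     (sqrt KK * s powr - ((real CARD('n) - 2) * ep / 2) * (1 - s) powr - ((real CARD('m) - 2) / 2))"
    using K0 by simp
  also have "\<dots> \<le> 22 * SB * 2 ^ CARD('n) * real L ^ (CARD('n) - 1) * KK ^ CARD('m) *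
     (sqrt KK * 2 powr real CARD('n) * (1 - s) powr - ((real CARD('m) - 2) / 2))"
  proof (intro mult_left_mono mult_right_mono half_powr_le)
    have "(real CARD('n) - 2) * ep \<le> (real CARD('n) - 2) * 1" using ep dims by (intro mult_left_mono) auto
    then have "(real CARD('n) - 2) * ep / 2 \<le> (real CARD('n) - 2) * 1 / 2" by (rule divide_right_mono) simp
    also have "\<dots> \<le> real CARD('n)" by simp
    finally show "(real CARD('n) - 2) * ep / 2 \<le> real CARD('n)" .
  qed (use SB0 K0 s dims ep in auto)
  also have "\<dots> = 22 * SB * 2 ^ CARD('n) * 1 * (2 ^ CARD('n) * real L ^ (CARD('n) - 1) * (KK ^ CARD('m) * sqrt KK) * (1 - s) powr - ((real CARD('m) - 2) / 2))"
    by (simp add: powr_realpow)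
  also have "\<dots> \<le> 22 * SB * 2 ^ CARD('n) * (2 ^ CARD('m) * (real CARD('n) + 2)) * (2 ^ CARD('n) * real L ^ (CARD('n) - 1) * (KK ^ CARD('m) * sqrt KK) * (1 - s) powr - ((real CARD('m) - 2) / 2))"
  proof (intro mult_right_mono mult_left_mono)
    have "1 * 1 \<le> (2::real) ^ CARD('m) * (real CARD('n) + 2)" by (intro mult_mono) auto
    then show "1 \<le> (2::real) ^ CARD('m) * (real CARD('n) + 2)" by simp
  qed (use SB0 K0 in auto)
  also have "\<dots> = C0 * 2 ^ CARD('n) * real L ^ (CARD('n) - 1) * (KK ^ CARD('m) * sqrt KK) * (1 - s) powr - ((real CARD('m) - 2) / 2)"
    unfolding C0_def base_const_def by (simp only: mult.assoc)
  finally show ?thesis .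
qed

lemma mass_add:
  assumes [measurable]: "W1 \<in> borel_measurable borel" "W2 \<in> borel_measurable borel"
    and nn: "\<And>s. W1 s \<ge> 0" "\<And>s. W2 s \<ge> 0" "A1 \<ge> 0" "A2 \<ge> 0" "B1 \<ge> 0" "B2 \<ge> 0"
    and B: "mass (\<lambda>s. ennreal (W1 s)) l j \<le> ennreal B1" "mass (\<lambda>s. ennreal (W2 s)) l j \<le> ennreal B2"
  shows "mass (\<lambda>s. ennreal (A1 * W1 s + A2 * W2 s)) l j \<le> ennreal (A1 * B1 + A2 * B2)"
proof -
  have [measurable]: "jf (deg l j) (mul l) (nuj j) \<in> borel_measurable borel" by (rule jac.borel_f[OF jac])
  let ?I = "\<lambda>W. \<integral>\<^sup>+s. indicator {0..1} s * (ennreal (W s) * ennreal (jf (deg l j) (mul l) (nuj j) s)) \<partial>lborel"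
  have "?I (\<lambda>s. A1 * W1 s + A2 * W2 s) = (\<integral>\<^sup>+s. ennreal A1 * (indicator {0..1} s * (ennreal (W1 s) * ennreal (jf (deg l j) (mul l) (nuj j) s)))
      + ennreal A2 * (indicator {0..1} s * (ennreal (W2 s) * ennreal (jf (deg l j) (mul l) (nuj j) s))) \<partial>lborel)"
    using nn by (intro nn_integral_cong) (simp add: ennreal_mult distrib_left distrib_right mult_ac)
  also have "\<dots> = ennreal A1 * ?I W1 + ennreal A2 * ?I W2"
    by (simp add: nn_integral_add nn_integral_cmult)
  finally have "mass (\<lambda>s. ennreal (A1 * W1 s + A2 * W2 s)) l j = ennreal A1 * mass (\<lambda>s. ennreal (W1 s)) l j + ennreal A2 * mass (\<lambda>s. ennreal (W2 s)) l j"
    unfolding mass_def by (simp add: distrib_left mult_ac)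
  also have "\<dots> \<le> ennreal A1 * ennreal B1 + ennreal A2 * ennreal B2"
    by (intro add_mono mult_left_mono B) auto
  also have "\<dots> = ennreal (A1 * B1 + A2 * B2)" using nn by (simp add: ennreal_mult)
  finally show ?thesis .
qed

end

section \<open>Dyadic blocks\<close>

text \<open>Replacing every term by the largest is crude, but where this is used M is logarithmic in
  k, so that a power of M is cheap.\<close>

lemma sum_powr_le:
  fixes a :: "nat \<Rightarrow> real"
  assumes a: "\<And>i. i < M \<Longrightarrow> a i \<ge> 0" and q: "q > 0"
  shows "(\<Sum>i<M. a i) powr q \<le> real M powr q * (\<Sum>i<M. a i powr q)"
proof (cases "M = 0")
  case False
  define x where "x = Max (a ` {..<M})"
  have fin: "finite (a ` {..<M})" "a ` {..<M} \<noteq> {}" using False by auto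
  obtain i where i: "i < M" "x = a i" using Max_in[OF fin] unfolding x_def by auto
  have le: "a j \<le> x" if "j < M" for j unfolding x_def using fin(1) that by (intro Max_ge) auto
  have "(\<Sum>i<M. a i) \<le> (\<Sum>i<M. x)" using le by (intro sum_mono) auto
  then have "(\<Sum>i<M. a i) powr q \<le> (real M * x) powr q"
    using a q by (intro powr_mono2) (auto intro: sum_nonneg)
  also have "\<dots> = real M powr q * a i powr q" using a i by (simp add: powr_mult)
  also have "\<dots> \<le> real M powr q * (\<Sum>i<M. a i powr q)"
    using i by (intro mult_left_mono member_le_sum) auto
  finally show ?thesis .
qed simp

text \<open>\<eta> is chosen so that the number M of blocks, at most (1 + 1 / (\<eta> ln 2))
  (k+1)^\<eta>, satisfies M^(3 + 2 t) \<le> const (k+1)^(1 - r). The exponent is q = 2 + 2 t from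
  \<open>sum_powr_le\<close>, plus 1 for adding M equal bounds.\<close>

definition est_const :: "real \<Rightarrow> nat \<Rightarrow> nat \<Rightarrow> nat \<Rightarrow> real \<Rightarrow> real" where
  "est_const S n m \<alpha> \<tau> =
     (let \<epsilon> = 1 / (real \<alpha> + 1); t = \<epsilon> / (real n + real m - 2);
          k1 = \<tau> + (real n - 2) * \<epsilon> * t / 2; r = max (7 / 8) (\<tau> + \<epsilon>); \<eta> = (1 - r) / (3 + 2 * t)
      in piece_const S n m (real \<alpha> + 1) t k1 * (real n + real m) * (1 + 1 / (\<eta> * ln 2)) powr (3 + 2 * t))"

context grushin_est
begin

text \<open>\<open>PL\<close> and \<open>PR\<close> are the factors free of s in the weighted
  kernel, raised to the power \<open>th\<close>, on the left and right half; the 2 in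
  \<open>PR\<close> bounds s^(-\<tau>) there.\<close>

definition PL :: "nat \<Rightarrow> real" where
  "PL L = C0 powr th * real L powr ((real CARD('n) - 1) * th) * KK powr (real CARD('m) * th)"

definition PR :: "nat \<Rightarrow> real" where
  "PR L = 2 * ((C0 * 2 ^ CARD('n)) powr th * real L powr ((real CARD('n) - 1) * th) * KK powr ((real CARD('m) + 1 / 2) * th))"

lemma L_powr:
  assumes "L \<ge> 1"
  shows "(real L ^ (CARD('n) - 1)) powr th = real L powr ((real CARD('n) - 1) * th)"
proof -
  have "real L ^ (CARD('n) - 1) = real L powr (real CARD('n) - 1)"
    using assms n2 by (simp add: powr_realpow[symmetric])
  then show ?thesis by (simp add: powr_powr)
qed

lemma KK_powr: "(KK ^ CARD('m)) powr th = KK powr (real CARD('m) * th)"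
  using KK1 by (simp add: powr_realpow[symmetric] powr_powr)

lemma weighted_kernel_left:
  assumes z: "z \<in> Omega \<alpha>" "0 < phi \<alpha> z" "phi \<alpha> z < pi / 2" and s: "s = (sin (phi \<alpha> z))\<^sup>2" "0 < s" "s \<le> 1 / 2"
    and L: "L \<ge> 1" and R: "R = 1 + real L / (KK * s) \<or> R = 1 \<and> L = 1 \<and> mul 0 = 0"
  shows "s powr - \<tau> * (\<Sum>\<iota>\<in>pc {L - 1..<2 * L - 1}. (cmod (u \<iota> z))\<^sup>2) powr th \<le> PL L * R powr th * s powr - k1"
proof -
  have R1: "R \<ge> 0" using R s KK1 by auto
  let ?a = "(real CARD('n) - 2) * ep / 2"
  have "(\<Sum>\<iota>\<in>pc {L - 1..<2 * L - 1}. (cmod (u \<iota> z))\<^sup>2) powr th \<le>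
     (C0 * real L ^ (CARD('n) - 1) * KK ^ CARD('m) * R * s powr - ?a) powr th"
    using kernel_left[OF z s L R] th by (intro powr_mono2) (auto intro: sum_nonneg)
  also have "\<dots> = C0 powr th * (real L ^ (CARD('n) - 1)) powr th * (KK ^ CARD('m)) powr th * R powr th * (s powr - ?a) powr th"
    using C0 KK1 R1 by (simp add: powr_mult)
  also have "\<dots> = PL L * R powr th * s powr - (?a * th)"
    unfolding L_powr[OF L] KK_powr PL_def powr_powr by simp
  finally have "s powr - \<tau> * (\<Sum>\<iota>\<in>pc {L - 1..<2 * L - 1}. (cmod (u \<iota> z))\<^sup>2) powr th \<le> s powr - \<tau> * (PL L * R powr th * s powr - (?a * th))"
    by (rule mult_left_mono) simp
  also have "\<dots> = PL L * R powr th * (s powr - \<tau> * s powr - (?a * th))" by (simp only: mult_ac)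
  also have "s powr - \<tau> * s powr - (?a * th) = s powr - k1"
    by (simp add: powr_add[symmetric] k1_def)
  finally show ?thesis .
qed

lemma weighted_kernel_right:
  assumes z: "z \<in> Omega \<alpha>" "0 < phi \<alpha> z" "phi \<alpha> z < pi / 2" and s: "s = (sin (phi \<alpha> z))\<^sup>2" "1 / 2 \<le> s" "s < 1"
    and L: "L \<ge> 1"
  shows "s powr - \<tau> * (\<Sum>\<iota>\<in>pc {L - 1..<2 * L - 1}. (cmod (u \<iota> z))\<^sup>2) powr th \<le> PR L * (1 - s) powr - k3"
proof -
  let ?b = "(real CARD('m) - 2) / 2"
  have "(\<Sum>\<iota>\<in>pc {L - 1..<2 * L - 1}. (cmod (u \<iota> z))\<^sup>2) powr th \<le>
     ((C0 * 2 ^ CARD('n)) * real L ^ (CARD('n) - 1) * (KK ^ CARD('m) * sqrt KK) * (1 - s) powr - ?b) powr th"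
    using kernel_right[OF z s L] th by (intro powr_mono2) (auto intro: sum_nonneg)
  also have "\<dots> = (C0 * 2 ^ CARD('n)) powr th * (real L ^ (CARD('n) - 1)) powr th * ((KK ^ CARD('m)) powr th * sqrt KK powr th) * ((1 - s) powr - ?b) powr th"
    using C0 KK1 by (simp add: powr_mult)
  also have "\<dots> = (C0 * 2 ^ CARD('n)) powr th * real L powr ((real CARD('n) - 1) * th) * (KK powr (real CARD('m) * th) * KK powr (1 / 2 * th)) * (1 - s) powr - k3"
    unfolding L_powr[OF L] KK_powr using KK1 by (simp add: powr_half_sqrt[symmetric] powr_powr k3_def)
  also have "KK powr (real CARD('m) * th) * KK powr (1 / 2 * th) = KK powr ((real CARD('m) + 1 / 2) * th)"
    unfolding powr_add[symmetric] distrib_right ..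
  finally have "s powr - \<tau> * (\<Sum>\<iota>\<in>pc {L - 1..<2 * L - 1}. (cmod (u \<iota> z))\<^sup>2) powr th \<le>
      2 * ((C0 * 2 ^ CARD('n)) powr th * real L powr ((real CARD('n) - 1) * th) * KK powr ((real CARD('m) + 1 / 2) * th) * (1 - s) powr - k3)"
  proof (rule mult_mono[rotated])
    have "\<tau> \<le> 1" using \<tau>1 ep unfolding ep_def by linarith
    then have "s powr - \<tau> \<le> 2 powr 1" using s \<tau>0 by (intro half_powr_le) auto
    then show "s powr - \<tau> \<le> 2" by simp
  qed auto
  then show ?thesis by (simp add: PR_def mult.assoc)
qed

text \<open>Each half of the interval gets its majorant, the moments turn it into powers of L and
  KK, and \<open>powr_mult_powr_le\<close> takes the worst L. Two cases arise because \<mu> = 0 for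
  n = 2 and l = 0, where moments are available only for exponents below 1; there R = 1 keeps the
  exponent at \<open>k1\<close> < 1.\<close>

lemma piece_bound:
  assumes L: "L \<ge> 1" "L \<le> k + 1"
  shows "(\<integral>\<^sup>+z. ennreal (((sin (phi \<alpha> z))\<^sup>2) powr - \<tau> * cmod (\<Sum>\<iota>\<in>pc {L - 1..<2 * L - 1}. c \<iota> * u \<iota> z) powr (2 + 2 * th)) \<partial>DD)
     \<le> ennreal (piece_const SB CARD('n) CARD('m) (real \<alpha> + 1) th k1 * KK powr rr * (\<Sum>\<iota>\<in>pc {L - 1..<2 * L - 1}. (cmod (c \<iota>))\<^sup>2) powr (1 + th))"
proof -
  have K0: "KK > 0" using KK1 by simp
  have L0: "real L \<ge> 1" using L by simp
  have LK: "real L \<le> (real \<alpha> + 1) * KK" using L k_le by linarith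
  define X where "X = C0 powr th"
  define X2 where "X2 = (C0 * 2 ^ CARD('n)) powr th"
  have PL0: "PL L \<ge> 0" "PR L \<ge> 0" by (auto simp: PL_def PR_def)
  have s01: "0 < s \<and> s < 1" if "0 < phi \<alpha> z" "phi \<alpha> z < pi / 2" "s = (sin (phi \<alpha> z))\<^sup>2" for s and z :: "(real^'n) \<times> (real^'m)"
  proof -
    have "sin (phi \<alpha> z) > 0" "cos (phi \<alpha> z) > 0" using that by (auto intro: sin_gt_zero cos_gt_zero)
    moreover have "1 - s = (cos (phi \<alpha> z))\<^sup>2" using that by (simp add: cos_squared_eq)
    ultimately have "1 - s > 0" by simp
    moreover have "s > 0" using \<open>sin (phi \<alpha> z) > 0\<close> that by simp
    ultimately show ?thesis by simp
  qed
  have PLb: "PL L * (KK / real L) powr k1 \<le> X * ((real \<alpha> + 1) * KK powr rr)"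
  proof -
    have "PL L * (KK / real L) powr k1 = X * (real L powr ((real CARD('n) - 1) * th - k1) * KK powr (real CARD('m) * th + k1))"
      using L0 K0 by (simp add: PL_def X_def powr_divide powr_diff powr_add field_simps)
    also have "\<dots> \<le> X * ((real \<alpha> + 1) * KK powr rr)"
      using L0 LK KK1 exponent_bounds by (intro mult_left_mono powr_mult_powr_le) (auto simp: X_def)
    finally show ?thesis .
  qed
  have PRb: "PR L * (2 * KK powr k3) \<le> 4 * X2 * ((real \<alpha> + 1) * KK powr rr)"
  proof -
    have "PR L * (2 * KK powr k3) = 4 * X2 * (real L powr ((real CARD('n) - 1) * th) * KK powr ((real CARD('m) + 1 / 2) * th + k3))"
      by (simp add: PR_def X2_def powr_add)
    also have "\<dots> \<le> 4 * X2 * ((real \<alpha> + 1) * KK powr rr)"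
      using L0 LK KK1 exponent_bounds by (intro mult_left_mono powr_mult_powr_le) (auto simp: X2_def)
    finally show ?thesis .
  qed
  have m3: "mass (\<lambda>s. ennreal ((1 - s) powr - k3)) (fst \<iota>) (fst (snd \<iota>)) \<le> ennreal (2 * KK powr k3)"
    if "\<iota> \<in> pc {L - 1..<2 * L - 1}" for \<iota>
    using that exponent_bounds by (intro mass_powr_right) (auto simp: pc_def idx_def k3_def)
  define B where "B = piece_const SB CARD('n) CARD('m) (real \<alpha> + 1) th k1 * KK powr rr"
  have Bge: "A * (X * ((real \<alpha> + 1) * KK powr rr)) + 4 * X2 * ((real \<alpha> + 1) * KK powr rr) \<le> B"
    if "A \<le> 8 * (real \<alpha> + 1) + 11 / (1 - k1) + 1" for A
  proof -
    have "A * (X * ((real \<alpha> + 1) * KK powr rr)) \<le> (8 * (real \<alpha> + 1) + 11 / (1 - k1) + 1) * (X * ((real \<alpha> + 1) * KK powr rr))"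
      using that by (intro mult_right_mono) (auto simp: X_def)
    moreover have "(a * (v * y + 4 * w)) * x = v * (y * (a * x)) + 4 * w * (a * x)" for a v x y w :: real
      by (simp add: algebra_simps)
    ultimately show ?thesis unfolding B_def piece_const_def C0_def[symmetric] X_def[symmetric] X2_def[symmetric]
      by simp
  qed
  have k1': "11 / (1 - k1) \<ge> 0" using exponent_bounds by simp
  have B0: "B \<ge> 0" using Bge[of 0] k1' by (simp add: X2_def) (smt (verit) mult_nonneg_nonneg powr_ge_zero of_nat_0_le_iff)
  show ?thesis unfolding B_def[symmetric]
  proof (cases "L = 1 \<and> mul 0 = 0")
    case True
    \<comment> \<open>The indicator confines the singular part to [0, 1/2], as
      \<open>mass_powr_0\<close> requires; the second term alone carries the right half.\<close>
    define W where "W s = PL L * (indicator {0..1/2} s * s powr - k1) + PR L * (1 - s) powr - k3" for s :: real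
    show "(\<integral>\<^sup>+z. ennreal (((sin (phi \<alpha> z))\<^sup>2) powr - \<tau> * cmod (\<Sum>\<iota>\<in>pc {L - 1..<2 * L - 1}. c \<iota> * u \<iota> z) powr (2 + 2 * th)) \<partial>DD)
     \<le> ennreal (B * (\<Sum>\<iota>\<in>pc {L - 1..<2 * L - 1}. (cmod (c \<iota>))\<^sup>2) powr (1 + th))"
    proof (rule kernel_power_estimate[of W])
      show "W \<in> borel_measurable borel" unfolding W_def[abs_def] by measurable
      show "W s \<ge> 0" for s unfolding W_def using PL0 by simp
      fix z :: "(real^'n) \<times> (real^'m)" and s :: real assume z: "z \<in> Omega \<alpha>" "0 < phi \<alpha> z" "phi \<alpha> z < pi / 2" and s: "s = (sin (phi \<alpha> z))\<^sup>2"
      have s': "0 < s" "s < 1" using s01[OF z(2,3) s] by auto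
      show "s powr - \<tau> * (\<Sum>\<iota>\<in>pc {L - 1..<2 * L - 1}. (cmod (u \<iota> z))\<^sup>2) powr th \<le> W s"
      proof (cases "s \<le> 1 / 2")
        case le: True
        have "s powr - \<tau> * (\<Sum>\<iota>\<in>pc {L - 1..<2 * L - 1}. (cmod (u \<iota> z))\<^sup>2) powr th \<le> PL L * 1 powr th * s powr - k1"
          by (rule weighted_kernel_left[OF z s s'(1) le L(1)]) (use True in simp)
        also have "\<dots> \<le> W s" unfolding W_def using le s' PL0 by simp
        finally show ?thesis .
      next
        case False
        then have "s powr - \<tau> * (\<Sum>\<iota>\<in>pc {L - 1..<2 * L - 1}. (cmod (u \<iota> z))\<^sup>2) powr th \<le> PR L * (1 - s) powr - k3"
          by (intro weighted_kernel_right[OF z s _ s'(2) L(1)]) simp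
        also have "\<dots> \<le> W s" unfolding W_def using PL0 by simp
        finally show ?thesis .
      qed
    next
      fix \<iota> assume i: "\<iota> \<in> pc {L - 1..<2 * L - 1}"
      then have ad: "adm (fst \<iota>) (fst (snd \<iota>))" "fst \<iota> = 0" using True by (auto simp: pc_def idx_def)
      have "mass (\<lambda>s. ennreal (W s)) (fst \<iota>) (fst (snd \<iota>)) \<le> ennreal (PL L * ((11 / (1 - k1) + 1) * KK powr k1) + PR L * (2 * KK powr k3))"
        unfolding W_def
      proof (rule mass_add)
        show "mass (\<lambda>s. ennreal (indicator {0..1/2} s * s powr - k1)) (fst \<iota>) (fst (snd \<iota>)) \<le> ennreal ((11 / (1 - k1) + 1) * KK powr k1)"
          using True ad exponent_bounds by (intro mass_powr_0) auto
      qed (use m3[OF i] PL0 k1' in auto)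
      also have "\<dots> \<le> ennreal B"
      proof (rule ennreal_leI)
        have "PL L * ((11 / (1 - k1) + 1) * KK powr k1) = (11 / (1 - k1) + 1) * (PL L * (KK / real L) powr k1)" using True by simp
        also have "\<dots> \<le> (11 / (1 - k1) + 1) * (X * ((real \<alpha> + 1) * KK powr rr))" using PLb k1' by (intro mult_left_mono) auto
        finally show "PL L * ((11 / (1 - k1) + 1) * KK powr k1) + PR L * (2 * KK powr k3) \<le> B"
          using PRb Bge[of "11 / (1 - k1) + 1"] by simp
      qed
      finally show "mass (\<lambda>s. ennreal (W s)) (fst \<iota>) (fst (snd \<iota>)) \<le> ennreal B" .
    qed (use B0 pc_sub in auto)
  next
    case False
    \<comment> \<open>The power \<open>th\<close> of 1 + L / (KK s) is split into its two regimes.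
      The second raises the singularity by \<open>th\<close>, but its factor (L / KK)^th cancels the
      extra (KK / L)^th in its moment.\<close>
    define W where "W s = (2 * PL L) * (1 * s powr - k1 + (real L / KK) powr th * s powr - (k1 + th)) + PR L * (1 - s) powr - k3" for s :: real
    show "(\<integral>\<^sup>+z. ennreal (((sin (phi \<alpha> z))\<^sup>2) powr - \<tau> * cmod (\<Sum>\<iota>\<in>pc {L - 1..<2 * L - 1}. c \<iota> * u \<iota> z) powr (2 + 2 * th)) \<partial>DD)
     \<le> ennreal (B * (\<Sum>\<iota>\<in>pc {L - 1..<2 * L - 1}. (cmod (c \<iota>))\<^sup>2) powr (1 + th))"
    proof (rule kernel_power_estimate[of W])
      show "W \<in> borel_measurable borel" unfolding W_def[abs_def] by measurable
      show "W s \<ge> 0" for s unfolding W_def using PL0 by simp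
      fix z :: "(real^'n) \<times> (real^'m)" and s :: real assume z: "z \<in> Omega \<alpha>" "0 < phi \<alpha> z" "phi \<alpha> z < pi / 2" and s: "s = (sin (phi \<alpha> z))\<^sup>2"
      have s': "0 < s" "s < 1" using s01[OF z(2,3) s] by auto
      show "s powr - \<tau> * (\<Sum>\<iota>\<in>pc {L - 1..<2 * L - 1}. (cmod (u \<iota> z))\<^sup>2) powr th \<le> W s"
      proof (cases "s \<le> 1 / 2")
        case le: True
        have "s powr - \<tau> * (\<Sum>\<iota>\<in>pc {L - 1..<2 * L - 1}. (cmod (u \<iota> z))\<^sup>2) powr th \<le> PL L * (1 + real L / (KK * s)) powr th * s powr - k1"
          by (rule weighted_kernel_left[OF z s s'(1) le L(1)]) simp
        also have "\<dots> \<le> PL L * (2 * (1 + (real L / (KK * s)) powr th)) * s powr - k1"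
          using PL0 th s' K0 by (intro mult_left_mono mult_right_mono one_add_powr_le) auto
        also have "(real L / (KK * s)) powr th = (real L / KK) powr th * s powr - th"
          using s' K0 by (simp add: powr_divide powr_mult powr_minus field_simps)
        also have "PL L * (2 * (1 + (real L / KK) powr th * s powr - th)) * s powr - k1
           = (2 * PL L) * (1 * s powr - k1 + (real L / KK) powr th * (s powr - th * s powr - k1))"
          by (simp add: algebra_simps)
        also have "s powr - th * s powr - k1 = s powr - (k1 + th)"
          unfolding powr_add[symmetric] by (rule arg_cong[where f = "\<lambda>x. s powr x"]) simp
        also have "(2 * PL L) * (1 * s powr - k1 + (real L / KK) powr th * s powr - (k1 + th)) \<le> W s" unfolding W_def using PL0 by simp
        finally show ?thesis .
      next
        case False
        then have "s powr - \<tau> * (\<Sum>\<iota>\<in>pc {L - 1..<2 * L - 1}. (cmod (u \<iota> z))\<^sup>2) powr th \<le> PR L * (1 - s) powr - k3"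
          by (intro weighted_kernel_right[OF z s _ s'(2) L(1)]) simp
        also have "\<dots> \<le> W s" unfolding W_def using PL0 by simp
        finally show ?thesis .
      qed
    next
      fix \<iota> assume i: "\<iota> \<in> pc {L - 1..<2 * L - 1}"
      let ?l = "fst \<iota>" and ?j = "fst (snd \<iota>)"
      have ad: "adm ?l ?j" "?l \<in> {L - 1..<2 * L - 1}" using i by (auto simp: pc_def idx_def)
      \<comment> \<open>For l \<ge> 1 already l \<ge> L / 2. The index l = 0 occurs only for L = 1,
        and then n \<ge> 3 supplies \<mu> \<ge> \<epsilon> / 2.\<close>
      have mu: "mul ?l \<ge> ep * real L / 2"
      proof (cases "?l = 0")
        case True
        then have "L = 1" using ad(2) by auto
        then have "mul 0 \<noteq> 0" using False by simp
        then have "CARD('n) \<noteq> 2" unfolding mul_eq by auto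
        then have "real CARD('n) - 2 \<ge> 1" using n2 by linarith
        then have "1 * (ep / 2) \<le> (real CARD('n) - 2) * (ep / 2)" using ep by (intro mult_right_mono) auto
        then show ?thesis using True \<open>L = 1\<close> unfolding mul_eq by simp
      next
        case F: False
        then have "real L \<le> 2 * real ?l" using ad(2) by auto
        then have "ep * real L \<le> ep * (2 * real ?l)" using ep by (intro mult_left_mono) auto
        moreover have "(real CARD('n) - 2) * ep / 2 \<ge> 0" using ep dims by simp
        moreover have "ep * (2 * real ?l) = 2 * (real ?l * ep)" by simp
        ultimately show ?thesis unfolding mul_eq by (intro add_increasing) simp_all
      qed
      have mu0: "mul ?l > 0" by (rule less_le_trans[OF _ mu]) (use ep L0 in simp)
      have mass\<kappa>: "mass (\<lambda>s. ennreal (s powr - \<kappa>)) ?l ?j \<le> ennreal (2 * (real \<alpha> + 1) * (KK / real L) powr \<kappa>)"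
        if \<kappa>: "0 \<le> \<kappa>" "\<kappa> \<le> 1" for \<kappa>
      proof (rule order_trans[OF mass_powr[OF ad(1) mu0 \<kappa>] ennreal_leI])
        have "KK / mul ?l \<le> KK / (ep * real L / 2)" using mu K0 ep L0 mu0 by (intro divide_left_mono) auto
        also have "\<dots> = (2 * (real \<alpha> + 1)) * (KK / real L)" using L0 by (simp add: ep_def)
        finally have "(KK / mul ?l) powr \<kappa> \<le> ((2 * (real \<alpha> + 1)) * (KK / real L)) powr \<kappa>"
          using \<kappa> K0 mu0 by (intro powr_mono2) auto
        also have "\<dots> = (2 * (real \<alpha> + 1)) powr \<kappa> * (KK / real L) powr \<kappa>" using K0 by (intro powr_mult; simp)
        also have "\<dots> \<le> (2 * (real \<alpha> + 1)) powr 1 * (KK / real L) powr \<kappa>"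
          using \<kappa> by (intro mult_right_mono powr_mono) auto
        finally show "(KK / mul ?l) powr \<kappa> \<le> 2 * (real \<alpha> + 1) * (KK / real L) powr \<kappa>" by simp
      qed
      let ?B1 = "2 * (real \<alpha> + 1) * (KK / real L) powr k1" and ?B2 = "2 * (real \<alpha> + 1) * (KK / real L) powr (k1 + th)"
      have "mass (\<lambda>s. ennreal (W s)) ?l ?j \<le> ennreal ((2 * PL L) * (1 * ?B1 + (real L / KK) powr th * ?B2) + PR L * (2 * KK powr k3))"
        unfolding W_def
      proof (rule mass_add)
        show "mass (\<lambda>s. ennreal (1 * s powr - k1 + (real L / KK) powr th * s powr - (k1 + th))) ?l ?j \<le> ennreal (1 * ?B1 + (real L / KK) powr th * ?B2)"
          by (rule mass_add[OF _ _ _ _ _ _ _ _ mass\<kappa> mass\<kappa>]) (use exponent_bounds th in auto)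
      qed (use m3[OF i] PL0 in \<open>auto intro!: add_nonneg_nonneg mult_nonneg_nonneg\<close>)
      also have "\<dots> \<le> ennreal B"
      proof (rule ennreal_leI)
        have "(real L / KK) powr th * (KK / real L) powr (k1 + th) = (KK / real L) powr k1"
          using L0 K0 by (simp add: powr_divide powr_add)
        then have "(2 * PL L) * (1 * ?B1 + (real L / KK) powr th * ?B2) = (8 * (real \<alpha> + 1)) * (PL L * (KK / real L) powr k1)"
          by (simp add: algebra_simps)
        also have "\<dots> \<le> (8 * (real \<alpha> + 1)) * (X * ((real \<alpha> + 1) * KK powr rr))" using PLb by (intro mult_left_mono) auto
        finally show "(2 * PL L) * (1 * ?B1 + (real L / KK) powr th * ?B2) + PR L * (2 * KK powr k3) \<le> B"
          using PRb Bge[of "8 * (real \<alpha> + 1)"] k1' by simp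
      qed
      finally show "mass (\<lambda>s. ennreal (W s)) ?l ?j \<le> ennreal B" .
    qed (use B0 pc_sub in auto)
  qed
qed

lemma main_estimate:
  "(\<integral>\<^sup>+z. ennreal (((sin (phi \<alpha> z))\<^sup>2) powr - \<tau> * cmod (\<Sum>\<iota>\<in>idx. c \<iota> * u \<iota> z) powr (2 + 2 * th)) \<partial>DD)
     \<le> ennreal (est_const SB CARD('n) CARD('m) \<alpha> \<tau> * (real k + 1) * (\<Sum>\<iota>\<in>idx. (cmod (c \<iota>))\<^sup>2) powr (1 + th))"
proof -
  define B where "B = piece_const SB CARD('n) CARD('m) (real \<alpha> + 1) th k1 * KK powr rr"
  define q where "q = 2 + 2 * th"
  define E where "E = (\<Sum>\<iota>\<in>idx. (cmod (c \<iota>))\<^sup>2)"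
  have q: "q > 0" using th by (simp add: q_def)
  have pc0: "piece_const SB CARD('n) CARD('m) (real \<alpha> + 1) th k1 \<ge> 0"
  proof -
    have "11 / (1 - k1) \<ge> 0" using exponent_bounds by simp
    then show ?thesis unfolding piece_const_def by (intro mult_nonneg_nonneg add_nonneg_nonneg) auto
  qed
  have B0: "B \<ge> 0" unfolding B_def using pc0 by simp
  \<comment> \<open>\<open>ix l\<close> is the binary logarithm of l + 1, rounded down; the shift by
    1 gives l = 0 a block.\<close>
  have "\<exists>i. 2 ^ i \<le> l + 1 \<and> l + 1 < 2 ^ (i + 1)" for l :: nat
    using ex_power_ivl1[of 2 "l + 1"] by auto
  then obtain ix where ix: "\<And>l. 2 ^ ix l \<le> l + 1" "\<And>l. l + 1 < (2::nat) ^ (ix l + 1)" by metis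
  define M where "M = ix k + 1"
  define \<Lambda> where "\<Lambda> i = {2 ^ i - 1..<2 * 2 ^ i - 1 :: nat}" for i :: nat
  have \<Lambda>: "l \<in> \<Lambda> i \<longleftrightarrow> ix l = i" for l i
  proof
    assume "l \<in> \<Lambda> i"
    then have l: "2 ^ i \<le> l + 1" "l + 1 < 2 ^ (i + 1)" by (auto simp: \<Lambda>_def)
    have "(2::nat) ^ i < 2 ^ (ix l + 1)" "(2::nat) ^ ix l < 2 ^ (i + 1)" using l ix[of l] by linarith+
    then have "i < ix l + 1" "ix l < i + 1" by (metis power_less_imp_less_exp one_less_numeral_iff semiring_norm(76))+
    then show "ix l = i" by simp
  next
    assume "ix l = i"
    then show "l \<in> \<Lambda> i" using ix[of l] by (auto simp: \<Lambda>_def)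
  qed
  have ixM: "ix l < M" if "l \<le> k" for l
  proof -
    have "(2::nat) ^ ix l < 2 ^ (ix k + 1)" using ix(1)[of l] ix(2)[of k] that by linarith
    then show ?thesis unfolding M_def by (metis power_less_imp_less_exp one_less_numeral_iff semiring_norm(76))
  qed
  have pcL: "pc (\<Lambda> i) = {\<iota> \<in> idx. ix (fst \<iota>) = i}" for i by (auto simp: pc_def \<Lambda>)
  \<comment> \<open>The blocks are the fibres of \<open>ix\<close>, hence they partition the index
    set.\<close>
  have grp: "(\<Sum>i<M. \<Sum>\<iota>\<in>pc (\<Lambda> i). h \<iota>) = (\<Sum>\<iota>\<in>idx. h \<iota>)" for h :: "_ \<Rightarrow> 'x::comm_monoid_add"
    unfolding pcL by (rule sum.group) (use finite_idx ixM in \<open>auto simp: idx_def adm_def\<close>)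
  define f where "f i z = (\<Sum>\<iota>\<in>pc (\<Lambda> i). c \<iota> * u \<iota> z)" for i z
  define Ei where "Ei i = (\<Sum>\<iota>\<in>pc (\<Lambda> i). (cmod (c \<iota>))\<^sup>2)" for i
  have fm: "(\<lambda>z. f i z) \<in> borel_measurable DD" for i
    unfolding f_def using u_borel pc_sub by (intro borel_measurable_sum borel_measurable_times borel_measurable_const) blast
  have [measurable]: "phi \<alpha> \<in> borel_measurable DD" by (rule phi_borel)
  have pb: "(\<integral>\<^sup>+z. ennreal (((sin (phi \<alpha> z))\<^sup>2) powr - \<tau> * cmod (f i z) powr q) \<partial>DD) \<le> ennreal (B * E powr (1 + th))"
    if i: "i < M" for i
  proof -
    have "2 ^ i \<le> (2::nat) ^ ix k" using i by (intro power_increasing) (auto simp: M_def)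
    then have "2 ^ i \<le> k + 1" using ix(1)[of k] by linarith
    then have "(\<integral>\<^sup>+z. ennreal (((sin (phi \<alpha> z))\<^sup>2) powr - \<tau> * cmod (f i z) powr q) \<partial>DD) \<le> ennreal (B * Ei i powr (1 + th))"
      unfolding f_def q_def B_def Ei_def \<Lambda>_def by (intro piece_bound) auto
    also have "\<dots> \<le> ennreal (B * E powr (1 + th))"
    proof (intro ennreal_leI mult_left_mono powr_mono2)
      show "Ei i \<le> E" unfolding Ei_def E_def using pc_sub finite_idx by (intro sum_mono2) auto
    qed (use B0 th in \<open>auto simp: Ei_def intro: sum_nonneg\<close>)
    finally show ?thesis .
  qed
  have "(\<integral>\<^sup>+z. ennreal (((sin (phi \<alpha> z))\<^sup>2) powr - \<tau> * cmod (\<Sum>\<iota>\<in>idx. c \<iota> * u \<iota> z) powr q) \<partial>DD)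
     \<le> (\<integral>\<^sup>+z. ennreal (real M powr q) * (\<Sum>i<M. ennreal (((sin (phi \<alpha> z))\<^sup>2) powr - \<tau> * cmod (f i z) powr q)) \<partial>DD)"
  proof (rule nn_integral_mono)
    fix z
    have "cmod (\<Sum>\<iota>\<in>idx. c \<iota> * u \<iota> z) \<le> (\<Sum>i<M. cmod (f i z))"
      unfolding grp[symmetric] f_def by (rule norm_sum)
    then have "cmod (\<Sum>\<iota>\<in>idx. c \<iota> * u \<iota> z) powr q \<le> (\<Sum>i<M. cmod (f i z)) powr q" using q by (intro powr_mono2) auto
    also have "\<dots> \<le> real M powr q * (\<Sum>i<M. cmod (f i z) powr q)" by (rule sum_powr_le) (use q in auto)
    finally have "((sin (phi \<alpha> z))\<^sup>2) powr - \<tau> * cmod (\<Sum>\<iota>\<in>idx. c \<iota> * u \<iota> z) powr q \<le> ((sin (phi \<alpha> z))\<^sup>2) powr - \<tau> * (real M powr q * (\<Sum>i<M. cmod (f i z) powr q))"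
      by (rule mult_left_mono) simp
    also have "\<dots> = real M powr q * (\<Sum>i<M. ((sin (phi \<alpha> z))\<^sup>2) powr - \<tau> * cmod (f i z) powr q)"
      unfolding sum_distrib_left by (simp only: mult_ac)
    finally have "ennreal (((sin (phi \<alpha> z))\<^sup>2) powr - \<tau> * cmod (\<Sum>\<iota>\<in>idx. c \<iota> * u \<iota> z) powr q) \<le> ennreal (real M powr q * (\<Sum>i<M. ((sin (phi \<alpha> z))\<^sup>2) powr - \<tau> * cmod (f i z) powr q))"
      by (rule ennreal_leI)
    also have "\<dots> = ennreal (real M powr q) * ennreal (\<Sum>i<M. ((sin (phi \<alpha> z))\<^sup>2) powr - \<tau> * cmod (f i z) powr q)"
      by (intro ennreal_mult sum_nonneg) auto
    also have "ennreal (\<Sum>i<M. ((sin (phi \<alpha> z))\<^sup>2) powr - \<tau> * cmod (f i z) powr q) = (\<Sum>i<M. ennreal (((sin (phi \<alpha> z))\<^sup>2) powr - \<tau> * cmod (f i z) powr q))"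
      by (subst sum_ennreal) auto
    finally show "ennreal (((sin (phi \<alpha> z))\<^sup>2) powr - \<tau> * cmod (\<Sum>\<iota>\<in>idx. c \<iota> * u \<iota> z) powr q)
       \<le> ennreal (real M powr q) * (\<Sum>i<M. ennreal (((sin (phi \<alpha> z))\<^sup>2) powr - \<tau> * cmod (f i z) powr q))" .
  qed
  also have "\<dots> = ennreal (real M powr q) * (\<Sum>i<M. (\<integral>\<^sup>+z. ennreal (((sin (phi \<alpha> z))\<^sup>2) powr - \<tau> * cmod (f i z) powr q) \<partial>DD))"
  proof -
    note fm [measurable]
    show ?thesis by (subst nn_integral_cmult, measurable) (subst nn_integral_sum, measurable)
  qed
  also have "\<dots> \<le> ennreal (real M powr q) * (\<Sum>i<M. ennreal (B * E powr (1 + th)))"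
    by (intro mult_left_mono sum_mono pb) auto
  also have "\<dots> = ennreal (real M powr q) * ennreal (real M * (B * E powr (1 + th)))"
    using B0 by (simp add: ennreal_mult ennreal_of_nat_eq_real_of_nat)
  also have "\<dots> = ennreal (real M powr q * (real M * (B * E powr (1 + th))))"
    using B0 by (intro ennreal_mult[symmetric]) auto
  also have "\<dots> \<le> ennreal (est_const SB CARD('n) CARD('m) \<alpha> \<tau> * (real k + 1) * E powr (1 + th))"
  proof (rule ennreal_leI)
    define x where "x = real k + 1"
    define \<eta> where "\<eta> = (1 - rr) / (3 + 2 * th)"
    define cc where "cc = 1 + 1 / (\<eta> * ln 2)"
    have x1: "x \<ge> 1" by (simp add: x_def)
    have \<eta>0: "\<eta> > 0" using exponent_bounds th by (simp add: \<eta>_def)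
    have cc0: "cc > 0" unfolding cc_def using \<eta>0 by (intro add_pos_pos) auto
    have M0: "real M > 0" by (simp add: M_def)
    have "real ((2::nat) ^ ix k) \<le> real (k + 1)" using ix(1)[of k] by (rule of_nat_mono)
    then have "2 powr real (ix k) \<le> x" by (simp add: powr_realpow x_def)
    then have "ln (2 powr real (ix k)) \<le> ln x" using x1 by (subst ln_le_cancel_iff) auto
    then have "real (ix k) * ln 2 \<le> ln x" by (simp add: ln_powr)
    also have "ln x \<le> x powr \<eta> / \<eta>" by (rule ln_powr_bound[OF x1 \<eta>0])
    finally have "real (ix k) \<le> x powr \<eta> / \<eta> / ln 2" by (rule pos_le_divide_eq[THEN iffD2, rotated]) simp
    moreover have "1 \<le> x powr \<eta>" using x1 \<eta>0 by (simp add: ge_one_powr_ge_zero)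
    ultimately have "real M \<le> cc * x powr \<eta>" unfolding M_def cc_def by (simp add: algebra_simps)
    then have "real M powr (3 + 2 * th) \<le> (cc * x powr \<eta>) powr (3 + 2 * th)" using th by (intro powr_mono2) auto
    also have "\<dots> = cc powr (3 + 2 * th) * x powr (\<eta> * (3 + 2 * th))" using cc0 by (simp add: powr_mult powr_powr)
    also have "\<eta> * (3 + 2 * th) = 1 - rr" using th by (simp add: \<eta>_def)
    finally have Mb: "real M powr (3 + 2 * th) \<le> cc powr (3 + 2 * th) * x powr (1 - rr)" .
    have r0: "rr \<ge> 0" by (simp add: rr_def)
    have KKx: "KK \<le> (real CARD('n) + real CARD('m)) * x"
    proof -
      have "real k * ep \<le> real k * 1" "(real CARD('n) - 2) * ep \<le> (real CARD('n) - 2) * 1"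
        using ep dims by (intro mult_left_mono; simp)+
      then have "KK \<le> real k + (real CARD('n) - 2) / 2 + real CARD('m) / 2"
        unfolding KK_def by (intro add_mono divide_right_mono) auto
      also have "\<dots> \<le> real k * 1 + (real CARD('n) + real CARD('m))" by (simp add: field_simps)
      also have "\<dots> \<le> real k * (real CARD('n) + real CARD('m)) + (real CARD('n) + real CARD('m))"
        using dims by (intro add_right_mono mult_left_mono) auto
      finally show ?thesis by (simp add: x_def algebra_simps)
    qed
    have "KK powr rr \<le> ((real CARD('n) + real CARD('m)) * x) powr rr" using KKx KK1 r0 by (intro powr_mono2) auto
    also have "\<dots> = (real CARD('n) + real CARD('m)) powr rr * x powr rr" using x1 by (simp add: powr_mult)
    also have "\<dots> \<le> (real CARD('n) + real CARD('m)) powr 1 * x powr rr"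
      using dims exponent_bounds by (intro mult_right_mono powr_mono) auto
    finally have Kb: "KK powr rr \<le> (real CARD('n) + real CARD('m)) * x powr rr" by simp
    have ec: "est_const SB CARD('n) CARD('m) \<alpha> \<tau> = piece_const SB CARD('n) CARD('m) (real \<alpha> + 1) th k1 * (real CARD('n) + real CARD('m)) * cc powr (3 + 2 * th)"
      unfolding est_const_def Let_def cc_def \<eta>_def rr_def k1_def th_def ep_def ..
    have "real M powr q * real M = real M powr (3 + 2 * th)"
      using M0 by (simp add: q_def powr_add[of _ 1 "2 + 2 * th", simplified] add.commute mult.commute)
    then have "real M powr q * (real M * (B * E powr (1 + th))) = real M powr (3 + 2 * th) * (KK powr rr * (piece_const SB CARD('n) CARD('m) (real \<alpha> + 1) th k1 * E powr (1 + th)))"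
      unfolding B_def by (simp add: mult.assoc[symmetric])
    also have "\<dots> \<le> (cc powr (3 + 2 * th) * x powr (1 - rr)) * (((real CARD('n) + real CARD('m)) * x powr rr) * (piece_const SB CARD('n) CARD('m) (real \<alpha> + 1) th k1 * E powr (1 + th)))"
      using Mb Kb pc0 by (intro mult_mono mult_right_mono mult_nonneg_nonneg) auto
    also have "\<dots> = est_const SB CARD('n) CARD('m) \<alpha> \<tau> * (x powr (1 - rr) * x powr rr) * E powr (1 + th)"
      unfolding ec by (simp only: mult_ac)
    also have "x powr (1 - rr) * x powr rr = x" using x1 by (simp flip: powr_add)
    finally show "real M powr q * (real M * (B * E powr (1 + th))) \<le> est_const SB CARD('n) CARD('m) \<alpha> \<tau> * (real k + 1) * E powr (1 + th)"
      unfolding x_def .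
  qed
  finally show ?thesis unfolding q_def E_def .
qed

end

section \<open>Choice of parameters and composition with the adjoint\<close>

theorem theorem4p17:
  fixes \<alpha> :: nat and \<beta> p q :: real
  assumes "CARD('n::finite) \<ge> 4 \<and> CARD('m::finite) \<ge> 2 \<and> \<alpha> \<ge> 1 \<or>
           CARD('n) \<in> {2, 3} \<and> CARD('m) \<ge> 2 \<and> \<alpha> = 1"
    and "p = 2 * (real CARD('n) + real CARD('m) - 2 + 1 / (real \<alpha> + 1)) /
             (real CARD('n) + real CARD('m) - 2 + 2 / (real \<alpha> + 1))"
    and "q = 2 * (real CARD('n) + real CARD('m) - 2 + 1 / (real \<alpha> + 1)) /
             (real CARD('n) + real CARD('m) - 2)"
    and "0 \<le> \<beta>" and "\<beta> < 1 / q"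
  shows "\<exists>C>0. \<forall>(Y :: nat \<Rightarrow> nat \<Rightarrow> real^'n \<Rightarrow> complex) (Z :: nat \<Rightarrow> nat \<Rightarrow> real^'m \<Rightarrow> complex).
           spherical_harmonic_bases Y \<longrightarrow> spherical_harmonic_bases Z \<longrightarrow>
           (\<forall>(k :: nat). \<forall>g \<in> Lp p (dOmega \<alpha>).
              let F = (\<lambda>z. of_real (psi \<alpha> (phi \<alpha> z) powr (- \<beta>)) *
                         proj \<alpha> Y Z k (\<lambda>\<zeta>. of_real (psi \<alpha> (phi \<alpha> \<zeta>) powr (- \<beta>)) * g \<zeta>) z)
              in F \<in> Lp q (dOmega \<alpha>) \<and>
                 Lp_norm q (dOmega \<alpha>) F
                   \<le> C * (real k + 1) powr
                         ((real CARD('n) + real CARD('m) - 2) /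
                          (real CARD('n) + real CARD('m) - 2 + 1 / (real \<alpha> + 1)))
                       * Lp_norm p (dOmega \<alpha>) g)"
proof -
  define n where "n = real CARD('n)"
  define m where "m = real CARD('m)"
  define \<epsilon> where "\<epsilon> = 1 / (real \<alpha> + 1)"
  define D where "D = n + m - 2"
  define t where "t = \<epsilon> / D"
  \<comment> \<open>Chosen so that the weight psi^(-\<beta>), raised to the power q, is (sin^2
    \<phi>)^(-\<tau>).\<close>
  define \<tau> where "\<tau> = real \<alpha> / (real \<alpha> + 1) * (\<beta> * q)"
  define S where "S = surface_bound TYPE(real^'n) * surface_bound TYPE(real^'m)"
  \<comment> \<open>The maximum with 1 makes the constant and the operator bound A positive.\<close>
  define c0 where "c0 = max 1 (est_const S CARD('n) CARD('m) \<alpha> \<tau>)"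
  have d: "CARD('n) \<ge> 2" "CARD('m) \<ge> 2" "\<alpha> \<ge> 1" using assms(1) by auto
  have D: "D \<ge> 2" using d unfolding D_def n_def m_def by linarith
  have \<epsilon>: "\<epsilon> > 0" by (simp add: \<epsilon>_def)
  have p: "p = 2 * (D + \<epsilon>) / (D + 2 * \<epsilon>)" using assms(2) by (simp add: D_def \<epsilon>_def n_def m_def)
  have q: "q = 2 * (D + \<epsilon>) / D" using assms(3) by (simp add: D_def \<epsilon>_def n_def m_def)
  have q2: "q = 2 + 2 * t" using D by (simp add: q t_def field_simps)
  have t: "t > 0" using D \<epsilon> by (simp add: t_def)
  have p1: "p > 1" using D \<epsilon> by (simp add: p)
  have q1: "q > 1" using t q2 by simp
  have pq: "1 / p + 1 / q = 1"
  proof -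
    have "1 / p + 1 / q = (D + 2 * \<epsilon> + D) / (2 * (D + \<epsilon>))" 
      unfolding p q divide_divide_eq_right mult_1 add_divide_distrib[symmetric] ..
    also have "\<dots> = 1" using D \<epsilon> by simp
    finally show ?thesis .
  qed
  have bq: "0 \<le> \<beta> * q" "\<beta> * q < 1" using assms(4,5) q1 by (simp_all add: pos_less_divide_eq)
  have a: "0 < real \<alpha> / (real \<alpha> + 1)" "real \<alpha> / (real \<alpha> + 1) + \<epsilon> = 1"
    using d by (auto simp: \<epsilon>_def add_divide_distrib[symmetric])
  have \<tau>0: "\<tau> \<ge> 0" using a bq by (simp add: \<tau>_def)
  \<comment> \<open>\<beta> q < 1 gives \<tau> < \<alpha> / (\<alpha>+1) = 1 - \<epsilon>, the form
    in which the locale asks for it.\<close>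
  have "real \<alpha> / (real \<alpha> + 1) * (\<beta> * q) < real \<alpha> / (real \<alpha> + 1) * 1"
    using a bq by (intro mult_strict_left_mono)
  then have \<tau>1: "\<tau> + 1 / (real \<alpha> + 1) < 1" using a unfolding \<tau>_def \<epsilon>_def by linarith
  have c0: "c0 \<ge> 1" by (simp add: c0_def)
  define w where "w z = psi \<alpha> (phi \<alpha> z) powr - \<beta>" for z :: "(real^'n) \<times> (real^'m)"
  have wm: "w \<in> borel_measurable (dOmega \<alpha>)"
  proof -
    have [measurable]: "phi \<alpha> \<in> borel_measurable (dOmega \<alpha> :: ((real^'n) \<times> (real^'m)) measure)" by (rule phi_borel)
    show ?thesis unfolding w_def[abs_def] psi_def by measurable
  qed
  \<comment> \<open>Where sin \<phi> = 0 both sides are 0 by the convention for powers of 0.\<close>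
  have wq: "w z powr q = ((sin (phi \<alpha> z))\<^sup>2) powr - \<tau>" if "z \<in> Omega \<alpha>" for z
  proof (cases "sin (phi \<alpha> z) = 0")
    case False
    moreover have "sin (phi \<alpha> z) \<ge> 0" using phi_range[OF that] by (intro sin_ge_zero) auto
    ultimately have "(sin (phi \<alpha> z))\<^sup>2 = sin (phi \<alpha> z) powr 2" by simp
    then show ?thesis by (simp add: w_def psi_def powr_powr \<tau>_def mult.assoc)
  qed (simp add: w_def psi_def)
  define C where "C = c0 powr (2 / q)"
  have "C > 0" using c0 by (simp add: C_def)
  moreover have "(let F = (\<lambda>z. of_real (psi \<alpha> (phi \<alpha> z) powr (- \<beta>)) *
                         proj \<alpha> Y Z k (\<lambda>\<zeta>. of_real (psi \<alpha> (phi \<alpha> \<zeta>) powr (- \<beta>)) * g \<zeta>) z)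
              in F \<in> Lp q (dOmega \<alpha>) \<and>
                 Lp_norm q (dOmega \<alpha>) F
                   \<le> C * (real k + 1) powr
                         ((real CARD('n) + real CARD('m) - 2) /
                          (real CARD('n) + real CARD('m) - 2 + 1 / (real \<alpha> + 1)))
                       * Lp_norm p (dOmega \<alpha>) g)"
    if Y: "spherical_harmonic_bases Y" and Z: "spherical_harmonic_bases Z" and g: "g \<in> Lp p (dOmega \<alpha>)"
    for Y :: "nat \<Rightarrow> nat \<Rightarrow> real^'n \<Rightarrow> complex" and Z :: "nat \<Rightarrow> nat \<Rightarrow> real^'m \<Rightarrow> complex" and k :: nat and g
  proof -
    interpret grushin_est \<alpha> k Y Z \<tau>
      by unfold_locales (use Y Z d \<tau>0 \<tau>1 in auto)
    have th: "th = t" by (simp add: th_def ep_def t_def D_def n_def m_def \<epsilon>_def)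
    obtain e :: "nat \<Rightarrow> (real^'n) \<times> (real^'m) \<Rightarrow> complex" and I where I: "finite I"
      and G: "\<And>z \<zeta>. G_kernel \<alpha> Y Z k z \<zeta> = (\<Sum>i\<in>I. e i z * cnj (e i \<zeta>))"
      and rep: "\<And>b. \<exists>c. (\<forall>z. (\<Sum>i\<in>I. b i * e i z) = (\<Sum>\<iota>\<in>idx. c \<iota> * u \<iota> z)) \<and> (\<Sum>\<iota>\<in>idx. (cmod (c \<iota>))\<^sup>2) = (\<Sum>i\<in>I. (cmod (b i))\<^sup>2)"
      by (rule G_kernel_basis) (rule that; assumption)
    have em: "e i \<in> borel_measurable DD" if i: "i \<in> I" for i
    proof -
      obtain c where c: "\<And>z. (\<Sum>l\<in>I. (if l = i then 1 else 0) * e l z) = (\<Sum>\<iota>\<in>idx. c \<iota> * u \<iota> z)"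
        using rep[of "\<lambda>l. if l = i then 1 else 0"] by blast
      have "(\<Sum>l\<in>I. (if l = i then 1 else 0) * e l z) = e i z" for z
        using i I by (simp add: if_distrib[where f = "\<lambda>x. x * _"] cong: if_cong)
      then have "e i = (\<lambda>z. \<Sum>\<iota>\<in>idx. c \<iota> * u \<iota> z)" using c by auto
      moreover have "(\<lambda>z. \<Sum>\<iota>\<in>idx. c \<iota> * u \<iota> z) \<in> borel_measurable DD"
        by (intro borel_measurable_sum borel_measurable_times borel_measurable_const u_borel)
      ultimately show ?thesis by simp
    qed
    \<comment> \<open>The bound from \<open>l2\<close> to weighted \<open>Lq\<close> whose q-th
      power is linear in k + 1.\<close>
    define A where "A = (c0 * (real k + 1)) powr (1 / q)"
    have A0: "A > 0" using c0 by (simp add: A_def)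
    have Aq: "A powr q = c0 * (real k + 1)" using c0 q1 by (simp add: A_def powr_powr)
    have est: "(\<integral>\<^sup>+z. ennreal ((w z * cmod (\<Sum>i\<in>I. b i * e i z)) powr q) \<partial>DD)
        \<le> ennreal (A powr q * (\<Sum>i\<in>I. (cmod (b i))\<^sup>2) powr (q / 2))" for b
    proof -
      obtain c where c: "\<And>z. (\<Sum>i\<in>I. b i * e i z) = (\<Sum>\<iota>\<in>idx. c \<iota> * u \<iota> z)" "(\<Sum>\<iota>\<in>idx. (cmod (c \<iota>))\<^sup>2) = (\<Sum>i\<in>I. (cmod (b i))\<^sup>2)"
        using rep[of b] by blast
      have "(\<integral>\<^sup>+z. ennreal ((w z * cmod (\<Sum>i\<in>I. b i * e i z)) powr q) \<partial>DD)
        = (\<integral>\<^sup>+z. ennreal (((sin (phi \<alpha> z))\<^sup>2) powr - \<tau> * cmod (\<Sum>\<iota>\<in>idx. c \<iota> * u \<iota> z) powr (2 + 2 * th)) \<partial>DD)"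
      proof (rule nn_integral_cong)
        fix z assume "z \<in> space DD"
        then have z: "z \<in> Omega \<alpha>" by (simp add: sets_dOmega)
        have "(w z * cmod (\<Sum>i\<in>I. b i * e i z)) powr q = w z powr q * cmod (\<Sum>i\<in>I. b i * e i z) powr q"
          by (intro powr_mult; simp add: w_def)
        then show "ennreal ((w z * cmod (\<Sum>i\<in>I. b i * e i z)) powr q) = ennreal (((sin (phi \<alpha> z))\<^sup>2) powr - \<tau> * cmod (\<Sum>\<iota>\<in>idx. c \<iota> * u \<iota> z) powr (2 + 2 * th))"
          by (simp only: wq[OF z] c(1) th q2[symmetric])
      qed
      also have "\<dots> \<le> ennreal (est_const SB CARD('n) CARD('m) \<alpha> \<tau> * (real k + 1) * (\<Sum>\<iota>\<in>idx. (cmod (c \<iota>))\<^sup>2) powr (1 + th))"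
        by (rule main_estimate)
      also have "\<dots> \<le> ennreal (c0 * (real k + 1) * (\<Sum>\<iota>\<in>idx. (cmod (c \<iota>))\<^sup>2) powr (1 + th))"
        by (intro ennreal_leI mult_right_mono) (auto simp: c0_def SB_def S_def)
      also have "\<dots> = ennreal (A powr q * (\<Sum>i\<in>I. (cmod (b i))\<^sup>2) powr (q / 2))"
      proof -
        have "q / 2 = 1 + th" by (simp add: q2 th)
        then show ?thesis by (simp only: Aq c(2))
      qed
      finally show ?thesis .
    qed
    let ?F = "\<lambda>z. of_real (w z) * (LINT \<zeta>|DD. (\<Sum>i\<in>I. e i z * cnj (e i \<zeta>)) * (of_real (w \<zeta>) * g \<zeta>))"
    have w0: "w z \<ge> 0" for z by (simp add: w_def)
    have F: "?F \<in> Lp q DD" "Lp_norm q DD ?F \<le> A\<^sup>2 * Lp_norm p DD g"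
      using kernel_duality[OF p1 q1 pq I em wm w0 A0 est g] by blast+
    have "A\<^sup>2 = A powr 2" using A0 by simp
    also have "\<dots> = c0 powr (2 / q) * (real k + 1) powr (2 / q)" using c0 by (simp add: A_def powr_powr powr_mult)
    \<comment> \<open>Here the exponent of the claim appears: A^2 carries the power 2 / q of k +
      1.\<close>
    also have "2 / q = D / (D + \<epsilon>)"
      unfolding q divide_divide_eq_right by (rule mult_divide_mult_cancel_left) simp
    finally have A2: "A\<^sup>2 = C * (real k + 1) powr ((real CARD('n) + real CARD('m) - 2) / (real CARD('n) + real CARD('m) - 2 + 1 / (real \<alpha> + 1)))"
      using \<open>2 / q = D / (D + \<epsilon>)\<close> by (simp add: C_def D_def \<epsilon>_def n_def m_def)
    show ?thesis
      unfolding Let_def proj_def G w_def[symmetric] using F unfolding A2 by blast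
  qed
  ultimately show ?thesis by blast
qed

end
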